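(* Let $f\in A^1_{\beta}$, $1<p\le q<\infty$, $\alpha>-1$, $\beta>-1$, and $$\gamma=\frac{n+1+\beta}{q}-\frac{n+1+\alpha}{p}.$$ (1) Suppose $n=1$. (a) If $\gamma \ge -1$, then $H^\beta_{\bar{f}}:A^p_{\alpha}\rightarrow L^q_{\beta}$ is bounded if and only if $f\in \mathcal{B}^{1+\gamma}$. (b) If $\gamma < -1$, then $H^\beta_{\bar{f}}:A^p_{\alpha}\rightarrow L^q_{\beta}$ is bounded if and only if $f$ is constant. (2) Suppose $n>1$. (a) If $\gamma > -1/2$, then $H^\beta_{\bar{f}}:A^p_{\alpha}\rightarrow L^q_{\beta}$ is bounded if and only if $f\in \mathcal{B}^{1+\gamma}$. (b) If $\gamma < -1/2$, then $H^\beta_{\bar{f}}:A^p_{\alpha}\rightarrow L^q_{\beta}$ is bounded if and only if $f$ is constant. (c) If $\gamma = -1/2$, then $H^\beta_{\bar{f}}:A^p_{\alpha}\rightarrow L^q_{\beta}$ is bounded if and only if $$\sup_{z\in \mathbb{B}_n} (1-|z|^2)^{-1/2} |\widetilde{\nabla }f(z)|<\infty.$$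
   Context: $\mathbb{B}_n$ is the open unit ball of $\mathbb{C}^n$ ($n\ge 1$), $\langle z,w\rangle=\sum_k z_k\overline{w_k}$, and $dv$ is Lebesgue volume measure on $\mathbb{B}_n$ normalized so that $v(\mathbb{B}_n)=1$. For $\alpha>-1$, $dv_\alpha(z)=c_\alpha(1-|z|^2)^\alpha dv(z)$ with $c_\alpha>0$ such that $v_\alpha(\mathbb{B}_n)=1$; $L^p_\alpha=L^p(\mathbb{B}_n,dv_\alpha)$ with norm $\|\cdot\|_{p,\alpha}$, and $A^p_\alpha$ is the subspace of holomorphic functions in $L^p_\alpha$. Hankel operators: $P_{\beta} g(z)=\int_{\mathbb{B}_n} \frac{g(w)\,dv_{\beta}(w)}{(1-\langle z,w\rangle )^{n+1+\beta}}$, and $H^\beta_{\bar f} g=(I-P_\beta)(\bar f g)$, defined for $g$ in the space $H^\infty$ of bounded holomorphic functions, which is dense in $A^p_\alpha$. Boundedness from $A^p_\alpha$ to $L^q_\beta$ means there is $C>0$ with $\|H^\beta_{\bar f} g\|_{q,\beta}\le C\|g\|_{p,\alpha}$ for all $g\in H^\infty$. Gradients: $\nabla f(z)=\left(\frac{\partial f}{\partial z_1}(z),\dots,\frac{\partial f}{\partial z_n}(z)\right)$ for $f$ holomorphic, and $\widetilde\nabla f(z)=\nabla(f\circ\varphi_z)(0)$, where for $a\ne0$ $\varphi_a(z)=\frac{a-P_a(z)-s_aQ_a(z)}{1-\langle z,a\rangle}$, $s_a=\sqrt{1-|a|^2}$, $P_a$ is the orthogonal projection of $\mathbb{C}^n$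 onto the complex line spanned by $a$, $Q_a=I-P_a$, and $\varphi_0(z)=-z$. Bloch type spaces: for $s\ge0$, $\mathcal{B}^{s}$ is the space of holomorphic functions $f$ on $\mathbb{B}_n$ with $\sup_{z\in\mathbb{B}_n}(1-|z|^2)^{s}|\nabla f(z)|<\infty$. *)

theory Defs
  imports "HOL-Analysis.Analysis"
begin

text \<open>
  Points of \<open>\<complex>\<^sup>n\<close> are vectors of type \<^typ>\<open>complex ^ 'n\<close> with \<open>n = CARD('n)\<close>. The library's norm on
  this type is the Euclidean one, so the open unit ball is \<^term>\<open>ball (0 :: complex ^ 'n) 1\<close>; the
  library's \<^term>\<open>inner\<close> is only the real part of the Hermitian product, which is therefore defined
  here. Functions on the ball are total functions whose values off the ball play no role.
\<close>

abbreviation unit_ball :: "(complex ^ 'n) set"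
  where "unit_ball \<equiv> ball 0 1"

definition hinner :: "complex ^ 'n \<Rightarrow> complex ^ 'n \<Rightarrow> complex"
  where "hinner z w = (\<Sum>k\<in>UNIV. z $ k * cnj (w $ k))"

text \<open>Both measures have the ball itself as their space, so measurability only concerns the
  restriction of a function to the ball.\<close>

definition ball_vol :: "(complex ^ 'n) measure"
  where "ball_vol = uniform_measure (restrict_space lborel unit_ball) unit_ball"

text \<open>For \<open>\<alpha> > -1\<close> the integrand is integrable, and the divisor is \<open>1 / c\<^sub>\<alpha>\<close>.\<close>

definition weighted_vol :: "real \<Rightarrow> (complex ^ 'n) measure"
  where "weighted_vol \<alpha> = density ball_vol
    (\<lambda>z. ennreal ((1 - (norm z)\<^sup>2) powr \<alpha> /
      (\<integral>w. (1 - (norm w)\<^sup>2) powr \<alpha> \<partial>(ball_vol :: (complex ^ 'n) measure))))"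

definition Lp_space :: "real \<Rightarrow> real \<Rightarrow> (complex ^ 'n \<Rightarrow> complex) set"
  where "Lp_space p \<alpha> = {g \<in> borel_measurable (weighted_vol \<alpha>).
    integrable (weighted_vol \<alpha>) (\<lambda>z. norm (g z) powr p)}"

text \<open>Only meaningful on \<^term>\<open>Lp_space p \<alpha>\<close>: the integral is \<open>0\<close> by convention when it diverges.\<close>

definition Lp_norm :: "real \<Rightarrow> real \<Rightarrow> (complex ^ 'n \<Rightarrow> complex) \<Rightarrow> real"
  where "Lp_norm p \<alpha> g = (\<integral>z. norm (g z) powr p \<partial>weighted_vol \<alpha>) powr (1 / p)"

definition ball_holomorphic :: "(complex ^ 'n \<Rightarrow> complex) \<Rightarrow> bool"
  where "ball_holomorphic f \<longleftrightarrow>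
    (\<forall>z\<in>unit_ball. \<exists>D. (f has_derivative D) (at z) \<and> (\<forall>c v. D (c *s v) = c * D v))"

definition bergman_space :: "real \<Rightarrow> real \<Rightarrow> (complex ^ 'n \<Rightarrow> complex) set"
  where "bergman_space p \<alpha> = {f \<in> Lp_space p \<alpha>. ball_holomorphic f}"

definition H_infinity :: "(complex ^ 'n \<Rightarrow> complex) set"
  where "H_infinity = {g. ball_holomorphic g \<and> bounded (g ` unit_ball)}"

text \<open>The complex power is the principal branch; \<open>1 - \<langle>z, w\<rangle>\<close> has positive real part on the ball.\<close>

definition bergman_proj :: "real \<Rightarrow> (complex ^ 'n \<Rightarrow> complex) \<Rightarrow> complex ^ 'n \<Rightarrow> complex"
  where "bergman_proj \<beta> g z =
    (\<integral>w. g w / (1 - hinner z w) powr of_real (real CARD('n) + 1 + \<beta>) \<partial>weighted_vol \<beta>)"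

text \<open>\<open>hankel \<beta> f\<close> is the Hankel operator whose symbol is the conjugate of \<open>f\<close>.\<close>

definition hankel ::
    "real \<Rightarrow> (complex ^ 'n \<Rightarrow> complex) \<Rightarrow> (complex ^ 'n \<Rightarrow> complex) \<Rightarrow> complex ^ 'n \<Rightarrow> complex"
  where "hankel \<beta> f g =
    (\<lambda>z. cnj (f z) * g z - bergman_proj \<beta> (\<lambda>w. cnj (f w) * g w) z)"

text \<open>Membership in \<^term>\<open>Lp_space q \<beta>\<close> is part of the norm inequality (an infinite norm violates it)
  and has to be stated separately because \<^const>\<open>Lp_norm\<close> is real-valued.\<close>

definition hankel_bounded ::
    "real \<Rightarrow> real \<Rightarrow> real \<Rightarrow> real \<Rightarrow> (complex ^ 'n \<Rightarrow> complex) \<Rightarrow> bool"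
  where "hankel_bounded p \<alpha> q \<beta> f \<longleftrightarrow>
    (\<exists>C>0. \<forall>g\<in>H_infinity. hankel \<beta> f g \<in> Lp_space q \<beta> \<and>
      Lp_norm q \<beta> (hankel \<beta> f g) \<le> C * Lp_norm p \<alpha> g)"

definition cgrad :: "(complex ^ 'n \<Rightarrow> complex) \<Rightarrow> complex ^ 'n \<Rightarrow> complex ^ 'n"
  where "cgrad f z = (\<chi> k. deriv (\<lambda>t. f (z + t *s axis k 1)) 0)"

definition line_proj :: "complex ^ 'n \<Rightarrow> complex ^ 'n \<Rightarrow> complex ^ 'n"
  where "line_proj a z = (hinner z a / hinner a a) *s a"

definition ball_involution :: "complex ^ 'n \<Rightarrow> complex ^ 'n \<Rightarrow> complex ^ 'n"
  where "ball_involution a z =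
    (if a = 0 then - z
     else (1 / (1 - hinner z a)) *s
       (a - line_proj a z - of_real (sqrt (1 - (norm a)\<^sup>2)) *s (z - line_proj a z)))"

definition invariant_grad :: "(complex ^ 'n \<Rightarrow> complex) \<Rightarrow> complex ^ 'n \<Rightarrow> complex ^ 'n"
  where "invariant_grad f z = cgrad (f \<circ> ball_involution z) 0"

definition bloch_space :: "real \<Rightarrow> (complex ^ 'n \<Rightarrow> complex) set"
  where "bloch_space s = {f. ball_holomorphic f \<and>
    bdd_above ((\<lambda>z. (1 - (norm z)\<^sup>2) powr s * norm (cgrad f z)) ` unit_ball)}"

end

theory Submission
  imports Defs "HOL-Complex_Analysis.Complex_Analysis"
begin

text \<open>
  Sufficiency: \<open>H\<^sub>f g (z)\<close> is the integral of \<open>cnj (f z) - cnj (f w)\<close> times \<open>g w\<close> against the Bergman kernel.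
  In each case with non-constant symbols the hypothesis on \<open>f\<close> bounds \<open>|f z - f w|\<close> by powers of
  \<open>|1 - \<langle>z,w\<rangle>|\<close>, \<open>1 - |z|\<^sup>2\<close> and \<open>1 - |w|\<^sup>2\<close>, so that \<open>|H\<^sub>f g|\<close> is dominated by positive integral operators
  applied to \<open>(1 - |w|\<^sup>2) powr (- \<gamma>) * |g w|\<close>. These satisfy Schur's test on \<open>L\<^sup>q\<close>, and the
  pointwise growth of functions in \<open>A\<^sup>p\<close> embeds \<open>A\<^sup>p\<close> with weight \<open>\<alpha>\<close> into the resulting weighted \<open>L\<^sup>q\<close>.

  Necessity: \<open>H\<^sub>f g\<close>, for \<open>g\<close> a power of the Bergman kernel at \<open>z\<close>, is paired with a function of the form
  \<open>\<langle>w - z, u\<rangle>\<close> times powers of \<open>1 - \<langle>w,z\<rangle>\<close> and \<open>1 - \<langle>z,w\<rangle>\<close>. By the reproducing formula the value of the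
  pairing is a derivative of \<open>f\<close> at \<open>z\<close>, and its size is controlled by the Hoelder inequality and the
  Forelli--Rudin estimate. When \<open>u\<close> is orthogonal to \<open>z\<close>, \<open>|\<langle>w - z, u\<rangle>|\<close> is of order \<open>|1 - \<langle>w,z\<rangle>| powr (1/2)\<close>,
  while along \<open>z\<close> it is only of order \<open>|1 - \<langle>w,z\<rangle>|\<close> with the derivative scaled by \<open>1 - |z|\<^sup>2\<close>; hence the
  tangential derivatives grow at most like \<open>(1 - |z|\<^sup>2) powr (- \<gamma> - 1/2)\<close> and the radial ones like
  \<open>(1 - |z|\<^sup>2) powr (- \<gamma> - 1)\<close>. Below the critical exponents these bounds decay at the sphere and the maximum
  principle forces \<open>f\<close> to be constant.
\<close>

text \<open>Write \<open>dfct x\<close> for one minus the squared norm of \<open>x\<close>. Every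
  sufficiency case with a non-constant symbol and \<open>\<gamma> \<le> 0\<close> passes through one
  anisotropic bound: with \<open>\<delta> = - \<gamma>\<close>, the derivative of \<open>f\<close>
  at \<open>x\<close> in direction \<open>v\<close> is at most a multiple of \<open>dfct x powr
  (\<delta> - 1/2) * norm v + dfct x powr (\<delta> - 1) * cmod (hinner v x)\<close>. In dimension
  one this is the Bloch condition rewritten, and at \<open>\<gamma> = -1/2\<close> it is the bound
  on \<open>invariant_grad\<close>. In between it follows from the Bloch condition by summing
  tangential increments over dyadic depths, a geometric series of ratio
  \<open>2 powr (\<delta> - 1/2)\<close>; this ratio is below 1 only for
  \<open>\<delta> < 1/2\<close>, which is the origin of the critical exponent -1/2.

  The exact integrals come from translation and rotation invariance: integration by parts and
  averaging over unimodular scalars give the moments of a holomorphic function against powers of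
  \<open>hinner z w\<close>. Summed against binomial series they yield the reproducing formula and
  turn the Forelli--Rudin estimate into a comparison of Pochhammer symbols.\<close>

unbundle no fps_syntax

section \<open>The Hermitian product\<close>

lemma norm_vec_smult: "norm (c *s v) = cmod c * norm (v :: complex ^ 'n)"
proof -
  have "(norm (c *s v))\<^sup>2 = (cmod c * norm v)\<^sup>2"
    by (simp add: norm_vec_def L2_set_def sum_nonneg power_mult_distrib norm_mult flip: sum_distrib_left)
  then show ?thesis by (simp add: power2_eq_iff_nonneg)
qed

lemma of_real_vec_smult: "complex_of_real r *s v = r *\<^sub>R (v :: complex ^ 'n)"
  unfolding vec_eq_iff vector_scaleR_component vector_smult_component by (simp add: scaleR_conv_of_real)

lemma hinner_add_left: "hinner (x + y) w = hinner x w + hinner y w"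
  by (simp add: hinner_def algebra_simps sum.distrib)

lemma hinner_add_right: "hinner w (x + y) = hinner w x + hinner w y"
  by (simp add: hinner_def algebra_simps sum.distrib)

lemma hinner_diff_left: "hinner (x - y) w = hinner x w - hinner y w"
  by (simp add: hinner_def algebra_simps sum_subtractf)

lemma hinner_diff_right: "hinner w (x - y) = hinner w x - hinner w y"
  by (simp add: hinner_def algebra_simps sum_subtractf)

lemma hinner_smult_left [simp]: "hinner (c *s x) w = c * hinner x w"
  by (simp add: hinner_def algebra_simps sum_distrib_left)

lemma hinner_smult_right [simp]: "hinner w (c *s x) = cnj c * hinner w x"
  by (simp add: hinner_def algebra_simps sum_distrib_left)

lemma hinner_scaleR_left [simp]: "hinner (c *\<^sub>R x) w = of_real c * hinner x w"
  by (simp flip: of_real_vec_smult)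

lemma hinner_scaleR_right [simp]: "hinner w (c *\<^sub>R x) = of_real c * hinner w x"
  by (simp flip: of_real_vec_smult)

lemma hinner_zero_left [simp]: "hinner 0 w = 0"
  by (simp add: hinner_def)

lemma hinner_zero_right [simp]: "hinner w 0 = 0"
  by (simp add: hinner_def)

lemma hinner_minus_left [simp]: "hinner (- x) w = - hinner x w"
  using hinner_diff_left[of 0 x w] by simp

lemma cnj_hinner [simp]: "cnj (hinner z w) = hinner w z"
  by (simp add: hinner_def mult.commute)

lemma hinner_self: "hinner z z = of_real ((norm z)\<^sup>2)"
proof -
  have "hinner z z = (\<Sum>k\<in>UNIV. of_real ((cmod (z $ k))\<^sup>2))"
    unfolding hinner_def by (intro sum.cong refl) (metis complex_norm_square)
  also have "\<dots> = of_real ((norm z)\<^sup>2)"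
    by (simp add: norm_vec_def L2_set_def sum_nonneg)
  finally show ?thesis .
qed

lemma Re_hinner: "Re (hinner z w) = inner z w"
  by (simp add: hinner_def inner_vec_def inner_complex_def)

lemma norm_hinner_le: "cmod (hinner z w) \<le> norm z * norm w"
proof -
  have "cmod (hinner z w) \<le> (\<Sum>k\<in>UNIV. cmod (z $ k) * cmod (w $ k))"
    unfolding hinner_def by (rule order_trans[OF norm_sum]) (simp add: norm_mult)
  also have "\<dots> \<le> norm z * norm w"
    unfolding norm_vec_def using L2_set_mult_ineq[of "\<lambda>k. cmod (z $ k)" "\<lambda>k. cmod (w $ k)" UNIV] by simp
  finally show ?thesis .
qed

lemma hinner_axis_right: "hinner z (axis k 1) = z $ k"
  by (simp add: hinner_def axis_def if_distrib [of cnj] if_distrib [of "\<lambda>x. _ * x"] cong: if_cong)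

lemma continuous_on_hinner [continuous_intros]:
  assumes "continuous_on S f" "continuous_on S g"
  shows "continuous_on S (\<lambda>x. hinner (f x) (g x))"
  unfolding hinner_def by (intro continuous_intros assms)

lemma bounded_linear_hinner_left: "bounded_linear (\<lambda>z. hinner z w)"
  by (rule bounded_linear_intro[where K = "norm w"])
    (simp_all add: hinner_add_left norm_hinner_le, simp add: scaleR_conv_of_real)

lemma bounded_linear_smult_left: "bounded_linear (\<lambda>c. c *s (v :: complex ^ 'n))"
  by (rule bounded_linear_intro[where K = "norm v"])
    (auto simp: vec_eq_iff algebra_simps norm_vec_smult)

lemma bounded_linear_smult_right: "bounded_linear (\<lambda>v. c *s (v :: complex ^ 'n))"
  by (rule bounded_linear_intro[where K = "cmod c"])
    (simp_all add: vec_eq_iff algebra_simps norm_vec_smult)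

lemma continuous_on_vec_smult [continuous_intros]:
  fixes g :: "'a::topological_space \<Rightarrow> complex ^ 'n"
  assumes "continuous_on S f" "continuous_on S g"
  shows "continuous_on S (\<lambda>x. f x *s g x)"
proof -
  have "(\<lambda>x. f x *s g x) = (\<lambda>x. \<chi> k. f x * g x $ k)" by (simp add: fun_eq_iff vec_eq_iff)
  then show ?thesis by (simp only:) (intro continuous_on_vec_lambda continuous_intros assms)
qed

section \<open>The defining function of the ball and its comparison with
  \<open>1 - hinner z w\<close>\<close>

definition dfct :: "complex ^ 'n \<Rightarrow> real"
  where "dfct w = 1 - (norm w)\<^sup>2"

lemma dfct_pos: "w \<in> unit_ball \<Longrightarrow> dfct w > 0"
  by (simp add: dfct_def power2_eq_square) (metis mult_strict_mono' mult_1 norm_ge_zero)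

lemma dfct_le_1: "dfct w \<le> 1"
  by (simp add: dfct_def)

lemma continuous_on_dfct [continuous_intros]: "continuous_on S f \<Longrightarrow> continuous_on S (\<lambda>x. dfct (f x))"
  unfolding dfct_def by (intro continuous_intros)

text \<open>The second argument may lie on the sphere. A kernel power with its pole inside the ball
  is therefore continuous on the closed ball, hence bounded.\<close>

lemma Re_one_minus_hinner:
  assumes "z \<in> unit_ball" "norm w \<le> 1"
  shows "1 - norm z \<le> Re (1 - hinner z w)" "0 < Re (1 - hinner z w)"
proof -
  have "Re (hinner z w) \<le> cmod (hinner z w)" by (rule complex_Re_le_cmod)
  also have "\<dots> \<le> norm z * norm w" by (rule norm_hinner_le)
  also have "\<dots> \<le> norm z" using assms(2) by (simp add: mult_left_le)
  finally show "1 - norm z \<le> Re (1 - hinner z w)" by simp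
  with assms(1) show "0 < Re (1 - hinner z w)" by simp
qed

lemma one_minus_hinner_commute: "1 - hinner z w = cnj (1 - hinner w z)"
  by simp

lemma cmod_one_minus_hinner_commute: "cmod (1 - hinner z w) = cmod (1 - hinner w z)"
  by (metis one_minus_hinner_commute complex_mod_cnj)

lemma cmod_one_minus_hinner_pos:
  assumes "z \<in> unit_ball" "w \<in> unit_ball"
  shows "0 < cmod (1 - hinner z w)"
  using order.strict_trans2[OF Re_one_minus_hinner(2)[of z w] complex_Re_le_cmod] assms by auto

lemma cmod_one_minus_hinner_le2:
  assumes "z \<in> unit_ball" "w \<in> unit_ball"
  shows "cmod (1 - hinner z w) \<le> 2"
proof -
  have "cmod (1 - hinner z w) \<le> 1 + cmod (hinner z w)"
    using norm_triangle_ineq4[of 1 "hinner z w"] by simp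
  moreover have "cmod (hinner z w) \<le> 1"
    using norm_hinner_le[of z w] assms mult_mono[of "norm z" 1 "norm w" 1] by simp
  ultimately show ?thesis by simp
qed

text \<open>Both sides are compared with \<open>1 - norm z\<close>: the factor
  \<open>1 + norm z\<close> costs 2, and the real part of \<open>1 - hinner z w\<close> dominates
  \<open>1 - norm z\<close>. This allows powers of the depth to be traded for powers of the
  kernel.\<close>

lemma dfct_le_hinner:
  assumes "z \<in> unit_ball" "w \<in> unit_ball"
  shows "dfct z \<le> 2 * cmod (1 - hinner z w)"
proof -
  have "dfct z = (1 + norm z) * (1 - norm z)"
    by (simp add: dfct_def power2_eq_square algebra_simps)
  also have "\<dots> \<le> 2 * (1 - norm z)"
    using assms(1) by (intro mult_right_mono) auto
  also have "1 - norm z \<le> cmod (1 - hinner z w)"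
    using Re_one_minus_hinner(1)[of z w] assms complex_Re_le_cmod[of "1 - hinner z w"] by simp
  finally show ?thesis by simp
qed

section \<open>Weighted Lebesgue measure on the ball\<close>

text \<open>Left unnormalised, so that a change of exponent is multiplication by a power of
  \<open>dfct\<close> without constants. The normalisation reappears only through the total mass
  \<open>bmass\<close>.\<close>

definition bmeas :: "real \<Rightarrow> (complex ^ 'n) measure"
  where "bmeas b = density (restrict_space lborel unit_ball) (\<lambda>w. ennreal (dfct w powr b))"

lemma space_bmeas [simp]: "space (bmeas b) = unit_ball"
  by (simp add: bmeas_def space_restrict_space)

lemma sets_bmeas: "sets (bmeas b) = sets (restrict_space borel unit_ball)"
  by (simp add: bmeas_def sets_restrict_space)

lemma measurable_bmeas: "borel_measurable (bmeas b) = borel_measurable (restrict_space borel unit_ball)"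
  by (intro measurable_cong_sets sets_bmeas refl)

lemma measurable_bmeas_lborel:
  "borel_measurable (restrict_space lborel unit_ball) = borel_measurable (restrict_space borel unit_ball)"
  by (intro measurable_cong_sets) (simp_all add: sets_restrict_space)

lemma dfct_measurable [measurable]: "dfct \<in> borel_measurable borel"
  unfolding dfct_def[abs_def] by measurable

lemma dfct_powr_measurable: "(\<lambda>w. dfct w powr b) \<in> borel_measurable borel"
  by measurable

lemma measurable_bmeas_of_borel:
  "f \<in> borel_measurable borel \<Longrightarrow> f \<in> borel_measurable (bmeas b)"
  unfolding measurable_bmeas by (rule measurable_restrict_space1)

lemma dfct_powr_measurable_bmeas [measurable]: "(\<lambda>w. dfct w powr r) \<in> borel_measurable (bmeas b)"
  by (rule measurable_bmeas_of_borel[OF dfct_powr_measurable])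

lemma measurable_bmeas_continuous:
  fixes f :: "complex ^ 'n \<Rightarrow> 'b::topological_space"
  shows "continuous_on unit_ball f \<Longrightarrow> f \<in> borel_measurable (bmeas b)"
  unfolding measurable_bmeas by (rule borel_measurable_continuous_on_restrict)

lemma integral_bmeas:
  fixes F :: "complex ^ 'n \<Rightarrow> 'b::{banach, second_countable_topology}"
  assumes "F \<in> borel_measurable (bmeas b)"
  shows "(\<integral>w. F w \<partial>bmeas b) = (\<integral>w. indicator unit_ball w *\<^sub>R (dfct w powr b *\<^sub>R F w) \<partial>lborel)"
proof -
  have "(\<integral>w. F w \<partial>bmeas b) = (\<integral>w. dfct w powr b *\<^sub>R F w \<partial>restrict_space lborel unit_ball)"
    unfolding bmeas_def
    by (rule integral_density)
      (use assms in \<open>auto simp: measurable_bmeas measurable_bmeas_lborel intro: measurable_restrict_space1\<close>)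
  also have "\<dots> = (\<integral>w. indicator unit_ball w *\<^sub>R (dfct w powr b *\<^sub>R F w) \<partial>lborel)"
    by (subst integral_restrict_space) auto
  finally show ?thesis .
qed

lemma integrable_bmeas:
  fixes F :: "complex ^ 'n \<Rightarrow> 'b::{banach, second_countable_topology}"
  assumes "F \<in> borel_measurable (bmeas b)"
  shows "integrable (bmeas b) F \<longleftrightarrow>
    integrable lborel (\<lambda>w. indicator unit_ball w *\<^sub>R (dfct w powr b *\<^sub>R F w))"
proof -
  have "integrable (bmeas b) F \<longleftrightarrow> integrable (restrict_space lborel unit_ball) (\<lambda>w. dfct w powr b *\<^sub>R F w)"
    unfolding bmeas_def
    by (rule integrable_density)
      (use assms in \<open>auto simp: measurable_bmeas measurable_bmeas_lborel intro: measurable_restrict_space1\<close>)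
  also have "\<dots> \<longleftrightarrow> integrable lborel (\<lambda>w. indicator unit_ball w *\<^sub>R (dfct w powr b *\<^sub>R F w))"
    by (subst integrable_restrict_space) auto
  finally show ?thesis .
qed

lemma bmeas_eq_density: "bmeas (a + b) = density (bmeas a) (\<lambda>w. ennreal (dfct w powr b))"
proof -
  have "density (bmeas a) (\<lambda>w. ennreal (dfct w powr b)) =
    density (restrict_space lborel unit_ball) (\<lambda>w. ennreal (dfct w powr a) * ennreal (dfct w powr b))"
    unfolding bmeas_def
    by (rule density_density_eq) (auto intro!: measurable_restrict_space1)
  also have "\<dots> = bmeas (a + b)"
    unfolding bmeas_def by (simp add: powr_add ennreal_mult)
  finally show ?thesis by (rule sym)
qed

lemma integral_bmeas_shift:
  fixes F :: "complex ^ 'n \<Rightarrow> 'b::{banach, second_countable_topology}"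
  assumes "F \<in> borel_measurable (bmeas a)"
  shows "(\<integral>w. F w \<partial>bmeas (a + b)) = (\<integral>w. dfct w powr b *\<^sub>R F w \<partial>bmeas a)"
  unfolding bmeas_eq_density
  by (rule integral_density) (use assms in auto)

lemma integrable_bmeas_shift:
  fixes F :: "complex ^ 'n \<Rightarrow> 'b::{banach, second_countable_topology}"
  assumes "F \<in> borel_measurable (bmeas a)"
  shows "integrable (bmeas (a + b)) F \<longleftrightarrow> integrable (bmeas a) (\<lambda>w. dfct w powr b *\<^sub>R F w)"
  unfolding bmeas_eq_density
  by (rule integrable_density) (use assms in auto)

text \<open>Bernoulli's inequality makes the volume linear in the thickness; with dyadic shells this
  stands in for integration in polar coordinates.\<close>

lemma emeasure_shell_le:
  assumes "0 \<le> u" "u \<le> 1"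
  shows "emeasure lborel {w :: complex ^ 'n. 1 - u \<le> norm w \<and> norm w < 1}
    \<le> ennreal (unit_ball_vol (real DIM(complex ^ 'n)) * real DIM(complex ^ 'n) * u)"
proof -
  let ?d = "DIM(complex ^ 'n)"
  have "{w :: complex ^ 'n. 1 - u \<le> norm w \<and> norm w < 1} = ball 0 1 - ball 0 (1 - u)"
    by auto
  then have "emeasure lborel {w :: complex ^ 'n. 1 - u \<le> norm w \<and> norm w < 1}
      = emeasure lborel (ball (0 :: complex ^ 'n) 1) - emeasure lborel (ball (0 :: complex ^ 'n) (1 - u))"
    using assms by (simp add: emeasure_Diff emeasure_ball subset_ball)
  also have "\<dots> = ennreal (unit_ball_vol (real ?d) * (1 - (1 - u) ^ ?d))"
    using assms by (simp add: emeasure_ball ennreal_minus unit_ball_vol_nonneg algebra_simps)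
  also have "\<dots> \<le> ennreal (unit_ball_vol (real ?d) * (real ?d * u))"
  proof (intro ennreal_leI mult_left_mono)
    have "1 + real ?d * (- u) \<le> (1 + (- u)) ^ ?d"
      by (rule Bernoulli_inequality) (use assms in auto)
    then show "1 - (1 - u) ^ ?d \<le> real ?d * u" by simp
  qed simp
  finally show ?thesis by (simp add: mult.assoc)
qed

text \<open>The shells are nested, so the sum overcounts. Only the term with
  \<open>1 / 2 ^ Suc j < 1 - norm w\<close> and \<open>1 - norm w \<le> 1 / 2 ^ j\<close> is used;
  there \<open>dfct w \<ge> 1 - norm w\<close> controls the singular weight.\<close>

lemma one_minus_norm_powr_le:
  fixes w :: "complex ^ 'n"
  assumes "b \<le> 0" "w \<in> unit_ball"
  shows "ennreal (dfct w powr b) \<le> (\<Sum>j. ennreal (2 powr (- b * (real j + 1))) *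
    indicator {w. 1 - 1 / 2 ^ j \<le> norm w \<and> norm w < 1} w)" (is "_ \<le> (\<Sum>j. ?g j)")
proof -
  define x where "x = 1 - norm w"
  have x: "0 < x" "x \<le> 1" using assms(2) by (auto simp: x_def)
  obtain j where j: "1 / 2 ^ Suc j < x" "x \<le> 1 / 2 ^ j"
  proof -
    define k where "k = (LEAST k. 1 / 2 ^ k < x)"
    have "\<exists>k. 1 / 2 ^ k < x"
      using real_arch_pow_inv[of x "1/2"] x by (auto simp: power_one_over)
    then have k: "1 / 2 ^ k < x" unfolding k_def by (rule LeastI_ex)
    then have "k \<noteq> 0" using x by (intro notI) simp
    then obtain j where "k = Suc j" by (cases k) auto
    moreover have "\<not> 1 / 2 ^ j < x"
      using not_less_Least[of j "\<lambda>k. 1 / 2 ^ k < x"] \<open>k = Suc j\<close> by (simp add: k_def)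
    ultimately show thesis using k that by auto
  qed
  have "dfct w powr b \<le> x powr b"
  proof (rule powr_mono2')
    have "dfct w = (1 + norm w) * x" by (simp add: dfct_def x_def power2_eq_square algebra_simps)
    also have "\<dots> \<ge> 1 * x" using x by (intro mult_right_mono) auto
    finally show "x \<le> dfct w" by simp
  qed (use assms x in auto)
  also have "\<dots> \<le> (1 / 2 ^ Suc j) powr b"
    by (rule powr_mono2') (use assms j in auto)
  also have "(1 / 2 ^ Suc j :: real) = 2 powr (- (real j + 1))"
    using powr_minus[of "2::real" "real (Suc j)"] powr_realpow[of "2::real" "Suc j"]
    by (simp add: inverse_eq_divide add.commute)
  also have "\<dots> powr b = 2 powr (- b * (real j + 1))"
    by (simp add: powr_powr mult.commute algebra_simps)
  finally have "ennreal (dfct w powr b) \<le> ?g j"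
    using j x by (simp add: x_def indicator_def ennreal_leI algebra_simps)
  also have "\<dots> \<le> (\<Sum>j. ?g j)"
  proof -
    have "sum ?g {j} \<le> suminf ?g" by (intro sum_le_suminf summableI) auto
    then show ?thesis
      by (simp only: sum.insert_if finite.intros sum.empty empty_iff if_False add_0_right)
  qed
  finally show ?thesis .
qed

text \<open>For \<open>b \<le> 0\<close> the shell of index j carries weight of order
  \<open>2 powr (- b * real j)\<close> and volume of order \<open>1 / 2 ^ j\<close>. The resulting
  geometric series has ratio \<open>2 powr (- b - 1)\<close>, which is below 1 because
  \<open>b > -1\<close>. For positive \<open>b\<close> the weight is at most 1.\<close>

lemma emeasure_bmeas_finite:
  assumes "b > -1"
  shows "emeasure (bmeas b) (space (bmeas b :: (complex ^ 'n) measure)) < \<infinity>"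
proof (cases "b \<le> 0")
  case True
  define C where "C = unit_ball_vol (real DIM(complex ^ 'n)) * real DIM(complex ^ 'n)"
  have C: "C \<ge> 0" by (simp add: C_def)
  have meas: "{w :: complex ^ 'n. 1 - 1 / 2 ^ j \<le> norm w \<and> norm w < 1} \<in> sets borel" for j :: nat
    by measurable
  have "emeasure (bmeas b) (space (bmeas b :: (complex ^ 'n) measure))
      = (\<integral>\<^sup>+w. ennreal (dfct w powr b) \<partial>restrict_space lborel (unit_ball :: (complex ^ 'n) set))"
    unfolding bmeas_def
    by (subst emeasure_density) (auto intro!: measurable_restrict_space1 nn_integral_cong simp: space_restrict_space sets_restrict_space)
  also have "\<dots> = (\<integral>\<^sup>+w. ennreal (dfct w powr b) * indicator (unit_ball :: (complex ^ 'n) set) w \<partial>lborel)"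
    by (rule nn_integral_restrict_space) simp
  also have "\<dots> \<le> (\<integral>\<^sup>+w. (\<Sum>j. ennreal (2 powr (- b * (real j + 1))) *
      indicator {w :: complex ^ 'n. 1 - 1 / 2 ^ j \<le> norm w \<and> norm w < 1} w) \<partial>lborel)"
  proof (intro nn_integral_mono)
    fix w :: "complex ^ 'n"
    show "ennreal (dfct w powr b) * indicator unit_ball w \<le> (\<Sum>j. ennreal (2 powr (- b * (real j + 1))) *
      indicator {w :: complex ^ 'n. 1 - 1 / 2 ^ j \<le> norm w \<and> norm w < 1} w)"
      using one_minus_norm_powr_le[OF True, of w]
      by (cases "w \<in> unit_ball") (simp_all del: mem_ball mem_ball_0)
  qed
  also have "\<dots> = (\<Sum>j. \<integral>\<^sup>+w. ennreal (2 powr (- b * (real j + 1))) *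
      indicator {w :: complex ^ 'n. 1 - 1 / 2 ^ j \<le> norm w \<and> norm w < 1} w \<partial>lborel)"
    by (rule nn_integral_suminf) (use meas in measurable)
  also have "\<dots> = (\<Sum>j. ennreal (2 powr (- b * (real j + 1))) *
      emeasure lborel {w :: complex ^ 'n. 1 - 1 / 2 ^ j \<le> norm w \<and> norm w < 1})"
    using meas by (simp add: nn_integral_cmult_indicator)
  also have "\<dots> \<le> (\<Sum>j. ennreal (2 powr (- b) * C * (2 powr (- b - 1)) ^ j))"
  proof (intro suminf_le summableI)
    fix j :: nat
    have "ennreal (2 powr (- b * (real j + 1))) *
        emeasure lborel {w :: complex ^ 'n. 1 - 1 / 2 ^ j \<le> norm w \<and> norm w < 1}
      \<le> ennreal (2 powr (- b * (real j + 1))) * ennreal (C * (1 / 2 ^ j))"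
      unfolding C_def by (intro mult_left_mono emeasure_shell_le) auto
    also have "\<dots> = ennreal (2 powr (- b * (real j + 1)) * (C * (1 / 2 ^ j)))"
      using C by (intro ennreal_mult[symmetric]) auto
    also have "2 powr (- b * (real j + 1)) * (C * (1 / 2 ^ j)) = 2 powr (- b) * C * (2 powr (- b - 1)) ^ j"
    proof -
      have "(2 powr (- b - 1)) ^ j = 2 powr ((- b - 1) * real j)"
        by (simp add: powr_powr flip: powr_realpow)
      moreover have "1 / 2 ^ j = 2 powr (- real j)" by (simp add: powr_minus powr_realpow divide_simps)
      ultimately show ?thesis
        by (simp add: powr_add[symmetric] algebra_simps) 
    qed
    finally show "ennreal (2 powr (- b * (real j + 1))) *
        emeasure lborel {w :: complex ^ 'n. 1 - 1 / 2 ^ j \<le> norm w \<and> norm w < 1}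
      \<le> ennreal (2 powr (- b) * C * (2 powr (- b - 1)) ^ j)" .
  qed
  also have "\<dots> < \<infinity>"
  proof -
    have "2 powr (- b - 1) < (1::real)" using assms by (intro powr_less_one) auto
    then have "summable (\<lambda>j. 2 powr (- b) * C * (2 powr (- b - 1)) ^ j)"
      by (intro summable_mult summable_geometric) auto
    then show ?thesis using C by (subst suminf_ennreal2) auto
  qed
  finally show ?thesis .
next
  case False
  have "emeasure (bmeas b) (space (bmeas b :: (complex ^ 'n) measure))
      = (\<integral>\<^sup>+w. ennreal (dfct w powr b) \<partial>restrict_space lborel (unit_ball :: (complex ^ 'n) set))"
    unfolding bmeas_def
    by (subst emeasure_density) (auto intro!: measurable_restrict_space1 nn_integral_cong simp: space_restrict_space sets_restrict_space)
  also have "\<dots> = (\<integral>\<^sup>+w. ennreal (dfct w powr b) * indicator (unit_ball :: (complex ^ 'n) set) w \<partial>lborel)"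
    by (rule nn_integral_restrict_space) simp
  also have "\<dots> \<le> (\<integral>\<^sup>+w. indicator (unit_ball :: (complex ^ 'n) set) w \<partial>lborel)"
  proof (intro nn_integral_mono)
    fix w :: "complex ^ 'n"
    show "ennreal (dfct w powr b) * indicator unit_ball w \<le> indicator unit_ball w"
    proof (cases "w \<in> unit_ball")
      case True
      then have "dfct w powr b \<le> 1" using dfct_pos[OF True] dfct_le_1[of w] False
        by (intro powr_le1) auto
      then show ?thesis using True by (simp add: ennreal_le_1)
    qed simp
  qed
  also have "\<dots> < \<infinity>" by (simp add: emeasure_ball)
  finally show ?thesis .
qed

lemma finite_measure_bmeas: "b > -1 \<Longrightarrow> finite_measure (bmeas b)"
  using emeasure_bmeas_finite[of b] by (intro finite_measureI) (simp add: less_top)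

text \<open>The type token carries the dimension, which the real-valued result could not
  reveal.\<close>

definition bmass :: "'n::finite itself \<Rightarrow> real \<Rightarrow> real"
  where "bmass _ b = measure (bmeas b) (unit_ball :: (complex ^ 'n) set)"

lemma bmass_pos:
  assumes "b > -1"
  shows "bmass TYPE('n::finite) b > 0"
proof -
  interpret finite_measure "bmeas b :: (complex ^ 'n) measure" by (rule finite_measure_bmeas[OF assms])
  have "emeasure (bmeas b) (unit_ball :: (complex ^ 'n) set) \<noteq> 0"
  proof
    assume "emeasure (bmeas b) (unit_ball :: (complex ^ 'n) set) = 0"
    then have "(\<integral>\<^sup>+w. ennreal (dfct w powr b) \<partial>restrict_space lborel (unit_ball :: (complex ^ 'n) set)) = 0"
      unfolding bmeas_def
      by (subst (asm) emeasure_density)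
        (auto intro!: measurable_restrict_space1 nn_integral_cong simp: space_restrict_space sets_restrict_space
          elim!: back_subst[of "\<lambda>x. x = 0"])
    then have "(\<integral>\<^sup>+w. ennreal (dfct w powr b) * indicator (unit_ball :: (complex ^ 'n) set) w \<partial>lborel) = 0"
      by (subst (asm) nn_integral_restrict_space) auto
    moreover have "(\<lambda>w. ennreal (dfct w powr b) * indicator (unit_ball :: (complex ^ 'n) set) w) \<in> borel_measurable lborel"
      by (intro borel_measurable_times_ennreal borel_measurable_indicator) auto
    ultimately have "AE w in lborel. ennreal (dfct w powr b) * indicator (unit_ball :: (complex ^ 'n) set) w = 0"
      by (subst (asm) nn_integral_0_iff_AE) auto
    then have "AE w in lborel. w \<notin> (unit_ball :: (complex ^ 'n) set)"
    proof eventually_elim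
      case (elim w)
      then show ?case using dfct_pos[of w] by (auto simp: ennreal_eq_0_iff indicator_def split: if_splits)
    qed
    then have "emeasure lborel (unit_ball :: (complex ^ 'n) set) = 0"
      by (subst (asm) AE_iff_measurable[of "unit_ball"]) auto
    then show False
      using unit_ball_vol_pos[of "real DIM(complex ^ 'n)"] by (simp add: emeasure_ball)
  qed
  then show ?thesis
    unfolding bmass_def by (simp add: emeasure_eq_measure zero_less_measure_iff)
qed

section \<open>Integration by parts and rotations\<close>

lemma integral_lborel_translate:
  fixes F :: "'a::euclidean_space \<Rightarrow> 'b::{banach, second_countable_topology}"
  assumes [measurable]: "F \<in> borel_measurable borel"
  shows "(\<integral>w. F (w + v) \<partial>lborel) = (\<integral>w. F w \<partial>lborel)"
    and "integrable lborel F \<Longrightarrow> integrable lborel (\<lambda>w. F (w + v))"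
proof -
  have eq: "lborel = distr lborel borel (\<lambda>w. w + v)"
  proof -
    have "(\<lambda>w. w + v) = (+) v" by (auto simp: add.commute)
    then show ?thesis by (simp only: lborel_distr_plus)
  qed
  show "(\<integral>w. F (w + v) \<partial>lborel) = (\<integral>w. F w \<partial>lborel)"
    by (subst (2) eq, subst integral_distr) auto
  show "integrable lborel (\<lambda>w. F (w + v))" if "integrable lborel F"
    using that by (subst (asm) eq, subst (asm) integrable_distr_eq) auto
qed

text \<open>Integrating the fundamental theorem of calculus along segments parallel to \<open>v\<close> over all base
  points turns the translation invariance of Lebesgue measure into an integration by parts formula;
  the finite exceptional sets allow an integrand whose derivative blows up on a sphere.\<close>

lemma integral_directional_derivative_eq_0:
  fixes \<Phi> \<Psi> :: "'a::euclidean_space \<Rightarrow> complex"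
  assumes int: "integrable lborel \<Phi>" "integrable lborel \<Psi>"
    and cont: "\<And>w. continuous_on UNIV (\<lambda>t::real. \<Phi> (w + t *\<^sub>R v))"
    and der: "\<And>w. \<exists>S. finite S \<and>
      (\<forall>t. t \<notin> S \<longrightarrow> ((\<lambda>t. \<Phi> (w + t *\<^sub>R v)) has_vector_derivative \<Psi> (w + t *\<^sub>R v)) (at t))"
  shows "(\<integral>w. \<Psi> w \<partial>lborel) = 0"
proof -
  have [measurable]: "\<Phi> \<in> borel_measurable borel" "\<Psi> \<in> borel_measurable borel"
    using int by (auto dest: borel_measurable_integrable)
  define f where "f = (\<lambda>(s::real, w). indicator {0..1} s *\<^sub>R \<Psi> (w + s *\<^sub>R v))"
  have f_meas: "f \<in> borel_measurable (lborel \<Otimes>\<^sub>M lborel)"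
    unfolding f_def by measurable
  have f_int: "integrable (lborel \<Otimes>\<^sub>M lborel) f"
  proof (rule lborel_pair.Fubini_integrable[OF f_meas])
    have "(\<integral>w. norm (f (s, w)) \<partial>lborel) = indicator {0..1} s * (\<integral>w. norm (\<Psi> w) \<partial>lborel)" for s
      using integral_lborel_translate(1)[of "\<lambda>w. norm (\<Psi> w)" "s *\<^sub>R v"] by (simp add: f_def)
    then show "integrable lborel (\<lambda>s. \<integral>w. norm (f (s, w)) \<partial>lborel)"
      by simp
    show "AE s in lborel. integrable lborel (\<lambda>w. f (s, w))"
      unfolding f_def using integral_lborel_translate(2)[OF _ int(2)] by simp
  qed
  have "(\<integral>w. \<integral>s. f (s, w) \<partial>lborel \<partial>lborel) = (\<integral>s. \<integral>w. f (s, w) \<partial>lborel \<partial>lborel)"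
    using lborel_pair.Fubini_integral[of "\<lambda>s w. f (s, w)"] f_int by (simp add: f_def)
  also have "\<dots> = (\<integral>s. indicator {0..1::real} s *\<^sub>R (\<integral>w. \<Psi> w \<partial>lborel) \<partial>lborel)"
    by (simp add: f_def integral_lborel_translate(1))
  also have "\<dots> = (\<integral>w. \<Psi> w \<partial>lborel)"
    by simp
  finally have "(\<integral>w. \<Psi> w \<partial>lborel) = (\<integral>w. \<integral>s. f (s, w) \<partial>lborel \<partial>lborel)" ..
  also have "\<dots> = (\<integral>w. \<Phi> (w + v) - \<Phi> w \<partial>lborel)"
  proof (rule integral_cong_AE)
    show "(\<lambda>w. \<integral>s. f (s, w) \<partial>lborel) \<in> borel_measurable lborel"
      unfolding f_def by measurable
    have "AE w in lborel. integrable lborel (\<lambda>s. f (s, w))"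
      using lborel_pair.AE_integrable_snd[of "\<lambda>s w. f (s, w)"] f_int by simp
    then show "AE w in lborel. (\<integral>s. f (s, w) \<partial>lborel) = \<Phi> (w + v) - \<Phi> w"
      unfolding f_def case_prod_conv
    proof eventually_elim
      case (elim w)
      obtain S where S: "finite S"
        "\<And>t. t \<notin> S \<Longrightarrow> ((\<lambda>t. \<Phi> (w + t *\<^sub>R v)) has_vector_derivative \<Psi> (w + t *\<^sub>R v)) (at t)"
        using der[of w] by blast
      have "((\<lambda>t. \<Psi> (w + t *\<^sub>R v)) has_integral \<Phi> (w + 1 *\<^sub>R v) - \<Phi> (w + 0 *\<^sub>R v)) {0..1}"
        by (rule fundamental_theorem_of_calculus_strong[OF S(1)])
          (use S(2) cont[of w] in \<open>auto intro: continuous_on_subset\<close>)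
      moreover have "set_integrable lborel {0..1} (\<lambda>s. \<Psi> (w + s *\<^sub>R v))"
        using elim by (simp add: set_integrable_def)
      from set_borel_integral_eq_integral(2)[OF this] have
        "(\<integral>s. indicator {0..1} s *\<^sub>R \<Psi> (w + s *\<^sub>R v) \<partial>lborel) = integral {0..1} (\<lambda>s. \<Psi> (w + s *\<^sub>R v))"
        by (simp add: set_lebesgue_integral_def)
      ultimately show ?case by (simp add: integral_unique)
    qed
  qed measurable
  also have "\<dots> = 0"
    using int integral_lborel_translate[of \<Phi> v] by simp
  finally show ?thesis .
qed

text \<open>The image measure \<open>m\<close> is compared with Lebesgue measure by a double
  integral over \<open>A\<close> and the unit ball \<open>?B\<close>: translations in each variable
  and Fubini turn the product of \<open>m A\<close> and the volume of \<open>?B\<close> into the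
  product of the volume of \<open>A\<close> and \<open>m ?B\<close>. An isometry preserves the ball,
  so the two factors belonging to \<open>?B\<close> cancel.\<close>

lemma lborel_distr_isometry:
  fixes T :: "'a::euclidean_space \<Rightarrow> 'a"
  assumes lin: "linear T" and iso: "\<And>x. norm (T x) = norm x"
  shows "distr lborel borel T = lborel"
proof -
  have "inj T"
    using lin by (simp add: linear_injective_0) (metis iso norm_eq_zero)
  then have "surj T" using lin linear_injective_imp_surjective by blast
  have [measurable]: "T \<in> borel_measurable borel"
    using lin by (simp add: linear_continuous_on linear_conv_bounded_linear borel_measurable_continuous_onI)
  let ?B = "ball (0::'a) 1"
  have [measurable]: "?B \<in> sets borel" by simp
  show ?thesis
  proof (rule measure_eqI)
    fix A assume "A \<in> sets (distr lborel borel T)"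
    then have [measurable]: "A \<in> sets borel" by simp
    have tr: "(\<integral>\<^sup>+y. g (y + c) \<partial>lborel) = (\<integral>\<^sup>+y. g y \<partial>lborel)"
      if [measurable]: "g \<in> borel_measurable borel" for g :: "'a \<Rightarrow> ennreal" and c
    proof -
      have "lborel = distr lborel borel (\<lambda>w. w + c)"
      proof -
        have "(\<lambda>w. w + c) = (+) c" by (auto simp: add.commute)
        then show ?thesis by (simp only: lborel_distr_plus)
      qed
      then show ?thesis by (subst (2) \<open>lborel = _\<close>, subst nn_integral_distr) auto
    qed
    have refl: "(\<integral>\<^sup>+y. g (- y) \<partial>lborel) = (\<integral>\<^sup>+y. g y \<partial>lborel)"
      if [measurable]: "g \<in> borel_measurable borel" for g :: "'a \<Rightarrow> ennreal"
    proof -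
      have "(\<integral>\<^sup>+y. g y \<partial>lborel) = (\<integral>\<^sup>+y. g y \<partial>distr lborel borel uminus)"
        using lborel_affine[of "-1" "0 :: 'a"] by (simp add: density_1)
      also have "\<dots> = (\<integral>\<^sup>+y. g (- y) \<partial>lborel)" by (rule nn_integral_distr) auto
      finally show ?thesis ..
    qed
    define m where "m X = emeasure lborel (T -` X)" for X
    have m: "(\<integral>\<^sup>+x. indicator X (T x) \<partial>lborel) = m X" if [measurable]: "X \<in> sets borel" for X
    proof -
      have "(\<integral>\<^sup>+x. indicator X (T x) \<partial>lborel) = (\<integral>\<^sup>+x. indicator (T -` X) x \<partial>lborel)"
        by (simp add: indicator_def)
      also have "T -` X \<in> sets lborel" using measurable_sets[of T borel borel X] by simp
      then have "(\<integral>\<^sup>+x. indicator (T -` X) x \<partial>lborel) = m X" unfolding m_def by simp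
      finally show ?thesis .
    qed
    have "m A * emeasure lborel ?B = (\<integral>\<^sup>+x. \<integral>\<^sup>+y. indicator A (T x) * indicator ?B y \<partial>lborel \<partial>lborel)"
      by (simp add: nn_integral_cmult nn_integral_multc m)
    also have "\<dots> = (\<integral>\<^sup>+x. \<integral>\<^sup>+y. indicator A (T x) * indicator ?B (y + T x) \<partial>lborel \<partial>lborel)"
    proof (rule nn_integral_cong)
      fix x
      show "(\<integral>\<^sup>+y. indicator A (T x) * indicator ?B y \<partial>lborel)
        = (\<integral>\<^sup>+y. indicator A (T x) * indicator ?B (y + T x) \<partial>lborel)"
        by (rule tr[symmetric]) measurable
    qed
    also have "\<dots> = (\<integral>\<^sup>+y. \<integral>\<^sup>+x. indicator A (T x) * indicator ?B (y + T x) \<partial>lborel \<partial>lborel)"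
      by (rule lborel_pair.Fubini'[symmetric]) measurable
    also have "\<dots> = (\<integral>\<^sup>+y. \<integral>\<^sup>+x. indicator A (T x - y) * indicator ?B (T x) \<partial>lborel \<partial>lborel)"
    proof (rule nn_integral_cong)
      fix y
      \<comment> \<open>Surjectivity pulls the translation by \<open>y\<close> in the image back to
        a translation by \<open>y'\<close> in the variable of integration.\<close>
      obtain y' where y': "y = T y'" using \<open>surj T\<close> by blast
      have "(\<integral>\<^sup>+x. indicator A (T x - y) * indicator ?B (T x) \<partial>lborel)
        = (\<integral>\<^sup>+x. indicator A (T (x + y') - y) * indicator ?B (T (x + y')) \<partial>lborel)"
        by (rule tr[symmetric]) measurable
      then show "(\<integral>\<^sup>+x. indicator A (T x) * indicator ?B (y + T x) \<partial>lborel)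
        = (\<integral>\<^sup>+x. indicator A (T x - y) * indicator ?B (T x) \<partial>lborel)"
        by (simp add: linear_add[OF lin] y' add.commute)
    qed
    also have "\<dots> = (\<integral>\<^sup>+x. \<integral>\<^sup>+y. indicator A (T x - y) * indicator ?B (T x) \<partial>lborel \<partial>lborel)"
      by (rule lborel_pair.Fubini') measurable
    also have "\<dots> = (\<integral>\<^sup>+x. emeasure lborel A * indicator ?B (T x) \<partial>lborel)"
    proof (rule nn_integral_cong)
      fix x
      have "(\<integral>\<^sup>+y. indicator A (T x - y) \<partial>lborel) = (\<integral>\<^sup>+y. indicator A (y + T x) \<partial>lborel)"
        using refl[of "\<lambda>y. indicator A (y + T x)"] by simp
      also have "\<dots> = emeasure lborel A" using tr[of "indicator A" "T x"] by simp
      finally show "(\<integral>\<^sup>+y. indicator A (T x - y) * indicator ?B (T x) \<partial>lborel)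
        = emeasure lborel A * indicator ?B (T x)"
        by (simp add: nn_integral_multc)
    qed
    also have "\<dots> = emeasure lborel A * m ?B"
      by (simp add: nn_integral_cmult m)
    also have "m ?B = emeasure lborel ?B"
      unfolding m_def by (rule arg_cong[of _ _ "emeasure lborel"]) (auto simp: iso)
    finally have "m A * emeasure lborel ?B = emeasure lborel A * emeasure lborel ?B" .
    moreover have "emeasure lborel ?B \<noteq> 0" "emeasure lborel ?B \<noteq> top"
      using less_imp_neq[OF unit_ball_vol_pos[of "real DIM('a)"]] by (auto simp: emeasure_ball)
    ultimately have "m A = emeasure lborel A"
      by (metis ennreal_mult_cancel_left mult.commute)
    then show "emeasure (distr lborel borel T) A = emeasure lborel A"
      by (simp add: emeasure_distr m_def)
  qed simp
qed

lemma dfct_rotate: "cmod c = 1 \<Longrightarrow> dfct (c *s w) = dfct w"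
  by (simp add: dfct_def norm_vec_smult)

lemma bmeas_rotate:
  fixes F :: "complex ^ 'n \<Rightarrow> 'b::{banach, second_countable_topology}"
  assumes c: "cmod c = 1" and F: "F \<in> borel_measurable (bmeas b)"
  shows "(\<lambda>w. F (c *s w)) \<in> borel_measurable (bmeas b)"
    and "(\<integral>w. F (c *s w) \<partial>bmeas b) = (\<integral>w. F w \<partial>bmeas b)"
    and "integrable (bmeas b) F \<Longrightarrow> integrable (bmeas b) (\<lambda>w. F (c *s w))"
proof -
  let ?T = "\<lambda>w :: complex ^ 'n. c *s w"
  have T: "distr lborel borel ?T = lborel"
    by (rule lborel_distr_isometry)
      (simp_all add: c norm_vec_smult bounded_linear_smult_right bounded_linear.linear)
  have Tm [measurable]: "?T \<in> borel_measurable borel"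
    by (intro borel_measurable_continuous_onI continuous_intros)
  show *: "(\<lambda>w. F (c *s w)) \<in> borel_measurable (bmeas b)"
    unfolding measurable_bmeas
    by (rule measurable_compose[OF _ F[unfolded measurable_bmeas]])
      (auto simp: norm_vec_smult c intro!: measurable_restrict_space3 Tm)
  define G where "G w = indicator unit_ball w *\<^sub>R (dfct w powr b *\<^sub>R F w)" for w
  have [measurable]: "G \<in> borel_measurable borel"
  proof -
    have "(\<lambda>w. dfct w powr b *\<^sub>R F w) \<in> borel_measurable (restrict_space borel unit_ball)"
      by (rule borel_measurable_scaleR[OF measurable_restrict_space1 F[unfolded measurable_bmeas]]) measurable
    then show ?thesis
      unfolding G_def by (subst borel_measurable_restrict_space_iff[symmetric]) auto
  qed
  have GT: "G (c *s w) = indicator unit_ball w *\<^sub>R (dfct w powr b *\<^sub>R F (c *s w))" for w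
    by (simp add: G_def dfct_rotate c indicator_def norm_vec_smult)
  show "(\<integral>w. F (c *s w) \<partial>bmeas b) = (\<integral>w. F w \<partial>bmeas b)"
    unfolding integral_bmeas[OF F] integral_bmeas[OF *] GT[symmetric] G_def[symmetric]
    by (subst (2) T[symmetric], subst integral_distr) auto
  show "integrable (bmeas b) (\<lambda>w. F (c *s w))" if "integrable (bmeas b) F"
    using that unfolding integrable_bmeas[OF F] integrable_bmeas[OF *] GT[symmetric] G_def[symmetric]
    by (subst (asm) T[symmetric], subst (asm) integrable_distr_eq) auto
qed

lemma integrable_bmeas_bounded:
  fixes F :: "complex ^ 'n \<Rightarrow> 'b::{banach, second_countable_topology}"
  assumes "b > -1" "F \<in> borel_measurable (bmeas b)" "\<And>w. w \<in> unit_ball \<Longrightarrow> norm (F w) \<le> B"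
  shows "integrable (bmeas b) F"
proof -
  interpret finite_measure "bmeas b :: (complex ^ 'n) measure" by (rule finite_measure_bmeas[OF assms(1)])
  show ?thesis
    by (rule integrable_const_bound[of _ B]) (use assms in auto)
qed

lemma integrable_bmeas_cball:
  fixes F :: "complex ^ 'n \<Rightarrow> 'b::{banach, second_countable_topology}"
  assumes "b > -1" "continuous_on (cball 0 1) F"
  shows "integrable (bmeas b) F"
proof -
  have "bounded (F ` cball 0 1)"
    by (intro compact_imp_bounded compact_continuous_image assms) auto
  then obtain B where B: "\<forall>y\<in>F ` cball 0 1. norm y \<le> B"
    unfolding bounded_iff by blast
  then show ?thesis
    by (intro integrable_bmeas_bounded[of _ _ B] assms measurable_bmeas_continuous)
      (use B in \<open>auto intro: continuous_on_subset[OF assms(2)]\<close>)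
qed

section \<open>Slice-holomorphic functions\<close>

text \<open>Continuity together with holomorphy on complex lines is a notion that one-variable
  arguments show to be stable under directional derivatives. The radius is a parameter because
  moments are first computed for functions holomorphic past the closed ball.\<close>

definition slice_hol :: "real \<Rightarrow> (complex ^ 'n \<Rightarrow> complex) \<Rightarrow> bool"
  where "slice_hol R h \<longleftrightarrow> continuous_on (ball 0 R) h \<and>
    (\<forall>x u. (\<lambda>t. h (x + t *s u)) holomorphic_on {t. x + t *s u \<in> ball 0 R})"

text \<open>The direction comes first, so that \<open>sderiv z h\<close> is again a function of the
  point and the operation can be iterated.\<close>

definition sderiv :: "complex ^ 'n \<Rightarrow> (complex ^ 'n \<Rightarrow> complex) \<Rightarrow> complex ^ 'n \<Rightarrow> complex"
  where "sderiv z h w = deriv (\<lambda>t. h (w + t *s z)) 0"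

lemma open_slice: "open {t. x + t *s u \<in> ball (a :: complex ^ 'n) R}"
proof -
  have "open ((\<lambda>t. x + t *s u) -` ball a R)"
    by (intro open_vimage continuous_intros) simp
  then show ?thesis by (simp add: vimage_def)
qed

lemma slice_hol_continuous: "slice_hol R h \<Longrightarrow> continuous_on (ball 0 R) h"
  by (simp add: slice_hol_def)

lemma slice_hol_slice:
  "slice_hol R h \<Longrightarrow> (\<lambda>t. h (x + t *s u)) holomorphic_on {t. x + t *s u \<in> ball 0 R}"
  by (simp add: slice_hol_def)

lemma slice_hol_subset: "slice_hol R h \<Longrightarrow> R' \<le> R \<Longrightarrow> slice_hol R' h"
proof -
  assume h: "slice_hol R h" and R: "R' \<le> R"
  have "(\<lambda>t. h (x + t *s u)) holomorphic_on {t. x + t *s u \<in> ball 0 R'}" for x u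
    by (rule holomorphic_on_subset[OF slice_hol_slice[OF h]]) (use R in auto)
  moreover have "continuous_on (ball 0 R') h"
    by (rule continuous_on_subset[OF slice_hol_continuous[OF h] subset_ball[OF R]])
  ultimately show ?thesis by (simp add: slice_hol_def)
qed

lemma slice_hol_has_field_derivative:
  assumes "slice_hol R h" "w + t0 *s z \<in> ball 0 R"
  shows "((\<lambda>t. h (w + t *s z)) has_field_derivative sderiv z h (w + t0 *s z)) (at t0)"
proof -
  have "((\<lambda>t. h (w + t *s z)) has_field_derivative deriv (\<lambda>t. h (w + t *s z)) t0) (at t0)"
    by (rule holomorphic_derivI[OF slice_hol_slice[OF assms(1)] open_slice]) (use assms in auto)
  moreover have "deriv (\<lambda>t. h (w + t *s z)) t0 = sderiv z h (w + t0 *s z)"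
  proof -
    have "deriv (\<lambda>t. h (w + t *s z)) t0 = deriv (\<lambda>t. h (w + (t + t0) *s z)) 0"
      using deriv_shift_0[of "\<lambda>t. h (w + t *s z)" t0] by (simp add: o_def add.commute)
    also have "(\<lambda>t. h (w + (t + t0) *s z)) = (\<lambda>t. h ((w + t0 *s z) + t *s z))"
      by (simp add: algebra_simps vector_sadd_rdistrib)
    finally show ?thesis by (simp add: sderiv_def)
  qed
  ultimately show ?thesis by simp
qed

text \<open>A first order Taylor expansion whose constant depends only on \<open>K\<close> and
  \<open>\<rho>\<close>, not on \<open>\<phi>\<close>; this uniformity carries limits and integrals
  later. The constant 32 is \<open>fact 2 * 4 ^ 2\<close>, from Cauchy's inequality for the second
  derivative on discs of radius \<open>\<rho> / 4\<close>.\<close>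

lemma holomorphic_remainder_bound:
  assumes hol: "\<phi> holomorphic_on ball 0 \<rho>" and K: "\<And>t. t \<in> ball 0 \<rho> \<Longrightarrow> cmod (\<phi> t) \<le> K"
    and \<rho>: "\<rho> > 0" and t: "cmod t \<le> \<rho> / 4"
  shows "cmod (\<phi> t - \<phi> 0 - deriv \<phi> 0 * t) \<le> 32 * K / \<rho>\<^sup>2 * (cmod t)\<^sup>2"
proof -
  have B: "cmod ((deriv ^^ 2) \<phi> x) \<le> 32 * K / \<rho>\<^sup>2" if x: "x \<in> ball 0 (\<rho>/2)" for x
  proof -
    have sub: "cball x (\<rho>/4) \<subseteq> ball 0 \<rho>"
    proof
      fix y assume "y \<in> cball x (\<rho>/4)"
      then have "cmod y \<le> cmod x + \<rho>/4"
        using norm_triangle_sub[of y x] by (auto simp: dist_norm norm_minus_commute)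
      then show "y \<in> ball 0 \<rho>" using x \<rho> by auto
    qed
    have "cmod ((deriv ^^ 2) \<phi> x) \<le> fact 2 * K / (\<rho>/4) ^ 2"
    proof (rule Cauchy_inequality)
      show "\<phi> holomorphic_on ball x (\<rho>/4)"
        using sub by (intro holomorphic_on_subset[OF hol]) auto
      show "continuous_on (cball x (\<rho>/4)) \<phi>"
        using sub by (intro holomorphic_on_imp_continuous_on holomorphic_on_subset[OF hol]) auto
      show "cmod (\<phi> y) \<le> K" if "cmod (x - y) = \<rho>/4" for y
        using sub that by (intro K) (auto simp: dist_norm)
    qed (use \<rho> in auto)
    then show ?thesis by (simp add: power2_eq_square divide_simps)
  qed
  have "cmod ((deriv ^^ 0) \<phi> t - (\<Sum>i\<le>1. (deriv ^^ i) \<phi> 0 * (t - 0) ^ i / fact i))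
    \<le> 32 * K / \<rho>\<^sup>2 * cmod (t - 0) ^ Suc 1 / fact 1"
  proof (rule complex_Taylor[of "ball 0 (\<rho>/2)" 1 "\<lambda>i. (deriv ^^ i) \<phi>"])
    fix i :: nat and x assume x: "x \<in> ball (0::complex) (\<rho>/2)"
    have "(deriv ^^ i) \<phi> holomorphic_on ball 0 \<rho>"
      by (intro holomorphic_higher_deriv hol) auto
    from holomorphic_derivI[OF this, of x]
    show "((deriv ^^ i) \<phi> has_field_derivative (deriv ^^ Suc i) \<phi> x) (at x within ball 0 (\<rho> / 2))"
      using x \<rho> by (auto intro: has_field_derivative_at_within)
  next
    fix x assume "x \<in> ball (0::complex) (\<rho>/2)"
    then show "cmod ((deriv ^^ Suc 1) \<phi> x) \<le> 32 * K / \<rho>\<^sup>2"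
      using B[of x] by (simp add: numeral_2_eq_2)
  qed (use t \<rho> in auto)
  then show ?thesis by (simp add: algebra_simps power2_eq_square)
qed

text \<open>Difference quotients in the fixed direction \<open>z\<close> converge uniformly on
  smaller balls: compactness of an intermediate closed ball supplies one bound \<open>K\<close>, and
  one radius \<open>\<rho>\<close> of discs fits at every base point.\<close>

lemma slice_hol_quotient_bound:
  fixes h :: "complex ^ 'n \<Rightarrow> complex"
  assumes h: "slice_hol R h" and R: "0 \<le> R'" "R' < R"
  obtains C \<epsilon> where "\<epsilon> > 0" "\<And>w t. w \<in> ball 0 R' \<Longrightarrow> cmod t \<le> \<epsilon> \<Longrightarrow>
    cmod (h (w + t *s z) - h w - sderiv z h w * t) \<le> C * (cmod t)\<^sup>2"
proof -
  define R2 where "R2 = (R + R') / 2"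
  have R2: "R' < R2" "R2 < R" using R by (auto simp: R2_def)
  have "bounded (h ` cball 0 R2)"
    by (intro compact_imp_bounded compact_continuous_image continuous_on_subset[OF slice_hol_continuous[OF h]])
      (use R2 in auto)
  then obtain K where K: "\<forall>y\<in>h ` cball 0 R2. norm y \<le> K"
    unfolding bounded_iff by blast
  define \<rho> where "\<rho> = (R2 - R') / (norm z + 1)"
  have \<rho>: "\<rho> > 0" using R2 by (simp add: \<rho>_def add_nonneg_pos)
  show thesis
  proof (rule that[of "\<rho> / 4" "32 * K / \<rho>\<^sup>2"])
    fix w :: "complex ^ 'n" and t assume w: "w \<in> ball 0 R'" and t: "cmod t \<le> \<rho> / 4"
    have sub: "w + s *s z \<in> ball 0 R2" if "s \<in> ball 0 \<rho>" for s
    proof -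
      have "norm (w + s *s z) \<le> norm w + cmod s * norm z"
        using norm_triangle_ineq[of w "s *s z"] by (simp add: norm_vec_smult)
      also have "cmod s * norm z \<le> \<rho> * (norm z + 1)"
        using that \<rho> by (intro mult_mono) auto
      also have "\<dots> = R2 - R'"
        unfolding \<rho>_def using norm_ge_zero[of z] by (simp add: divide_simps del: norm_ge_zero)
      finally show ?thesis using w by simp
    qed
    have "cmod (h (w + t *s z) - h (w + 0 *s z) - deriv (\<lambda>t. h (w + t *s z)) 0 * t) \<le> 32 * K / \<rho>\<^sup>2 * (cmod t)\<^sup>2"
    proof (rule holomorphic_remainder_bound[OF _ _ \<rho> t])
      show "(\<lambda>t. h (w + t *s z)) holomorphic_on ball 0 \<rho>"
        by (rule holomorphic_on_subset[OF slice_hol_slice[OF h]]) (use sub R2 in fastforce)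
      show "cmod (h (w + s *s z)) \<le> K" if "s \<in> ball 0 \<rho>" for s
        using K sub[OF that] by auto
    qed
    then show "cmod (h (w + t *s z) - h w - sderiv z h w * t) \<le> 32 * K / \<rho>\<^sup>2 * (cmod t)\<^sup>2"
      by (simp add: sderiv_def)
  qed (use \<rho> in auto)
qed

text \<open>The difference quotients \<open>D N\<close> with increment 1/N are continuous and
  slice-holomorphic on smaller balls once N is large. Their limit is uniform there, so both
  properties pass to \<open>sderiv z h\<close> by the uniform limit theorems.\<close>

lemma slice_hol_sderiv:
  fixes h :: "complex ^ 'n \<Rightarrow> complex"
  assumes h: "slice_hol R h"
  shows "slice_hol R (sderiv z h)"
proof -
  define D where "D N w = of_nat N * (h (w + inverse (of_nat N) *s z) - h w)" for N :: nat and w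
  have unif: "\<exists>N0. (\<forall>N\<ge>N0. continuous_on (ball 0 R') (D N) \<and>
      (\<forall>x u. (\<lambda>t. D N (x + t *s u)) holomorphic_on {t. x + t *s u \<in> ball 0 R'}))
      \<and> uniform_limit (ball 0 R') D (sderiv z h) sequentially"
    if R': "0 \<le> R'" "R' < R" for R'
  proof -
    obtain C \<epsilon> where \<epsilon>: "\<epsilon> > 0" and C: "\<And>w t. w \<in> ball 0 R' \<Longrightarrow> cmod t \<le> \<epsilon> \<Longrightarrow>
        cmod (h (w + t *s z) - h w - sderiv z h w * t) \<le> C * (cmod t)\<^sup>2"
      using slice_hol_quotient_bound[OF h R', of z] by metis
    define \<epsilon>' where "\<epsilon>' = min \<epsilon> ((R - R') / (norm z + 1))"
    have \<epsilon>': "\<epsilon>' > 0" using \<epsilon> R' by (simp add: \<epsilon>'_def add_nonneg_pos)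
    obtain N0 where N0: "N0 > 0" "inverse (real N0) < \<epsilon>'"
      using ex_inverse_of_nat_less[OF \<epsilon>'] by blast
    have N: "N > 0" "inverse (real N) \<le> \<epsilon>'" if "N \<ge> N0" for N
    proof -
      show "N > 0" using that N0 by simp
      have "inverse (real N) \<le> inverse (real N0)" using that N0 by (intro le_imp_inverse_le) auto
      then show "inverse (real N) \<le> \<epsilon>'" using N0 by simp
    qed
    have shift: "w + inverse (of_nat N) *s z \<in> ball 0 R" if "N \<ge> N0" "w \<in> ball 0 R'" for N w
    proof -
      have "norm (w + inverse (of_nat N) *s z) \<le> norm w + inverse (real N) * norm z"
        using norm_triangle_ineq[of w "inverse (of_nat N) *s z"] by (simp add: norm_vec_smult norm_inverse)
      also have "inverse (real N) * norm z \<le> (R - R') / (norm z + 1) * (norm z + 1)"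
        using N[OF that(1)] R' by (intro mult_mono) (auto simp: \<epsilon>'_def)
      also have "\<dots> = R - R'"
        using norm_ge_zero[of z] by (simp add: divide_simps del: norm_ge_zero)
      finally show ?thesis using that by simp
    qed
    have "continuous_on (ball 0 R') (D N)" if "N \<ge> N0" for N
      unfolding D_def using shift[OF that] R'
      by (intro continuous_intros continuous_on_compose2[OF slice_hol_continuous[OF h]]) auto
    moreover have "(\<lambda>t. D N (x + t *s u)) holomorphic_on {t. x + t *s u \<in> ball 0 R'}" if "N \<ge> N0" for N x u
    proof -
      have "(\<lambda>t. h ((x + inverse (of_nat N) *s z) + t *s u)) holomorphic_on {t. x + t *s u \<in> ball 0 R'}"
        by (rule holomorphic_on_subset[OF slice_hol_slice[OF h]])
          (use shift[OF that, of "x + _ *s u"] in \<open>auto simp: add.assoc add.commute add.left_commute\<close>)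
      moreover have "(\<lambda>t. h (x + t *s u)) holomorphic_on {t. x + t *s u \<in> ball 0 R'}"
        by (rule holomorphic_on_subset[OF slice_hol_slice[OF h]]) (use R' in auto)
      ultimately show ?thesis
        unfolding D_def by (intro holomorphic_intros) (simp add: algebra_simps)
    qed
    moreover have "uniform_limit (ball 0 R') D (sderiv z h) sequentially"
    proof (rule metric_uniform_limit_imp_uniform_limit[OF _ ])
      have b: "cmod (D N w - sderiv z h w) \<le> C * inverse (real N)" if "N \<ge> N0" "w \<in> ball 0 R'" for N w
      proof -
        let ?t = "inverse (of_nat N) :: complex"
        have t: "cmod ?t = inverse (real N)" "of_nat N * ?t = 1" using N[OF that(1)] by (auto simp: norm_inverse)
        have "D N w - sderiv z h w = of_nat N * (h (w + ?t *s z) - h w - sderiv z h w * ?t)"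
          unfolding D_def using t(2) by (simp add: algebra_simps)
        then have "cmod (D N w - sderiv z h w) = real N * cmod (h (w + ?t *s z) - h w - sderiv z h w * ?t)"
          by (simp add: norm_mult)
        also have "\<dots> \<le> real N * (C * (cmod ?t)\<^sup>2)"
          using N[OF that(1)] by (intro mult_left_mono C that) (auto simp: t \<epsilon>'_def)
        also have "\<dots> = C * inverse (real N)"
          using N[OF that(1)] unfolding t(1) by (simp add: power2_eq_square field_simps)
        finally show ?thesis .
      qed
      show "uniform_limit (ball 0 R') (\<lambda>N w. of_real (C * inverse (real N))) (\<lambda>_. 0 :: complex) sequentially"
      proof (rule uniform_limit_sequentially_iff[THEN iffD2], intro allI impI)
        fix e :: real assume e: "e > 0"
        have "(\<lambda>N. C * inverse (real N)) \<longlonglongrightarrow> C * 0"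
          by (intro tendsto_mult tendsto_const lim_inverse_n)
        then obtain no where "\<forall>n\<ge>no. \<bar>C * inverse (real n)\<bar> < e"
          using e unfolding lim_sequentially by auto
        then show "\<exists>N. \<forall>n\<ge>N. \<forall>x\<in>ball 0 R'. dist (complex_of_real (C * inverse (real n))) 0 < e"
          by (intro exI[of _ no]) (auto simp: dist_norm simp del: of_real_mult of_real_inverse of_real_of_nat_eq)
      qed
      show "\<forall>\<^sub>F N in sequentially. \<forall>w\<in>ball 0 R'. dist (D N w) (sderiv z h w) \<le> dist (complex_of_real (C * inverse (real N))) 0"
        using eventually_ge_at_top[of N0]
      proof eventually_elim
        case (elim N)
        then show ?case using b[OF elim]
          by (auto simp: dist_norm simp del: of_real_mult of_real_inverse of_real_of_nat_eq intro: order_trans[OF _ abs_ge_self])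
      qed
    qed
    ultimately show ?thesis by blast
  qed
  have main: "continuous_on (ball 0 R') (sderiv z h)"
    "\<And>x u. (\<lambda>t. sderiv z h (x + t *s u)) holomorphic_on {t. x + t *s u \<in> ball 0 R'}"
    if R': "0 \<le> R'" "R' < R" for R'
  proof -
    obtain N0 where N0: "\<And>N. N \<ge> N0 \<Longrightarrow> continuous_on (ball 0 R') (D N)"
        "\<And>N x u. N \<ge> N0 \<Longrightarrow> (\<lambda>t. D N (x + t *s u)) holomorphic_on {t. x + t *s u \<in> ball 0 R'}"
      and u: "uniform_limit (ball 0 R') D (sderiv z h) sequentially"
      using unif[OF R'] by blast
    show "continuous_on (ball 0 R') (sderiv z h)"
      by (rule uniform_limit_theorem[OF _ u])
        (use N0(1) in \<open>auto simp: eventually_sequentially\<close>)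
    fix x v :: "complex ^ 'n"
    let ?S = "{t. x + t *s v \<in> ball 0 R'}"
    \<comment> \<open>The shift by \<open>N0\<close> discards the quotients whose displaced argument
      may leave the domain of \<open>h\<close>.\<close>
    have us: "uniform_limit ?S (\<lambda>N t. D (N + N0) (x + t *s v)) (\<lambda>t. sderiv z h (x + t *s v)) sequentially"
    proof -
      have "uniform_limit (ball 0 R') (\<lambda>N. D (N + N0)) (sderiv z h) sequentially"
        by (rule filterlim_compose[OF u filterlim_add_const_nat_at_top[of N0]])
      then show ?thesis by (rule uniform_limit_compose') auto
    qed
    show "(\<lambda>t. sderiv z h (x + t *s v)) holomorphic_on ?S"
    proof (rule holomorphic_uniform_sequence[OF open_slice])
      fix t assume "t \<in> ?S"
      then obtain d where d: "d > 0" "cball t d \<subseteq> ?S"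
        using open_slice[of x v 0 R'] open_contains_cball by blast
      then show "\<exists>d>0. cball t d \<subseteq> ?S \<and>
          uniform_limit (cball t d) (\<lambda>N t. D (N + N0) (x + t *s v)) (\<lambda>t. sderiv z h (x + t *s v)) sequentially"
        using uniform_limit_on_subset[OF us] by blast
    qed (use N0(2) in auto)
  qed
  have mid: "\<exists>R'. 0 \<le> R' \<and> R' < R \<and> w \<in> ball 0 R'" if "w \<in> ball 0 R" for w :: "complex ^ 'n"
    using that dense[of "norm w" R] by (auto intro: order_trans[OF norm_ge_zero] less_imp_le)
  show ?thesis
    unfolding slice_hol_def
  proof safe
    show "continuous_on (ball 0 R) (sderiv z h)"
    proof (rule continuous_at_imp_continuous_on, rule ballI)
      fix w :: "complex ^ 'n" assume "w \<in> ball 0 R"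
      from mid[OF this] obtain R' where R': "0 \<le> R'" "R' < R" "w \<in> ball 0 R'" by blast
      then show "isCont (sderiv z h) w"
        using main(1)[of R'] by (simp add: continuous_on_eq_continuous_at del: mem_ball mem_ball_0)
    qed
    fix x u :: "complex ^ 'n"
    show "(\<lambda>t. sderiv z h (x + t *s u)) holomorphic_on {t. x + t *s u \<in> ball 0 R}"
      unfolding holomorphic_on_open[OF open_slice]
    proof
      fix t assume "t \<in> {t. x + t *s u \<in> ball 0 R}"
      with mid obtain R' where R': "0 \<le> R'" "R' < R" "x + t *s u \<in> ball 0 R'" by blast
      then show "\<exists>f'. ((\<lambda>t. sderiv z h (x + t *s u)) has_field_derivative f') (at t)"
        using main(2)[of R' x u] unfolding holomorphic_on_open[OF open_slice] by blast
    qed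
  qed
qed

section \<open>Moments of holomorphic functions\<close>

text \<open>The weighted integrand may fail to be differentiable on the sphere; a line meets it only
  in the zeros of a quadratic polynomial.\<close>

lemma finite_sphere_line:
  fixes w v :: "'a::real_inner"
  assumes "v \<noteq> 0"
  shows "finite {t::real. norm (w + t *\<^sub>R v) = 1}"
proof -
  have "{t::real. norm (w + t *\<^sub>R v) = 1} \<subseteq> {t. poly [:(norm w)\<^sup>2 - 1, 2 * inner w v, (norm v)\<^sup>2:] t = 0}"
  proof
    fix t assume "t \<in> {t::real. norm (w + t *\<^sub>R v) = 1}"
    then have "(norm (w + t *\<^sub>R v))\<^sup>2 = 1" by simp
    then show "t \<in> {t. poly [:(norm w)\<^sup>2 - 1, 2 * inner w v, (norm v)\<^sup>2:] t = 0}"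
      by (simp add: power2_norm_eq_inner inner_add_left inner_add_right inner_commute algebra_simps)
  qed
  moreover have "finite \<dots>" by (rule poly_roots_finite) (use assms in auto)
  ultimately show ?thesis by (rule finite_subset)
qed

text \<open>Integration by parts along the real direction \<open>c z\<close>; the choices \<open>c = 1\<close> and
  \<open>c = \<i>\<close> combine to the complex derivative, which does not see the antiholomorphic factor.\<close>

lemma ibp_real_direction:
  fixes h :: "complex ^ 'n \<Rightarrow> complex" and k :: nat
  assumes h: "slice_hol R h" and R: "R > 1" and b: "b > -1" and cz: "c *s z \<noteq> 0"
  defines "E \<equiv> \<lambda>w. c * sderiv z h w * hinner z w ^ k * of_real (dfct w)
      + h w * (of_nat k * hinner z w ^ (k - 1) * (cnj c * hinner z z)) * of_real (dfct w)
      - h w * hinner z w ^ k * of_real (2 * (b + 1) * Re (c * hinner z w))"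
  shows "integrable (bmeas b) E" "(\<integral>w. E w \<partial>bmeas b) = 0"
proof -
  define H where "H w = h w * hinner z w ^ k" for w
  \<comment> \<open>The exponent \<open>b + 1\<close> is positive, so the cut-off by
    \<open>max 0\<close> leaves \<open>\<Phi>\<close> continuous across the sphere even where its
    derivative, of order \<open>dfct w powr b\<close>, blows up.\<close>
  define \<Phi> where "\<Phi> w = (if w \<in> ball 0 R then H w * of_real (max 0 (dfct w) powr (b + 1)) else 0)" for w
  define \<Psi> where "\<Psi> w = indicator unit_ball w *\<^sub>R (dfct w powr b *\<^sub>R E w)" for w
  define v where "v = c *s z"
  have sub: "cball 0 1 \<subseteq> ball (0 :: complex ^ 'n) R" using R by auto
  have H_cont: "continuous_on (ball 0 R) H"
    unfolding H_def by (intro continuous_intros slice_hol_continuous[OF h])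
  have E_cont: "continuous_on (cball 0 1) E"
    unfolding E_def
    by (intro continuous_intros continuous_on_subset[OF slice_hol_continuous[OF h] sub]
        continuous_on_subset[OF slice_hol_continuous[OF slice_hol_sderiv[OF h]] sub])
  have E_meas: "E \<in> borel_measurable (bmeas b)"
    by (intro measurable_bmeas_continuous continuous_on_subset[OF E_cont]) auto
  show E_int: "integrable (bmeas b) E"
    by (rule integrable_bmeas_cball[OF b E_cont])
  have \<Psi>_int: "integrable lborel \<Psi>"
    using E_int unfolding integrable_bmeas[OF E_meas] \<Psi>_def[symmetric] .
  have \<Phi>_alt: "\<Phi> w = indicator unit_ball w *\<^sub>R (dfct w powr b *\<^sub>R (of_real (dfct w) * H w))" for w
  proof (cases "w \<in> unit_ball")
    case True
    then have "dfct w powr (b + 1) = dfct w powr b * dfct w"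
      using dfct_pos[OF True] by (simp add: powr_add)
    then show ?thesis
      using True R dfct_pos[OF True] by (auto simp: \<Phi>_def scaleR_conv_of_real max_def)
  next
    case False
    then have "dfct w \<le> 0" by (simp add: dfct_def)
    then show ?thesis using False by (simp add: \<Phi>_def max_def)
  qed
  have DH_cont: "continuous_on (cball 0 1) (\<lambda>w. of_real (dfct w) * H w)"
    by (intro continuous_intros continuous_on_subset[OF H_cont sub])
  have DH_meas: "(\<lambda>w. of_real (dfct w) * H w) \<in> borel_measurable (bmeas b)"
    by (intro measurable_bmeas_continuous continuous_on_subset[OF DH_cont]) auto
  have \<Phi>_int: "integrable lborel \<Phi>"
    using integrable_bmeas_cball[OF b DH_cont] unfolding integrable_bmeas[OF DH_meas] \<Phi>_alt[symmetric] .
  have \<Phi>_out: "\<Phi> w = 0" if "norm w > 1" for w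
    using that by (simp add: \<Phi>_alt)
  have "(\<integral>w. \<Psi> w \<partial>lborel) = 0"
  proof (rule integral_directional_derivative_eq_0[OF \<Phi>_int \<Psi>_int, of v])
    fix w
    have op: "open {t::real. w + t *\<^sub>R v \<in> ball 0 R}" "open {t::real. 1 < norm (w + t *\<^sub>R v)}"
      by (rule open_Collect_less[of "\<lambda>t. dist 0 (w + t *\<^sub>R v)" "\<lambda>_. R", folded mem_ball],
          (intro continuous_intros)+) (intro open_Collect_less continuous_intros)
    \<comment> \<open>Continuity is checked on two open sets, the ball of radius \<open>R\<close>
      and the exterior of the closed unit ball. Because \<open>R > 1\<close> they overlap and cover
      the line.\<close>
    have "continuous_on ({t::real. w + t *\<^sub>R v \<in> ball 0 R} \<union> {t::real. 1 < norm (w + t *\<^sub>R v)}) (\<lambda>t. \<Phi> (w + t *\<^sub>R v))"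
    proof (rule continuous_on_open_Un[OF op])
      have "continuous_on {t::real. w + t *\<^sub>R v \<in> ball 0 R}
          (\<lambda>t. H (w + t *\<^sub>R v) * of_real (max 0 (dfct (w + t *\<^sub>R v)) powr (b + 1)))"
        by (intro continuous_intros continuous_on_compose2[OF H_cont] continuous_on_powr') (use b in auto)
      then show "continuous_on {t::real. w + t *\<^sub>R v \<in> ball 0 R} (\<lambda>t. \<Phi> (w + t *\<^sub>R v))"
        by (rule continuous_on_eq) (auto simp: \<Phi>_def)
      show "continuous_on {t::real. 1 < norm (w + t *\<^sub>R v)} (\<lambda>t. \<Phi> (w + t *\<^sub>R v))"
        by (rule continuous_on_eq[of _ "\<lambda>_. 0"]) (auto simp: \<Phi>_out)
    qed
    moreover have "{t::real. w + t *\<^sub>R v \<in> ball 0 R} \<union> {t::real. 1 < norm (w + t *\<^sub>R v)} = UNIV"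
      using R by force
    ultimately show "continuous_on UNIV (\<lambda>t. \<Phi> (w + t *\<^sub>R v))" by simp
    show "\<exists>S. finite S \<and> (\<forall>t. t \<notin> S \<longrightarrow> ((\<lambda>t. \<Phi> (w + t *\<^sub>R v)) has_vector_derivative \<Psi> (w + t *\<^sub>R v)) (at t))"
    proof (intro exI conjI allI impI)
      show "finite {t::real. norm (w + t *\<^sub>R v) = 1}"
        by (rule finite_sphere_line) (use cz in \<open>simp add: v_def\<close>)
      fix t :: real assume t: "t \<notin> {t::real. norm (w + t *\<^sub>R v) = 1}"
      show "((\<lambda>t. \<Phi> (w + t *\<^sub>R v)) has_vector_derivative \<Psi> (w + t *\<^sub>R v)) (at t)"
      proof (cases "norm (w + t *\<^sub>R v) < 1")
        case False
        then have "norm (w + t *\<^sub>R v) > 1" using t by simp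
        have "((\<lambda>t. \<Phi> (w + t *\<^sub>R v)) has_vector_derivative 0) (at t)"
        proof (rule has_vector_derivative_transform_within_open[OF _ op(2)])
          show "((\<lambda>t. 0) has_vector_derivative 0) (at t)" by simp
        qed (use \<open>norm (w + t *\<^sub>R v) > 1\<close> in \<open>auto simp: \<Phi>_out\<close>)
        then show ?thesis using False by (simp add: \<Psi>_def)
      next
        case True
        let ?w = "w + t *\<^sub>R v"
        have w: "?w \<in> unit_ball" using True by simp
        have eq: "w + s *\<^sub>R v = w + (c * of_real s) *s z" for s
          by (simp add: v_def of_real_vec_smult[symmetric] vector_smult_assoc mult.commute)
        have dH: "((\<lambda>t. h (w + t *\<^sub>R v)) has_vector_derivative c * sderiv z h ?w) (at t)"
        proof -
          have "((\<lambda>s. h (w + s *s z)) has_field_derivative sderiv z h (w + (c * of_real t) *s z)) (at (c * of_real t))"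
            by (rule slice_hol_has_field_derivative[OF h]) (use True R in \<open>simp add: eq\<close>)
          moreover have "((\<lambda>t. c * of_real t) has_vector_derivative c) (at t)"
            by (auto intro!: derivative_eq_intros)
          ultimately have "((\<lambda>s. h (w + s *s z)) \<circ> (\<lambda>t. c * of_real t) has_vector_derivative
              c * sderiv z h (w + (c * of_real t) *s z)) (at t)"
            by (rule field_vector_diff_chain_at[rotated])
          then show ?thesis by (simp add: o_def eq)
        qed
        have dh: "((\<lambda>t. hinner z (w + t *\<^sub>R v)) has_vector_derivative cnj c * hinner z z) (at t)"
          unfolding v_def by (auto simp: hinner_add_right intro!: derivative_eq_intros)
        have dp: "((\<lambda>t. hinner z (w + t *\<^sub>R v) ^ k) has_vector_derivative
            of_nat k * hinner z ?w ^ (k - 1) * (cnj c * hinner z z)) (at t)"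
          using field_vector_diff_chain_at[OF dh DERIV_power[OF DERIV_ident, of k]]
          by (simp add: o_def mult_ac)
        have dd: "((\<lambda>t. dfct (w + t *\<^sub>R v)) has_real_derivative - 2 * Re (c * hinner z ?w)) (at t)"
        proof -
          have "dfct (w + s *\<^sub>R v) = 1 - (norm w)\<^sup>2 - 2 * s * inner v w - s\<^sup>2 * inner v v" for s
            unfolding dfct_def power2_norm_eq_inner
            by (simp add: inner_add_left inner_add_right inner_commute
                algebra_simps power2_eq_square)
          moreover have "((\<lambda>s. 1 - (norm w)\<^sup>2 - 2 * s * inner v w - s\<^sup>2 * inner v v) has_real_derivative
              - 2 * (inner v w + t * inner v v)) (at t)"
            by (auto intro!: derivative_eq_intros)
          moreover have "inner v w + t * inner v v = Re (c * hinner z ?w)"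
          proof -
            have "inner v w + t * inner v v = Re (hinner v ?w)"
              by (simp only: Re_hinner inner_add_right inner_scaleR_right)
            also have "hinner v ?w = c * hinner z ?w" unfolding v_def by (rule hinner_smult_left)
            finally show ?thesis .
          qed
          ultimately show ?thesis by simp
        qed
        have dpow: "((\<lambda>t. of_real (dfct (w + t *\<^sub>R v) powr (b + 1)) :: complex) has_vector_derivative
            of_real ((b + 1) * dfct ?w powr b * (- 2 * Re (c * hinner z ?w)))) (at t)"
          using DERIV_fun_powr[OF dd dfct_pos[OF w], of "b + 1"]
          by (intro has_vector_derivative_of_real) (simp add: has_real_derivative_iff_has_vector_derivative)
        have "((\<lambda>t. h (w + t *\<^sub>R v) * hinner z (w + t *\<^sub>R v) ^ k * of_real (dfct (w + t *\<^sub>R v) powr (b + 1)))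
            has_vector_derivative \<Psi> ?w) (at t)"
        proof -
          have "\<Psi> ?w = (h ?w * hinner z ?w ^ k) * of_real ((b + 1) * dfct ?w powr b * (- 2 * Re (c * hinner z ?w)))
             + (h ?w * (of_nat k * hinner z ?w ^ (k - 1) * (cnj c * hinner z z)) + c * sderiv z h ?w * hinner z ?w ^ k)
                * of_real (dfct ?w powr (b + 1))"
            using w dfct_pos[OF w] by (simp add: \<Psi>_def E_def powr_add scaleR_conv_of_real algebra_simps)
          then show ?thesis
            by (simp only:) (intro has_vector_derivative_mult dH dp dpow)
        qed
        then show ?thesis
        proof (rule has_vector_derivative_transform_within_open)
          show "open {t::real. norm (w + t *\<^sub>R v) < 1}"
            by (intro open_Collect_less continuous_intros)
          fix s assume "s \<in> {t::real. norm (w + t *\<^sub>R v) < 1}"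
          then have "w + s *\<^sub>R v \<in> unit_ball" by simp
          then show "h (w + s *\<^sub>R v) * hinner z (w + s *\<^sub>R v) ^ k * of_real (dfct (w + s *\<^sub>R v) powr (b + 1)) = \<Phi> (w + s *\<^sub>R v)"
            using dfct_pos[of "w + s *\<^sub>R v"] R by (simp add: \<Phi>_def H_def max_def)
        qed (use True in auto)
      qed
    qed
  qed
  then show "(\<integral>w. E w \<partial>bmeas b) = 0"
    unfolding integral_bmeas[OF E_meas] \<Psi>_def[symmetric] .
qed

lemma integral_bmeas_Suc:
  fixes F :: "complex ^ 'n \<Rightarrow> complex"
  assumes "F \<in> borel_measurable (bmeas b)"
  shows "(\<integral>w. F w \<partial>bmeas (b + 1)) = (\<integral>w. of_real (dfct w) * F w \<partial>bmeas b)"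
  unfolding integral_bmeas_shift[OF assms]
proof (rule Bochner_Integration.integral_cong)
  fix w :: "complex ^ 'n" assume "w \<in> space (bmeas b)"
  then show "dfct w powr 1 *\<^sub>R F w = of_real (dfct w) * F w"
    using dfct_pos[of w] by (simp add: scaleR_conv_of_real)
qed simp

text \<open>One factor \<open>hinner z w\<close> is the derivative of \<open>dfct\<close> up to a
  constant, so integration by parts exchanges it for a derivative of \<open>h\<close> and one more
  power of the weight. Iteration computes all moments.\<close>

lemma moment_Suc:
  fixes h :: "complex ^ 'n \<Rightarrow> complex"
  assumes h: "slice_hol R h" and R: "R > 1" and b: "b > -1"
  shows "(\<integral>w. h w * hinner z w ^ Suc k \<partial>bmeas b) =
    (\<integral>w. sderiv z h w * hinner z w ^ k \<partial>bmeas (b + 1)) / of_real (b + 1)"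
proof (cases "z = 0")
  case True
  then show ?thesis by (simp add: sderiv_def)
next
  case False
  have sub: "cball 0 1 \<subseteq> ball (0 :: complex ^ 'n) R" using R by auto
  define A where "A w = sderiv z h w * hinner z w ^ k" for w
  define B where "B w = h w * hinner z w ^ Suc k" for w
  have A_cont: "continuous_on (cball 0 1) A" unfolding A_def
    by (intro continuous_intros continuous_on_subset[OF slice_hol_continuous[OF slice_hol_sderiv[OF h]] sub])
  have B_cont: "continuous_on (cball 0 1) B" unfolding B_def
    by (intro continuous_intros continuous_on_subset[OF slice_hol_continuous[OF h] sub])
  have A_meas: "A \<in> borel_measurable (bmeas b)"
    by (intro measurable_bmeas_continuous continuous_on_subset[OF A_cont]) auto
  have dA_int: "integrable (bmeas b) (\<lambda>w. of_real (dfct w) * A w)"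
    by (intro integrable_bmeas_cball b continuous_intros A_cont)
  have B_int: "integrable (bmeas b) B"
    by (intro integrable_bmeas_cball b B_cont)
  define E where "E c w = c * sderiv z h w * hinner z w ^ k * of_real (dfct w)
      + h w * (of_nat k * hinner z w ^ (k - 1) * (cnj c * hinner z z)) * of_real (dfct w)
      - h w * hinner z w ^ k * of_real (2 * (b + 1) * Re (c * hinner z w))" for c w
  have E: "integrable (bmeas b) (E c)" "(\<integral>w. E c w \<partial>bmeas b) = 0" if "c \<noteq> 0" for c
    using ibp_real_direction[OF h R b, of c z k] that False unfolding E_def by auto
  \<comment> \<open>In this combination the coefficient \<open>c\<close> becomes 2 and
    \<open>cnj c\<close> becomes 0, while \<open>Re (c * hinner z w)\<close> becomes
    \<open>hinner z w\<close>. The term that differentiates the power of \<open>hinner z w\<close>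
    thus disappears.\<close>
  have pt: "E 1 w - \<i> * E \<i> w = 2 * (of_real (dfct w) * A w) - of_real (2 * (b + 1)) * B w" for w
  proof -
    have "hinner z w = of_real (Re (hinner z w)) - \<i> * of_real (Re (\<i> * hinner z w))"
      by (simp add: complex_eq_iff)
    then have "of_real (2 * (b + 1)) * B w = h w * hinner z w ^ k * (of_real (2 * (b + 1)) *
       (of_real (Re (hinner z w)) - \<i> * of_real (Re (\<i> * hinner z w))))"
      unfolding B_def by (simp add: mult_ac)
    then show ?thesis
      by (simp add: E_def A_def algebra_simps)
  qed
  have "0 = (\<integral>w. E 1 w - \<i> * E \<i> w \<partial>bmeas b)"
    using E[of 1] E[of \<i>] by simp
  also have "\<dots> = 2 * (\<integral>w. of_real (dfct w) * A w \<partial>bmeas b) - of_real (2 * (b + 1)) * (\<integral>w. B w \<partial>bmeas b)"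
    unfolding pt using dA_int B_int by (subst Bochner_Integration.integral_diff) auto
  finally have "2 * (of_real (b + 1) * (\<integral>w. B w \<partial>bmeas b)) = 2 * (\<integral>w. of_real (dfct w) * A w \<partial>bmeas b)"
    by (simp add: algebra_simps)
  then have "of_real (b + 1) * (\<integral>w. B w \<partial>bmeas b) = (\<integral>w. of_real (dfct w) * A w \<partial>bmeas b)"
    by simp
  moreover have "complex_of_real (b + 1) \<noteq> 0" using b by (simp only: of_real_eq_0_iff)
  ultimately show ?thesis
    unfolding A_def[symmetric] B_def[symmetric] integral_bmeas_Suc[OF A_meas] by (simp add: field_simps)
qed

lemma integrable_mult_bounded:
  fixes h g :: "'a \<Rightarrow> complex"
  assumes "integrable M h" "g \<in> borel_measurable M" "\<And>w. w \<in> space M \<Longrightarrow> cmod (g w) \<le> B"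
  shows "integrable M (\<lambda>w. h w * g w)"
proof (rule Bochner_Integration.integrable_bound)
  show "integrable M (\<lambda>w. h w * of_real B)" using assms(1) by simp
  show "(\<lambda>w. h w * g w) \<in> borel_measurable M"
    using assms(1,2) by (intro borel_measurable_times) (auto dest: borel_measurable_integrable)
  show "AE w in M. cmod (h w * g w) \<le> cmod (h w * of_real B)"
    using assms(3) by (intro AE_I2) (auto simp: norm_mult intro!: mult_left_mono order_trans[OF _ abs_ge_self])
qed

text \<open>Cauchy's formula for Taylor coefficients on the unit circle, where \<open>cnj\<close> is
  inversion.\<close>

lemma circle_average:
  assumes f: "f holomorphic_on ball 0 R" and R: "R > 1"
  shows "((\<lambda>\<theta>. f (cis (2 * pi * \<theta>)) * cnj (cis (2 * pi * \<theta>)) ^ k) has_integral (deriv ^^ k) f 0 / fact k) {0..1}"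
proof -
  let ?c = "\<lambda>\<theta>. cis (2 * pi * \<theta>)"
  have "((\<lambda>u. f u / (u - 0) ^ Suc k) has_contour_integral (2 * pi * \<i>) / fact k * (deriv ^^ k) f 0) (circlepath 0 1)"
  proof (rule Cauchy_has_contour_integral_higher_derivative_circlepath)
    show "continuous_on (cball 0 1) f"
      using R by (intro holomorphic_on_imp_continuous_on holomorphic_on_subset[OF f]) auto
    show "f holomorphic_on ball 0 1"
      using R by (intro holomorphic_on_subset[OF f]) auto
  qed simp
  then have "((\<lambda>x. f (circlepath 0 1 x) / (circlepath 0 1 x) ^ Suc k * vector_derivative (circlepath 0 1) (at x))
      has_integral (2 * pi * \<i>) / fact k * (deriv ^^ k) f 0) {0..1}"
    by (simp add: has_contour_integral)
  then have "((\<lambda>x. (2 * pi * \<i>) * (f (?c x) * cnj (?c x) ^ k))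
      has_integral (2 * pi * \<i>) * ((deriv ^^ k) f 0 / fact k)) {0..1}"
  proof (rule has_integral_eq_rhs[OF has_integral_eq[rotated]])
    fix x :: real
    have c: "circlepath 0 1 x = ?c x"
      by (simp add: circlepath cis_conv_exp mult_ac)
    have ci: "cnj (?c x) = inverse (?c x)"
      by (simp add: cis_cnj cis_inverse)
    have "vector_derivative (circlepath 0 1) (at x) = 2 * pi * \<i> * ?c x"
      by (simp add: vector_derivative_circlepath cis_conv_exp mult_ac)
    then show "f (circlepath 0 1 x) / circlepath 0 1 x ^ Suc k * vector_derivative (circlepath 0 1) (at x)
        = (2 * pi * \<i>) * (f (?c x) * cnj (?c x) ^ k)"
      unfolding c ci by (simp add: power_inverse field_simps)
  qed simp
  from has_integral_mult_right[OF this, of "inverse (2 * pi * \<i>)"]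
  show ?thesis by (simp add: field_simps)
qed

lemma slice_hol_disc:
  assumes h: "slice_hol R h" and w: "r * norm w \<le> R" 
  shows "(\<lambda>t. h (t *s w)) holomorphic_on ball 0 r"
proof (cases "w = 0")
  case True then show ?thesis by simp
next
  case False
  show ?thesis
  proof (rule holomorphic_on_subset[OF slice_hol_slice[OF h, of 0 w, simplified]])
    show "ball 0 r \<subseteq> {t. norm (t *s w) < R}"
    proof
      fix t assume "t \<in> ball (0::complex) r"
      then have "cmod t * norm w < r * norm w" using False by (intro mult_strict_right_mono) auto
      then show "t \<in> {t. norm (t *s w) < R}" using w by (simp add: norm_vec_smult)
    qed
  qed
qed

text \<open>Replacing \<open>w\<close> by a unimodular multiple \<open>c *s w\<close> preserves the
  measure and multiplies \<open>hinner z w ^ k\<close> by \<open>cnj c ^ k\<close>. Averaging over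
  \<open>c\<close> therefore leaves only the homogeneous part of \<open>h\<close> of degree
  \<open>k\<close>, under mere integrability of \<open>h\<close> up to the sphere.\<close>

lemma rotation_average:
  fixes h :: "complex ^ 'n \<Rightarrow> complex"
  assumes h: "slice_hol 1 h" and int: "integrable (bmeas b) h" and b: "b > -1"
  shows "(\<integral>w. h w * hinner z w ^ k \<partial>bmeas b) =
    (\<integral>w. (deriv ^^ k) (\<lambda>t. h (t *s w)) 0 / fact k * hinner z w ^ k \<partial>bmeas b)"
proof -
  let ?M = "bmeas b :: (complex ^ 'n) measure"
  interpret M: finite_measure ?M by (rule finite_measure_bmeas[OF b])
  interpret L: pair_sigma_finite ?M "lborel :: real measure" ..
  let ?c = "\<lambda>\<theta>. cis (2 * pi * \<theta>)"
  define G where "G w = h w * hinner z w ^ k" for w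
  have G_meas: "G \<in> borel_measurable ?M"
    unfolding G_def by (intro measurable_bmeas_continuous continuous_intros slice_hol_continuous h)
  have G_int: "integrable ?M G"
    unfolding G_def
  proof (rule integrable_mult_bounded[OF int])
    show "(\<lambda>w. hinner z w ^ k) \<in> borel_measurable ?M"
      by (intro measurable_bmeas_continuous continuous_intros)
    show "cmod (hinner z w ^ k) \<le> norm z ^ k" if "w \<in> space ?M" for w
    proof -
      have "cmod (hinner z w) \<le> norm z"
        using norm_hinner_le[of z w] that mult_left_le[of "norm w" "norm z"] by simp
      then show ?thesis by (simp add: norm_power power_mono)
    qed
  qed
  define F where "F = (\<lambda>(w, \<theta>). indicator {0..1::real} \<theta> *\<^sub>R G (?c \<theta> *s w))"
  have cis_meas: "(\<lambda>x. ?c (snd x) *s fst x) \<in> measurable (?M \<Otimes>\<^sub>M lborel) ?M"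
  proof -
    have 1: "(\<lambda>x. fst x) \<in> borel_measurable (?M \<Otimes>\<^sub>M (lborel :: real measure))"
      by (rule measurable_compose[OF measurable_fst]) (rule measurable_bmeas_of_borel, simp)
    have 2: "(\<lambda>(\<theta>, w :: complex ^ 'n). ?c \<theta> *s w) \<in> borel_measurable (borel \<Otimes>\<^sub>M borel)"
      unfolding borel_prod
      by (intro borel_measurable_continuous_onI) (simp add: case_prod_beta' continuous_intros)
    have 3: "(\<lambda>x. ?c (snd x) *s fst x) \<in> borel_measurable (?M \<Otimes>\<^sub>M (lborel :: real measure))"
      using measurable_compose[OF measurable_Pair[OF _ 1] 2, of snd] by simp
    have "(\<lambda>x. ?c (snd x) *s fst x) \<in> measurable (?M \<Otimes>\<^sub>M (lborel :: real measure)) (restrict_space borel unit_ball)"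
      by (rule measurable_restrict_space2[OF _ 3]) (auto simp: space_pair_measure norm_vec_smult)
    then show ?thesis
      by (subst measurable_cong_sets[OF refl sets_bmeas])
  qed
  have F_meas: "F \<in> borel_measurable (?M \<Otimes>\<^sub>M lborel)"
    unfolding F_def case_prod_beta'
    by (intro borel_measurable_scaleR measurable_compose[OF cis_meas G_meas]) measurable
  have rot: "(\<integral>w. G (?c \<theta> *s w) \<partial>?M) = (\<integral>w. G w \<partial>?M)" "integrable ?M (\<lambda>w. G (?c \<theta> *s w))" for \<theta>
    using bmeas_rotate[of "?c \<theta>" G b] G_meas G_int by auto
  have rotn: "(\<integral>w. cmod (G (?c \<theta> *s w)) \<partial>?M) = (\<integral>w. cmod (G w) \<partial>?M)" for \<theta>
    using bmeas_rotate(2)[of "?c \<theta>" "\<lambda>w. cmod (G w)" b] G_meas by auto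
  have F_int: "integrable (?M \<Otimes>\<^sub>M lborel) F"
  proof -
    interpret L': pair_sigma_finite "lborel :: real measure" ?M ..
    have "integrable (lborel \<Otimes>\<^sub>M ?M) (\<lambda>(\<theta>, w). F (w, \<theta>))"
    proof (rule L'.Fubini_integrable)
      show "(\<lambda>(\<theta>, w). F (w, \<theta>)) \<in> borel_measurable (lborel \<Otimes>\<^sub>M ?M)"
        by (rule measurable_pair_swap_iff[THEN iffD1, OF F_meas])
      have "(\<integral>w. norm (F (w, \<theta>)) \<partial>?M) = indicator {0..1} \<theta> * (\<integral>w. cmod (G w) \<partial>?M)" for \<theta>
        by (simp add: F_def rotn)
      then show "integrable lborel (\<lambda>\<theta>. \<integral>w. norm (case (\<theta>, w) of (\<theta>, w) \<Rightarrow> F (w, \<theta>)) \<partial>?M)"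
        by simp
      show "AE \<theta> in lborel. integrable ?M (\<lambda>w. case (\<theta>, w) of (\<theta>, w) \<Rightarrow> F (w, \<theta>))"
        by (simp add: F_def rot)
    qed
    then show ?thesis by (subst (asm) L'.integrable_product_swap_iff[symmetric]) (simp add: case_prod_beta')
  qed
  have "(\<integral>w. G w \<partial>?M) = (\<integral>\<theta>. indicator {0..1::real} \<theta> *\<^sub>R (\<integral>w. G w \<partial>?M) \<partial>lborel)"
    by simp
  also have "\<dots> = (\<integral>\<theta>. \<integral>w. F (w, \<theta>) \<partial>?M \<partial>lborel)"
    by (simp add: F_def rot)
  also have "\<dots> = (\<integral>w. \<integral>\<theta>. F (w, \<theta>) \<partial>lborel \<partial>?M)"
    using L.Fubini_integral[of "\<lambda>w \<theta>. F (w, \<theta>)"] F_int by (simp add: case_prod_beta')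
  also have "\<dots> = (\<integral>w. (deriv ^^ k) (\<lambda>t. h (t *s w)) 0 / fact k * hinner z w ^ k \<partial>?M)"
  proof (rule Bochner_Integration.integral_cong[OF refl])
    fix w :: "complex ^ 'n" assume "w \<in> space ?M"
    then have w: "norm w < 1" by simp
    \<comment> \<open>This radius exceeds 1 while \<open>R * norm w \<le> 1\<close>, so the slice
      through \<open>w\<close> is holomorphic past the unit circle.\<close>
    define R where "R = 2 / (1 + norm w)"
    have R: "R > 1" "R * norm w \<le> 1"
      using w by (auto simp: R_def divide_simps add_nonneg_pos) (smt (verit) norm_ge_zero)+
    have "((\<lambda>\<theta>. h (?c \<theta> *s w) * cnj (?c \<theta>) ^ k) has_integral (deriv ^^ k) (\<lambda>t. h (t *s w)) 0 / fact k) {0..1}"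
      by (rule circle_average[OF slice_hol_disc[OF h R(2)] R(1)])
    from has_integral_mult_left[OF this, of "hinner z w ^ k"]
    have I: "((\<lambda>\<theta>. G (?c \<theta> *s w)) has_integral (deriv ^^ k) (\<lambda>t. h (t *s w)) 0 / fact k * hinner z w ^ k) {0..1}"
      by (simp add: G_def power_mult_distrib mult_ac)
    have "continuous_on {0..1} (\<lambda>\<theta>. G (?c \<theta> *s w))"
      unfolding G_def using w
      by (intro continuous_intros continuous_on_compose2[OF slice_hol_continuous[OF h]]) (auto simp: norm_vec_smult)
    then have "set_integrable lborel {0..1} (\<lambda>\<theta>. G (?c \<theta> *s w))"
      by (rule borel_integrable_atLeastAtMost')
    from set_borel_integral_eq_integral(2)[OF this]
    show "(\<integral>\<theta>. F (w, \<theta>) \<partial>lborel) = (deriv ^^ k) (\<lambda>t. h (t *s w)) 0 / fact k * hinner z w ^ k"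
      using I by (simp add: F_def set_lebesgue_integral_def integral_unique)
  qed
  finally show ?thesis by (simp add: G_def)
qed

lemma integral_bmeas_const:
  assumes "b > -1"
  shows "(\<integral>w. c \<partial>(bmeas b :: (complex ^ 'n) measure)) = of_real (bmass TYPE('n::finite) b) * (c :: complex)"
    "integrable (bmeas b :: (complex ^ 'n) measure) (\<lambda>w. c)"
proof -
  interpret finite_measure "bmeas b :: (complex ^ 'n) measure" by (rule finite_measure_bmeas[OF assms])
  show "(\<integral>w. c \<partial>(bmeas b :: (complex ^ 'n) measure)) = of_real (bmass TYPE('n) b) * (c :: complex)"
    by (simp add: bmass_def scaleR_conv_of_real)
  show "integrable (bmeas b :: (complex ^ 'n) measure) (\<lambda>w. c)" by simp
qed

text \<open>\<open>moment_Suc\<close> applied to a coordinate function evaluates the integral of the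
  squared modulus of that coordinate. The sum over the coordinates is the integral of
  \<open>1 - dfct w\<close>, which gives a recursion in place of a Beta function evaluation.\<close>

lemma bmass_Suc:
  assumes b: "b > -1"
  shows "bmass TYPE('n::finite) (b + 1) = (b + 1) / (real CARD('n) + 1 + b) * bmass TYPE('n) b"
proof -
  let ?M = "bmeas b :: (complex ^ 'n) measure"
  have comp: "(\<integral>w. w $ j * cnj (w $ j) \<partial>?M) = of_real (bmass TYPE('n) (b + 1) / (b + 1))" for j
  proof -
    have sl: "slice_hol 2 (\<lambda>w :: complex ^ 'n. w $ j)"
      unfolding slice_hol_def by (auto intro!: continuous_intros holomorphic_intros)
    have sd: "sderiv (axis j 1) (\<lambda>w :: complex ^ 'n. w $ j) w = 1" for w
    proof -
      have "((\<lambda>t. (w + t *s axis j 1) $ j) has_field_derivative 1) (at 0)"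
        by (auto intro!: derivative_eq_intros)
      then show ?thesis unfolding sderiv_def by (rule DERIV_imp_deriv)
    qed
    have hi: "hinner (axis j 1) w = cnj (w $ j)" for w
      by (metis cnj_hinner hinner_axis_right)
    show ?thesis
      using moment_Suc[OF sl _ b, of "axis j 1" 0] b
      by (simp add: sd hi integral_bmeas_const(1) del: lebesgue_integral_const)
  qed
  have "of_real (bmass TYPE('n) b) - of_real (bmass TYPE('n) (b + 1))
      = (\<integral>w. (1::complex) \<partial>?M) - (\<integral>w. of_real (dfct w) * 1 \<partial>?M)"
    using b integral_bmeas_Suc[of "\<lambda>w :: complex ^ 'n. 1" b]
    by (simp add: integral_bmeas_const(1) del: lebesgue_integral_const)
  also have "\<dots> = (\<integral>w. 1 - of_real (dfct w) \<partial>?M)"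
    by (subst Bochner_Integration.integral_diff)
      (auto intro!: integrable_bmeas_cball b continuous_intros)
  also have "\<dots> = (\<integral>w. (\<Sum>j\<in>UNIV. w $ j * cnj (w $ j)) \<partial>?M)"
  proof (rule Bochner_Integration.integral_cong[OF refl])
    fix w :: "complex ^ 'n"
    have "1 - complex_of_real (dfct w) = hinner w w" by (simp add: hinner_self dfct_def)
    then show "1 - complex_of_real (dfct w) = (\<Sum>j\<in>UNIV. w $ j * cnj (w $ j))" by (simp add: hinner_def)
  qed
  also have "\<dots> = (\<Sum>j\<in>UNIV. \<integral>w. w $ j * cnj (w $ j) \<partial>?M)"
    by (intro Bochner_Integration.integral_sum integrable_bmeas_cball b continuous_intros)
  also have "\<dots> = of_real (real CARD('n) * (bmass TYPE('n) (b + 1) / (b + 1)))"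
    by (simp add: comp)
  finally have "bmass TYPE('n) b - bmass TYPE('n) (b + 1) = real CARD('n) * (bmass TYPE('n) (b + 1) / (b + 1))"
    unfolding of_real_diff[symmetric] of_real_eq_iff .
  then show ?thesis using b by (simp add: field_simps)
qed

text \<open>Each use of \<open>moment_Suc\<close> lowers \<open>k\<close>, differentiates
  \<open>h\<close> along \<open>z\<close> and raises \<open>b\<close>, hence the generalisation over
  \<open>h\<close> and \<open>b\<close>. The factors from \<open>bmass_Suc\<close> accumulate to the
  Pochhammer symbol, and \<open>k = 0\<close> is the mean value property supplied by
  \<open>rotation_average\<close>.\<close>

lemma moment_formula_large:
  fixes h :: "complex ^ 'n \<Rightarrow> complex"
  assumes "slice_hol R h" "R > 1" "b > -1"
  shows "(\<integral>w. h w * hinner z w ^ k \<partial>bmeas b) =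
    of_real (bmass TYPE('n) b) * (deriv ^^ k) (\<lambda>t. h (t *s z)) 0 / pochhammer (of_real (real CARD('n) + 1 + b)) k"
  using assms
proof (induction k arbitrary: h b)
  case 0
  have sub: "cball 0 1 \<subseteq> ball (0 :: complex ^ 'n) R" using 0 by auto
  have int: "integrable (bmeas b) h"
    by (intro integrable_bmeas_cball 0 continuous_on_subset[OF slice_hol_continuous[OF 0(1)] sub])
  show ?case
    using rotation_average[OF slice_hol_subset[OF 0(1)] int 0(3), of z 0] 0
    by (simp add: integral_bmeas_const(1) del: lebesgue_integral_const)
next
  case (Suc k)
  note h = Suc.prems(1) and R = Suc.prems(2) and b = Suc.prems(3)
  let ?l = "of_real (real CARD('n) + 1 + b) :: complex"
  have l0: "real CARD('n) + 1 + b > 0" using b by simp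
  have d: "(deriv ^^ k) (\<lambda>t. sderiv z h (t *s z)) 0 = (deriv ^^ Suc k) (\<lambda>t. h (t *s z)) 0"
  proof -
    have S: "open {t. t *s z \<in> ball 0 R}" using open_slice[of 0 z 0 R] by simp
    have "deriv (\<lambda>t. h (t *s z)) t = sderiv z h (t *s z)" if "t \<in> {t. t *s z \<in> ball 0 R}" for t
      using slice_hol_has_field_derivative[OF h, of 0 t z] that by (auto intro: DERIV_imp_deriv)
    then have "(deriv ^^ k) (deriv (\<lambda>t. h (t *s z))) 0 = (deriv ^^ k) (\<lambda>t. sderiv z h (t *s z)) 0"
      using S R by (intro higher_deriv_cong_ev eventually_nhds_in_open[THEN eventually_mono] refl) 
        (auto intro!: exI[of _ "{t. t *s z \<in> ball 0 R}"] simp: eventually_nhds)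
    then show ?thesis by (simp add: funpow_Suc_right del: funpow.simps)
  qed
  have "(\<integral>w. h w * hinner z w ^ Suc k \<partial>bmeas b) =
      (\<integral>w. sderiv z h w * hinner z w ^ k \<partial>bmeas (b + 1)) / of_real (b + 1)"
    by (rule moment_Suc[OF h R b])
  also have "\<dots> = of_real (bmass TYPE('n) (b + 1)) * (deriv ^^ Suc k) (\<lambda>t. h (t *s z)) 0
      / pochhammer (?l + 1) k / of_real (b + 1)"
    using b by (subst Suc.IH[OF slice_hol_sderiv[OF h] R]) (simp_all add: d add_ac del: funpow.simps)
  also have "\<dots> = of_real (bmass TYPE('n) b) * (deriv ^^ Suc k) (\<lambda>t. h (t *s z)) 0 / (?l * pochhammer (?l + 1) k)"
  proof -
    have "complex_of_real (bmass TYPE('n) (b + 1)) = of_real (b + 1) / ?l * of_real (bmass TYPE('n) b)"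
      unfolding bmass_Suc[OF b] by simp
    moreover have "complex_of_real (b + 1) \<noteq> 0" using b by (simp only: of_real_eq_0_iff)
    moreover have "?l \<noteq> 0" using l0 by (simp only: of_real_eq_0_iff)
    moreover have "X * D / P / p = Y * D / (l * P)" if "X = p / l * Y" "p \<noteq> 0" "l \<noteq> 0" for X Y D P p l :: complex
      unfolding that(1) using that(2,3) by simp
    ultimately show ?thesis by blast
  qed
  finally show ?case by (simp add: pochhammer_rec)
qed

text \<open>By \<open>rotation_average\<close> both sides see only the homogeneous part of
  \<open>h\<close> of degree \<open>k\<close>. The dilate \<open>g\<close> of \<open>h\<close> by
  1/2 is holomorphic on the ball of radius 2, and its part of degree \<open>k\<close> differs by the
  factor \<open>(1/2) ^ k\<close>, which cancels.\<close>

lemma moment_formula: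
  fixes h :: "complex ^ 'n \<Rightarrow> complex"
  assumes h: "slice_hol 1 h" and int: "integrable (bmeas b) h" and b: "b > -1"
  shows "(\<integral>w. h w * hinner z w ^ k \<partial>bmeas b) =
    of_real (bmass TYPE('n) b) * (deriv ^^ k) (\<lambda>t. h (t *s z)) 0 / pochhammer (of_real (real CARD('n) + 1 + b)) k"
proof -
  define g where "g w = h ((1/2) *s w)" for w
  have g: "slice_hol 2 g"
    unfolding slice_hol_def
  proof (intro conjI allI)
    show "continuous_on (ball 0 2) g"
      unfolding g_def
      by (intro continuous_on_compose2[OF slice_hol_continuous[OF h]] continuous_intros) (auto simp: norm_vec_smult)
    fix x u :: "complex ^ 'n"
    have "(\<lambda>t. h ((1/2) *s x + t *s ((1/2) *s u))) holomorphic_on {t. x + t *s u \<in> ball 0 2}"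
    proof (rule holomorphic_on_subset[OF slice_hol_slice[OF h]], rule subsetI)
      fix t assume "t \<in> {t. x + t *s u \<in> ball 0 2}"
      moreover have "(1/2) *s x + t *s ((1/2) *s u) = (1/2) *s (x + t *s u)"
        by (simp add: vec_eq_iff algebra_simps)
      ultimately show "t \<in> {t. (1/2) *s x + t *s ((1/2) *s u) \<in> ball 0 1}"
        by (simp only: mem_Collect_eq mem_ball_0 norm_vec_smult) simp
    qed
    moreover have "(\<lambda>t. h ((1/2) *s x + t *s ((1/2) *s u))) = (\<lambda>t. g (x + t *s u))"
      unfolding g_def by (intro ext arg_cong[of _ _ h]) (simp add: vec_eq_iff algebra_simps)
    ultimately show "(\<lambda>t. g (x + t *s u)) holomorphic_on {t. x + t *s u \<in> ball 0 2}" by simp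
  qed
  have g1: "slice_hol 1 g" by (rule slice_hol_subset[OF g]) simp
  have g_int: "integrable (bmeas b) g"
    by (intro integrable_bmeas_cball b continuous_on_subset[OF slice_hol_continuous[OF g]]) auto
  have dg: "(deriv ^^ k) (\<lambda>t. g (t *s w)) 0 = (1/2) ^ k * (deriv ^^ k) (\<lambda>t. h (t *s w)) 0" for w
  proof -
    have hol: "(\<lambda>t. h (t *s w)) holomorphic_on {t. 0 + t *s w \<in> ball 0 1}"
      using slice_hol_slice[OF h, of 0 w] by simp
    have "(deriv ^^ k) (\<lambda>t. (\<lambda>t. h (t *s w)) ((1/2) * t)) 0 = (1/2) ^ k * (deriv ^^ k) (\<lambda>t. h (t *s w)) ((1/2) * 0)"
    proof (rule higher_deriv_compose_linear[OF hol, of "{t. 0 + ((1/2) * t) *s w \<in> ball 0 1}"])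
      show "open {t. 0 + (1 / 2 * t) *s w \<in> ball 0 1}"
        using open_slice[of 0 "(1/2) *s w" 0 1] by (simp add: vector_smult_assoc mult.commute)
    qed (use open_slice[of 0 w 0 1] in auto)
    moreover have "(\<lambda>t. g (t *s w)) = (\<lambda>t. h (((1/2) * t) *s w))"
      by (simp add: g_def vector_smult_assoc)
    ultimately show ?thesis by simp
  qed
  have "(1/2) ^ k * (\<integral>w. h w * hinner z w ^ k \<partial>bmeas b) = (\<integral>w. g w * hinner z w ^ k \<partial>bmeas b)"
    unfolding rotation_average[OF h int b] rotation_average[OF g1 g_int b] dg
    by (subst Bochner_Integration.integral_mult_right_zero[symmetric]) (simp add: mult_ac)
  also have "\<dots> = (1/2) ^ k * (of_real (bmass TYPE('n) b) * (deriv ^^ k) (\<lambda>t. h (t *s z)) 0 / pochhammer (of_real (real CARD('n) + 1 + b)) k)"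
    by (subst moment_formula_large[OF g _ b]) (simp_all add: dg)
  finally show ?thesis by (simp only: mult_cancel_left) simp
qed

text \<open>On the ball \<open>hinner z w\<close> stays in the closed disc of radius
  \<open>norm z < 1\<close>, so the power series of \<open>\<kappa>\<close> is dominated uniformly
  in \<open>w\<close> and may be integrated term by term against an integrable
  \<open>h\<close>.\<close>

lemma kernel_series:
  fixes h :: "complex ^ 'n \<Rightarrow> complex"
  assumes h: "slice_hol 1 h" and int: "integrable (bmeas b) h" and b: "b > -1" and z: "z \<in> unit_ball"
    and \<kappa>: "\<And>u. cmod u < 1 \<Longrightarrow> (\<lambda>k. a k * u ^ k) sums \<kappa> u"
  shows "(\<lambda>k. a k * (of_real (bmass TYPE('n) b) * (deriv ^^ k) (\<lambda>t. h (t *s z)) 0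
      / pochhammer (of_real (real CARD('n) + 1 + b)) k)) sums (\<integral>w. h w * \<kappa> (hinner z w) \<partial>bmeas b)"
proof -
  let ?M = "bmeas b :: (complex ^ 'n) measure"
  have hz: "cmod (hinner z w) \<le> norm z" if "w \<in> space ?M" for w
    using norm_hinner_le[of z w] that mult_left_le[of "norm w" "norm z"] by simp
  define f where "f k w = h w * (a k * hinner z w ^ k)" for k w
  have fb: "cmod (a k * hinner z w ^ k) \<le> cmod (a k) * norm z ^ k" if "w \<in> space ?M" for k w
    using hz[OF that] by (simp add: norm_mult norm_power mult_left_mono power_mono)
  have fle: "norm (f k w) \<le> cmod (h w) * (cmod (a k) * norm z ^ k)" if "w \<in> space ?M" for k w
    unfolding f_def norm_mult[of "h w"] by (intro mult_left_mono fb that norm_ge_zero)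
  have f_int: "integrable ?M (f k)" for k
    unfolding f_def
    by (rule integrable_mult_bounded[OF int _ fb]) (intro measurable_bmeas_continuous continuous_intros)
  \<comment> \<open>Convergence at the larger radius \<open>\<rho>\<close> gives absolute
    convergence at \<open>norm z\<close>.\<close>
  obtain \<rho> where \<rho>: "norm z < \<rho>" "\<rho> < 1" using z dense by auto
  have "summable (\<lambda>k. a k * of_real \<rho> ^ k)"
    using \<kappa>[of "of_real \<rho>"] \<rho> norm_ge_zero[of z] by (intro sums_summable) auto
  then have "summable (\<lambda>k. norm (a k * of_real (norm z) ^ k))"
    by (rule powser_insidea) (use \<rho> in auto)
  then have sa: "summable (\<lambda>k. cmod (a k) * norm z ^ k)"
    by (simp add: norm_mult norm_power)
  have "(\<lambda>k. \<integral>w. f k w \<partial>?M) sums (\<integral>w. (\<Sum>k. f k w) \<partial>?M)"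
  proof (rule sums_integral[OF f_int])
    show "AE w in ?M. summable (\<lambda>k. norm (f k w))"
    proof (rule AE_I2)
      fix w assume w: "w \<in> space ?M"
      have "summable (\<lambda>k. cmod (h w) * (cmod (a k) * norm z ^ k))" by (intro summable_mult sa)
      then show "summable (\<lambda>k. norm (f k w))"
        by (rule summable_comparison_test'[where N = 0]) (use fle[OF w] in simp)
    qed
    have "summable (\<lambda>k. (\<integral>w. cmod (h w) \<partial>?M) * (cmod (a k) * norm z ^ k))" by (intro summable_mult sa)
    then show "summable (\<lambda>k. \<integral>w. norm (f k w) \<partial>?M)"
    proof (rule summable_comparison_test'[where N = 0])
      fix k :: nat
      have "(\<integral>w. norm (f k w) \<partial>?M) \<le> (\<integral>w. cmod (h w) * (cmod (a k) * norm z ^ k) \<partial>?M)"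
      proof (rule integral_mono)
        show "integrable ?M (\<lambda>w. norm (f k w))" by (intro integrable_norm f_int)
        show "integrable ?M (\<lambda>w. cmod (h w) * (cmod (a k) * norm z ^ k))" using int by auto
        show "norm (f k w) \<le> cmod (h w) * (cmod (a k) * norm z ^ k)" if "w \<in> space ?M" for w
          by (rule fle[OF that])
      qed
      then show "norm (\<integral>w. norm (f k w) \<partial>?M) \<le> (\<integral>w. cmod (h w) \<partial>?M) * (cmod (a k) * norm z ^ k)"
        by simp
    qed
  qed
  moreover have "(\<integral>w. (\<Sum>k. f k w) \<partial>?M) = (\<integral>w. h w * \<kappa> (hinner z w) \<partial>?M)"
  proof (rule Bochner_Integration.integral_cong[OF refl])
    fix w assume w: "w \<in> space ?M"
    then have "cmod (hinner z w) < 1" using hz[OF w] z by auto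
    from sums_mult[OF \<kappa>[OF this], of "h w"] show "(\<Sum>k. f k w) = h w * \<kappa> (hinner z w)"
      by (simp add: f_def sums_iff)
  qed
  moreover have "(\<integral>w. f k w \<partial>?M) = a k * (of_real (bmass TYPE('n) b) * (deriv ^^ k) (\<lambda>t. h (t *s z)) 0
      / pochhammer (of_real (real CARD('n) + 1 + b)) k)" for k
  proof -
    have "(\<integral>w. f k w \<partial>?M) = a k * (\<integral>w. h w * hinner z w ^ k \<partial>?M)"
      unfolding f_def by (subst Bochner_Integration.integral_mult_right_zero[symmetric]) (simp add: mult_ac)
    then show ?thesis by (simp add: moment_formula[OF h int b])
  qed
  ultimately show ?thesis by simp
qed

section \<open>The reproducing formula and the Forelli--Rudin estimate\<close>

text \<open>With \<open>u = hinner z w\<close> and \<open>\<mu> = n + 1 + b\<close> this is the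
  weighted Bergman kernel. As a function of one complex variable it is open to the binomial series
  and to one-variable calculus; the sign convention makes differentiation raise the index by
  1.\<close>

definition kpow :: "real \<Rightarrow> complex \<Rightarrow> complex"
  where "kpow \<mu> u = (1 - u) powr (- of_real \<mu>)"

lemma norm_kpow: "cmod (kpow \<mu> u) = cmod (1 - u) powr (- \<mu>)"
  unfolding kpow_def using norm_powr_real_powr'[of "- of_real \<mu>" "1 - u"] by simp

lemma Re_one_minus_pos: "cmod u < 1 \<Longrightarrow> 0 < Re (1 - u)"
  using complex_Re_le_cmod[of u] by simp

lemma one_minus_not_nonpos: "cmod u < 1 \<Longrightarrow> 1 - u \<notin> \<real>\<^sub>\<le>\<^sub>0"
  using Re_one_minus_pos[of u] by (auto simp: complex_nonpos_Reals_iff)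

lemma kpow_has_derivative:
  assumes "cmod u < 1"
  shows "(kpow \<mu> has_field_derivative of_real \<mu> * kpow (\<mu> + 1) u) (at u)"
proof -
  have e: "- complex_of_real (\<mu> + 1) = - of_real \<mu> - 1" by simp
  show ?thesis
    unfolding kpow_def[abs_def] e
    by (rule derivative_eq_intros refl one_minus_not_nonpos assms)+ simp
qed

lemma kpow_holomorphic: "kpow \<mu> holomorphic_on ball 0 1"
  unfolding holomorphic_on_open[OF open_ball] by (auto intro!: exI kpow_has_derivative)

lemma kpow_deriv: "cmod u < 1 \<Longrightarrow> deriv (kpow \<mu>) u = of_real \<mu> * kpow (\<mu> + 1) u"
  by (rule DERIV_imp_deriv[OF kpow_has_derivative])

lemma kpow_add: "cmod u < 1 \<Longrightarrow> kpow (\<mu> + \<nu>) u = kpow \<mu> u * kpow \<nu> u"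
  using Re_one_minus_pos[of u] by (auto simp: kpow_def powr_add[symmetric])

lemma kpow_minus_1: "cmod u < 1 \<Longrightarrow> kpow (-1) u = 1 - u"
  using Re_one_minus_pos[of u] by (auto simp: kpow_def)

lemma cnj_kpow: "cmod u < 1 \<Longrightarrow> cnj (kpow \<mu> u) = kpow \<mu> (cnj u)"
  using Re_one_minus_pos[of u] by (simp add: kpow_def cnj_powr)

lemma kpow_sums:
  assumes "cmod u < 1"
  shows "(\<lambda>k. of_real (pochhammer \<mu> k / fact k) * u ^ k) sums kpow \<mu> u"
proof -
  have "(\<lambda>k. ((- of_real \<mu>) gchoose k) * (- u) ^ k) sums (1 + (- u)) powr (- of_real \<mu>)"
    by (rule gen_binomial_complex) (use assms in simp)
  moreover have "((- of_real \<mu>) gchoose k) * (- u) ^ k = of_real (pochhammer \<mu> k / fact k) * u ^ k" for k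
  proof -
    have "((- of_real \<mu>) gchoose k) * (- u) ^ k = ((-1) ^ k * (-1) ^ k) * (pochhammer (of_real \<mu>) k / fact k * u ^ k)"
      by (simp add: gbinomial_pochhammer power_minus[of u] mult_ac)
    also have "(-1) ^ k * (-1) ^ k = (1 :: complex)"
      by (simp flip: power_mult_distrib)
    finally show ?thesis by (simp add: pochhammer_of_real)
  qed
  ultimately show ?thesis by (simp add: kpow_def)
qed

lemma norm_hinner_less_1: "z \<in> unit_ball \<Longrightarrow> norm w \<le> 1 \<Longrightarrow> cmod (hinner z w) < 1"
  using norm_hinner_le[of z w] mult_left_le[of "norm w" "norm z"] by simp

lemma kpow_hinner_right_continuous:
  assumes "z \<in> unit_ball"
  shows "continuous_on (cball 0 1) (\<lambda>w. kpow \<mu> (hinner z w))"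
  by (rule continuous_on_compose2[OF holomorphic_on_imp_continuous_on[OF kpow_holomorphic]])
    (use norm_hinner_less_1[OF assms] in \<open>auto intro!: continuous_intros\<close>)

lemma taylor_sums_slice:
  assumes h: "slice_hol 1 h" and z: "z \<in> unit_ball"
  shows "(\<lambda>k. (deriv ^^ k) (\<lambda>t. h (t *s z)) 0 / fact k) sums h z"
proof -
  define R where "R = 2 / (1 + norm z)"
  have R: "R > 1" "R * norm z \<le> 1"
    using z by (auto simp: R_def divide_simps add_nonneg_pos) (smt (verit) norm_ge_zero)+
  have "(\<lambda>k. (deriv ^^ k) (\<lambda>t. h (t *s z)) 0 / fact k * (1 - 0) ^ k) sums h (1 *s z)"
    by (rule holomorphic_power_series[OF slice_hol_disc[OF h R(2)]]) (use R in auto)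
  then show ?thesis by simp
qed

text \<open>At the index \<open>n + 1 + b\<close> the Pochhammer symbols of the binomial series
  cancel those of the moments. What remains is the Taylor series of \<open>h\<close> along the line
  through \<open>z\<close>, evaluated at parameter 1.\<close>

lemma reproducing_formula:
  fixes h :: "complex ^ 'n \<Rightarrow> complex"
  assumes h: "slice_hol 1 h" and int: "integrable (bmeas b) h" and b: "b > -1" and z: "z \<in> unit_ball"
  shows "(\<integral>w. h w * kpow (real CARD('n) + 1 + b) (hinner z w) \<partial>bmeas b) = of_real (bmass TYPE('n) b) * h z"
proof -
  let ?l = "real CARD('n) + 1 + b"
  let ?D = "\<lambda>k. (deriv ^^ k) (\<lambda>t. h (t *s z)) 0"
  have l: "?l > 0" using b by simp
  have "(\<lambda>k. of_real (pochhammer ?l k / fact k) * (of_real (bmass TYPE('n) b) * ?D k / pochhammer (of_real ?l) k))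
      sums (\<integral>w. h w * kpow ?l (hinner z w) \<partial>bmeas b)"
    by (rule kernel_series[OF h int b z kpow_sums])
  moreover have "of_real (pochhammer ?l k / fact k) * (of_real (bmass TYPE('n) b) * ?D k / pochhammer (of_real ?l) k)
      = of_real (bmass TYPE('n) b) * (?D k / fact k)" for k
    using pochhammer_pos[OF l, of k] unfolding pochhammer_of_real by (simp add: field_simps)
  ultimately have "(\<lambda>k. of_real (bmass TYPE('n) b) * (?D k / fact k)) sums (\<integral>w. h w * kpow ?l (hinner z w) \<partial>bmeas b)"
    by (simp only:)
  moreover have "(\<lambda>k. of_real (bmass TYPE('n) b) * (?D k / fact k)) sums (of_real (bmass TYPE('n) b) * h z)"
    by (intro sums_mult taylor_sums_slice h z)
  ultimately show ?thesis by (rule sums_unique2)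
qed

section \<open>Complex derivatives in the ball and differentiation of kernel integrals\<close>

lemma ball_holomorphic_field_derivative:
  fixes f :: "complex ^ 'n \<Rightarrow> complex"
  assumes D: "(f has_derivative D) (at (x + t *s u))" "\<And>c v. D (c *s v) = c * D v"
  shows "((\<lambda>t. f (x + t *s u)) has_field_derivative D u) (at t)"
proof -
  have "((\<lambda>t. x + t *s u) has_derivative (\<lambda>t. t *s u)) (at t)"
    by (auto intro!: derivative_eq_intros bounded_linear_imp_has_derivative bounded_linear_smult_left)
  from diff_chain_at[OF this D(1)]
  have "((\<lambda>t. f (x + t *s u)) has_derivative (\<lambda>s. D (s *s u))) (at t)" by (simp add: o_def)
  moreover have "(\<lambda>s. D (s *s u)) = (*) (D u)" by (auto simp: D(2))
  ultimately show ?thesis by (simp add: has_field_derivative_def)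
qed

lemma ball_holomorphic_imp_slice_hol:
  assumes "ball_holomorphic f"
  shows "slice_hol 1 f"
  unfolding slice_hol_def
proof (intro conjI allI)
  show "continuous_on unit_ball f"
    using assms unfolding ball_holomorphic_def
    by (meson continuous_at_imp_continuous_on has_derivative_continuous)
  fix x u :: "complex ^ 'a"
  show "(\<lambda>t. f (x + t *s u)) holomorphic_on {t. x + t *s u \<in> unit_ball}"
    unfolding holomorphic_on_open[OF open_slice]
    using assms ball_holomorphic_field_derivative unfolding ball_holomorphic_def by blast
qed

lemma sderiv_eq:
  assumes "(f has_derivative D) (at z)" "\<And>c v. D (c *s v) = c * D v"
  shows "sderiv u f z = D u"
  unfolding sderiv_def
  by (rule DERIV_imp_deriv[OF ball_holomorphic_field_derivative]) (use assms in auto)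

lemma ball_holomorphic_has_derivative:
  assumes "ball_holomorphic f" "z \<in> unit_ball"
  shows "(f has_derivative (\<lambda>v. sderiv v f z)) (at z)"
proof -
  obtain D where D: "(f has_derivative D) (at z)" "\<And>c v. D (c *s v) = c * D v"
    using assms unfolding ball_holomorphic_def by blast
  have "(\<lambda>v. sderiv v f z) = D" using sderiv_eq[OF D] by auto
  then show ?thesis using D by simp
qed

lemma sderiv_smult:
  assumes "ball_holomorphic f" "z \<in> unit_ball"
  shows "sderiv (c *s v) f z = c * sderiv v f z"
proof -
  obtain D where D: "(f has_derivative D) (at z)" "\<And>c v. D (c *s v) = c * D v"
    using assms unfolding ball_holomorphic_def by blast
  show ?thesis by (simp add: sderiv_eq[OF D] D(2))
qed

lemma sderiv_add:
  assumes "ball_holomorphic f" "z \<in> unit_ball"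
  shows "sderiv (u + v) f z = sderiv u f z + sderiv v f z"
  using linear_add[OF has_derivative_linear[OF ball_holomorphic_has_derivative[OF assms]]] .

lemma sderiv_sum:
  assumes "ball_holomorphic f" "z \<in> unit_ball"
  shows "sderiv (\<Sum>k\<in>A. v k) f z = (\<Sum>k\<in>A. sderiv (v k) f z)"
  using linear_sum[OF has_derivative_linear[OF ball_holomorphic_has_derivative[OF assms]]] .

text \<open>For \<open>z\<close> fixed and a small increment \<open>x\<close> all arguments of
  \<open>\<kappa>\<close> stay in one compact disc. The remainder bound is then quadratic in
  \<open>norm x\<close> uniformly in \<open>w\<close>, and integrating it against
  \<open>\<psi>\<close> gives differentiability directly.\<close>

lemma kernel_integral_has_derivative:
  fixes \<psi> :: "complex ^ 'n \<Rightarrow> complex"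
  assumes int: "integrable (bmeas b) \<psi>" and \<kappa>: "\<kappa> holomorphic_on ball 0 1" and z: "z \<in> unit_ball"
  shows "((\<lambda>z. \<integral>w. \<psi> w * \<kappa> (hinner z w) \<partial>bmeas b) has_derivative
      (\<lambda>x. \<integral>w. \<psi> w * (deriv \<kappa> (hinner z w) * hinner x w) \<partial>bmeas b)) (at z)"
proof -
  let ?I = "\<lambda>z. \<integral>w. \<psi> w * \<kappa> (hinner z w) \<partial>bmeas b"
  let ?D = "\<lambda>x. \<integral>w. \<psi> w * (deriv \<kappa> (hinner z w) * hinner x w) \<partial>bmeas b"
  let ?M = "bmeas b :: (complex ^ 'n) measure"
  have \<psi>_meas: "\<psi> \<in> borel_measurable ?M" using int by auto
  have d\<kappa>: "deriv \<kappa> holomorphic_on ball 0 1" by (intro holomorphic_deriv \<kappa>) auto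
  have hz: "cmod (hinner x w) \<le> norm x" if "w \<in> space ?M" for w x
    using norm_hinner_le[of x w] that mult_left_le[of "norm w" "norm x"] by simp
  have cont: "continuous_on unit_ball (\<lambda>w. g (hinner x w))" if "g holomorphic_on ball 0 1" "x \<in> unit_ball" for g and x :: "complex ^ 'n"
  proof (rule continuous_on_compose2[OF holomorphic_on_imp_continuous_on[OF that(1)]])
    show "continuous_on unit_ball (\<lambda>w. hinner x w)" by (intro continuous_intros)
    show "(\<lambda>w. hinner x w) ` unit_ball \<subseteq> ball 0 1"
      using norm_hinner_less_1[OF that(2)] by auto
  qed
  have bnd: "\<exists>B. \<forall>w\<in>space ?M. cmod (g (hinner x w)) \<le> B" if "g holomorphic_on ball 0 1" "x \<in> unit_ball" for g and x :: "complex ^ 'n"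
  proof -
    have "bounded (g ` cball 0 (norm x))"
      by (intro compact_imp_bounded compact_continuous_image
          holomorphic_on_imp_continuous_on holomorphic_on_subset[OF that(1)]) (use that(2) in auto)
    then obtain B where "\<forall>y\<in>g ` cball 0 (norm x). cmod y \<le> B" unfolding bounded_iff by blast
    then show ?thesis using hz by (intro exI[of _ B]) auto
  qed
  have I_int: "integrable ?M (\<lambda>w. \<psi> w * \<kappa> (hinner x w))" if x: "x \<in> unit_ball" for x
  proof -
    obtain B where "\<And>w. w \<in> space ?M \<Longrightarrow> cmod (\<kappa> (hinner x w)) \<le> B" using bnd[OF \<kappa> x] by blast
    then show ?thesis
      by (intro integrable_mult_bounded[OF int] measurable_bmeas_continuous cont \<kappa> x)
  qed
  obtain B where B: "\<And>w. w \<in> space ?M \<Longrightarrow> cmod (deriv \<kappa> (hinner z w)) \<le> B" using bnd[OF d\<kappa> z] by blast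
  have D_int: "integrable ?M (\<lambda>w. \<psi> w * (deriv \<kappa> (hinner z w) * hinner x w))" for x
  proof (rule integrable_mult_bounded[OF int])
    show "(\<lambda>w. deriv \<kappa> (hinner z w) * hinner x w) \<in> borel_measurable ?M"
      by (intro measurable_bmeas_continuous continuous_intros cont d\<kappa> z)
    show "cmod (deriv \<kappa> (hinner z w) * hinner x w) \<le> B * norm x" if "w \<in> space ?M" for w
      unfolding norm_mult using B[OF that] hz[OF that, of x]
      by (intro mult_mono) (auto intro: order_trans[OF norm_ge_zero])
  qed
  define \<rho> where "\<rho> = (1 - norm z) / 2"
  have \<rho>: "\<rho> > 0" "norm z + \<rho> < 1" using z by (auto simp: \<rho>_def field_simps)
  have "bounded (\<kappa> ` cball 0 (norm z + \<rho>))"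
    by (intro compact_imp_bounded compact_continuous_image
        holomorphic_on_imp_continuous_on holomorphic_on_subset[OF \<kappa>]) (use \<rho> in auto)
  then obtain K where K: "\<forall>y\<in>\<kappa> ` cball 0 (norm z + \<rho>). cmod y \<le> K" unfolding bounded_iff by blast
  define C where "C = 32 * K / \<rho>\<^sup>2"
  have rem: "cmod (\<kappa> (hinner (z + x) w) - \<kappa> (hinner z w) - deriv \<kappa> (hinner z w) * hinner x w) \<le> C * (norm x)\<^sup>2"
    if x: "norm x \<le> \<rho> / 4" and w: "w \<in> space ?M" for x w
  proof -
    have sub: "hinner z w + t \<in> cball 0 (norm z + \<rho>)" if "t \<in> ball 0 \<rho>" for t
      using that hz[OF w, of z] norm_triangle_ineq[of "hinner z w" t] by simp
    have "0 \<le> cmod (\<kappa> (hinner z w + 0))" by simp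
    also have "\<dots> \<le> K"
      by (rule K[rule_format, OF imageI[OF sub]]) (use \<rho> in simp)
    finally have "C \<ge> 0"
      unfolding C_def by simp
    have "cmod (\<kappa> (hinner z w + hinner x w) - \<kappa> (hinner z w + 0) - deriv (\<lambda>t. \<kappa> (hinner z w + t)) 0 * hinner x w)
        \<le> 32 * K / \<rho>\<^sup>2 * (cmod (hinner x w))\<^sup>2"
    proof (rule holomorphic_remainder_bound[OF _ _ \<rho>(1)])
      have "(\<lambda>t. hinner z w + t) ` ball 0 \<rho> \<subseteq> ball 0 1"
      proof
        fix y assume "y \<in> (\<lambda>t. hinner z w + t) ` ball 0 \<rho>"
        then have "y \<in> cball 0 (norm z + \<rho>)" using sub by blast
        then show "y \<in> ball 0 1" using \<rho>(2) by simp
      qed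
      moreover have "(\<lambda>t. hinner z w + t) holomorphic_on ball 0 \<rho>" by (intro holomorphic_intros)
      ultimately show "(\<lambda>t. \<kappa> (hinner z w + t)) holomorphic_on ball 0 \<rho>"
        using holomorphic_on_compose_gen[of "\<lambda>t. hinner z w + t" "ball 0 \<rho>" \<kappa> "ball 0 1"] \<kappa> by (simp only: o_def)
      show "cmod (\<kappa> (hinner z w + t)) \<le> K" if "t \<in> ball 0 \<rho>" for t
        by (rule K[rule_format, OF imageI[OF sub[OF that]]])
      show "cmod (hinner x w) \<le> \<rho> / 4" using hz[OF w, of x] x by simp
    qed
    also have "deriv (\<lambda>t. \<kappa> (hinner z w + t)) 0 = deriv \<kappa> (hinner z w)"
      using deriv_shift_0[of \<kappa> "hinner z w"] by (simp add: o_def)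
    also have "32 * K / \<rho>\<^sup>2 * (cmod (hinner x w))\<^sup>2 \<le> C * (norm x)\<^sup>2"
      unfolding C_def[symmetric] using hz[OF w, of x] \<open>C \<ge> 0\<close> by (intro mult_left_mono power_mono) auto
    finally show ?thesis by (simp add: hinner_add_left)
  qed
  define N where "N = (\<integral>w. cmod (\<psi> w) \<partial>?M)"
  have main: "cmod (?I (z + x) - ?I z - ?D x) \<le> (C * N) * (norm x)\<^sup>2" if x: "norm x \<le> \<rho> / 4" for x
  proof -
    have zx: "z + x \<in> unit_ball" using norm_triangle_ineq[of z x] x \<rho> by simp
    have "?I (z + x) - ?I z - ?D x =
        (\<integral>w. \<psi> w * \<kappa> (hinner (z + x) w) - \<psi> w * \<kappa> (hinner z w) - \<psi> w * (deriv \<kappa> (hinner z w) * hinner x w) \<partial>?M)"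
      using I_int[OF zx] I_int[OF z] D_int[of x] by simp
    also have "cmod \<dots> \<le> (\<integral>w. cmod (\<psi> w) * (C * (norm x)\<^sup>2) \<partial>?M)"
    proof (rule Bochner_Integration.integral_norm_bound_integral)
      show "integrable ?M (\<lambda>w. \<psi> w * \<kappa> (hinner (z + x) w) - \<psi> w * \<kappa> (hinner z w) - \<psi> w * (deriv \<kappa> (hinner z w) * hinner x w))"
        using I_int[OF zx] I_int[OF z] D_int[of x] by simp
      show "integrable ?M (\<lambda>w. cmod (\<psi> w) * (C * (norm x)\<^sup>2))" using int by simp
      show "cmod (\<psi> w * \<kappa> (hinner (z + x) w) - \<psi> w * \<kappa> (hinner z w) - \<psi> w * (deriv \<kappa> (hinner z w) * hinner x w))
          \<le> cmod (\<psi> w) * (C * (norm x)\<^sup>2)" if "w \<in> space ?M" for w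
      proof -
        have "\<psi> w * \<kappa> (hinner (z + x) w) - \<psi> w * \<kappa> (hinner z w) - \<psi> w * (deriv \<kappa> (hinner z w) * hinner x w)
          = \<psi> w * (\<kappa> (hinner (z + x) w) - \<kappa> (hinner z w) - deriv \<kappa> (hinner z w) * hinner x w)"
          by (simp add: algebra_simps)
        then show ?thesis using rem[OF x that] by (simp only: norm_mult mult_left_mono norm_ge_zero)
      qed
    qed
    finally show ?thesis by (simp add: N_def mult_ac)
  qed
  show ?thesis
  proof (rule has_derivativeI_sandwich[of "\<rho> / 4"])
    show "bounded_linear ?D"
    proof (rule bounded_linear_intro[where K = "B * N"])
      show "?D (x + y) = ?D x + ?D y" for x y
        using D_int[of x] D_int[of y] by (simp add: hinner_add_left algebra_simps)
      show "?D (r *\<^sub>R x) = r *\<^sub>R ?D x" for r x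
      proof -
        have "?D (r *\<^sub>R x) = (\<integral>w. of_real r * (\<psi> w * (deriv \<kappa> (hinner z w) * hinner x w)) \<partial>?M)"
          by (simp add: mult_ac)
        also have "\<dots> = of_real r * ?D x" by (rule Bochner_Integration.integral_mult_right_zero)
        finally show ?thesis by (simp only: scaleR_conv_of_real)
      qed
      show "norm (?D x) \<le> norm x * (B * N)" for x
      proof -
        have "norm (?D x) \<le> (\<integral>w. cmod (\<psi> w) * (B * norm x) \<partial>?M)"
        proof (rule Bochner_Integration.integral_norm_bound_integral[OF D_int])
          show "integrable ?M (\<lambda>w. cmod (\<psi> w) * (B * norm x))" using int by simp
          show "cmod (\<psi> w * (deriv \<kappa> (hinner z w) * hinner x w)) \<le> cmod (\<psi> w) * (B * norm x)" if "w \<in> space ?M" for w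
            unfolding norm_mult using B[OF that] hz[OF that, of x]
            by (intro mult_left_mono mult_mono) (auto intro: order_trans[OF norm_ge_zero])
        qed
        then show ?thesis by (simp add: N_def mult_ac)
      qed
    qed
    show "((\<lambda>y. (C * N) * norm (y - z)) \<longlongrightarrow> 0) (at z)"
      by (rule tendsto_eq_intros refl)+ simp
    show "norm (?I y - ?I z - ?D (y - z)) / norm (y - z) \<le> (C * N) * norm (y - z)"
      if "y \<noteq> z" "dist y z < \<rho> / 4" for y
    proof -
      have "cmod (?I (z + (y - z)) - ?I z - ?D (y - z)) \<le> (C * N) * (norm (y - z))\<^sup>2"
        by (rule main) (use that in \<open>simp add: dist_norm\<close>)
      then have "norm (?I y - ?I z - ?D (y - z)) \<le> ((C * N) * norm (y - z)) * norm (y - z)"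
        by (simp add: power2_eq_square mult_ac)
      then show ?thesis using that by (simp add: divide_le_eq)
    qed
  qed (use \<rho> in auto)
qed

lemma kernel_integral_holomorphic:
  fixes \<psi> :: "complex ^ 'n \<Rightarrow> complex"
  assumes int: "integrable (bmeas b) \<psi>" and \<kappa>: "\<kappa> holomorphic_on ball 0 1"
  defines "I \<equiv> \<lambda>z. \<integral>w. \<psi> w * \<kappa> (hinner z w) \<partial>bmeas b"
  shows "ball_holomorphic I"
    and "z \<in> unit_ball \<Longrightarrow> sderiv u I z = (\<integral>w. \<psi> w * (deriv \<kappa> (hinner z w) * hinner u w) \<partial>bmeas b)"
proof -
  have lin: "(\<integral>w. \<psi> w * (deriv \<kappa> (hinner z w) * hinner (c *s v) w) \<partial>bmeas b)
    = c * (\<integral>w. \<psi> w * (deriv \<kappa> (hinner z w) * hinner v w) \<partial>bmeas b)" for c v z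
    by (subst Bochner_Integration.integral_mult_right_zero[symmetric]) (simp add: mult_ac)
  show "ball_holomorphic I"
    unfolding ball_holomorphic_def I_def
    using kernel_integral_has_derivative[OF int \<kappa>] lin by blast
  show "sderiv u I z = (\<integral>w. \<psi> w * (deriv \<kappa> (hinner z w) * hinner u w) \<partial>bmeas b)" if "z \<in> unit_ball"
    unfolding I_def by (rule sderiv_eq[OF kernel_integral_has_derivative[OF int \<kappa> that] lin])
qed

lemma sderiv_cong:
  assumes "\<And>w. w \<in> unit_ball \<Longrightarrow> f w = g w" "z \<in> unit_ball"
  shows "sderiv u f z = sderiv u g z"
  unfolding sderiv_def
proof (rule deriv_cong_ev[OF _ refl])
  have "0 \<in> {t. z + t *s u \<in> unit_ball}" using assms(2) by simp
  from eventually_nhds_in_open[OF open_slice this]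
  show "\<forall>\<^sub>F t in nhds 0. f (z + t *s u) = g (z + t *s u)"
    by (rule eventually_mono) (use assms(1) in auto)
qed

text \<open>Differentiation of the reproducing formula with respect to \<open>z\<close> under the
  integral; the necessity part reads off derivatives of the symbol in this form.\<close>

lemma reproducing_formula_deriv:
  fixes h :: "complex ^ 'n \<Rightarrow> complex"
  assumes h: "ball_holomorphic h" and int: "integrable (bmeas b) h" and b: "b > -1" and z: "z \<in> unit_ball"
  defines "l \<equiv> real CARD('n) + 1 + b"
  shows "(\<integral>w. h w * (of_real l * kpow (l + 1) (hinner z w) * hinner u w) \<partial>bmeas b)
    = of_real (bmass TYPE('n) b) * sderiv u h z"
proof -
  let ?I = "\<lambda>z. \<integral>w. h w * kpow l (hinner z w) \<partial>bmeas b"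
  have "(\<integral>w. h w * (of_real l * kpow (l + 1) (hinner z w) * hinner u w) \<partial>bmeas b)
    = (\<integral>w. h w * (deriv (kpow l) (hinner z w) * hinner u w) \<partial>bmeas b)"
    by (intro Bochner_Integration.integral_cong refl)
      (simp add: kpow_deriv[OF norm_hinner_less_1[OF z less_imp_le]])
  also have "\<dots> = sderiv u ?I z"
    by (rule kernel_integral_holomorphic(2)[OF int kpow_holomorphic z, symmetric])
  also have "\<dots> = sderiv u (\<lambda>z. of_real (bmass TYPE('n) b) * h z) z"
    unfolding l_def
    by (rule sderiv_cong[OF reproducing_formula[OF ball_holomorphic_imp_slice_hol[OF h] int b] z])
  also have "\<dots> = of_real (bmass TYPE('n) b) * sderiv u h z"
  proof (rule sderiv_eq)
    show "((\<lambda>z. of_real (bmass TYPE('n) b) * h z) has_derivative (\<lambda>v. of_real (bmass TYPE('n) b) * sderiv v h z)) (at z)"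
      by (intro has_derivative_mult_right ball_holomorphic_has_derivative h z)
  qed (simp add: sderiv_smult[OF h z])
  finally show ?thesis .
qed

section \<open>The Forelli--Rudin estimate\<close>

lemma higher_deriv_kpow_linear:
  assumes "0 \<le> a" "a < 1" "cmod t < 1"
  shows "(deriv ^^ k) (\<lambda>t. kpow \<mu> (t * of_real a)) t = of_real (pochhammer \<mu> k * a ^ k) * kpow (\<mu> + real k) (t * of_real a)"
  using assms(3)
proof (induction k arbitrary: t)
  case (Suc k)
  have lt: "cmod (s * of_real a) < 1" if "cmod s < 1" for s
    using that assms mult_left_le[of a "cmod s"] by (simp add: norm_mult)
  have "(deriv ^^ Suc k) (\<lambda>t. kpow \<mu> (t * of_real a)) t = deriv ((deriv ^^ k) (\<lambda>t. kpow \<mu> (t * of_real a))) t"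
    by simp
  also have "\<dots> = deriv (\<lambda>t. of_real (pochhammer \<mu> k * a ^ k) * kpow (\<mu> + real k) (t * of_real a)) t"
  proof (rule deriv_cong_ev[OF _ refl])
    have "t \<in> ball 0 1" using Suc by simp
    from eventually_nhds_in_open[OF open_ball this]
    show "\<forall>\<^sub>F s in nhds t. (deriv ^^ k) (\<lambda>t. kpow \<mu> (t * of_real a)) s = of_real (pochhammer \<mu> k * a ^ k) * kpow (\<mu> + real k) (s * of_real a)"
      by (rule eventually_mono) (use Suc.IH in auto)
  qed
  also have "\<dots> = of_real (pochhammer \<mu> k * a ^ k) * (of_real (\<mu> + real k) * kpow (\<mu> + real k + 1) (t * of_real a) * of_real a)"
    by (intro DERIV_imp_deriv DERIV_cmult Suc.prems
        DERIV_chain2[where f = "kpow (\<mu> + real k)" and g = "\<lambda>t. t * complex_of_real a", OF kpow_has_derivative[OF lt]])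
      (auto intro!: derivative_eq_intros)
  finally show ?case by (simp add: pochhammer_Suc algebra_simps)
qed simp

text \<open>Since \<open>\<mu>\<close> is the midpoint, \<open>(\<mu> + real j)\<^sup>2\<close>
  exceeds \<open>(l + real j) * (c + real j)\<close> by the constant
  \<open>((l - c) / 2)\<^sup>2\<close>. The quotient is thus 1 plus a term of order
  \<open>1 / (real j + 1)\<^sup>2\<close>, and the product of these factors is bounded by the
  exponential of a convergent sum.\<close>

lemma pochhammer_ratio_bounded:
  fixes l c :: real
  assumes "l > 0" "c > 0"
  defines "\<mu> \<equiv> (l + c) / 2"
  obtains C where "C > 0" "\<And>k. (pochhammer \<mu> k)\<^sup>2 \<le> C * (pochhammer l k * pochhammer c k)"
proof -
  define D where "D = ((l - c) / 2)\<^sup>2 / (min l 1 * min c 1)"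
  define \<epsilon> where "\<epsilon> j = D * inverse ((real j + 1)\<^sup>2)" for j
  have D: "D \<ge> 0" using assms by (simp add: D_def)
  have sum: "summable \<epsilon>"
    unfolding \<epsilon>_def
    by (intro summable_mult) (use inverse_power_summable[of 2, where 'a = real] summable_Suc_iff[of "\<lambda>n. inverse ((real n)\<^sup>2)"]
        in \<open>simp add: add.commute\<close>)
  have \<epsilon>0: "\<epsilon> j \<ge> 0" for j using D by (simp add: \<epsilon>_def)
  have step: "(\<mu> + real j)\<^sup>2 \<le> exp (\<epsilon> j) * ((l + real j) * (c + real j))" for j
  proof -
    have ge: "min x 1 * (real j + 1) \<le> x + real j" if "x > 0" for x :: real
    proof -
      have "min x 1 * (real j + 1) = min x 1 * real j + min x 1" by (simp add: algebra_simps)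
      also have "\<dots> \<le> 1 * real j + x" by (intro add_mono mult_right_mono) auto
      finally show ?thesis by simp
    qed
    have "(min l 1 * (real j + 1)) * (min c 1 * (real j + 1)) \<le> (l + real j) * (c + real j)"
      using assms by (intro mult_mono ge) auto
    then have "\<epsilon> j * ((min l 1 * (real j + 1)) * (min c 1 * (real j + 1))) \<le> \<epsilon> j * ((l + real j) * (c + real j))"
      using \<epsilon>0 by (intro mult_left_mono) auto
    moreover have "\<epsilon> j * ((min l 1 * (real j + 1)) * (min c 1 * (real j + 1))) = ((l - c) / 2)\<^sup>2"
    proof -
      have "min l 1 \<noteq> 0" "min c 1 \<noteq> 0" using assms by auto
      moreover have "E / (A * B) * inverse (S\<^sup>2) * ((A * S) * (B * S)) = E"
        if "A \<noteq> 0" "B \<noteq> 0" "S \<noteq> 0" for E A B S :: real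
        using that by (simp add: power2_eq_square field_simps)
      ultimately show ?thesis
        unfolding \<epsilon>_def D_def by (metis of_nat_Suc of_nat_eq_0_iff Zero_not_Suc add.commute)
    qed
    moreover have "(\<mu> + real j)\<^sup>2 = (l + real j) * (c + real j) + ((l - c) / 2)\<^sup>2"
      by (simp add: \<mu>_def power2_eq_square field_simps)
    ultimately have "(\<mu> + real j)\<^sup>2 \<le> (1 + \<epsilon> j) * ((l + real j) * (c + real j))"
      by (simp add: algebra_simps)
    also have "\<dots> \<le> exp (\<epsilon> j) * ((l + real j) * (c + real j))"
      using assms by (intro mult_right_mono exp_ge_add_one_self) auto
    finally show ?thesis .
  qed
  have "(pochhammer \<mu> k)\<^sup>2 \<le> exp (\<Sum>j<k. \<epsilon> j) * (pochhammer l k * pochhammer c k)" for k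
  proof (induction k)
    case (Suc k)
    have "(pochhammer \<mu> (Suc k))\<^sup>2 = (pochhammer \<mu> k)\<^sup>2 * (\<mu> + real k)\<^sup>2"
      by (simp add: pochhammer_Suc power_mult_distrib)
    also have "\<dots> \<le> (exp (\<Sum>j<k. \<epsilon> j) * (pochhammer l k * pochhammer c k)) * (exp (\<epsilon> k) * ((l + real k) * (c + real k)))"
      using assms pochhammer_pos[of l k] pochhammer_pos[of c k] by (intro mult_mono Suc step) auto
    finally show ?case by (simp add: pochhammer_Suc exp_add mult_ac)
  qed simp
  moreover have "exp (\<Sum>j<k. \<epsilon> j) * (pochhammer l k * pochhammer c k) \<le> exp (suminf \<epsilon>) * (pochhammer l k * pochhammer c k)" for k
    using assms pochhammer_pos[of l k] pochhammer_pos[of c k]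
    by (intro mult_right_mono) (auto intro!: sum_le_suminf sum \<epsilon>0)
  ultimately show thesis
    by (intro that[of "exp (suminf \<epsilon>)"]) (auto intro: order_trans)
qed

lemma kernel_powr_integrable:
  assumes "b > -1" "z \<in> unit_ball"
  shows "integrable (bmeas b) (\<lambda>w. cmod (1 - hinner z w) powr r)"
proof (rule integrable_bmeas_cball[OF assms(1)])
  have "continuous_on (cball 0 1) (\<lambda>w. cmod (kpow (- r) (hinner z w)))"
    by (intro continuous_intros kpow_hinner_right_continuous assms)
  then show "continuous_on (cball 0 1) (\<lambda>w. cmod (1 - hinner z w) powr r)"
    by (simp add: norm_kpow)
qed

text \<open>With \<open>\<mu> = (l + c) / 2\<close> the integrand is the squared modulus of
  \<open>kpow \<mu> (hinner z w)\<close>, that is, a function holomorphic in \<open>w\<close> times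
  a power series in \<open>hinner z w\<close>. \<open>kernel_series\<close> gives coefficients
  \<open>(pochhammer \<mu> k)\<^sup>2 / (fact k * pochhammer l k)\<close>, comparable from above to
  \<open>pochhammer c k / fact k\<close>, the coefficients of \<open>dfct z powr (- c)\<close> in
  powers of the squared norm of \<open>z\<close>.\<close>

lemma forelli_rudin:
  assumes b: "b > -1" and c: "c > 0"
  obtains C where "C > 0" "\<And>z :: complex ^ 'n. z \<in> unit_ball \<Longrightarrow>
    (\<integral>w. cmod (1 - hinner z w) powr (- (real CARD('n) + 1 + b + c)) \<partial>bmeas b) \<le> C * dfct z powr (- c)"
proof -
  define l where "l = real CARD('n) + 1 + b"
  define \<mu> where "\<mu> = (l + c) / 2"
  define m where "m = bmass TYPE('n) b"
  have l: "l > 0" using b by (simp add: l_def)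
  have m: "m > 0" unfolding m_def by (rule bmass_pos[OF b])
  obtain C where C: "C > 0" "\<And>k. (pochhammer \<mu> k)\<^sup>2 \<le> C * (pochhammer l k * pochhammer c k)"
    using pochhammer_ratio_bounded[OF l c] unfolding \<mu>_def by blast
  show thesis
  proof (rule that[of "C * m"])
    fix z :: "complex ^ 'n" assume z: "z \<in> unit_ball"
    define a where "a = (norm z)\<^sup>2"
    have a: "0 \<le> a" "a < 1" "dfct z = 1 - a"
      using dfct_pos[OF z] by (auto simp: a_def dfct_def)
    define h where "h w = kpow \<mu> (hinner w z)" for w
    have lt: "cmod (hinner w z) < 1" if "w \<in> unit_ball" for w
      using norm_hinner_less_1[OF that, of z] z by simp
    have h_hol: "ball_holomorphic h"
      unfolding ball_holomorphic_def
    proof (intro ballI exI conjI allI)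
      fix w :: "complex ^ 'n" assume w: "w \<in> unit_ball"
      have "((\<lambda>w. hinner w z) has_derivative (\<lambda>x. hinner x z)) (at w)"
        by (rule bounded_linear_imp_has_derivative[OF bounded_linear_hinner_left])
      from diff_chain_at[OF this kpow_has_derivative[OF lt[OF w], unfolded has_field_derivative_def]]
      show "(h has_derivative (\<lambda>x. of_real \<mu> * kpow (\<mu> + 1) (hinner w z) * hinner x z)) (at w)"
        by (simp add: o_def h_def[abs_def])
    qed (simp add: mult_ac)
    have h_sl: "slice_hol 1 h" by (rule ball_holomorphic_imp_slice_hol[OF h_hol])
    have hcnj: "h w = cnj (kpow \<mu> (hinner z w))" if "norm w \<le> 1" for w
      unfolding h_def using cnj_kpow[OF norm_hinner_less_1[OF z that]] by simp
    have h_int: "integrable (bmeas b) h"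
    proof (rule integrable_bmeas_cball[OF b])
      have "continuous_on (cball 0 1) (\<lambda>w. cnj (kpow \<mu> (hinner z w)))"
        by (intro continuous_intros kpow_hinner_right_continuous z)
      then show "continuous_on (cball 0 1) h" by (rule continuous_on_eq) (simp add: hcnj)
    qed
    have d: "(deriv ^^ k) (\<lambda>t. h (t *s z)) 0 = of_real (pochhammer \<mu> k * a ^ k)" for k
      using higher_deriv_kpow_linear[OF a(1,2), of 0 k \<mu>] by (simp add: h_def hinner_self a_def kpow_def)
    define F where "F = (\<integral>w. cmod (1 - hinner z w) powr (- (l + c)) \<partial>bmeas b)"
    have "(\<lambda>k. of_real (pochhammer \<mu> k / fact k) * (of_real m * (deriv ^^ k) (\<lambda>t. h (t *s z)) 0 / pochhammer (of_real l) k))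
        sums (\<integral>w. h w * kpow \<mu> (hinner z w) \<partial>bmeas b)"
      unfolding m_def l_def by (rule kernel_series[OF h_sl h_int b z kpow_sums])
    moreover have "(\<integral>w. h w * kpow \<mu> (hinner z w) \<partial>bmeas b) = (\<integral>w. of_real (cmod (1 - hinner z w) powr (- (l + c))) \<partial>bmeas b)"
    proof (rule Bochner_Integration.integral_cong[OF refl])
      fix w :: "complex ^ 'n" assume "w \<in> space (bmeas b)"
      then have w: "norm w \<le> 1" by simp
      have "h w * kpow \<mu> (hinner z w) = of_real ((cmod (kpow \<mu> (hinner z w)))\<^sup>2)"
        unfolding hcnj[OF w] by (metis complex_norm_square mult.commute)
      also have "(cmod (kpow \<mu> (hinner z w)))\<^sup>2 = cmod (1 - hinner z w) powr (- (l + c))"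
        by (simp add: norm_kpow power2_eq_square powr_add[symmetric] \<mu>_def)
      finally show "h w * kpow \<mu> (hinner z w) = of_real (cmod (1 - hinner z w) powr (- (l + c)))" .
    qed
    moreover have "\<dots> = of_real F" unfolding F_def l_def by (rule integral_of_real[OF kernel_powr_integrable[OF b z]])
    ultimately have "(\<lambda>k. complex_of_real (m * (pochhammer \<mu> k)\<^sup>2 / (fact k * pochhammer l k) * a ^ k)) sums of_real F"
      unfolding d by (simp add: pochhammer_of_real power2_eq_square mult_ac)
    then have s1: "(\<lambda>k. m * (pochhammer \<mu> k)\<^sup>2 / (fact k * pochhammer l k) * a ^ k) sums F"
      by (simp only: sums_of_real_iff)
    have "(\<lambda>k. of_real (pochhammer c k / fact k) * of_real a ^ k) sums kpow c (of_real a)"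
      by (rule kpow_sums) (use a in simp)
    moreover have "kpow c (of_real a) = of_real ((1 - a) powr (- c))"
      using a powr_of_real[of "1 - a" "- c"] by (simp add: kpow_def)
    ultimately have "(\<lambda>k. complex_of_real (pochhammer c k / fact k * a ^ k)) sums of_real ((1 - a) powr (- c))"
      by simp
    then have "(\<lambda>k. pochhammer c k / fact k * a ^ k) sums ((1 - a) powr (- c))"
      by (simp only: sums_of_real_iff)
    then have s2: "(\<lambda>k. (C * m) * (pochhammer c k / fact k * a ^ k)) sums ((C * m) * (1 - a) powr (- c))"
      by (rule sums_mult)
    have "F \<le> (C * m) * (1 - a) powr (- c)"
    proof (rule sums_le[OF _ s1 s2])
      fix k
      have "m * (pochhammer \<mu> k)\<^sup>2 / (fact k * pochhammer l k) * a ^ k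
        \<le> m * (C * (pochhammer l k * pochhammer c k)) / (fact k * pochhammer l k) * a ^ k"
        using pochhammer_pos[OF l, of k] m a
        by (intro mult_right_mono divide_right_mono mult_left_mono C(2)) auto
      also have "\<dots> = (C * m) * (pochhammer c k / fact k * a ^ k)"
        using pochhammer_pos[OF l, of k] by (simp add: field_simps)
      finally show "m * (pochhammer \<mu> k)\<^sup>2 / (fact k * pochhammer l k) * a ^ k \<le> (C * m) * (pochhammer c k / fact k * a ^ k)" .
    qed
    then show "(\<integral>w. cmod (1 - hinner z w) powr (- (real CARD('n) + 1 + b + c)) \<partial>bmeas b) \<le> C * m * dfct z powr (- c)"
      by (simp add: F_def l_def a)
  qed (use C m in simp)
qed

section \<open>Integral operators with Bergman kernels\<close>

text \<open>Young's inequality applied after normalising both factors; a vanishing norm is a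
  separate case because the normalisation divides by it.\<close>

lemma hoelder_integral:
  fixes u v :: "'a \<Rightarrow> real"
  assumes p: "p > 1" "1 / p + 1 / q = 1"
    and meas: "u \<in> borel_measurable M" "v \<in> borel_measurable M"
    and nonneg: "\<And>x. x \<in> space M \<Longrightarrow> u x \<ge> 0" "\<And>x. x \<in> space M \<Longrightarrow> v x \<ge> 0"
    and int: "integrable M (\<lambda>x. u x powr p)" "integrable M (\<lambda>x. v x powr q)"
  shows "integrable M (\<lambda>x. u x * v x)"
    and "(\<integral>x. u x * v x \<partial>M) \<le> (\<integral>x. u x powr p \<partial>M) powr (1 / p) * (\<integral>x. v x powr q \<partial>M) powr (1 / q)"
proof -
  have "1 / q = 1 - 1 / p" using p(2) by simp
  then have q1: "0 < 1 / q" "1 / q < 1" using p(1) by auto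
  then have "0 < q" by (simp add: zero_less_divide_iff)
  then have q: "q > 1" using q1 by (simp add: divide_less_eq)
  have young: "s * t \<le> s powr p / p + t powr q / q" if "s \<ge> 0" "t \<ge> 0" for s t :: real
    using Youngs_inequality[of p q s t] p q that by simp
  show int_uv: "integrable M (\<lambda>x. u x * v x)"
  proof (rule Bochner_Integration.integrable_bound)
    show "integrable M (\<lambda>x. u x powr p / p + v x powr q / q)" using int by simp
    show "AE x in M. norm (u x * v x) \<le> norm (u x powr p / p + v x powr q / q)"
    proof (rule AE_I2)
      fix x assume x: "x \<in> space M"
      have "0 \<le> u x * v x" using nonneg x by simp
      then show "norm (u x * v x) \<le> norm (u x powr p / p + v x powr q / q)"
        using young[of "u x" "v x"] nonneg x by simp
    qed
  qed (use meas in measurable)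
  define X where "X = (\<integral>x. u x powr p \<partial>M)"
  define Y where "Y = (\<integral>x. v x powr q \<partial>M)"
  have XY: "X \<ge> 0" "Y \<ge> 0" by (auto simp: X_def Y_def)
  show "(\<integral>x. u x * v x \<partial>M) \<le> (\<integral>x. u x powr p \<partial>M) powr (1 / p) * (\<integral>x. v x powr q \<partial>M) powr (1 / q)"
  proof (cases "X = 0 \<or> Y = 0")
    case True
    have "AE x in M. u x * v x = 0"
    proof (cases "X = 0")
      case True
      then have "AE x in M. u x powr p = 0"
        using int(1) unfolding X_def by (subst (asm) integral_nonneg_eq_0_iff_AE) auto
      then show ?thesis by eventually_elim auto
    next
      case False
      then have "Y = 0" using True by simp
      then have "AE x in M. v x powr q = 0"
        using int(2) unfolding Y_def by (subst (asm) integral_nonneg_eq_0_iff_AE) auto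
      then show ?thesis by eventually_elim auto
    qed
    then have "(\<integral>x. u x * v x \<partial>M) = (\<integral>x. 0 \<partial>M)"
      by (intro integral_cong_AE) (use meas in auto)
    then show ?thesis by simp
  next
    case False
    define A where "A = X powr (1 / p)"
    define B where "B = Y powr (1 / q)"
    have AB: "A > 0" "B > 0" "A powr p = X" "B powr q = Y"
      using False XY p q by (auto simp: A_def B_def powr_powr)
    have "(\<integral>x. u x * v x \<partial>M) = (\<integral>x. (A * B) * ((u x / A) * (v x / B)) \<partial>M)"
      using AB by simp
    also have "\<dots> \<le> (\<integral>x. (A * B) * (u x powr p / X / p + v x powr q / Y / q) \<partial>M)"
    proof (rule integral_mono)
      show "integrable M (\<lambda>x. (A * B) * ((u x / A) * (v x / B)))" using int_uv AB by simp
      show "integrable M (\<lambda>x. (A * B) * (u x powr p / X / p + v x powr q / Y / q))" using int by simp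
      fix x assume x: "x \<in> space M"
      have "(u x / A) * (v x / B) \<le> (u x / A) powr p / p + (v x / B) powr q / q"
        using AB nonneg[OF x] by (intro young) auto
      then show "(A * B) * ((u x / A) * (v x / B)) \<le> (A * B) * (u x powr p / X / p + v x powr q / Y / q)"
        using AB nonneg[OF x] by (intro mult_left_mono) (simp_all add: powr_divide)
    qed
    also have "\<dots> = (A * B) * (X / X / p + Y / Y / q)"
      using int by (simp add: X_def[symmetric] Y_def[symmetric])
    also have "\<dots> = A * B" using False p by simp
    finally show ?thesis by (simp add: A_def B_def X_def Y_def)
  qed
qed

lemma kernel_measurable [measurable]:
  "(\<lambda>x. cmod (1 - hinner (fst x) (snd x)) powr r) \<in> borel_measurable (bmeas a \<Otimes>\<^sub>M bmeas b)"
proof -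
  have 1: "(\<lambda>x :: (complex ^ 'n) \<times> (complex ^ 'n). cmod (1 - hinner (fst x) (snd x))) \<in> borel_measurable (borel \<Otimes>\<^sub>M borel)"
    unfolding borel_prod by (intro borel_measurable_continuous_onI continuous_intros)
  have 2: "(\<lambda>x. x) \<in> measurable (bmeas a \<Otimes>\<^sub>M bmeas b) (borel \<Otimes>\<^sub>M (borel :: (complex ^ 'n) measure))"
  proof -
    have "(\<lambda>x. (fst x, snd x)) \<in> measurable (bmeas a \<Otimes>\<^sub>M bmeas b) (borel \<Otimes>\<^sub>M (borel :: (complex ^ 'n) measure))"
      by (intro measurable_Pair measurable_compose[OF measurable_fst] measurable_compose[OF measurable_snd]
          measurable_bmeas_of_borel) auto
    then show ?thesis by simp
  qed
  show ?thesis
    using measurable_compose[OF 2 1] by measurable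
qed

lemma kernel_integral_symmetric_bound:
  assumes b: "b > -1" and c: "c > 0"
  obtains C where "C > 0" "\<And>z :: complex ^ 'n. z \<in> unit_ball \<Longrightarrow>
    (\<integral>w. cmod (1 - hinner w z) powr (- (real CARD('n) + 1 + b + c)) \<partial>bmeas b) \<le> C * dfct z powr (- c)"
proof -
  obtain C where C: "C > 0" "\<And>z :: complex ^ 'n. z \<in> unit_ball \<Longrightarrow>
    (\<integral>w. cmod (1 - hinner z w) powr (- (real CARD('n) + 1 + b + c)) \<partial>bmeas b) \<le> C * dfct z powr (- c)"
    using forelli_rudin[OF b c, where 'n = 'n] by blast
  show thesis
  proof (rule that[OF C(1)])
    fix z :: "complex ^ 'n" assume "z \<in> unit_ball"
    from C(2)[OF this]
    show "(\<integral>w. cmod (1 - hinner w z) powr (- (real CARD('n) + 1 + b + c)) \<partial>bmeas b) \<le> C * dfct z powr (- c)"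
      unfolding cmod_one_minus_hinner_commute[of z] .
  qed
qed

text \<open>Schur's test with a power of \<open>dfct\<close> as test function:
  \<open>K z w * G w\<close> is split as \<open>K powr (1/q') * dfct powr (- \<sigma>)\<close> times
  \<open>K powr (1/q) * dfct powr \<sigma> * G\<close>. Hoelder and Forelli--Rudin in
  \<open>w\<close>, then Fubini and Forelli--Rudin in \<open>z\<close>, close the estimate.
  Integrability is part of the conclusion because a divergent Bochner integral would silently be
  0.\<close>

lemma schur_test:
  fixes \<beta> q a b :: real
  assumes \<beta>: "\<beta> > -1" and q: "q > 1" and a: "- q * a < \<beta> + 1" and b: "\<beta> + 1 < q * (b + 1)"
  defines "K \<equiv> \<lambda>z w :: complex ^ 'n. cmod (1 - hinner z w) powr (- (real CARD('n) + 1 + a + b))"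
  obtains C where "C > 0" "\<And>G :: complex ^ 'n \<Rightarrow> real. G \<in> borel_measurable (bmeas \<beta>) \<Longrightarrow> (\<And>w. G w \<ge> 0) \<Longrightarrow>
      integrable (bmeas \<beta>) (\<lambda>w. G w powr q) \<Longrightarrow>
      (\<forall>z\<in>unit_ball. integrable (bmeas b) (\<lambda>w. K z w * G w)) \<and>
      integrable (bmeas \<beta>) (\<lambda>z. (dfct z powr a * (\<integral>w. K z w * G w \<partial>bmeas b)) powr q) \<and>
      (\<integral>z. (dfct z powr a * (\<integral>w. K z w * G w \<partial>bmeas b)) powr q \<partial>bmeas \<beta>) \<le> C * (\<integral>w. G w powr q \<partial>bmeas \<beta>)"
proof -
  define n where "n = real CARD('n)"
  define q' where "q' = q / (q - 1)"
  have q': "q' > 1" "1 / q' + 1 / q = 1" "q' * (q - 1) = q" "q / q' = q - 1"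
    using q by (auto simp: q'_def field_simps)
  have b1: "b > -1"
  proof (rule ccontr)
    assume "\<not> b > -1"
    then have "q * (b + 1) \<le> 0" using q by (intro mult_nonneg_nonpos) auto
    then show False using \<beta> b by simp
  qed
  have ab: "- a < b + 1"
  proof -
    have "q * (- a) < q * (b + 1)" using a b by simp
    then show ?thesis using q by (simp only: mult_less_cancel_left_pos)
  qed
  \<comment> \<open>The two Forelli--Rudin estimates need weights \<open>b - \<sigma> * q'\<close>
    and \<open>\<beta> + a - \<sigma> * q\<close> above -1 and gains
    \<open>a + \<sigma> * q'\<close> and \<open>b - \<beta> + \<sigma> * q\<close> above 0. These
    are two lower and two upper bounds on \<open>\<sigma>\<close>; the four comparisons starting
    here show that they are compatible.\<close>
  have "- a / q' < (a + \<beta> + 1) / q"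
  proof -
    have "- a / q' = - a * (q - 1) / q" using q by (simp add: q'_def)
    also have "\<dots> < (a + \<beta> + 1) / q" using q a by (intro divide_strict_right_mono) (auto simp: algebra_simps)
    finally show ?thesis .
  qed
  moreover have "(\<beta> - b) / q < (b + 1) / q'"
  proof -
    have "(b + 1) / q' = (b + 1) * (q - 1) / q" using q by (simp add: q'_def)
    also have "\<dots> > (\<beta> - b) / q" using q b by (intro divide_strict_right_mono) (auto simp: algebra_simps)
    finally show ?thesis .
  qed
  moreover have "- a / q' < (b + 1) / q'" "(\<beta> - b) / q < (a + \<beta> + 1) / q"
    by (rule divide_strict_right_mono, use ab q q' in simp, use ab q q' in simp)+
  ultimately have "max (- a / q') ((\<beta> - b) / q) < min ((b + 1) / q') ((a + \<beta> + 1) / q)"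
    by (simp add: max_def min_def)
  then obtain \<sigma> where "max (- a / q') ((\<beta> - b) / q) < \<sigma>" "\<sigma> < min ((b + 1) / q') ((a + \<beta> + 1) / q)"
    using dense by blast
  then have \<sigma>: "- a < \<sigma> * q'" "\<beta> - b < \<sigma> * q" "\<sigma> * q' < b + 1" "\<sigma> * q < a + \<beta> + 1"
    using q q' by (auto simp: field_simps)
  obtain C1 where C1: "C1 > 0" "\<And>z :: complex ^ 'n. z \<in> unit_ball \<Longrightarrow>
      (\<integral>w. cmod (1 - hinner z w) powr (- (real CARD('n) + 1 + (b - \<sigma> * q') + (a + \<sigma> * q'))) \<partial>bmeas (b - \<sigma> * q'))
        \<le> C1 * dfct z powr (- (a + \<sigma> * q'))"
    using forelli_rudin[of "b - \<sigma> * q'" "a + \<sigma> * q'", where 'n = 'n] \<sigma> by auto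
  obtain C2 where C2: "C2 > 0" "\<And>w :: complex ^ 'n. w \<in> unit_ball \<Longrightarrow>
      (\<integral>z. cmod (1 - hinner z w) powr (- (real CARD('n) + 1 + (\<beta> + a - \<sigma> * q) + (b - \<beta> + \<sigma> * q))) \<partial>bmeas (\<beta> + a - \<sigma> * q))
        \<le> C2 * dfct w powr (- (b - \<beta> + \<sigma> * q))"
    using kernel_integral_symmetric_bound[of "\<beta> + a - \<sigma> * q" "b - \<beta> + \<sigma> * q", where 'n = 'n] \<sigma> by auto
  have Kexp: "real CARD('n) + 1 + (b - \<sigma> * q') + (a + \<sigma> * q') = real CARD('n) + 1 + a + b"
    "real CARD('n) + 1 + (\<beta> + a - \<sigma> * q) + (b - \<beta> + \<sigma> * q) = real CARD('n) + 1 + a + b" by simp_all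
  have C1K: "(\<integral>w. K z w \<partial>bmeas (b - \<sigma> * q')) \<le> C1 * dfct z powr (- (a + \<sigma> * q'))" if "z \<in> unit_ball" for z
    using C1(2)[OF that] unfolding Kexp K_def .
  have C2K: "(\<integral>z. K z w \<partial>bmeas (\<beta> + a - \<sigma> * q)) \<le> C2 * dfct w powr (- (b - \<beta> + \<sigma> * q))" if "w \<in> unit_ball" for w
    using C2(2)[OF that] unfolding Kexp K_def .
  have Kc: "continuous_on unit_ball (\<lambda>w. K z w)" if "z \<in> unit_ball" for z
  proof -
    have "continuous_on unit_ball (\<lambda>w. cmod (kpow (n + 1 + a + b) (hinner z w)))"
      by (intro continuous_intros continuous_on_subset[OF kpow_hinner_right_continuous[OF that]]) auto
    then show ?thesis by (simp add: norm_kpow K_def n_def)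
  qed
  have K0: "K z w \<ge> 0" for z w by (simp add: K_def)
  have Kb: "\<exists>B. \<forall>w\<in>unit_ball. K z w \<le> B" if z: "z \<in> unit_ball" for z
  proof -
    have "compact ((\<lambda>w. cmod (kpow (n + 1 + a + b) (hinner z w))) ` cball 0 1)"
      by (intro compact_continuous_image continuous_intros kpow_hinner_right_continuous z) auto
    from compact_imp_bounded[OF this] obtain B where
      "\<forall>y\<in>(\<lambda>w. cmod (kpow (n + 1 + a + b) (hinner z w))) ` cball 0 1. norm y \<le> B"
      unfolding bounded_iff by blast
    then show ?thesis by (intro exI[of _ B]) (auto simp: norm_kpow K_def n_def)
  qed
  \<comment> \<open>The weights \<open>\<nu>\<close> in \<open>z\<close> and \<open>\<tau>\<close>
    in \<open>w\<close> absorb the powers of \<open>dfct\<close> left by Hoelder, so that Fubini is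
    applied to \<open>K z w * G w powr q\<close> alone.\<close>
  define \<nu> where "\<nu> = \<beta> + a - \<sigma> * q"
  define \<tau> where "\<tau> = b + \<sigma> * q"
  have \<nu>': "\<beta> + (a - \<sigma> * q) = \<nu>" by (simp add: \<nu>_def)
  have \<nu>: "\<nu> > -1" using \<sigma> by (simp add: \<nu>_def)
  have \<tau>: "\<tau> > -1" "\<tau> > \<beta>" using \<sigma> \<beta> by (auto simp: \<tau>_def)
  show thesis
  proof (rule that[of "C1 powr (q - 1) * C2"])
    show "C1 powr (q - 1) * C2 > 0" using C1 C2 by simp
    fix G :: "complex ^ 'n \<Rightarrow> real"
    assume G: "G \<in> borel_measurable (bmeas \<beta>)" and G0: "\<And>w. G w \<ge> 0" and Gq: "integrable (bmeas \<beta>) (\<lambda>w. G w powr q)"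
    have Gm: "G \<in> borel_measurable (bmeas r)" for r using G by (simp add: measurable_bmeas)
    note Gm [measurable]
    have Gqm: "(\<lambda>w. G w powr q) \<in> borel_measurable (bmeas r)" for r by measurable
    have G\<tau>: "integrable (bmeas \<tau>) (\<lambda>w. G w powr q)"
    proof -
      have "integrable (bmeas \<beta>) (\<lambda>w. dfct w powr (\<tau> - \<beta>) *\<^sub>R G w powr q)"
      proof (rule Bochner_Integration.integrable_bound[OF Gq])
        show "AE w in bmeas \<beta>. norm (dfct w powr (\<tau> - \<beta>) *\<^sub>R G w powr q) \<le> norm (G w powr q)"
        proof (rule AE_I2)
          fix w :: "complex ^ 'n" assume "w \<in> space (bmeas \<beta>)"
          then have "dfct w powr (\<tau> - \<beta>) \<le> 1"
            using dfct_pos[of w] dfct_le_1[of w] \<tau> by (intro powr_le1) auto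
          then show "norm (dfct w powr (\<tau> - \<beta>) *\<^sub>R G w powr q) \<le> norm (G w powr q)"
            using mult_right_mono[of "dfct w powr (\<tau> - \<beta>)" 1 "G w powr q"] by simp
        qed
        show "(\<lambda>w. dfct w powr (\<tau> - \<beta>) *\<^sub>R G w powr q) \<in> borel_measurable (bmeas \<beta>)"
          by measurable
      qed
      then show ?thesis using integrable_bmeas_shift[OF Gqm, of \<beta> "\<tau> - \<beta>"] by simp
    qed
    have KG\<tau>: "integrable (bmeas \<tau>) (\<lambda>w. K z w * G w powr q)" if z: "z \<in> unit_ball" for z
    proof -
      obtain B where B: "\<forall>w\<in>unit_ball. K z w \<le> B" using Kb[OF z] by blast
      show ?thesis
      proof (rule Bochner_Integration.integrable_bound)
        show "integrable (bmeas \<tau>) (\<lambda>w. B * G w powr q)" using G\<tau> by simp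
        show "AE w in bmeas \<tau>. norm (K z w * G w powr q) \<le> norm (B * G w powr q)"
          using B K0 by (intro AE_I2) (auto simp: abs_mult intro!: mult_right_mono order_trans[OF _ abs_ge_self])
        show "(\<lambda>w. K z w * G w powr q) \<in> borel_measurable (bmeas \<tau>)"
          by (rule borel_measurable_times[OF measurable_bmeas_continuous[OF Kc[OF z]] Gqm])
      qed
    qed
    have dp: "dfct w > 0" if "w \<in> space (bmeas r)" for w :: "complex ^ 'n" and r using that dfct_pos[of w] by simp
    have step: "integrable (bmeas b) (\<lambda>w. K z w * G w)"
        "(dfct z powr a * (\<integral>w. K z w * G w \<partial>bmeas b)) powr q \<le>
          C1 powr (q - 1) * (dfct z powr (a - \<sigma> * q) * (\<integral>w. K z w * G w powr q \<partial>bmeas \<tau>))"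
      if z: "z \<in> unit_ball" for z
    proof -
      define u where "u w = K z w powr (1 / q') * dfct w powr (- \<sigma>)" for w
      define v where "v w = K z w powr (1 / q) * dfct w powr \<sigma> * G w" for w
      have Km [measurable]: "K z \<in> borel_measurable (bmeas r)" for r by (rule measurable_bmeas_continuous[OF Kc[OF z]])
      have um: "u \<in> borel_measurable (bmeas b)"
        unfolding u_def by measurable
      have vm: "v \<in> borel_measurable (bmeas b)"
        unfolding v_def by measurable
      have uv: "u w * v w = K z w * G w" if "w \<in> space (bmeas b)" for w
      proof -
        have "u w * v w = (K z w powr (1 / q') * K z w powr (1 / q)) * (dfct w powr (- \<sigma>) * dfct w powr \<sigma>) * G w"
          by (simp add: u_def v_def)
        also have "\<dots> = K z w * G w"
          using dp[OF that] K0[of z w] by (simp add: powr_add[symmetric] q'(2))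
        finally show ?thesis .
      qed
      have up: "u w powr q' = dfct w powr (- (\<sigma> * q')) *\<^sub>R K z w" if "w \<in> space (bmeas b)" for w
        using K0[of z w] q' by (simp add: u_def powr_mult powr_powr)
      have vp: "v w powr q = dfct w powr (\<sigma> * q) *\<^sub>R (K z w * G w powr q)" if "w \<in> space (bmeas b)" for w
        using K0[of z w] G0[of w] q by (simp add: v_def powr_mult powr_powr)
      have Kint: "integrable (bmeas (b - \<sigma> * q')) (K z)"
        unfolding K_def by (rule kernel_powr_integrable) (use \<sigma> z in auto)
      have KGm: "(\<lambda>w. K z w * G w powr q) \<in> borel_measurable (bmeas r)" for r by measurable
      have iu: "integrable (bmeas b) (\<lambda>w. u w powr q')"
      proof -
        have "integrable (bmeas b) (\<lambda>w. u w powr q') \<longleftrightarrow> integrable (bmeas b) (\<lambda>w. dfct w powr (- (\<sigma> * q')) *\<^sub>R K z w)"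
          by (rule Bochner_Integration.integrable_cong[OF refl up])
        then show ?thesis using Kint integrable_bmeas_shift[OF Km, of b "- (\<sigma> * q')"] by simp
      qed
      have iv: "integrable (bmeas b) (\<lambda>w. v w powr q)"
      proof -
        have "integrable (bmeas b) (\<lambda>w. v w powr q) \<longleftrightarrow> integrable (bmeas b) (\<lambda>w. dfct w powr (\<sigma> * q) *\<^sub>R (K z w * G w powr q))"
          by (rule Bochner_Integration.integrable_cong[OF refl vp])
        then show ?thesis using KG\<tau>[OF z] integrable_bmeas_shift[OF KGm, of b "\<sigma> * q"] by (simp add: \<tau>_def)
      qed
      have eu: "(\<integral>w. u w powr q' \<partial>bmeas b) = (\<integral>w. K z w \<partial>bmeas (b - \<sigma> * q'))"
      proof -
        have "(\<integral>w. u w powr q' \<partial>bmeas b) = (\<integral>w. dfct w powr (- (\<sigma> * q')) *\<^sub>R K z w \<partial>bmeas b)"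
          by (rule Bochner_Integration.integral_cong[OF refl up])
        then show ?thesis using integral_bmeas_shift[OF Km, of b "- (\<sigma> * q')"] by simp
      qed
      have ev: "(\<integral>w. v w powr q \<partial>bmeas b) = (\<integral>w. K z w * G w powr q \<partial>bmeas \<tau>)"
      proof -
        have "(\<integral>w. v w powr q \<partial>bmeas b) = (\<integral>w. dfct w powr (\<sigma> * q) *\<^sub>R (K z w * G w powr q) \<partial>bmeas b)"
          by (rule Bochner_Integration.integral_cong[OF refl vp])
        then show ?thesis using integral_bmeas_shift[OF KGm, of b "\<sigma> * q"] by (simp add: \<tau>_def)
      qed
      have u0: "u w \<ge> 0" and v0: "v w \<ge> 0" for w
        using G0 by (auto simp: u_def v_def)
      note H = hoelder_integral[OF q'(1,2) um vm u0 v0 iu iv]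
      show "integrable (bmeas b) (\<lambda>w. K z w * G w)"
        proof -
        have "integrable (bmeas b) (\<lambda>w. u w * v w) \<longleftrightarrow> integrable (bmeas b) (\<lambda>w. K z w * G w)"
          by (rule Bochner_Integration.integrable_cong[OF refl uv])
        then show ?thesis using H(1) by simp
      qed
      have Y0: "0 \<le> (\<integral>w. K z w * G w powr q \<partial>bmeas \<tau>)" by (intro Bochner_Integration.integral_nonneg) (simp add: K0)
      have I0: "0 \<le> (\<integral>w. K z w * G w \<partial>bmeas b)" by (intro Bochner_Integration.integral_nonneg) (simp add: K0 G0)
      have X0: "0 \<le> (\<integral>w. K z w \<partial>bmeas (b - \<sigma> * q'))" by (intro Bochner_Integration.integral_nonneg) (simp add: K0)
      have "(\<integral>w. K z w * G w \<partial>bmeas b) \<le> (\<integral>w. K z w \<partial>bmeas (b - \<sigma> * q')) powr (1 / q') * (\<integral>w. K z w * G w powr q \<partial>bmeas \<tau>) powr (1 / q)"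
        proof -
        have "(\<integral>w. u w * v w \<partial>bmeas b) = (\<integral>w. K z w * G w \<partial>bmeas b)"
          by (rule Bochner_Integration.integral_cong[OF refl uv])
        then show ?thesis using H(2) unfolding eu ev by simp
      qed
      also have "\<dots> \<le> (C1 * dfct z powr (- (a + \<sigma> * q'))) powr (1 / q') * (\<integral>w. K z w * G w powr q \<partial>bmeas \<tau>) powr (1 / q)"
        using C1K[OF z] q' X0 by (intro mult_right_mono powr_mono2) auto
      finally have "(\<integral>w. K z w * G w \<partial>bmeas b) powr q \<le>
          ((C1 * dfct z powr (- (a + \<sigma> * q'))) powr (1 / q') * (\<integral>w. K z w * G w powr q \<partial>bmeas \<tau>) powr (1 / q)) powr q"
        using I0 q by (intro powr_mono2) auto
      also have "\<dots> = (C1 * dfct z powr (- (a + \<sigma> * q'))) powr (q - 1) * (\<integral>w. K z w * G w powr q \<partial>bmeas \<tau>)"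
      proof -
        have e: "1 / q' * q = q - 1" "1 / q * q = 1" using q q'(4) by simp_all
        have "(X powr (1 / q') * Y powr (1 / q)) powr q = X powr (q - 1) * Y" if "Y \<ge> 0" for X Y :: real
        proof -
          have "(X powr (1 / q') * Y powr (1 / q)) powr q = (X powr (1 / q')) powr q * (Y powr (1 / q)) powr q"
            by (rule powr_mult)
          also have "\<dots> = X powr (q - 1) * Y" unfolding powr_powr e using that by simp
          finally show ?thesis .
        qed
        then show ?thesis using Y0 .
      qed
      also have "\<dots> = C1 powr (q - 1) * (dfct z powr (- (a + \<sigma> * q') * (q - 1)) * (\<integral>w. K z w * G w powr q \<partial>bmeas \<tau>))"
        using C1 by (simp add: powr_mult powr_powr)
      finally have "dfct z powr (a * q) * (\<integral>w. K z w * G w \<partial>bmeas b) powr q \<le> dfct z powr (a * q) *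
          (C1 powr (q - 1) * (dfct z powr (- (a + \<sigma> * q') * (q - 1)) * (\<integral>w. K z w * G w powr q \<partial>bmeas \<tau>)))"
        by (intro mult_left_mono) auto
      also have "\<dots> = C1 powr (q - 1) * (dfct z powr (a * q + (- (a + \<sigma> * q') * (q - 1))) * (\<integral>w. K z w * G w powr q \<partial>bmeas \<tau>))"
        by (simp add: powr_add)
      also have "a * q + (- (a + \<sigma> * q') * (q - 1)) = a - \<sigma> * (q' * (q - 1))"
        by (simp add: algebra_simps)
      also have "\<dots> = a - \<sigma> * q" using q' by simp
      finally show "(dfct z powr a * (\<integral>w. K z w * G w \<partial>bmeas b)) powr q \<le>
          C1 powr (q - 1) * (dfct z powr (a - \<sigma> * q) * (\<integral>w. K z w * G w powr q \<partial>bmeas \<tau>))"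
        using I0 by (simp add: powr_mult powr_powr)
    qed
    let ?N = "bmeas \<nu> :: (complex ^ 'n) measure" and ?T = "bmeas \<tau> :: (complex ^ 'n) measure"
    interpret N: finite_measure ?N by (rule finite_measure_bmeas[OF \<nu>])
    interpret T: finite_measure ?T by (rule finite_measure_bmeas[OF \<tau>(1)])
    interpret TN: pair_sigma_finite ?T ?N ..
    have Kjm: "(\<lambda>x. K (snd x) (fst x)) \<in> borel_measurable (?T \<Otimes>\<^sub>M ?N)"
      using kernel_measurable[of "- (n + 1 + a + b)" \<tau> \<nu>] unfolding K_def n_def
      by (subst cmod_one_minus_hinner_commute) simp
    define F where "F = (\<lambda>(w, z). K z w * G w powr q)"
    have Fm: "F \<in> borel_measurable (?T \<Otimes>\<^sub>M ?N)"
      unfolding F_def case_prod_beta'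
      by (intro borel_measurable_times Kjm measurable_compose[OF measurable_fst]) measurable
    have KzI: "integrable ?N (\<lambda>z. K z w)" if "w \<in> unit_ball" for w
      using kernel_powr_integrable[OF \<nu> that] unfolding K_def by (subst cmod_one_minus_hinner_commute) simp
    have KzB: "(\<integral>z. K z w \<partial>?N) \<le> C2 * dfct w powr (- (\<tau> - \<beta>))" if "w \<in> unit_ball" for w
      using C2K[OF that] by (simp add: \<nu>_def \<tau>_def algebra_simps)
    have inner: "(\<integral>z. F (w, z) \<partial>?N) = (\<integral>z. K z w \<partial>?N) * G w powr q" for w
      by (simp add: F_def)
    have bd: "(\<integral>z. K z w \<partial>?N) * G w powr q \<le> C2 * (dfct w powr (\<beta> - \<tau>) *\<^sub>R G w powr q)" if "w \<in> unit_ball" for w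
      using mult_right_mono[OF KzB[OF that], of "G w powr q"] by simp
    have bi: "integrable ?T (\<lambda>w. C2 * (dfct w powr (\<beta> - \<tau>) *\<^sub>R G w powr q))"
      using Gq integrable_bmeas_shift[OF Gqm, of \<tau> "\<beta> - \<tau>"] by simp
    have innI: "integrable ?T (\<lambda>w. \<integral>z. F (w, z) \<partial>?N)"
    proof (rule Bochner_Integration.integrable_bound[OF bi])
      show "(\<lambda>w. \<integral>z. F (w, z) \<partial>?N) \<in> borel_measurable ?T"
        by (rule N.borel_measurable_lebesgue_integral) (use Fm in \<open>simp add: case_prod_beta'\<close>)
      show "AE w in ?T. norm (\<integral>z. F (w, z) \<partial>?N) \<le> norm (C2 * (dfct w powr (\<beta> - \<tau>) *\<^sub>R G w powr q))"
        unfolding inner using bd C2(1) by (intro AE_I2) (auto simp: abs_mult Bochner_Integration.integral_nonneg K0)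
    qed
    have Fi: "integrable (?T \<Otimes>\<^sub>M ?N) F"
    proof (rule TN.Fubini_integrable[OF Fm])
      have "norm (F x) = F x" for x by (auto simp: F_def K0 split: prod.split)
      then show "integrable ?T (\<lambda>w. \<integral>z. norm (F (w, z)) \<partial>?N)" using innI by simp
      show "AE w in ?T. integrable ?N (\<lambda>z. F (w, z))"
        using KzI by (intro AE_I2) (simp add: F_def)
    qed
    have swap: "(\<integral>z. \<integral>w. F (w, z) \<partial>?T \<partial>?N) = (\<integral>w. \<integral>z. F (w, z) \<partial>?N \<partial>?T)"
      using TN.Fubini_integral[of "\<lambda>w z. F (w, z)"] Fi by (simp add: F_def)
    have zI: "integrable ?N (\<lambda>z. \<integral>w. F (w, z) \<partial>?T)"
      using TN.integrable_snd[of "\<lambda>w z. F (w, z)"] Fi by (simp add: F_def)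
    have tot: "(\<integral>w. \<integral>z. F (w, z) \<partial>?N \<partial>?T) \<le> C2 * (\<integral>w. G w powr q \<partial>bmeas \<beta>)"
    proof -
      have "(\<integral>w. \<integral>z. F (w, z) \<partial>?N \<partial>?T) \<le> (\<integral>w. C2 * (dfct w powr (\<beta> - \<tau>) *\<^sub>R G w powr q) \<partial>?T)"
        by (rule integral_mono[OF innI bi]) (use bd in \<open>simp add: inner\<close>)
      also have "\<dots> = C2 * (\<integral>w. G w powr q \<partial>bmeas \<beta>)"
        using integral_bmeas_shift[OF Gqm, of \<tau> "\<beta> - \<tau>"] by simp
      finally show ?thesis .
    qed
    define Q where "Q z = (dfct z powr a * (\<integral>w. K z w * G w \<partial>bmeas b)) powr q" for z
    define R where "R z = C1 powr (q - 1) * (dfct z powr (a - \<sigma> * q) *\<^sub>R (\<integral>w. F (w, z) \<partial>?T))" for z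
    have zm: "(\<lambda>z. \<integral>w. F (w, z) \<partial>?T) \<in> borel_measurable (bmeas r)" for r
      using borel_measurable_integrable[OF zI] by (simp only: measurable_bmeas)
    have Ri: "integrable (bmeas \<beta>) R"
      unfolding R_def using zI integrable_bmeas_shift[OF zm, of \<beta> "a - \<sigma> * q", unfolded \<nu>'] by simp
    have QR: "Q z \<le> R z" if "z \<in> unit_ball" for z
      using step(2)[OF that] by (simp add: Q_def R_def F_def)
    have Qm: "Q \<in> borel_measurable (bmeas \<beta>)"
    proof -
      interpret B: finite_measure "bmeas b :: (complex ^ 'n) measure" by (rule finite_measure_bmeas[OF b1])
      have "(\<lambda>x. K (fst x) (snd x) * G (snd x)) \<in> borel_measurable (bmeas \<beta> \<Otimes>\<^sub>M bmeas b)"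
        unfolding K_def
        by (intro borel_measurable_times kernel_measurable measurable_compose[OF measurable_snd Gm])
      then have "(\<lambda>z. \<integral>w. K z w * G w \<partial>bmeas b) \<in> borel_measurable (bmeas \<beta>)"
        by (intro B.borel_measurable_lebesgue_integral) (simp add: case_prod_beta')
      then show ?thesis unfolding Q_def by measurable
    qed
    have Q0: "Q z \<ge> 0" for z by (simp add: Q_def)
    have Qi: "integrable (bmeas \<beta>) Q"
      by (rule Bochner_Integration.integrable_bound[OF Ri Qm])
        (use QR Q0 in \<open>auto intro!: AE_I2 order_trans[OF _ abs_ge_self]\<close>)
    have "(\<integral>z. Q z \<partial>bmeas \<beta>) \<le> (\<integral>z. R z \<partial>bmeas \<beta>)"
      by (rule integral_mono[OF Qi Ri]) (use QR in simp)
    also have "\<dots> = C1 powr (q - 1) * (\<integral>z. \<integral>w. F (w, z) \<partial>?T \<partial>?N)"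
      unfolding R_def using integral_bmeas_shift[OF zm, of \<beta> "a - \<sigma> * q", unfolded \<nu>'] by simp
    also have "\<dots> \<le> C1 powr (q - 1) * (C2 * (\<integral>w. G w powr q \<partial>bmeas \<beta>))"
      unfolding swap by (intro mult_left_mono tot) auto
    finally have "(\<integral>z. Q z \<partial>bmeas \<beta>) \<le> C1 powr (q - 1) * C2 * (\<integral>w. G w powr q \<partial>bmeas \<beta>)"
      by (simp add: mult.assoc)
    then show "(\<forall>z\<in>unit_ball. integrable (bmeas b) (\<lambda>w. K z w * G w)) \<and>
      integrable (bmeas \<beta>) (\<lambda>z. (dfct z powr a * (\<integral>w. K z w * G w \<partial>bmeas b)) powr q) \<and>
      (\<integral>z. (dfct z powr a * (\<integral>w. K z w * G w \<partial>bmeas b)) powr q \<partial>bmeas \<beta>) \<le> C1 powr (q - 1) * C2 * (\<integral>w. G w powr q \<partial>bmeas \<beta>)"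
      using Qi unfolding Q_def by (intro conjI ballI step(1))
  qed
qed

section \<open>The normalised measures, projections and Hankel operators\<close>

lemma bmass_eq:
  "bmass TYPE('n::finite) \<alpha> = (\<integral>w. dfct w powr \<alpha> \<partial>restrict_space lborel (unit_ball :: (complex ^ 'n) set))"
proof -
  have "bmass TYPE('n) \<alpha> = (\<integral>w. 1 \<partial>(bmeas \<alpha> :: (complex ^ 'n) measure))"
    by (simp add: bmass_def)
  also have "\<dots> = (\<integral>w. dfct w powr \<alpha> *\<^sub>R 1 \<partial>restrict_space lborel (unit_ball :: (complex ^ 'n) set))"
    unfolding bmeas_def by (rule integral_density) (auto intro!: measurable_restrict_space1)
  finally show ?thesis by simp
qed

text \<open>The volume of the ball enters both through \<open>ball_vol\<close> and through the
  integral defining the normalising constant, and cancels; one constant remains.\<close>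

lemma weighted_vol_eq:
  assumes "\<alpha> > -1"
  shows "weighted_vol \<alpha> = density (bmeas \<alpha>) (\<lambda>_ :: complex ^ 'n. ennreal (1 / bmass TYPE('n) \<alpha>))"
proof -
  let ?R = "restrict_space lborel (unit_ball :: (complex ^ 'n) set)"
  define V where "V = unit_ball_vol (real DIM(complex ^ 'n))"
  have V: "V > 0" unfolding V_def by (rule unit_ball_vol_pos) simp
  have eV: "emeasure ?R unit_ball = ennreal V"
    by (subst emeasure_restrict_space) (simp_all add: emeasure_ball V_def)
  have ind: "indicator unit_ball w / ennreal V = ennreal (1 / V)" if "w \<in> space ?R" for w
    using that V by (simp add: space_restrict_space divide_ennreal[of 1 V, simplified])
  have "ball_vol = density ?R (\<lambda>w. indicator unit_ball w / ennreal V)"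
    unfolding ball_vol_def uniform_measure_def eV ..
  also have "\<dots> = density ?R (\<lambda>_. ennreal (1 / V))"
  proof (rule density_cong)
    show "(\<lambda>w. indicator unit_ball w / ennreal V) \<in> borel_measurable ?R"
      by (subst measurable_cong[OF ind]) auto
  qed (simp, rule AE_I2, erule ind)
  finally have ball_vol: "ball_vol = density ?R (\<lambda>_. ennreal (1 / V))" .
  have m: "(\<lambda>w. dfct w powr \<alpha>) \<in> borel_measurable ?R"
    by (intro measurable_restrict_space1) measurable
  have I: "(\<integral>w. (1 - (norm w)\<^sup>2) powr \<alpha> \<partial>(ball_vol :: (complex ^ 'n) measure)) = bmass TYPE('n) \<alpha> / V"
  proof -
    have "(\<integral>w. dfct w powr \<alpha> \<partial>density ?R (\<lambda>_. ennreal (1 / V))) = (\<integral>w. (1 / V) *\<^sub>R dfct w powr \<alpha> \<partial>?R)"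
      using m V by (intro integral_density) auto
    also have "\<dots> = bmass TYPE('n) \<alpha> / V" by (simp add: bmass_eq)
    finally show ?thesis unfolding ball_vol dfct_def .
  qed
  have b: "bmass TYPE('n) \<alpha> > 0" by (rule bmass_pos[OF assms])
  have "weighted_vol \<alpha> = density ?R (\<lambda>w. ennreal (1 / V) * ennreal (dfct w powr \<alpha> / (bmass TYPE('n) \<alpha> / V)))"
    unfolding weighted_vol_def I unfolding ball_vol dfct_def[symmetric]
    using m by (intro density_density_eq) auto
  also have "(\<lambda>w :: complex ^ 'n. ennreal (1 / V) * ennreal (dfct w powr \<alpha> / (bmass TYPE('n) \<alpha> / V)))
    = (\<lambda>w. ennreal (dfct w powr \<alpha>) * ennreal (1 / bmass TYPE('n) \<alpha>))"
  proof (rule ext)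
    fix w :: "complex ^ 'n"
    have "ennreal (1 / V) * ennreal (dfct w powr \<alpha> / (bmass TYPE('n) \<alpha> / V))
      = ennreal (1 / V * (dfct w powr \<alpha> / (bmass TYPE('n) \<alpha> / V)))"
      by (rule ennreal_mult[symmetric]) (use V b in auto)
    also have "1 / V * (dfct w powr \<alpha> / (bmass TYPE('n) \<alpha> / V)) = dfct w powr \<alpha> * (1 / bmass TYPE('n) \<alpha>)"
      using V b by (simp add: field_simps)
    also have "ennreal \<dots> = ennreal (dfct w powr \<alpha>) * ennreal (1 / bmass TYPE('n) \<alpha>)"
      by (rule ennreal_mult) (use b in auto)
    finally show "ennreal (1 / V) * ennreal (dfct w powr \<alpha> / (bmass TYPE('n) \<alpha> / V))
      = ennreal (dfct w powr \<alpha>) * ennreal (1 / bmass TYPE('n) \<alpha>)" .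
  qed
  also have "density ?R \<dots> = density (bmeas \<alpha>) (\<lambda>_. ennreal (1 / bmass TYPE('n) \<alpha>))"
    unfolding bmeas_def using m by (intro density_density_eq[symmetric]) auto
  finally show ?thesis .
qed

lemma measurable_weighted_vol:
  "\<alpha> > -1 \<Longrightarrow> borel_measurable (weighted_vol \<alpha> :: (complex ^ 'n) measure) = borel_measurable (bmeas \<alpha>)"
  by (intro measurable_cong_sets) (simp_all add: weighted_vol_eq)

lemma integral_weighted_vol:
  fixes F :: "complex ^ 'n \<Rightarrow> 'b::{banach, second_countable_topology}"
  assumes \<alpha>: "\<alpha> > -1" and F: "F \<in> borel_measurable (bmeas \<alpha>)"
  shows "(\<integral>w. F w \<partial>weighted_vol \<alpha>) = (1 / bmass TYPE('n) \<alpha>) *\<^sub>R (\<integral>w. F w \<partial>bmeas \<alpha>)"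
    and "integrable (weighted_vol \<alpha>) F \<longleftrightarrow> integrable (bmeas \<alpha>) F"
proof -
  have b: "bmass TYPE('n) \<alpha> > 0" by (rule bmass_pos[OF \<alpha>])
  show "(\<integral>w. F w \<partial>weighted_vol \<alpha>) = (1 / bmass TYPE('n) \<alpha>) *\<^sub>R (\<integral>w. F w \<partial>bmeas \<alpha>)"
    unfolding weighted_vol_eq[OF \<alpha>] using F b by (subst integral_density) auto
  show "integrable (weighted_vol \<alpha>) F \<longleftrightarrow> integrable (bmeas \<alpha>) F"
  proof -
    let ?m = "bmass TYPE('n) \<alpha>"
    have "integrable (bmeas \<alpha>) F" if "integrable (bmeas \<alpha>) (\<lambda>w. (1 / ?m) *\<^sub>R F w)"
      using integrable_scaleR_right[of ?m, OF that] b by simp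
    then show ?thesis
      unfolding weighted_vol_eq[OF \<alpha>] using F b by (subst integrable_density) auto
  qed
qed

lemma powr_norm_measurable:
  "h \<in> borel_measurable M \<Longrightarrow> (\<lambda>w. cmod (h w) powr r) \<in> borel_measurable M"
  by measurable

lemma Lp_space_iff:
  assumes "\<alpha> > -1"
  shows "h \<in> Lp_space p \<alpha> \<longleftrightarrow> h \<in> borel_measurable (bmeas \<alpha>) \<and> integrable (bmeas \<alpha>) (\<lambda>w. cmod (h w) powr p)"
  unfolding Lp_space_def mem_Collect_eq measurable_weighted_vol[OF assms]
  using integral_weighted_vol(2)[OF assms powr_norm_measurable] by blast

lemma Lp_norm_eq:
  fixes h :: "complex ^ 'n \<Rightarrow> complex"
  assumes "\<alpha> > -1" "h \<in> borel_measurable (bmeas \<alpha>)"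
  shows "Lp_norm p \<alpha> h = (1 / bmass TYPE('n) \<alpha>) powr (1 / p) * (\<integral>w. cmod (h w) powr p \<partial>bmeas \<alpha>) powr (1 / p)"
  unfolding Lp_norm_def using integral_weighted_vol(1)[OF assms(1) powr_norm_measurable[OF assms(2)]]
  by (simp add: powr_mult powr_divide)

lemma bergman_proj_eq:
  fixes \<psi> :: "complex ^ 'n \<Rightarrow> complex"
  assumes b: "b > -1" and \<psi>: "\<psi> \<in> borel_measurable (bmeas b)" and z: "z \<in> unit_ball"
  shows "bergman_proj b \<psi> z =
    (\<integral>w. \<psi> w * kpow (real CARD('n) + 1 + b) (hinner z w) \<partial>bmeas b) / of_real (bmass TYPE('n) b)"
proof -
  let ?l = "real CARD('n) + 1 + b"
  have eq: "\<psi> w / (1 - hinner z w) powr of_real ?l = \<psi> w * kpow ?l (hinner z w)" for w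
    unfolding kpow_def powr_minus by (simp only: divide_inverse)
  have "(\<lambda>w. kpow ?l (hinner z w)) \<in> borel_measurable (bmeas b)"
    by (intro measurable_bmeas_continuous continuous_on_subset[OF kpow_hinner_right_continuous[OF z]]) auto
  then have "(\<lambda>w. \<psi> w * kpow ?l (hinner z w)) \<in> borel_measurable (bmeas b)"
    using \<psi> by (intro borel_measurable_times)
  from integral_weighted_vol(1)[OF b this] show ?thesis
    unfolding bergman_proj_def eq by (simp add: scaleR_conv_of_real)
qed

section \<open>Bergman projections and Hankel operators on bounded holomorphic functions\<close>

lemma integrable_mult_kpow:
  assumes "integrable (bmeas b) \<psi>" "z \<in> unit_ball"
  shows "integrable (bmeas b) (\<lambda>w. \<psi> w * kpow \<mu> (hinner z w))"
proof -
  have "bounded ((\<lambda>w. kpow \<mu> (hinner z w)) ` cball 0 1)"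
    by (intro compact_imp_bounded compact_continuous_image kpow_hinner_right_continuous assms) auto
  then obtain B where B: "\<forall>y\<in>(\<lambda>w. kpow \<mu> (hinner z w)) ` cball 0 1. cmod y \<le> B"
    unfolding bounded_iff by blast
  show ?thesis
  proof (rule integrable_mult_bounded[OF assms(1)])
    show "(\<lambda>w. kpow \<mu> (hinner z w)) \<in> borel_measurable (bmeas b)"
      by (intro measurable_bmeas_continuous continuous_on_subset[OF kpow_hinner_right_continuous[OF assms(2)]]) auto
    show "cmod (kpow \<mu> (hinner z w)) \<le> B" if "w \<in> space (bmeas b)" for w
      using B that by auto
  qed
qed

lemma bergman_proj_holomorphic:
  fixes \<psi> :: "complex ^ 'n \<Rightarrow> complex"
  assumes b: "b > -1" and \<psi>: "integrable (bmeas b) \<psi>"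
  shows "ball_holomorphic (bergman_proj b \<psi>)"
proof -
  let ?l = "real CARD('n) + 1 + b" and ?m = "of_real (bmass TYPE('n) b) :: complex"
  define \<psi>' where "\<psi>' w = \<psi> w / ?m" for w
  have "integrable (bmeas b) \<psi>'" unfolding \<psi>'_def using \<psi> by simp
  from kernel_integral_holomorphic(1)[OF this kpow_holomorphic[of ?l]]
  have hol: "ball_holomorphic (\<lambda>z. \<integral>w. \<psi>' w * kpow ?l (hinner z w) \<partial>bmeas b)" .
  have eq: "bergman_proj b \<psi> z = (\<integral>w. \<psi>' w * kpow ?l (hinner z w) \<partial>bmeas b)" if "z \<in> unit_ball" for z
    using bergman_proj_eq[OF b _ that, of \<psi>] \<psi> by (simp add: \<psi>'_def borel_measurable_integrable)
  show ?thesis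
    unfolding ball_holomorphic_def
  proof
    fix z :: "complex ^ 'n" assume z: "z \<in> unit_ball"
    with hol obtain D where D: "((\<lambda>z. \<integral>w. \<psi>' w * kpow ?l (hinner z w) \<partial>bmeas b) has_derivative D) (at z)"
      "\<forall>c v. D (c *s v) = c * D v" unfolding ball_holomorphic_def by blast
    have "(bergman_proj b \<psi> has_derivative D) (at z)"
      by (rule has_derivative_transform_within_open[OF D(1) open_ball z]) (use eq in auto)
    with D show "\<exists>D. (bergman_proj b \<psi> has_derivative D) (at z) \<and> (\<forall>c v. D (c *s v) = c * D v)" by blast
  qed
qed

lemma bergman_proj_reproduces:
  fixes h :: "complex ^ 'n \<Rightarrow> complex"
  assumes "ball_holomorphic h" "integrable (bmeas b) h" "b > -1" "z \<in> unit_ball"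
  shows "bergman_proj b h z = h z"
  using reproducing_formula[OF ball_holomorphic_imp_slice_hol[OF assms(1)] assms(2-4)] bmass_pos[OF assms(3), where 'n = 'n]
    bergman_proj_eq[OF assms(3) _ assms(4), of h] assms(2) by (simp add: borel_measurable_integrable)

lemma ball_holomorphic_measurable: "ball_holomorphic h \<Longrightarrow> h \<in> borel_measurable (bmeas b)"
  by (intro measurable_bmeas_continuous slice_hol_continuous ball_holomorphic_imp_slice_hol)

lemma H_infinity_bounded:
  assumes "g \<in> H_infinity"
  obtains B where "B > 0" "\<And>w. w \<in> unit_ball \<Longrightarrow> cmod (g w) \<le> B"
  using assms unfolding H_infinity_def bounded_pos by auto

lemma H_infinity_holomorphic: "g \<in> H_infinity \<Longrightarrow> ball_holomorphic g"
  by (simp add: H_infinity_def)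

lemma H_infinity_integrable:
  assumes g: "g \<in> H_infinity" and b: "b > -1"
  shows "integrable (bmeas b) g" and "p \<ge> 0 \<Longrightarrow> integrable (bmeas b) (\<lambda>w. cmod (g w) powr p)"
proof -
  obtain B where B: "B > 0" "\<And>w. w \<in> unit_ball \<Longrightarrow> cmod (g w) \<le> B" by (rule H_infinity_bounded[OF g]) blast
  note m = ball_holomorphic_measurable[OF H_infinity_holomorphic[OF g]]
  show "integrable (bmeas b) g" by (rule integrable_bmeas_bounded[OF b m B(2)])
  show "integrable (bmeas b) (\<lambda>w. cmod (g w) powr p)" if "p \<ge> 0"
    by (rule integrable_bmeas_bounded[OF b powr_norm_measurable[OF m], of _ "B powr p"])
      (use B that in \<open>auto intro!: powr_mono2\<close>)
qed

lemma symbol_times_H_infinity_integrable: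
  assumes f: "integrable (bmeas b) f" and g: "g \<in> H_infinity"
  shows "integrable (bmeas b) (\<lambda>w. cnj (f w) * g w)"
proof -
  obtain B where B: "B > 0" "\<And>w. w \<in> unit_ball \<Longrightarrow> cmod (g w) \<le> B" by (rule H_infinity_bounded[OF g]) blast
  show ?thesis
    by (rule integrable_mult_bounded[of _ _ _ B])
      (use f B ball_holomorphic_measurable[OF H_infinity_holomorphic[OF g]] in \<open>auto simp: integrable_cnj\<close>)
qed

lemma integrable_bmeas_mono:
  fixes F :: "complex ^ 'n \<Rightarrow> complex"
  assumes F: "integrable (bmeas a) F" and ab: "a \<le> b"
  shows "integrable (bmeas b) F"
proof -
  have m: "F \<in> borel_measurable (bmeas a)" using F by (rule borel_measurable_integrable)
  have "integrable (bmeas a) (\<lambda>w. F w * of_real (dfct w powr (b - a)))"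
  proof (rule integrable_mult_bounded[OF F, of _ 1])
    show "(\<lambda>w. complex_of_real (dfct w powr (b - a))) \<in> borel_measurable (bmeas a)" by measurable
    show "cmod (of_real (dfct w powr (b - a))) \<le> 1" if "w \<in> space (bmeas a)" for w :: "complex ^ 'n"
      using dfct_pos[of w] dfct_le_1[of w] that ab by (simp add: powr_le1)
  qed
  then show ?thesis
    using integrable_bmeas_shift[OF m, of "b - a"] by (simp add: scaleR_conv_of_real mult.commute)
qed

text \<open>The bounded function \<open>g\<close> is reproduced by the kernel, so
  \<open>cnj (f z) * g z\<close> can be written under the same integral as the projection.\<close>

lemma hankel_eq:
  fixes f g :: "complex ^ 'n \<Rightarrow> complex"
  assumes f: "integrable (bmeas b) f" and g: "g \<in> H_infinity" and b: "b > -1" and z: "z \<in> unit_ball"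
  shows "hankel b f g z =
    (\<integral>w. (cnj (f z) - cnj (f w)) * g w * kpow (real CARD('n) + 1 + b) (hinner z w) \<partial>bmeas b) / of_real (bmass TYPE('n) b)"
proof -
  let ?k = "\<lambda>w. kpow (real CARD('n) + 1 + b) (hinner z w)" and ?m = "of_real (bmass TYPE('n) b) :: complex"
  have m: "?m \<noteq> 0" using bmass_pos[OF b, where 'n = 'n] by simp
  have fg: "integrable (bmeas b) (\<lambda>w. cnj (f w) * g w)" by (rule symbol_times_H_infinity_integrable[OF f g])
  have 1: "g z = (\<integral>w. g w * ?k w \<partial>bmeas b) / ?m"
    using bergman_proj_reproduces[OF H_infinity_holomorphic[OF g] H_infinity_integrable(1)[OF g b] b z]
      bergman_proj_eq[OF b _ z, of g] ball_holomorphic_measurable[OF H_infinity_holomorphic[OF g]] by simp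
  have 2: "bergman_proj b (\<lambda>w. cnj (f w) * g w) z = (\<integral>w. cnj (f w) * g w * ?k w \<partial>bmeas b) / ?m"
    by (rule bergman_proj_eq[OF b borel_measurable_integrable[OF fg] z])
  have i1: "integrable (bmeas b) (\<lambda>w. cnj (f z) * (g w * ?k w))"
    by (intro integrable_mult_right integrable_mult_kpow H_infinity_integrable(1) g b z)
  have i2: "integrable (bmeas b) (\<lambda>w. cnj (f w) * g w * ?k w)"
    by (intro integrable_mult_kpow fg z)
  have "hankel b f g z = cnj (f z) * ((\<integral>w. g w * ?k w \<partial>bmeas b) / ?m) - (\<integral>w. cnj (f w) * g w * ?k w \<partial>bmeas b) / ?m"
    unfolding hankel_def 2 using 1 by simp
  also have "\<dots> = ((\<integral>w. cnj (f z) * (g w * ?k w) \<partial>bmeas b) - (\<integral>w. cnj (f w) * g w * ?k w \<partial>bmeas b)) / ?m"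
    by (simp add: diff_divide_distrib)
  also have "\<dots> = (\<integral>w. cnj (f z) * (g w * ?k w) - cnj (f w) * g w * ?k w \<partial>bmeas b) / ?m"
    using i1 i2 by simp
  also have "(\<lambda>w. cnj (f z) * (g w * ?k w) - cnj (f w) * g w * ?k w) = (\<lambda>w. (cnj (f z) - cnj (f w)) * g w * ?k w)"
    by (simp add: algebra_simps)
  finally show ?thesis .
qed

text \<open>The two normalising constants are absorbed into the operator bound, so that all further
  estimates take place on \<open>bmeas\<close>.\<close>

lemma hankel_bounded_iff:
  fixes f :: "complex ^ 'n \<Rightarrow> complex"
  assumes \<alpha>: "\<alpha> > -1" and \<beta>: "\<beta> > -1"
  shows "hankel_bounded p \<alpha> q \<beta> f \<longleftrightarrow> (\<exists>C>0. \<forall>g\<in>H_infinity.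
    hankel \<beta> f g \<in> borel_measurable (bmeas \<beta>) \<and> integrable (bmeas \<beta>) (\<lambda>w. cmod (hankel \<beta> f g w) powr q) \<and>
    (\<integral>w. cmod (hankel \<beta> f g w) powr q \<partial>bmeas \<beta>) powr (1 / q) \<le> C * (\<integral>w. cmod (g w) powr p \<partial>bmeas \<alpha>) powr (1 / p))"
    (is "_ \<longleftrightarrow> (\<exists>C>0. \<forall>g\<in>H_infinity. ?P g \<and> ?I g \<and> ?A g \<le> C * ?B g)")
proof -
  define a where "a = (1 / bmass TYPE('n) \<alpha>) powr (1 / p)"
  define b where "b = (1 / bmass TYPE('n) \<beta>) powr (1 / q)"
  have ab: "a > 0" "b > 0" using bmass_pos[OF \<alpha>, where 'n = 'n] bmass_pos[OF \<beta>, where 'n = 'n] by (auto simp: a_def b_def)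
  have 1: "hankel_bounded p \<alpha> q \<beta> f \<longleftrightarrow> (\<exists>C>0. \<forall>g\<in>H_infinity. ?P g \<and> ?I g \<and> b * ?A g \<le> C * (a * ?B g))"
  proof -
    have "(hankel \<beta> f g \<in> Lp_space q \<beta> \<and> Lp_norm q \<beta> (hankel \<beta> f g) \<le> C * Lp_norm p \<alpha> g) \<longleftrightarrow>
      (?P g \<and> ?I g \<and> b * ?A g \<le> C * (a * ?B g))" if g: "g \<in> H_infinity" for g C
    proof (cases "?P g")
      case True
      show ?thesis
        unfolding Lp_space_iff[OF \<beta>] Lp_norm_eq[OF \<beta> True]
          Lp_norm_eq[OF \<alpha> ball_holomorphic_measurable[OF H_infinity_holomorphic[OF g]]] a_def b_def by simp
    next
      case False
      then show ?thesis unfolding Lp_space_iff[OF \<beta>] by simp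
    qed
    then show ?thesis unfolding hankel_bounded_def by (simp cong: conj_cong)
  qed
  show ?thesis
    unfolding 1
  proof
    assume "\<exists>C>0. \<forall>g\<in>H_infinity. ?P g \<and> ?I g \<and> b * ?A g \<le> C * (a * ?B g)"
    then obtain C where C: "C > 0" "\<And>g. g \<in> H_infinity \<Longrightarrow> ?P g \<and> ?I g \<and> b * ?A g \<le> C * (a * ?B g)" by blast
    show "\<exists>C>0. \<forall>g\<in>H_infinity. ?P g \<and> ?I g \<and> ?A g \<le> C * ?B g"
    proof (intro exI[of _ "C * a / b"] conjI ballI)
      fix g :: "complex ^ 'n \<Rightarrow> complex" assume "g \<in> H_infinity"
      from C(2)[OF this] show "?P g" "?I g" "?A g \<le> C * a / b * ?B g" using ab by (auto simp: field_simps)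
    qed (use C ab in auto)
  next
    assume "\<exists>C>0. \<forall>g\<in>H_infinity. ?P g \<and> ?I g \<and> ?A g \<le> C * ?B g"
    then obtain C where C: "C > 0" "\<And>g. g \<in> H_infinity \<Longrightarrow> ?P g \<and> ?I g \<and> ?A g \<le> C * ?B g" by blast
    show "\<exists>C>0. \<forall>g\<in>H_infinity. ?P g \<and> ?I g \<and> b * ?A g \<le> C * (a * ?B g)"
    proof (intro exI[of _ "C * b / a"] conjI ballI)
      fix g :: "complex ^ 'n \<Rightarrow> complex" assume "g \<in> H_infinity"
      from C(2)[OF this] show "?P g" "?I g" "b * ?A g \<le> C * b / a * (a * ?B g)" using ab by (auto simp: field_simps)
    qed (use C ab in auto)
  qed
qed

section \<open>Pointwise estimates for bounded holomorphic functions\<close>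

text \<open>Hoelder in the reproducing formula; the dual norm of the kernel is measured by
  Forelli--Rudin at the positive exponent \<open>l * (p' - 1)\<close>, whose root of order
  \<open>p'\<close> is \<open>l / p\<close>.\<close>

lemma pointwise_estimate:
  assumes \<alpha>: "\<alpha> > -1" and p: "p > 1"
  obtains C where "C > 0" "\<And>(g :: complex ^ 'n \<Rightarrow> complex) z. g \<in> H_infinity \<Longrightarrow> z \<in> unit_ball \<Longrightarrow>
    cmod (g z) \<le> C * (\<integral>w. cmod (g w) powr p \<partial>bmeas \<alpha>) powr (1 / p) * dfct z powr (- ((real CARD('n) + 1 + \<alpha>) / p))"
proof -
  define l where "l = real CARD('n) + 1 + \<alpha>"
  define p' where "p' = p / (p - 1)"
  define m where "m = bmass TYPE('n) \<alpha>"
  have l: "l > 0" using \<alpha> by (simp add: l_def)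
  have m: "m > 0" unfolding m_def by (rule bmass_pos[OF \<alpha>])
  have p': "p' > 1" "1 / p + 1 / p' = 1" "(p' - 1) / p' = 1 / p" using p by (auto simp: p'_def field_simps)
  obtain C where C: "C > 0" "\<And>z :: complex ^ 'n. z \<in> unit_ball \<Longrightarrow>
    (\<integral>w. cmod (1 - hinner z w) powr (- (real CARD('n) + 1 + \<alpha> + l * (p' - 1))) \<partial>bmeas \<alpha>) \<le> C * dfct z powr (- (l * (p' - 1)))"
    using forelli_rudin[OF \<alpha>, of "l * (p' - 1)", where 'n = 'n] l p' by auto
  show thesis
  proof (rule that[of "C powr (1 / p') / m"])
    show "C powr (1 / p') / m > 0" using C m by simp
    fix g :: "complex ^ 'n \<Rightarrow> complex" and z :: "complex ^ 'n"
    assume g: "g \<in> H_infinity" and z: "z \<in> unit_ball"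
    let ?k = "\<lambda>w. kpow l (hinner z w)"
    define X where "X = (\<integral>w. cmod (g w) powr p \<partial>bmeas \<alpha>)"
    note gm = ball_holomorphic_measurable[OF H_infinity_holomorphic[OF g], of \<alpha>]
    have km: "?k \<in> borel_measurable (bmeas \<alpha>)"
      by (intro measurable_bmeas_continuous continuous_on_subset[OF kpow_hinner_right_continuous[OF z]]) auto
    have kp: "cmod (?k w) powr p' = cmod (1 - hinner z w) powr (- (real CARD('n) + 1 + \<alpha> + l * (p' - 1)))" for w
      by (simp add: norm_kpow powr_powr l_def algebra_simps)
    have ki: "integrable (bmeas \<alpha>) (\<lambda>w. cmod (?k w) powr p')"
      unfolding kp by (rule kernel_powr_integrable[OF \<alpha> z])
    have gk: "integrable (bmeas \<alpha>) (\<lambda>w. g w * ?k w)"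
      by (rule integrable_mult_kpow[OF H_infinity_integrable(1)[OF g \<alpha>] z])
    have "of_real m * g z = (\<integral>w. g w * ?k w \<partial>bmeas \<alpha>)"
      unfolding m_def l_def
      by (rule reproducing_formula[OF ball_holomorphic_imp_slice_hol[OF H_infinity_holomorphic[OF g]]
            H_infinity_integrable(1)[OF g \<alpha>] \<alpha> z, symmetric])
    then have "m * cmod (g z) = cmod (\<integral>w. g w * ?k w \<partial>bmeas \<alpha>)"
      using m by (metis norm_mult norm_of_real abs_of_pos)
    also have "\<dots> \<le> (\<integral>w. cmod (g w) * cmod (?k w) \<partial>bmeas \<alpha>)"
      using integral_norm_bound[of "bmeas \<alpha>" "\<lambda>w. g w * ?k w"] by (simp add: norm_mult)
    also have "\<dots> \<le> X powr (1 / p) * (\<integral>w. cmod (?k w) powr p' \<partial>bmeas \<alpha>) powr (1 / p')"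
      unfolding X_def
      by (rule hoelder_integral(2)[OF p p'(2)])
        (use gm km ki p H_infinity_integrable(2)[OF g \<alpha>, of p] in auto)
    also have "\<dots> \<le> X powr (1 / p) * (C * dfct z powr (- (l * (p' - 1)))) powr (1 / p')"
      using C(2)[OF z] p' unfolding kp
      by (intro mult_left_mono powr_mono2) (auto intro!: Bochner_Integration.integral_nonneg)
    also have "\<dots> = C powr (1 / p') * X powr (1 / p) * dfct z powr (- (l / p))"
    proof -
      have "- (l * (p' - 1)) * (1 / p') = - (l * ((p' - 1) / p'))" by simp
      also have "\<dots> = - (l / p)" unfolding p'(3) by simp
      finally show ?thesis unfolding powr_mult powr_powr by (simp only: mult_ac)
    qed
    finally show "cmod (g z) \<le> C powr (1 / p') / m * (\<integral>w. cmod (g w) powr p \<partial>bmeas \<alpha>) powr (1 / p)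
      * dfct z powr (- ((real CARD('n) + 1 + \<alpha>) / p))"
      using m by (simp add: X_def l_def field_simps)
  qed
qed

text \<open>Here \<open>p \<le> q\<close> is used: in \<open>cmod (g w) powr q\<close> the factor
  \<open>cmod (g w) powr (q - p)\<close> is estimated pointwise. The exponent
  \<open>\<gamma>\<close> is the one for which the leftover weight is exactly
  \<open>dfct w powr (\<alpha> - \<beta>)\<close>, turning \<open>bmeas \<beta>\<close> into
  \<open>bmeas \<alpha>\<close>.\<close>

lemma weighted_embedding:
  fixes p q \<alpha> \<beta> :: real
  assumes \<alpha>: "\<alpha> > -1" and \<beta>: "\<beta> > -1" and p: "p > 1" and q: "p \<le> q"
  defines "\<gamma> \<equiv> (real CARD('n) + 1 + \<beta>) / q - (real CARD('n) + 1 + \<alpha>) / p"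
  obtains C where "C > 0" "\<And>g :: complex ^ 'n \<Rightarrow> complex. g \<in> H_infinity \<Longrightarrow>
    integrable (bmeas \<beta>) (\<lambda>w. (cmod (g w) * dfct w powr (- \<gamma>)) powr q) \<and>
    (\<integral>w. (cmod (g w) * dfct w powr (- \<gamma>)) powr q \<partial>bmeas \<beta>) \<le> C * (\<integral>w. cmod (g w) powr p \<partial>bmeas \<alpha>) powr (q / p)"
proof -
  define l where "l = real CARD('n) + 1 + \<alpha>"
  obtain C where C: "C > 0" "\<And>(g :: complex ^ 'n \<Rightarrow> complex) z. g \<in> H_infinity \<Longrightarrow> z \<in> unit_ball \<Longrightarrow>
    cmod (g z) \<le> C * (\<integral>w. cmod (g w) powr p \<partial>bmeas \<alpha>) powr (1 / p) * dfct z powr (- (l / p))"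
    using pointwise_estimate[OF \<alpha> p, where 'n = 'n] unfolding l_def by blast
  show thesis
  proof (rule that[of "C powr (q - p)"])
    show "C powr (q - p) > 0" using C by simp
    fix g :: "complex ^ 'n \<Rightarrow> complex" assume g: "g \<in> H_infinity"
    define X where "X = (\<integral>w. cmod (g w) powr p \<partial>bmeas \<alpha>)"
    have X: "X \<ge> 0" unfolding X_def by (intro Bochner_Integration.integral_nonneg) simp
    note gm [measurable] = ball_holomorphic_measurable[OF H_infinity_holomorphic[OF g]]
    define A where "A = C powr (q - p) * X powr ((q - p) / p)"
    have bound: "(cmod (g w) * dfct w powr (- \<gamma>)) powr q \<le> A * (dfct w powr (\<alpha> - \<beta>) *\<^sub>R cmod (g w) powr p)"
      if w: "w \<in> unit_ball" for w
    proof (cases "g w = 0")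
      case True
      then show ?thesis using p q by simp
    next
      case False
      have "cmod (g w) powr q = cmod (g w) powr p * cmod (g w) powr (q - p)"
        by (simp add: powr_add[symmetric])
      also have "\<dots> \<le> cmod (g w) powr p * (C * X powr (1 / p) * dfct w powr (- (l / p))) powr (q - p)"
        using C(2)[OF g w] q unfolding X_def by (intro mult_left_mono powr_mono2) auto
      also have "\<dots> = cmod (g w) powr p * (A * dfct w powr (- (l / p) * (q - p)))"
        by (simp add: A_def powr_mult powr_powr)
      finally have "dfct w powr (- \<gamma> * q) * cmod (g w) powr q
          \<le> dfct w powr (- \<gamma> * q) * (cmod (g w) powr p * (A * dfct w powr (- (l / p) * (q - p))))"
        by (intro mult_left_mono) auto
      also have "\<dots> = A * (dfct w powr (- \<gamma> * q + - (l / p) * (q - p)) * cmod (g w) powr p)"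
        by (simp only: powr_add mult_ac)
      also have "- \<gamma> * q + - (l / p) * (q - p) = \<alpha> - \<beta>"
        using p q by (simp add: \<gamma>_def l_def field_simps)
      finally show ?thesis by (simp add: powr_mult powr_powr mult.commute)
    qed
    have Ai: "integrable (bmeas \<beta>) (\<lambda>w. A * (dfct w powr (\<alpha> - \<beta>) *\<^sub>R cmod (g w) powr p))"
      using H_infinity_integrable(2)[OF g \<alpha>, of p] p
        integrable_bmeas_shift[OF powr_norm_measurable[OF gm], of \<beta> "\<alpha> - \<beta>"] by simp
    have int: "integrable (bmeas \<beta>) (\<lambda>w. (cmod (g w) * dfct w powr (- \<gamma>)) powr q)"
    proof (rule Bochner_Integration.integrable_bound[OF Ai])
      show "AE w in bmeas \<beta>. norm ((cmod (g w) * dfct w powr (- \<gamma>)) powr q) \<le> norm (A * (dfct w powr (\<alpha> - \<beta>) *\<^sub>R cmod (g w) powr p))"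
        using bound by (intro AE_I2) (simp add: order_trans[OF _ abs_ge_self])
    qed measurable
    have "(\<integral>w. (cmod (g w) * dfct w powr (- \<gamma>)) powr q \<partial>bmeas \<beta>) \<le> (\<integral>w. A * (dfct w powr (\<alpha> - \<beta>) *\<^sub>R cmod (g w) powr p) \<partial>bmeas \<beta>)"
      by (rule integral_mono[OF int Ai]) (use bound in simp)
    also have "\<dots> = A * X"
      using integral_bmeas_shift[OF powr_norm_measurable[OF gm], of \<beta> "\<alpha> - \<beta>"] by (simp add: X_def)
    also have "\<dots> = C powr (q - p) * X powr (q / p)"
    proof (cases "X = 0")
      case False
      have "X powr ((q - p) / p) * X powr 1 = X powr (q / p)"
        unfolding powr_add[symmetric] using p by (simp add: field_simps)
      then show ?thesis using X False by (simp add: A_def)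
    qed simp
    finally show "integrable (bmeas \<beta>) (\<lambda>w. (cmod (g w) * dfct w powr (- \<gamma>)) powr q) \<and>
      (\<integral>w. (cmod (g w) * dfct w powr (- \<gamma>)) powr q \<partial>bmeas \<beta>)
        \<le> C powr (q - p) * (\<integral>w. cmod (g w) powr p \<partial>bmeas \<alpha>) powr (q / p)"
      using int by (simp add: X_def)
  qed
qed

section \<open>Oscillation of holomorphic functions\<close>

lemma line_has_vector_derivative:
  fixes f :: "complex ^ 'n \<Rightarrow> complex"
  assumes f: "ball_holomorphic f" and x: "x + t *\<^sub>R v \<in> unit_ball"
  shows "((\<lambda>t. f (x + t *\<^sub>R v)) has_vector_derivative sderiv v f (x + t *\<^sub>R v)) (at t)"
proof -
  have "((\<lambda>t. f (x + t *s v)) has_field_derivative sderiv v f (x + of_real t *s v)) (at (of_real t))"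
    by (rule slice_hol_has_field_derivative[OF ball_holomorphic_imp_slice_hol[OF f]])
      (use x in \<open>simp add: of_real_vec_smult\<close>)
  from has_vector_derivative_real_field[OF this] show ?thesis
    by (simp add: of_real_vec_smult)
qed

lemma sderiv_scaleR:
  assumes "ball_holomorphic f" "z \<in> unit_ball"
  shows "sderiv (r *\<^sub>R v) f z = of_real r * sderiv v f z"
  using sderiv_smult[OF assms, of "of_real r" v] by (simp add: of_real_vec_smult)

lemma sderiv_zero: "sderiv 0 f z = 0"
  by (simp add: sderiv_def)

lemma segment_in_ball:
  fixes x y :: "complex ^ 'n"
  assumes "x \<in> unit_ball" "y \<in> unit_ball" "0 \<le> t" "t \<le> 1"
  shows "x + t *\<^sub>R (y - x) \<in> unit_ball"
proof -
  have "(1 - t) *\<^sub>R x + t *\<^sub>R y \<in> unit_ball"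
    by (rule convexD[OF convex_ball assms(1,2)]) (use assms in auto)
  then show ?thesis by (simp add: algebra_simps)
qed

text \<open>The majorant \<open>\<phi>\<close> needs a derivative only inside the interval, which
  admits derivative bounds that are singular but integrable at an endpoint.\<close>

lemma segment_bound_general:
  fixes f :: "complex ^ 'n \<Rightarrow> complex"
  assumes f: "ball_holomorphic f" and ab: "a < b"
    and sub: "\<And>t. a \<le> t \<Longrightarrow> t \<le> b \<Longrightarrow> x + t *\<^sub>R v \<in> unit_ball"
    and \<phi>: "continuous_on {a..b} \<phi>" "\<And>t. a < t \<Longrightarrow> t < b \<Longrightarrow> (\<phi> has_real_derivative \<phi>' t) (at t)"
    and bnd: "\<And>t. a < t \<Longrightarrow> t < b \<Longrightarrow> cmod (sderiv v f (x + t *\<^sub>R v)) \<le> \<phi>' t"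
  shows "cmod (f (x + b *\<^sub>R v) - f (x + a *\<^sub>R v)) \<le> \<phi> b - \<phi> a"
proof (rule differentiable_bound_general[OF ab _ \<phi>(1)])
  show "continuous_on {a..b} (\<lambda>t. f (x + t *\<^sub>R v))"
    by (rule continuous_on_compose2[OF slice_hol_continuous[OF ball_holomorphic_imp_slice_hol[OF f]]])
      (use sub in \<open>auto intro!: continuous_intros\<close>)
  show "((\<lambda>t. f (x + t *\<^sub>R v)) has_vector_derivative sderiv v f (x + t *\<^sub>R v)) (at t)" if "a < t" "t < b" for t
    by (rule line_has_vector_derivative[OF f sub]) (use that in auto)
  show "(\<phi> has_vector_derivative \<phi>' t) (at t)" if "a < t" "t < b" for t
    using \<phi>(2)[OF that] by (simp add: has_real_derivative_iff_has_vector_derivative)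
qed (use bnd in auto)

lemma segment_bound:
  fixes f :: "complex ^ 'n \<Rightarrow> complex"
  assumes f: "ball_holomorphic f" and x: "x \<in> unit_ball" and y: "y \<in> unit_ball"
    and bnd: "\<And>t. 0 < t \<Longrightarrow> t < 1 \<Longrightarrow> cmod (sderiv (y - x) f (x + t *\<^sub>R (y - x))) \<le> B"
  shows "cmod (f y - f x) \<le> B"
proof -
  have "cmod (f (x + 1 *\<^sub>R (y - x)) - f (x + 0 *\<^sub>R (y - x))) \<le> 1 * B - 0 * B"
    by (rule segment_bound_general[OF f, of 0 1 x "y - x" "\<lambda>t. t * B" "\<lambda>_. B"])
      (use segment_in_ball[OF x y] bnd in \<open>auto intro!: continuous_intros derivative_eq_intros\<close>)
  then show ?thesis by simp
qed

text \<open>Contraction towards the origin by the factor \<open>1 - t\<close> produces a depth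
  comparable to the larger of \<open>dfct z\<close> and \<open>t\<close>; these are the two-sided
  bounds.\<close>

lemma dfct_scale:
  fixes z :: "complex ^ 'n"
  assumes "z \<in> unit_ball" "0 \<le> t" "t \<le> 1"
  defines "x \<equiv> z + t *\<^sub>R (- z)"
  shows "dfct z \<le> dfct x" "t \<le> dfct x" "dfct x \<le> dfct z + 2 * t" "x \<in> unit_ball"
proof -
  have "x = (1 - t) *\<^sub>R z" by (simp add: x_def algebra_simps)
  then have nx: "norm x = (1 - t) * norm z" using assms by simp
  then have dx: "dfct x = 1 - (1 - t)\<^sup>2 * (norm z)\<^sup>2" by (simp add: dfct_def power_mult_distrib)
  have nz: "0 \<le> (norm z)\<^sup>2" "(norm z)\<^sup>2 \<le> 1" using dfct_pos[OF assms(1)] by (auto simp: dfct_def)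
  have "(1 - t)\<^sup>2 \<le> 1 - t" using assms by (simp add: power2_eq_square mult_left_le)
  have "(1 - t)\<^sup>2 * (norm z)\<^sup>2 \<le> 1 * (norm z)\<^sup>2"
    using nz \<open>(1 - t)\<^sup>2 \<le> 1 - t\<close> assms by (intro mult_right_mono) auto
  then show "dfct z \<le> dfct x" unfolding dx by (simp add: dfct_def)
  have "(1 - t)\<^sup>2 * (norm z)\<^sup>2 \<le> (1 - t) * 1"
    using nz \<open>(1 - t)\<^sup>2 \<le> 1 - t\<close> assms by (intro mult_mono) auto
  then show "t \<le> dfct x" unfolding dx by simp
  have "dfct x - dfct z = (2 * t - t\<^sup>2) * (norm z)\<^sup>2"
    unfolding dx by (simp add: dfct_def power2_eq_square algebra_simps)
  also have "\<dots> \<le> (2 * t) * 1" using nz assms by (intro mult_mono) (auto simp: power2_eq_square mult_left_le)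
  finally show "dfct x \<le> dfct z + 2 * t" by simp
  have "(1 - t) * norm z \<le> 1 * norm z" using assms by (intro mult_right_mono) auto
  then show "x \<in> unit_ball" using assms(1) nx by simp
qed

text \<open>Integrating \<open>dfct powr (\<delta> - 1)\<close> along a radius would cost a
  logarithm at \<open>\<delta> = 0\<close>. The loss \<open>\<epsilon>\<close> avoids it and is
  harmless for Schur's test when small.\<close>

lemma radial_oscillation:
  fixes f :: "complex ^ 'n \<Rightarrow> complex"
  assumes f: "ball_holomorphic f" and M: "M \<ge> 0" and \<delta>: "\<delta> \<ge> 0" and \<epsilon>: "0 < \<epsilon>" "\<epsilon> < 1"
    and star: "\<And>x v. x \<in> unit_ball \<Longrightarrow>
      cmod (sderiv v f x) \<le> M * (dfct x powr (\<delta> - 1/2) * norm v + dfct x powr (\<delta> - 1) * cmod (hinner v x))"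
    and z: "z \<in> unit_ball" and d: "0 < d" "d \<le> 2" "dfct z \<le> 2 * d"
  shows "cmod (f (z + (d/4) *\<^sub>R (- z)) - f z) \<le> 2 * M * 3 powr \<delta> / \<epsilon> * (d powr (\<delta> + \<epsilon>) * dfct z powr (- \<epsilon>))"
proof -
  define A where "A = 2 * M * (3 * d) powr \<delta> * dfct z powr (- \<epsilon>)"
  have A: "A \<ge> 0" using M by (simp add: A_def)
  have "cmod (f (z + (d/4) *\<^sub>R (- z)) - f (z + 0 *\<^sub>R (- z))) \<le> A / \<epsilon> * (d/4) powr \<epsilon> - A / \<epsilon> * 0 powr \<epsilon>"
  proof (rule segment_bound_general[OF f, of 0 "d/4" z "- z" "\<lambda>t. A / \<epsilon> * t powr \<epsilon>" "\<lambda>t. A * t powr (\<epsilon> - 1)"])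
    show "continuous_on {0..d/4} (\<lambda>t. A / \<epsilon> * t powr \<epsilon>)"
      using \<epsilon> by (intro continuous_intros continuous_on_powr') auto
    show "((\<lambda>t. A / \<epsilon> * t powr \<epsilon>) has_real_derivative A * t powr (\<epsilon> - 1)) (at t)" if "0 < t" for t
      using that \<epsilon> by (auto intro!: derivative_eq_intros simp: divide_simps)
    show "z + t *\<^sub>R (- z) \<in> unit_ball" if "0 \<le> t" "t \<le> d/4" for t
      by (rule dfct_scale(4)[OF z]) (use that d in auto)
    fix t assume t: "0 < t" "t < d/4"
    define x where "x = z + t *\<^sub>R (- z)"
    have t1: "0 \<le> t" "t \<le> 1" using t d by auto
    note ds = dfct_scale[OF z t1, folded x_def]
    have sp: "dfct x > 0" by (rule dfct_pos[OF ds(4)])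
    have "cmod (sderiv (- z) f x) \<le> M * (dfct x powr (\<delta> - 1/2) * norm (- z) + dfct x powr (\<delta> - 1) * cmod (hinner (- z) x))"
      by (rule star[OF ds(4)])
    also have "\<dots> \<le> M * (dfct x powr (\<delta> - 1) * 1 + dfct x powr (\<delta> - 1) * 1)"
    proof (intro mult_left_mono add_mono mult_mono M)
      show "dfct x powr (\<delta> - 1/2) \<le> dfct x powr (\<delta> - 1)"
        using sp dfct_le_1[of x] by (intro powr_mono') auto
      show "cmod (hinner (- z) x) \<le> 1"
        using norm_hinner_less_1[OF z, of x] ds(4) by simp
    qed (use z in auto)
    \<comment> \<open>The exponent \<open>\<delta> - 1\<close> is split so that each part has its
      own bound: depth at most \<open>3 * d\<close> for \<open>\<delta>\<close>, depth at least
      \<open>dfct z\<close> for \<open>- \<epsilon>\<close>, and depth at least \<open>t\<close> for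
      the integrable power \<open>\<epsilon> - 1\<close>.\<close>
    also have "\<dots> = 2 * M * dfct x powr (\<delta> + - \<epsilon> + (\<epsilon> - 1))" by simp
    also have "\<dots> = 2 * M * (dfct x powr \<delta> * dfct x powr (- \<epsilon>) * dfct x powr (\<epsilon> - 1))"
      by (simp only: powr_add)
    also have "\<dots> \<le> 2 * M * ((3 * d) powr \<delta> * dfct z powr (- \<epsilon>) * t powr (\<epsilon> - 1))"
    proof (intro mult_left_mono mult_mono)
      show "dfct x powr \<delta> \<le> (3 * d) powr \<delta>"
        using sp ds(3) d t \<delta> by (intro powr_mono2) auto
      show "dfct x powr (- \<epsilon>) \<le> dfct z powr (- \<epsilon>)"
        using dfct_pos[OF z] ds(1) \<epsilon> by (intro powr_mono2') auto
      show "dfct x powr (\<epsilon> - 1) \<le> t powr (\<epsilon> - 1)"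
        using t ds(2) \<epsilon> by (intro powr_mono2') auto
    qed (use M in auto)
    finally show "cmod (sderiv (- z) f (z + t *\<^sub>R (- z))) \<le> A * t powr (\<epsilon> - 1)"
      by (simp add: A_def x_def mult_ac)
  qed (use d in auto)
  also have "\<dots> \<le> A / \<epsilon> * d powr \<epsilon>"
  proof -
    have "(d/4) powr \<epsilon> \<le> d powr \<epsilon>" using \<epsilon> d by (intro powr_mono2) auto
    from mult_left_mono[OF this, of "A / \<epsilon>"] show ?thesis using A \<epsilon> by simp
  qed
  also have "\<dots> = 2 * M * 3 powr \<delta> / \<epsilon> * (d powr (\<delta> + \<epsilon>) * dfct z powr (- \<epsilon>))"
    using d by (simp add: A_def powr_add powr_mult)
  finally show ?thesis by simp
qed

lemma powr_comparable:
  fixes \<sigma> d e :: real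
  assumes "0 < d" "d / 4 \<le> \<sigma>" "\<sigma> \<le> 5 * d"
  shows "\<sigma> powr e \<le> 5 powr \<bar>e\<bar> * d powr e"
proof (cases "e \<ge> 0")
  case True
  have "\<sigma> powr e \<le> (5 * d) powr e" using True assms by (intro powr_mono2) auto
  then show ?thesis using True by (simp add: powr_mult)
next
  case False
  have "\<sigma> powr e \<le> (d / 4) powr e" using False assms by (intro powr_mono2') auto
  also have "\<dots> = 4 powr (- e) * d powr e" by (simp add: powr_divide powr_minus field_simps)
  also have "\<dots> \<le> 5 powr (- e) * d powr e" using False by (intro mult_right_mono powr_mono2) auto
  finally show ?thesis using False by simp
qed

text \<open>Points are joined by moving both radially to depth comparable to \<open>|1 - \<langle>z,w\<rangle>|\<close> and then along a segment.\<close>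

lemma oscillation_bound:
  fixes f :: "complex ^ 'n \<Rightarrow> complex"
  assumes f: "ball_holomorphic f" and M: "M \<ge> 0" and \<delta>: "\<delta> \<ge> 0" and \<epsilon>: "0 < \<epsilon>" "\<epsilon> < 1"
    and star: "\<And>x v. x \<in> unit_ball \<Longrightarrow>
      cmod (sderiv v f x) \<le> M * (dfct x powr (\<delta> - 1/2) * norm v + dfct x powr (\<delta> - 1) * cmod (hinner v x))"
  obtains C where "C > 0" "\<And>z w. z \<in> unit_ball \<Longrightarrow> w \<in> unit_ball \<Longrightarrow>
    cmod (f z - f w) \<le> C * (cmod (1 - hinner z w) powr (\<delta> + \<epsilon>) * dfct z powr (- \<epsilon>)
      + cmod (1 - hinner z w) powr (\<delta> + \<epsilon>) * dfct w powr (- \<epsilon>))"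
proof -
  define C1 where "C1 = 2 * M * 3 powr \<delta> / \<epsilon>"
  define C2 where "C2 = M * (5 powr \<bar>\<delta> - 1/2\<bar> * 2 + 5 powr \<bar>\<delta> - 1\<bar> * 3) * 2 powr \<epsilon>"
  have C: "C1 \<ge> 0" "C2 \<ge> 0" using M \<epsilon> by (auto simp: C1_def C2_def)
  show thesis
  proof (rule that[of "C1 + C2 + 1"])
    show "C1 + C2 + 1 > 0" using C by simp
    fix z w :: "complex ^ 'n" assume z: "z \<in> unit_ball" and w: "w \<in> unit_ball"
    define d where "d = cmod (1 - hinner z w)"
    have d: "0 < d" "d \<le> 2" "dfct z \<le> 2 * d" "dfct w \<le> 2 * d"
      using cmod_one_minus_hinner_pos[OF z w] cmod_one_minus_hinner_le2[OF z w] dfct_le_hinner[OF z w]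
        dfct_le_hinner[OF w z] cmod_one_minus_hinner_commute[of z w] by (auto simp: d_def)
    define z' where "z' = z + (d/4) *\<^sub>R (- z)"
    define w' where "w' = w + (d/4) *\<^sub>R (- w)"
    have tau: "0 \<le> d/4" "d/4 \<le> 1" using d by auto
    have z': "z' \<in> unit_ball" "w' \<in> unit_ball" using dfct_scale(4)[OF z tau] dfct_scale(4)[OF w tau] by (auto simp: z'_def w'_def)
    have r1: "cmod (f z' - f z) \<le> C1 * (d powr (\<delta> + \<epsilon>) * dfct z powr (- \<epsilon>))"
      unfolding z'_def C1_def by (rule radial_oscillation[OF f M \<delta> \<epsilon> star z]) (use d in auto)
    have r2: "cmod (f w' - f w) \<le> C1 * (d powr (\<delta> + \<epsilon>) * dfct w powr (- \<epsilon>))"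
      unfolding w'_def C1_def by (rule radial_oscillation[OF f M \<delta> \<epsilon> star w]) (use d in auto)
    \<comment> \<open>Two scales match the two terms of the hypothesis: the displacement has length
      of order \<open>sqrt d\<close>, while its products with the base points are of order
      \<open>d\<close> (\<open>h1\<close>, \<open>h2\<close>). At depth comparable to
      \<open>d\<close> both terms are then of order \<open>d powr \<delta>\<close>.\<close>
    have nzw: "norm (w - z) powr 2 \<le> 2 * d"
    proof -
      have "(norm (w - z))\<^sup>2 = (norm z)\<^sup>2 + (norm w)\<^sup>2 - 2 * Re (hinner z w)"
        by (simp add: Re_hinner power2_norm_eq_inner inner_diff_left inner_diff_right inner_commute)
      also have "\<dots> = 2 * Re (1 - hinner z w) - dfct z - dfct w" by (simp add: dfct_def)
      also have "\<dots> \<le> 2 * d" using dfct_pos[OF z] dfct_pos[OF w] complex_Re_le_cmod[of "1 - hinner z w"] by (simp add: d_def)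
      finally show ?thesis by simp
    qed
    have nv: "norm (w' - z') \<le> 2 * d powr (1/2)"
    proof -
      have "w' - z' = (1 - d/4) *\<^sub>R (w - z)" by (simp add: w'_def z'_def algebra_simps)
      then have "norm (w' - z') \<le> 1 * norm (w - z)" using d mult_right_mono[of "1 - d/4" 1 "norm (w - z)"] by simp
      also have "\<dots> = (norm (w - z) powr 2) powr (1/2)" by (simp add: powr_powr)
      also have "\<dots> \<le> (2 * d) powr (1/2)" using nzw by (intro powr_mono2) auto
      also have "\<dots> = sqrt 2 * d powr (1/2)" by (simp add: powr_mult powr_half_sqrt)
      also have "\<dots> \<le> 2 * d powr (1/2)" by (intro mult_right_mono) (auto intro: real_le_lsqrt)
      finally show ?thesis .
    qed
    have h1: "cmod (hinner (w - z) z) \<le> 3 * d"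
    proof -
      have "hinner (w - z) z = of_real (dfct z) - (1 - hinner w z)"
        by (simp add: hinner_diff_left hinner_self dfct_def)
      then have "cmod (hinner (w - z) z) \<le> dfct z + cmod (1 - hinner w z)"
        using norm_triangle_ineq4[of "of_real (dfct z)" "1 - hinner w z"] dfct_pos[OF z] by simp
      then show ?thesis using d cmod_one_minus_hinner_commute[of z w] by (simp add: d_def)
    qed
    have h2: "cmod (hinner (w - z) w) \<le> 3 * d"
    proof -
      have "hinner (w - z) w = (1 - hinner z w) - of_real (dfct w)"
        by (simp add: hinner_diff_left hinner_self dfct_def)
      then have "cmod (hinner (w - z) w) \<le> cmod (1 - hinner z w) + dfct w"
        using norm_triangle_ineq4[of "1 - hinner z w" "of_real (dfct w)"] dfct_pos[OF w] by simp
      then show ?thesis using d by (simp add: d_def)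
    qed
    have "cmod (f w' - f z') \<le> C2 / 2 powr \<epsilon> * d powr \<delta>"
    proof (rule segment_bound[OF f z'])
      fix t :: real assume t: "0 < t" "t < 1"
      define x where "x = z' + t *\<^sub>R (w' - z')"
      define y where "y = z + t *\<^sub>R (w - z)"
      have y: "y \<in> unit_ball" unfolding y_def by (rule segment_in_ball[OF z w]) (use t in auto)
      have xy: "x = y + (d/4) *\<^sub>R (- y)" by (simp add: x_def y_def z'_def w'_def algebra_simps)
      note ds = dfct_scale[OF y tau, folded xy]
      have sy: "dfct y \<le> 4 * d"
      proof -
        \<comment> \<open>As \<open>t\<close> is real, this is the convex combination of the values
          at the endpoints \<open>z\<close> and \<open>w\<close>; it keeps the depth along the
          segment of order \<open>d\<close> from above.\<close>
        have e: "1 - hinner z y = of_real (1 - t) * of_real (dfct z) + of_real t * (1 - hinner z w)"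
          by (simp add: y_def hinner_add_right hinner_diff_right hinner_self dfct_def algebra_simps)
        have "cmod (1 - hinner z y) \<le> (1 - t) * dfct z + t * d"
          unfolding e using t dfct_pos[OF z]
          by (intro order_trans[OF norm_triangle_ineq]) (simp add: norm_mult d_def del: of_real_diff)
        also have "\<dots> \<le> (1 - t) * (2 * d) + t * (2 * d)" using t d by (intro add_mono mult_left_mono) auto
        finally have "cmod (1 - hinner z y) \<le> 2 * d" by (simp add: algebra_simps)
        then show ?thesis using dfct_le_hinner[OF y z] cmod_one_minus_hinner_commute[of y z] by simp
      qed
      have s: "d / 4 \<le> dfct x" "dfct x \<le> 5 * d" using ds sy d by auto
      have hv: "cmod (hinner (w' - z') x) \<le> 3 * d"
      proof -
        have "w' - z' = (1 - d/4) *\<^sub>R (w - z)" "x = (1 - d/4) *\<^sub>R y" by (simp_all add: w'_def z'_def xy algebra_simps)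
        then have "cmod (hinner (w' - z') x) = ((1 - d/4) * (1 - d/4)) * cmod (hinner (w - z) y)"
          using d by (simp add: norm_mult del: of_real_diff)
        also have "\<dots> \<le> 1 * cmod (hinner (w - z) y)"
          using d by (intro mult_right_mono mult_le_one) auto
        also have "hinner (w - z) y = of_real (1 - t) * hinner (w - z) z + of_real t * hinner (w - z) w"
          by (simp add: y_def hinner_add_right hinner_diff_right algebra_simps)
        also have "1 * cmod \<dots> \<le> (1 - t) * cmod (hinner (w - z) z) + t * cmod (hinner (w - z) w)"
          using t norm_triangle_ineq[of "of_real (1 - t) * hinner (w - z) z" "of_real t * hinner (w - z) w"]
          by (simp add: norm_mult del: of_real_diff)
        also have "\<dots> \<le> (1 - t) * (3 * d) + t * (3 * d)" using t h1 h2 by (intro add_mono mult_left_mono) auto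
        finally show ?thesis by (simp add: algebra_simps)
      qed
      have "cmod (sderiv (w' - z') f x) \<le> M * (dfct x powr (\<delta> - 1/2) * norm (w' - z') + dfct x powr (\<delta> - 1) * cmod (hinner (w' - z') x))"
        by (rule star[OF ds(4)])
      also have "\<dots> \<le> M * ((5 powr \<bar>\<delta> - 1/2\<bar> * d powr (\<delta> - 1/2)) * (2 * d powr (1/2)) + (5 powr \<bar>\<delta> - 1\<bar> * d powr (\<delta> - 1)) * (3 * d))"
        by (intro mult_left_mono add_mono mult_mono M powr_comparable s d nv hv) auto
      also have "\<dots> = M * (5 powr \<bar>\<delta> - 1/2\<bar> * 2 * (d powr (\<delta> - 1/2) * d powr (1/2)) + 5 powr \<bar>\<delta> - 1\<bar> * 3 * (d powr (\<delta> - 1) * d powr 1))"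
        using d by (simp add: algebra_simps)
      also have "\<dots> = C2 / 2 powr \<epsilon> * d powr \<delta>"
        unfolding powr_add[symmetric] by (simp add: C2_def field_simps)
      finally show "cmod (sderiv (w' - z') f (z' + t *\<^sub>R (w' - z'))) \<le> C2 / 2 powr \<epsilon> * d powr \<delta>"
        by (simp add: x_def)
    qed
    \<comment> \<open>From \<open>dfct z \<le> 2 * d\<close> the quotient of \<open>2 * d\<close> by
      \<open>dfct z\<close> is at least 1; its power \<open>\<epsilon>\<close> is inserted to give
      this term the same shape as the radial ones.\<close>
    also have "\<dots> \<le> C2 / 2 powr \<epsilon> * (2 powr \<epsilon> * (d powr (\<delta> + \<epsilon>) * dfct z powr (- \<epsilon>)))"
    proof (intro mult_left_mono)
      have "(2 * d) powr (- \<epsilon>) \<le> dfct z powr (- \<epsilon>)" using d dfct_pos[OF z] \<epsilon> by (intro powr_mono2') auto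
      note le = this
      have "d powr \<delta> = d powr (\<delta> + \<epsilon>) * d powr (- \<epsilon>)" unfolding powr_add[symmetric] by simp
      also have "d powr (- \<epsilon>) = 2 powr \<epsilon> * (2 * d) powr (- \<epsilon>)"
        by (simp add: powr_mult powr_minus field_simps)
      also have "d powr (\<delta> + \<epsilon>) * (2 powr \<epsilon> * (2 * d) powr (- \<epsilon>)) \<le> d powr (\<delta> + \<epsilon>) * (2 powr \<epsilon> * dfct z powr (- \<epsilon>))"
        by (intro mult_left_mono le) auto
      finally show "d powr \<delta> \<le> 2 powr \<epsilon> * (d powr (\<delta> + \<epsilon>) * dfct z powr (- \<epsilon>))" by (simp add: mult_ac)
    qed (use C in auto)
    also have "\<dots> = C2 * (d powr (\<delta> + \<epsilon>) * dfct z powr (- \<epsilon>))" by simp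
    finally have r3: "cmod (f w' - f z') \<le> C2 * (d powr (\<delta> + \<epsilon>) * dfct z powr (- \<epsilon>))" .
    define X where "X = d powr (\<delta> + \<epsilon>) * dfct z powr (- \<epsilon>)"
    define Y where "Y = d powr (\<delta> + \<epsilon>) * dfct w powr (- \<epsilon>)"
    have XY: "X \<ge> 0" "Y \<ge> 0" by (auto simp: X_def Y_def)
    have "cmod (f z - f w) \<le> cmod (f w' - f w) + cmod (f z' - f z) + cmod (f w' - f z')"
      using norm_triangle_ineq4[of "(f w' - f w) - (f z' - f z)" "f w' - f z'"]
        norm_triangle_ineq4[of "f w' - f w" "f z' - f z"] by simp
    also have "\<dots> \<le> C1 * Y + C1 * X + C2 * X" using r1 r2 r3 by (simp add: X_def Y_def)
    also have "\<dots> \<le> (C1 + C2 + 1) * (X + Y)" using C XY by (simp add: algebra_simps)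
    finally show "cmod (f z - f w) \<le> (C1 + C2 + 1) * (cmod (1 - hinner z w) powr (\<delta> + \<epsilon>) * dfct z powr (- \<epsilon>)
      + cmod (1 - hinner z w) powr (\<delta> + \<epsilon>) * dfct w powr (- \<epsilon>))"
      by (simp add: X_def Y_def d_def)
  qed
qed

text \<open>Both points are joined to the origin along radii. For positive \<open>\<gamma>\<close>
  the primitive of the Bloch bound is governed by its value at the outer endpoint, of order
  \<open>dfct powr (- \<gamma>)\<close>.\<close>

lemma growth_bound:
  fixes f :: "complex ^ 'n \<Rightarrow> complex"
  assumes f: "ball_holomorphic f" and M: "M \<ge> 0" and \<gamma>: "\<gamma> > 0"
    and bloch: "\<And>x v. x \<in> unit_ball \<Longrightarrow> cmod (sderiv v f x) \<le> M * (dfct x powr (- (1 + \<gamma>)) * norm v)"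
  obtains C where "C > 0" "\<And>z w. z \<in> unit_ball \<Longrightarrow> w \<in> unit_ball \<Longrightarrow>
    cmod (f z - f w) \<le> C * (dfct z powr (- \<gamma>) + dfct w powr (- \<gamma>))"
proof -
  define C where "C = M / \<gamma> * 2 powr \<gamma>"
  have C: "C \<ge> 0" using M \<gamma> by (simp add: C_def)
  have zero: "cmod (f z - f 0) \<le> C * dfct z powr (- \<gamma>)" if z: "z \<in> unit_ball" for z :: "complex ^ 'n"
  proof -
    define r where "r = norm z"
    have r: "0 \<le> r" "r < 1" using z by (auto simp: r_def)
    have "cmod (f (0 + 1 *\<^sub>R z) - f (0 + 0 *\<^sub>R z)) \<le> M / \<gamma> * (1 - 1 * r) powr (- \<gamma>) - M / \<gamma> * (1 - 0 * r) powr (- \<gamma>)"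
    proof (rule segment_bound_general[OF f, of 0 1 0 z "\<lambda>t. M / \<gamma> * (1 - t * r) powr (- \<gamma>)" "\<lambda>t. M * (r * (1 - t * r) powr (- (1 + \<gamma>)))"])
      have pos: "1 - t * r > 0" if "0 \<le> t" "t \<le> 1" for t
        using that r mult_mono[of t 1 r r] by simp
      show "continuous_on {0..1} (\<lambda>t. M / \<gamma> * (1 - t * r) powr (- \<gamma>))"
        using pos by (intro continuous_intros) force
      show "((\<lambda>t. M / \<gamma> * (1 - t * r) powr (- \<gamma>)) has_real_derivative M * (r * (1 - t * r) powr (- (1 + \<gamma>)))) (at t)"
        if "0 < t" "t < 1" for t
      proof -
        have "((\<lambda>t. (1 - t * r)) has_real_derivative - r) (at t)" by (auto intro!: derivative_eq_intros)
        from DERIV_fun_powr[OF this, of "- \<gamma>"] pos[of t] that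
        have "((\<lambda>t. (1 - t * r) powr (- \<gamma>)) has_real_derivative - \<gamma> * (1 - t * r) powr (- \<gamma> - 1) * - r) (at t)" by simp
        from DERIV_cmult[OF this, of "M / \<gamma>"]
        have "((\<lambda>t. M / \<gamma> * (1 - t * r) powr (- \<gamma>)) has_real_derivative
          M / \<gamma> * (- \<gamma> * (1 - t * r) powr (- \<gamma> - 1) * - r)) (at t)" .
        moreover have "M / \<gamma> * (- \<gamma> * (1 - t * r) powr (- \<gamma> - 1) * - r) = M * (r * (1 - t * r) powr (- (1 + \<gamma>)))"
        proof -
          have "- (1 + \<gamma>) = - \<gamma> - 1" by simp
          then show ?thesis using \<gamma> by (simp only:) simp
        qed
        ultimately show ?thesis by simp
      qed
      fix t :: real
      show sub: "0 + t *\<^sub>R z \<in> unit_ball" if "0 \<le> t" "t \<le> 1"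
        using that r mult_mono[of t 1 r r] by (simp add: r_def)
      assume t: "0 < t" "t < 1"
      have tr: "0 \<le> t * r" "t * r < 1" using t r mult_mono[of t 1 r r] by auto
      have "cmod (sderiv z f (0 + t *\<^sub>R z)) \<le> M * (dfct (0 + t *\<^sub>R z) powr (- (1 + \<gamma>)) * norm z)"
        by (rule bloch[OF sub]) (use t in auto)
      also have "\<dots> \<le> M * ((1 - t * r) powr (- (1 + \<gamma>)) * r)"
      proof (intro mult_left_mono mult_mono M powr_mono2')
        have "dfct (0 + t *\<^sub>R z) = 1 - (t * r) * (t * r)" using t by (simp add: dfct_def r_def power2_eq_square)
        also have "\<dots> \<ge> 1 - t * r" using tr by (simp add: mult_left_le)
        finally show "1 - t * r \<le> dfct (0 + t *\<^sub>R z)" .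
      qed (use r tr \<gamma> in \<open>auto simp: r_def\<close>)
      finally show "cmod (sderiv z f (0 + t *\<^sub>R z)) \<le> M * (r * (1 - t * r) powr (- (1 + \<gamma>)))" by (simp add: mult_ac)
    qed simp
    also have "\<dots> \<le> M / \<gamma> * (1 - r) powr (- \<gamma>)" using M \<gamma> by simp
    also have "\<dots> \<le> M / \<gamma> * (dfct z / 2) powr (- \<gamma>)"
    proof (intro mult_left_mono powr_mono2')
      have "dfct z = (1 + r) * (1 - r)" by (simp add: dfct_def r_def power2_eq_square algebra_simps)
      also have "\<dots> \<le> 2 * (1 - r)" using r by (intro mult_right_mono) auto
      finally show "dfct z / 2 \<le> 1 - r" by simp
    qed (use dfct_pos[OF z] M \<gamma> in auto)
    also have "\<dots> = C * dfct z powr (- \<gamma>)" by (simp add: C_def powr_divide powr_minus divide_simps)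
    finally show ?thesis by simp
  qed
  show thesis
  proof (rule that[of "C + 1"])
    show "C + 1 > 0" using C by simp
    fix z w :: "complex ^ 'n" assume z: "z \<in> unit_ball" and w: "w \<in> unit_ball"
    have "cmod (f z - f w) \<le> cmod (f z - f 0) + cmod (f w - f 0)"
      using norm_triangle_ineq4[of "f z - f 0" "f w - f 0"] by simp
    also have "\<dots> \<le> C * dfct z powr (- \<gamma>) + C * dfct w powr (- \<gamma>)" by (intro add_mono zero z w)
    also have "\<dots> \<le> (C + 1) * (dfct z powr (- \<gamma>) + dfct w powr (- \<gamma>))" by (simp add: algebra_simps)
    finally show "cmod (f z - f w) \<le> (C + 1) * (dfct z powr (- \<gamma>) + dfct w powr (- \<gamma>))" .
  qed
qed

section \<open>Gradients\<close>

lemma cgrad_nth: "cgrad f z $ k = sderiv (axis k 1) f z"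
  by (simp add: cgrad_def sderiv_def)

lemma vec_sum_axis: "v = (\<Sum>k\<in>UNIV. v $ k *s axis k (1 :: complex))"
  by (simp add: vec_eq_iff axis_def if_distrib[of "\<lambda>x. _ * x"] cong: if_cong)

lemma sum_mult_norm_le:
  fixes a b :: "complex ^ 'n"
  shows "cmod (\<Sum>k\<in>UNIV. a $ k * b $ k) \<le> norm a * norm b"
proof -
  have "cmod (\<Sum>k\<in>UNIV. a $ k * b $ k) \<le> (\<Sum>k\<in>UNIV. cmod (a $ k) * cmod (b $ k))"
    by (rule order_trans[OF norm_sum]) (simp add: norm_mult)
  also have "\<dots> \<le> norm a * norm b"
    unfolding norm_vec_def using L2_set_mult_ineq[of "\<lambda>k. cmod (a $ k)" "\<lambda>k. cmod (b $ k)" UNIV] by simp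
  finally show ?thesis .
qed

lemma norm_le_of_functional_bound:
  fixes a :: "complex ^ 'n"
  assumes "B \<ge> 0" "\<And>x. cmod (\<Sum>k\<in>UNIV. x $ k * a $ k) \<le> B * norm x"
  shows "norm a \<le> B"
proof (cases "a = 0")
  case False
  \<comment> \<open>The pairing is bilinear, so the extremal vector is the conjugate of
    \<open>a\<close>.\<close>
  define x where "x = (\<chi> k. cnj (a $ k))"
  have nx: "norm x = norm a" by (simp add: x_def norm_vec_def)
  have "(\<Sum>k\<in>UNIV. x $ k * a $ k) = hinner a a" by (simp add: x_def hinner_def mult.commute)
  then have "(norm a)\<^sup>2 \<le> B * norm a" using assms(2)[of x] by (simp add: hinner_self nx norm_power)
  then show ?thesis using False by (simp add: power2_eq_square)
qed (use assms in simp)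

lemma sderiv_cgrad:
  assumes "ball_holomorphic f" "z \<in> unit_ball"
  shows "sderiv v f z = (\<Sum>k\<in>UNIV. v $ k * cgrad f z $ k)"
proof -
  have "sderiv v f z = sderiv (\<Sum>k\<in>UNIV. v $ k *s axis k 1) f z"
    by (subst vec_sum_axis[of v]) simp
  also have "\<dots> = (\<Sum>k\<in>UNIV. v $ k * cgrad f z $ k)"
    by (simp add: sderiv_sum[OF assms] sderiv_smult[OF assms] cgrad_nth)
  finally show ?thesis .
qed

lemma sderiv_le_cgrad:
  assumes "ball_holomorphic f" "z \<in> unit_ball"
  shows "cmod (sderiv v f z) \<le> norm (cgrad f z) * norm v"
  unfolding sderiv_cgrad[OF assms] using sum_mult_norm_le[of v "cgrad f z"] by (simp add: mult.commute)

lemma cgrad_le: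
  assumes "ball_holomorphic f" "z \<in> unit_ball" "B \<ge> 0" "\<And>v. cmod (sderiv v f z) \<le> B * norm v"
  shows "norm (cgrad f z) \<le> B"
  by (rule norm_le_of_functional_bound[OF assms(3)])
    (use assms(4) in \<open>simp add: sderiv_cgrad[OF assms(1,2)]\<close>)

text \<open>This is the complex derivative of \<open>ball_involution z\<close> at 0: on the line
  through \<open>z\<close> it scales by \<open>- dfct z\<close>, on the orthogonal complement by
  \<open>- sqrt (dfct z)\<close>.\<close>

definition invol_deriv :: "complex ^ 'n \<Rightarrow> complex ^ 'n \<Rightarrow> complex ^ 'n"
  where "invol_deriv z x = - (dfct z *\<^sub>R line_proj z x + sqrt (dfct z) *\<^sub>R (x - line_proj z x))"

lemma line_proj_zero [simp]: "line_proj 0 x = 0"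
  by (simp add: line_proj_def)

lemma line_proj_smult: "line_proj z (c *s x) = c *s line_proj z x"
  by (simp add: line_proj_def vector_smult_assoc)

lemma line_proj_add: "line_proj z (x + y) = line_proj z x + line_proj z y"
  by (simp add: line_proj_def hinner_add_left add_divide_distrib vector_sadd_rdistrib)

lemma hinner_line_proj: "hinner (line_proj z x) z = hinner x z"
  by (simp add: line_proj_def)
    (metis hinner_zero_right hinner_self norm_eq_zero of_real_eq_0_iff power_eq_0_iff nonzero_eq_divide_eq)

lemma hinner_perp: "hinner (x - line_proj z x) z = 0"
  by (simp add: hinner_diff_left hinner_line_proj)

lemma line_proj_multiple: "line_proj z x = (hinner x z / of_real ((norm z)\<^sup>2)) *s z"
  by (simp add: line_proj_def hinner_self)

lemma norm_line_proj: "norm (line_proj z x) * norm z = cmod (hinner x z)"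
  by (cases "z = 0") (simp_all add: line_proj_multiple norm_vec_smult norm_divide norm_mult power2_eq_square)

lemma pythagoras_line_proj: "(norm x)\<^sup>2 = (norm (x - line_proj z x))\<^sup>2 + (norm (line_proj z x))\<^sup>2"
proof -
  have "hinner (x - line_proj z x) (line_proj z x) = 0"
    unfolding line_proj_multiple[of z x] using hinner_perp[of x z] by (simp add: line_proj_multiple)
  then have 0: "inner (x - line_proj z x) (line_proj z x) = 0" by (simp flip: Re_hinner)
  have "(norm x)\<^sup>2 = (norm ((x - line_proj z x) + line_proj z x))\<^sup>2" by simp
  also have "\<dots> = (norm (x - line_proj z x))\<^sup>2 + (norm (line_proj z x))\<^sup>2"
    using 0 unfolding power2_norm_eq_inner by (simp add: inner_add_left inner_add_right inner_commute inner_diff_left inner_diff_right)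
  finally show ?thesis .
qed

lemma norm_perp_le: "norm (x - line_proj z x) \<le> norm x" "norm (line_proj z x) \<le> norm x"
proof -
  have "(norm (x - line_proj z x))\<^sup>2 \<le> (norm x)\<^sup>2" "(norm (line_proj z x))\<^sup>2 \<le> (norm x)\<^sup>2"
    unfolding pythagoras_line_proj[of x z] by auto
  then show "norm (x - line_proj z x) \<le> norm x" "norm (line_proj z x) \<le> norm x" by (auto intro: power2_le_imp_le)
qed

text \<open>By the chain rule only the derivative at 0 of the involution along each coordinate line
  is involved; it is computed as that of a quotient of affine functions.\<close>

lemma invariant_grad_nth:
  fixes f :: "complex ^ 'n \<Rightarrow> complex"
  assumes f: "ball_holomorphic f" and z: "z \<in> unit_ball"
  shows "invariant_grad f z $ k = sderiv (invol_deriv z (axis k 1)) f z"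
proof -
  define e where "e = (axis k 1 :: complex ^ 'n)"
  define \<phi> where "\<phi> t = ball_involution z (t *s e)" for t
  have \<phi>': "(\<phi> has_derivative (\<lambda>t. t *s invol_deriv z e)) (at 0) \<and> \<phi> 0 = z"
  proof (cases "z = 0")
    case True
    have "\<phi> = (\<lambda>t. t *s (- e))" by (simp add: \<phi>_def ball_involution_def True fun_eq_iff)
    moreover have "invol_deriv z e = - e" by (simp add: invol_deriv_def True dfct_def)
    ultimately show ?thesis
      by (simp add: True bounded_linear_imp_has_derivative bounded_linear_smult_left del: vector_smult_rneg)
  next
    case False
    define u where "u = - line_proj z e - of_real (sqrt (1 - (norm z)\<^sup>2)) *s (e - line_proj z e)"
    have form: "\<phi> t = (1 / (1 - t * hinner e z)) *s (z + t *s u)" for t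
    proof -
      have "\<phi> t = (1 / (1 - hinner (t *s e) z)) *s (z - line_proj z (t *s e)
          - of_real (sqrt (1 - (norm z)\<^sup>2)) *s (t *s e - line_proj z (t *s e)))"
        using False by (simp add: \<phi>_def ball_involution_def)
      also have "z - line_proj z (t *s e) - of_real (sqrt (1 - (norm z)\<^sup>2)) *s (t *s e - line_proj z (t *s e)) = z + t *s u"
        by (simp add: u_def line_proj_smult vec_eq_iff algebra_simps)
      finally show ?thesis by simp
    qed
    have d1: "((\<lambda>t. 1 / (1 - t * hinner e z)) has_derivative (\<lambda>t. t * hinner e z)) (at 0)"
      by (auto intro!: derivative_eq_intros)
    have d2: "((\<lambda>t. z + t *s u) has_derivative (\<lambda>t. t *s u)) (at 0)"
      by (auto intro!: derivative_eq_intros bounded_linear_imp_has_derivative bounded_linear_smult_left)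
    have bb: "bounded_bilinear (\<lambda>c (v :: complex ^ 'n). c *s v)"
      by (rule bounded_bilinear.intro)
        (auto simp: vec_eq_iff algebra_simps norm_vec_smult intro!: exI[of _ 1])
    have "((\<lambda>t. (1 / (1 - t * hinner e z)) *s (z + t *s u)) has_derivative
        (\<lambda>t. (1 / (1 - 0 * hinner e z)) *s (t *s u) + (t * hinner e z) *s (z + 0 *s u))) (at 0)"
      by (rule bounded_bilinear.FDERIV[OF bb d1 d2])
    \<comment> \<open>Differentiating the denominator contributes \<open>hinner e z *s z\<close>,
      which is the squared norm of \<open>z\<close> times \<open>line_proj z e\<close>; added to
      \<open>- line_proj z e\<close> it leaves the factor \<open>- dfct z\<close>.\<close>
    moreover have eu: "invol_deriv z e = u + hinner e z *s z"
    proof -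
      have "hinner e z *s z = ((norm z)\<^sup>2) *\<^sub>R line_proj z e"
        using False by (simp add: line_proj_multiple vector_smult_assoc flip: of_real_vec_smult)
      then show ?thesis
        by (simp add: u_def invol_deriv_def dfct_def of_real_vec_smult algebra_simps)
    qed
    have "(\<lambda>t. (1 / (1 - 0 * hinner e z)) *s (t *s u) + (t * hinner e z) *s (z + 0 *s u)) = (\<lambda>t. t *s invol_deriv z e)"
      unfolding eu by (auto simp: vector_smult_assoc vector_add_ldistrib fun_eq_iff)
    ultimately show ?thesis unfolding form[abs_def] by simp
  qed
  have "(f has_derivative (\<lambda>v. sderiv v f z)) (at (\<phi> 0))"
    using \<phi>' ball_holomorphic_has_derivative[OF f z] by simp
  with \<phi>' have "(f \<circ> \<phi> has_derivative (\<lambda>v. sderiv v f z) \<circ> (\<lambda>t. t *s invol_deriv z e)) (at 0)"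
    by (intro diff_chain_at) auto
  moreover have "(\<lambda>v. sderiv v f z) \<circ> (\<lambda>t. t *s invol_deriv z e) = (*) (sderiv (invol_deriv z e) f z)"
    by (auto simp: sderiv_smult[OF f z])
  ultimately have "(f \<circ> \<phi> has_field_derivative sderiv (invol_deriv z e) f z) (at 0)"
    by (simp add: has_field_derivative_def)
  from DERIV_imp_deriv[OF this] show ?thesis
    by (simp add: invariant_grad_def cgrad_def \<phi>_def e_def o_def)
qed

lemma invol_deriv_add: "invol_deriv z (x + y) = invol_deriv z x + invol_deriv z y"
  by (simp add: invol_deriv_def line_proj_add algebra_simps)

lemma invol_deriv_smult: "invol_deriv z (c *s x) = c *s invol_deriv z x"
  unfolding invol_deriv_def of_real_vec_smult[symmetric]
  by (simp add: line_proj_smult vec_eq_iff algebra_simps)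

lemma invol_deriv_sum: "finite A \<Longrightarrow> invol_deriv z (\<Sum>k\<in>A. v k) = (\<Sum>k\<in>A. invol_deriv z (v k))"
proof (induction A rule: finite_induct)
  case empty
  then show ?case using invol_deriv_smult[of z 0 0] by simp
qed (simp add: invol_deriv_add)

lemma sderiv_invol_deriv:
  fixes f :: "complex ^ 'n \<Rightarrow> complex"
  assumes f: "ball_holomorphic f" and z: "z \<in> unit_ball"
  shows "sderiv (invol_deriv z x) f z = (\<Sum>k\<in>UNIV. x $ k * invariant_grad f z $ k)"
proof -
  have "invol_deriv z x = (\<Sum>k\<in>UNIV. x $ k *s invol_deriv z (axis k 1))"
    by (subst vec_sum_axis[of x]) (simp add: invol_deriv_sum invol_deriv_smult)
  then show ?thesis
    by (simp add: sderiv_sum[OF f z] sderiv_smult[OF f z] invariant_grad_nth[OF f z])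
qed

text \<open>The squared norm of the projection is split by the weights \<open>dfct z\<close> and the
  squared norm of \<open>z\<close>, which add up to 1. The second share is
  \<open>cmod (hinner v z)\<close> squared, so no division by \<open>norm z\<close> occurs near the
  origin.\<close>

lemma norm_line_proj_le:
  assumes "z \<in> unit_ball"
  shows "norm (line_proj z v) \<le> sqrt (dfct z) * norm v + cmod (hinner v z)"
proof (rule power2_le_imp_le)
  have s: "dfct z \<ge> 0" using dfct_pos[OF assms] by simp
  have "(norm (line_proj z v))\<^sup>2 = dfct z * (norm (line_proj z v))\<^sup>2 + (norm (line_proj z v) * norm z)\<^sup>2"
    by (simp add: dfct_def power_mult_distrib algebra_simps)
  also have "\<dots> \<le> dfct z * (norm v)\<^sup>2 + (cmod (hinner v z))\<^sup>2"
    unfolding norm_line_proj using norm_perp_le(2)[of z v] s by (intro add_mono mult_left_mono power_mono) auto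
  also have "\<dots> = (sqrt (dfct z) * norm v)\<^sup>2 + (cmod (hinner v z))\<^sup>2"
    using s by (simp add: power_mult_distrib)
  also have "\<dots> \<le> (sqrt (dfct z) * norm v + cmod (hinner v z))\<^sup>2"
    using s by (simp add: power2_sum)
  finally show "(norm (line_proj z v))\<^sup>2 \<le> (sqrt (dfct z) * norm v + cmod (hinner v z))\<^sup>2" .
qed (use dfct_pos[OF assms] in simp)

text \<open>The vector \<open>x\<close> in the proof is the preimage of \<open>v\<close> under
  \<open>invol_deriv z\<close>. Inversion divides the radial part by \<open>dfct z\<close> and the
  tangential part by its square root, and the bound is the norm of this preimage.\<close>

lemma sderiv_le_invariant_grad:
  fixes f :: "complex ^ 'n \<Rightarrow> complex"
  assumes f: "ball_holomorphic f" and z: "z \<in> unit_ball"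
  shows "cmod (sderiv v f z) \<le> norm (invariant_grad f z) * (2 * (norm v / sqrt (dfct z)) + cmod (hinner v z) / dfct z)"
proof -
  define s where "s = dfct z"
  define r where "r = sqrt s"
  have s: "s > 0" "r > 0" "r * r = s" using dfct_pos[OF z] by (auto simp: s_def r_def)
  define P where "P = line_proj z v"
  define x where "x = - ((1 / s) *\<^sub>R P + (1 / r) *\<^sub>R (v - P))"
  have PP: "line_proj z P = P" unfolding P_def by (simp add: line_proj_def[of z "line_proj z v"] hinner_line_proj) (simp add: line_proj_def)
  have Pv: "line_proj z (v - P) = 0"
  proof -
    have "line_proj z (v - P) + line_proj z P = line_proj z v" by (simp flip: line_proj_add)
    then show ?thesis unfolding PP by (simp add: P_def)
  qed
  have "line_proj z x = (- of_real (1 / s)) *s P"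
  proof -
    have "x = (- of_real (1 / s)) *s P + (- of_real (1 / r)) *s (v - P)"
      by (simp add: x_def flip: of_real_vec_smult)
    then show ?thesis by (simp only: line_proj_add line_proj_smult PP Pv) simp
  qed
  then have lp: "line_proj z x = - ((1 / s) *\<^sub>R P)" by (simp flip: of_real_vec_smult)
  have "invol_deriv z x = - (s *\<^sub>R (- ((1 / s) *\<^sub>R P)) + r *\<^sub>R (- ((1 / r) *\<^sub>R (v - P))))"
    unfolding invol_deriv_def lp s_def[symmetric] r_def[symmetric] by (simp add: x_def)
  also have "\<dots> = v" using s by simp
  finally have Lx: "invol_deriv z x = v" .
  have "norm x \<le> norm P / s + norm (v - P) / r"
    unfolding x_def norm_minus_cancel using norm_triangle_ineq[of "(1 / s) *\<^sub>R P" "(1 / r) *\<^sub>R (v - P)"] s by simp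
  also have "\<dots> \<le> (r * norm v + cmod (hinner v z)) / s + norm v / r"
    using norm_line_proj_le[OF z, of v] norm_perp_le(1)[of v z] s
    by (intro add_mono divide_right_mono) (auto simp: P_def r_def s_def)
  also have "\<dots> = 2 * (norm v / r) + cmod (hinner v z) / s"
  proof -
    have "r * norm v / (r * r) = norm v / r" using s(2) by simp
    then have "r * norm v / s = norm v / r" unfolding s(3) .
    then show ?thesis by (simp add: add_divide_distrib)
  qed
  finally have nx: "norm x \<le> 2 * (norm v / r) + cmod (hinner v z) / s" .
  have "cmod (sderiv v f z) = cmod (\<Sum>k\<in>UNIV. x $ k * invariant_grad f z $ k)"
    unfolding sderiv_invol_deriv[OF f z, symmetric] Lx ..
  also have "\<dots> \<le> norm x * norm (invariant_grad f z)" by (rule sum_mult_norm_le)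
  also have "\<dots> \<le> (2 * (norm v / r) + cmod (hinner v z) / s) * norm (invariant_grad f z)"
    by (intro mult_right_mono nx) simp
  finally show ?thesis by (simp add: r_def s_def mult.commute)
qed

lemma sderiv_line_proj_le:
  fixes f :: "complex ^ 'n \<Rightarrow> complex"
  assumes f: "ball_holomorphic f" and z: "z \<in> unit_ball" and rad: "cmod (sderiv z f z) \<le> N * norm z"
  shows "cmod (sderiv (line_proj z x) f z) \<le> N * norm (line_proj z x)"
proof -
  let ?c = "hinner x z / of_real ((norm z)\<^sup>2)"
  have "cmod (sderiv (line_proj z x) f z) = cmod ?c * cmod (sderiv z f z)"
    by (simp add: line_proj_multiple sderiv_smult[OF f z] norm_mult norm_divide del: of_real_power)
  also have "\<dots> \<le> cmod ?c * (N * norm z)" by (intro mult_left_mono rad) auto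
  finally show ?thesis by (simp add: line_proj_multiple norm_vec_smult mult_ac del: of_real_power)
qed

text \<open>The converse passage: the involution weights radial derivatives by \<open>dfct z\<close>
  and tangential ones by its square root.\<close>

lemma invariant_grad_le:
  fixes f :: "complex ^ 'n \<Rightarrow> complex"
  assumes f: "ball_holomorphic f" and z: "z \<in> unit_ball" and TN: "T \<ge> 0" "N \<ge> 0"
    and tan: "\<And>u. hinner u z = 0 \<Longrightarrow> cmod (sderiv u f z) \<le> T * norm u"
    and rad: "cmod (sderiv z f z) \<le> N * norm z"
  shows "norm (invariant_grad f z) \<le> dfct z * N + sqrt (dfct z) * T"
proof (rule norm_le_of_functional_bound)
  have s: "dfct z > 0" by (rule dfct_pos[OF z])
  show "0 \<le> dfct z * N + sqrt (dfct z) * T" using s TN by simp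
  fix x :: "complex ^ 'n"
  let ?P = "line_proj z x"
  note radP = sderiv_line_proj_le[OF f z rad, of x]
  have "(\<Sum>k\<in>UNIV. x $ k * invariant_grad f z $ k) = sderiv (invol_deriv z x) f z"
    by (rule sderiv_invol_deriv[OF f z, symmetric])
  also have "invol_deriv z x = (- of_real (dfct z)) *s ?P + (- of_real (sqrt (dfct z))) *s (x - ?P)"
    by (simp add: invol_deriv_def flip: of_real_vec_smult)
  also have "sderiv \<dots> f z = (- of_real (dfct z)) * sderiv ?P f z + (- of_real (sqrt (dfct z))) * sderiv (x - ?P) f z"
    by (simp only: sderiv_add[OF f z] sderiv_smult[OF f z])
  also have "cmod \<dots> \<le> dfct z * cmod (sderiv ?P f z) + sqrt (dfct z) * cmod (sderiv (x - ?P) f z)"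
    using s norm_triangle_ineq[of "(- of_real (dfct z)) * sderiv ?P f z" "(- of_real (sqrt (dfct z))) * sderiv (x - ?P) f z"]
    by (simp add: norm_mult)
  also have "\<dots> \<le> dfct z * (N * norm x) + sqrt (dfct z) * (T * norm x)"
  proof (intro add_mono mult_left_mono)
    show "cmod (sderiv ?P f z) \<le> N * norm x"
      using radP mult_left_mono[OF norm_perp_le(2)[of z x] TN(2)] by simp
    show "cmod (sderiv (x - ?P) f z) \<le> T * norm x"
      using tan[OF hinner_perp] mult_left_mono[OF norm_perp_le(1)[of x z] TN(1)] by (rule order_trans)
  qed (use s in auto)
  finally show "cmod (\<Sum>k\<in>UNIV. x $ k * invariant_grad f z $ k) \<le> (dfct z * N + sqrt (dfct z) * T) * norm x"
    by (simp add: algebra_simps)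
qed

text \<open>Tangential derivatives of a Bloch type function gain half a power of \<open>1 - |z|\<^sup>2\<close>: the disc of
  radius comparable to \<open>(1 - |z|\<^sup>2) powr (1/2)\<close> in a direction orthogonal to \<open>z\<close> stays in the ball.\<close>

lemma tangential_increment:
  fixes f :: "complex ^ 'n \<Rightarrow> complex"
  assumes f: "ball_holomorphic f" and M: "M \<ge> 0" and \<delta>: "\<delta> \<le> 1"
    and bloch: "\<And>x v. x \<in> unit_ball \<Longrightarrow> cmod (sderiv v f x) \<le> M * (dfct x powr (\<delta> - 1) * norm v)"
    and \<zeta>: "norm \<zeta> = 1" and u: "norm u = 1" "hinner u \<zeta> = 0" and y: "0 < y" "2 * y \<le> 1"
  shows "cmod (sderiv u f ((1 - y) *\<^sub>R \<zeta>) - sderiv u f ((1 - 2 * y) *\<^sub>R \<zeta>)) \<le> M * 2 powr (3/2 - \<delta>) * y powr (\<delta> - 1/2)"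
proof -
  \<comment> \<open>With \<open>\<rho> \<le> 1 - y\<close> and \<open>cmod \<xi> \<le> R\<close> the
    squared norm of the point is at most \<open>(1 - y) + y / 2\<close>, so the whole disc stays at
    depth at least \<open>y / 2\<close>.\<close>
  define R where "R = sqrt (y / 2)"
  have R: "R > 0" "R\<^sup>2 = y / 2" using y by (auto simp: R_def)
  have nrm: "(norm (\<rho> *\<^sub>R \<zeta> + \<xi> *s u))\<^sup>2 = \<rho>\<^sup>2 + (cmod \<xi>)\<^sup>2" for \<rho> \<xi>
  proof -
    have i: "inner (\<rho> *\<^sub>R \<zeta>) (\<xi> *s u) = 0"
      using u(2) cnj_hinner[of u \<zeta>] by (simp flip: Re_hinner)
    have "(norm (\<rho> *\<^sub>R \<zeta> + \<xi> *s u))\<^sup>2 = (norm (\<rho> *\<^sub>R \<zeta>))\<^sup>2 + (norm (\<xi> *s u))\<^sup>2"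
      using norm_add_Pythagorean[OF i[folded orthogonal_def]] .
    then show ?thesis using \<zeta> u by (simp add: norm_vec_smult)
  qed
  have dep: "y / 2 \<le> dfct (\<rho> *\<^sub>R \<zeta> + \<xi> *s u)" "\<rho> *\<^sub>R \<zeta> + \<xi> *s u \<in> unit_ball"
    if "0 \<le> \<rho>" "\<rho> \<le> 1 - y" "cmod \<xi> \<le> R" for \<rho> \<xi>
  proof -
    have "\<rho>\<^sup>2 \<le> (1 - y)\<^sup>2" using that by (intro power_mono) auto
    also have "\<dots> \<le> 1 - y" using y by (simp add: power2_eq_square mult_left_le)
    finally have "\<rho>\<^sup>2 + (cmod \<xi>)\<^sup>2 \<le> 1 - y / 2"
      using power_mono[OF that(3), of 2] R by simp
    then have n: "(norm (\<rho> *\<^sub>R \<zeta> + \<xi> *s u))\<^sup>2 \<le> 1 - y / 2" by (simp only: nrm)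
    then show "y / 2 \<le> dfct (\<rho> *\<^sub>R \<zeta> + \<xi> *s u)" by (simp add: dfct_def)
    have "(norm (\<rho> *\<^sub>R \<zeta> + \<xi> *s u))\<^sup>2 < 1\<^sup>2" using n y by simp
    then show "\<rho> *\<^sub>R \<zeta> + \<xi> *s u \<in> unit_ball" using power2_less_imp_less by fastforce
  qed
  \<comment> \<open>Cauchy's inequality is applied to a radial increment of \<open>f\<close>: its
    bound is the Bloch bound times the length \<open>y\<close>, and division by \<open>R\<close>
    leaves the order \<open>y powr (\<delta> - 1/2)\<close>.\<close>
  define g where "g \<xi> = f ((1 - y) *\<^sub>R \<zeta> + \<xi> *s u) - f ((1 - 2 * y) *\<^sub>R \<zeta> + \<xi> *s u)" for \<xi>
  define B where "B = M * ((y / 2) powr (\<delta> - 1) * y)"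
  have gB: "cmod (g \<xi>) \<le> B" if \<xi>: "cmod \<xi> \<le> R" for \<xi>
    unfolding g_def
  proof (rule segment_bound[OF f])
    show "(1 - 2 * y) *\<^sub>R \<zeta> + \<xi> *s u \<in> unit_ball" "(1 - y) *\<^sub>R \<zeta> + \<xi> *s u \<in> unit_ball"
      using y \<xi> by (auto intro!: dep(2) simp del: mem_ball mem_ball_0)
    fix t :: real assume t: "0 < t" "t < 1"
    let ?v = "(1 - y) *\<^sub>R \<zeta> + \<xi> *s u - ((1 - 2 * y) *\<^sub>R \<zeta> + \<xi> *s u)"
    have v: "?v = y *\<^sub>R \<zeta>"
    proof -
      have "?v = ((1 - y) - (1 - 2 * y)) *\<^sub>R \<zeta>"
        by (simp only: scaleR_left_diff_distrib add_diff_cancel_right)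
      then show ?thesis by simp
    qed
    define \<rho> where "\<rho> = 1 - 2 * y + t * y"
    have \<rho>: "0 \<le> \<rho>" "\<rho> \<le> 1 - y" using t y mult_right_mono[of t 1 y] by (auto simp: \<rho>_def)
    have x: "(1 - 2 * y) *\<^sub>R \<zeta> + \<xi> *s u + t *\<^sub>R (y *\<^sub>R \<zeta>) = \<rho> *\<^sub>R \<zeta> + \<xi> *s u"
      unfolding \<rho>_def by (simp add: scaleR_left_distrib)
    have "cmod (sderiv (y *\<^sub>R \<zeta>) f (\<rho> *\<^sub>R \<zeta> + \<xi> *s u)) \<le> M * (dfct (\<rho> *\<^sub>R \<zeta> + \<xi> *s u) powr (\<delta> - 1) * norm (y *\<^sub>R \<zeta>))"
      by (rule bloch[OF dep(2)[OF \<rho> \<xi>]])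
    also have "\<dots> \<le> M * ((y / 2) powr (\<delta> - 1) * y)"
      using dep(1)[OF \<rho> \<xi>] y \<delta> \<zeta> by (intro mult_left_mono mult_mono powr_mono2' M) auto
    finally show "cmod (sderiv ?v f ((1 - 2 * y) *\<^sub>R \<zeta> + \<xi> *s u + t *\<^sub>R ?v)) \<le> B"
      unfolding x v B_def .
  qed
  have sl: "slice_hol 1 f" by (rule ball_holomorphic_imp_slice_hol[OF f])
  have dg: "(g has_field_derivative sderiv u f ((1 - y) *\<^sub>R \<zeta> + \<xi> *s u) - sderiv u f ((1 - 2 * y) *\<^sub>R \<zeta> + \<xi> *s u)) (at \<xi>)"
    if \<xi>: "cmod \<xi> \<le> R" for \<xi>
    unfolding g_def
    by (intro DERIV_diff slice_hol_has_field_derivative[OF sl] dep(2)) (use y \<xi> in auto)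
  have "cmod ((deriv ^^ 1) g 0) \<le> fact 1 * B / R ^ 1"
  proof (rule Cauchy_inequality)
    show "g holomorphic_on ball 0 R"
      unfolding holomorphic_on_open[OF open_ball]
    proof
      fix x :: complex assume "x \<in> ball 0 R"
      then have "cmod x \<le> R" by simp
      from dg[OF this] show "\<exists>f'. (g has_field_derivative f') (at x)" by blast
    qed
    show "continuous_on (cball 0 R) g"
    proof (rule continuous_at_imp_continuous_on, rule ballI)
      fix x :: complex assume "x \<in> cball 0 R"
      then have "cmod x \<le> R" by simp
      from DERIV_isCont[OF dg[OF this]] show "isCont g x" .
    qed
    show "cmod (g x) \<le> B" if "cmod (0 - x) = R" for x using gB[of x] that by simp
  qed (use R in auto)
  moreover have "deriv g 0 = sderiv u f ((1 - y) *\<^sub>R \<zeta>) - sderiv u f ((1 - 2 * y) *\<^sub>R \<zeta>)"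
    using DERIV_imp_deriv[OF dg[of 0]] R by simp
  moreover have "B / R = M * 2 powr (3/2 - \<delta>) * y powr (\<delta> - 1/2)"
  proof -
    have "B / R = M * (2 * ((y / 2) powr (\<delta> - 1) * (y / 2) powr 1) / (y / 2) powr (1/2))"
      using y by (simp add: B_def R_def powr_half_sqrt)
    also have "\<dots> = M * (2 * (y / 2) powr (\<delta> - 1/2))"
      unfolding powr_add[symmetric] by (simp add: powr_diff[symmetric] flip: times_divide_eq_right)
    also have "\<dots> = M * ((2 powr 1 * 2 powr (- (\<delta> - 1/2))) * y powr (\<delta> - 1/2))"
      by (simp add: powr_divide powr_minus divide_simps)
    also have "\<dots> = M * 2 powr (3/2 - \<delta>) * y powr (\<delta> - 1/2)"
      unfolding powr_add[symmetric] by simp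
    finally show ?thesis .
  qed
  ultimately show ?thesis by simp
qed

text \<open>The depth \<open>y\<close> is doubled until it reaches 1/2, each doubling costing one
  \<open>tangential_increment\<close>. Doubling multiplies \<open>y powr (\<delta> - 1/2)\<close> by
  \<open>h\<close>, and \<open>\<delta> < 1/2\<close> makes \<open>h < 1\<close>, so the accumulated
  increments form a geometric series.\<close>

lemma tangential_bound:
  fixes f :: "complex ^ 'n \<Rightarrow> complex"
  assumes f: "ball_holomorphic f" and M: "M \<ge> 0" and \<delta>: "0 \<le> \<delta>" "\<delta> < 1/2"
    and bloch: "\<And>x v. x \<in> unit_ball \<Longrightarrow> cmod (sderiv v f x) \<le> M * (dfct x powr (\<delta> - 1) * norm v)"
  obtains C where "C > 0" "\<And>z u. z \<in> unit_ball \<Longrightarrow> hinner u z = 0 \<Longrightarrow>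
    cmod (sderiv u f z) \<le> C * (dfct z powr (\<delta> - 1/2) * norm u)"
proof -
  define h where "h = 2 powr (\<delta> - 1/2)"
  have h: "0 < h" "h < 1" using \<delta> by (auto simp: h_def intro!: powr_less_one)
  \<comment> \<open>The first entry settles depths of at least 1/2; the second makes the recursion
    \<open>A * h + M * 2 powr (3/2 - \<delta>) \<le> A\<close> hold.\<close>
  define A where "A = max (2 * M) (M * 2 powr (3/2 - \<delta>) / (1 - h))"
  have A: "A \<ge> 2 * M" "A * (1 - h) \<ge> M * 2 powr (3/2 - \<delta>)" "A \<ge> 0"
  proof -
    show "A \<ge> 2 * M" by (simp add: A_def)
    then show "A \<ge> 0" using M by simp
    have "M * 2 powr (3/2 - \<delta>) / (1 - h) \<le> A" by (simp add: A_def)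
    then show "A * (1 - h) \<ge> M * 2 powr (3/2 - \<delta>)" using h by (simp add: divide_le_eq)
  qed
  have main: "cmod (sderiv u f ((1 - y) *\<^sub>R \<zeta>)) \<le> A * y powr (\<delta> - 1/2)"
    if "norm \<zeta> = 1" "norm u = 1" "hinner u \<zeta> = 0" "1 / 2 ^ k \<le> y" "y \<le> 1" for \<zeta> u y and k :: nat
    using that
  proof (induction k arbitrary: y)
    case (0 y)
    then have y: "y = 1" by simp
    have "cmod (sderiv u f 0) \<le> M * (dfct (0 :: complex ^ 'n) powr (\<delta> - 1) * norm u)"
      by (rule bloch) simp
    then show ?case using 0 y A M by (simp add: dfct_def)
  next
    case (Suc k y)
    have y: "y > 0" using Suc.prems by (intro less_le_trans[OF _ Suc.prems(4)]) simp
    show ?case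
    proof (cases "y \<ge> 1/2")
      case True
      have b: "(1 - y) *\<^sub>R \<zeta> \<in> unit_ball" using y Suc.prems by simp
      have "1/2 \<le> dfct ((1 - y) *\<^sub>R \<zeta>)"
      proof -
        have "(1 - y) * (1 - y) \<le> (1 - y) * 1" using y Suc.prems by (intro mult_left_mono) auto
        then show ?thesis using True Suc.prems by (simp add: dfct_def power2_eq_square)
      qed
      then have "dfct ((1 - y) *\<^sub>R \<zeta>) powr (\<delta> - 1) \<le> (1/2) powr (\<delta> - 1)"
        using \<delta> by (intro powr_mono2') auto
      also have "\<dots> \<le> (1/2) powr (-1)" using \<delta> by (intro powr_mono') auto
      finally have "M * (dfct ((1 - y) *\<^sub>R \<zeta>) powr (\<delta> - 1) * norm u) \<le> M * (2 * 1)"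
        using Suc.prems by (intro mult_left_mono M) (simp add: powr_minus)
      also have "\<dots> \<le> A * 1" using A by simp
      also have "\<dots> \<le> A * y powr (\<delta> - 1/2)"
      proof (intro mult_left_mono A)
        have "1 powr (\<delta> - 1/2) \<le> y powr (\<delta> - 1/2)" using y Suc.prems \<delta> by (intro powr_mono2') auto
        then show "1 \<le> y powr (\<delta> - 1/2)" by simp
      qed
      finally show ?thesis using bloch[OF b, of u] by linarith
    next
      case False
      have "cmod (sderiv u f ((1 - y) *\<^sub>R \<zeta>)) \<le> cmod (sderiv u f ((1 - 2 * y) *\<^sub>R \<zeta>))
        + cmod (sderiv u f ((1 - y) *\<^sub>R \<zeta>) - sderiv u f ((1 - 2 * y) *\<^sub>R \<zeta>))"
        using norm_triangle_ineq[of "sderiv u f ((1 - 2 * y) *\<^sub>R \<zeta>)" "sderiv u f ((1 - y) *\<^sub>R \<zeta>) - sderiv u f ((1 - 2 * y) *\<^sub>R \<zeta>)"] by simp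
      also have "\<dots> \<le> A * (2 * y) powr (\<delta> - 1/2) + M * 2 powr (3/2 - \<delta>) * y powr (\<delta> - 1/2)"
      proof (rule add_mono)
        show "cmod (sderiv u f ((1 - 2 * y) *\<^sub>R \<zeta>)) \<le> A * (2 * y) powr (\<delta> - 1/2)"
          by (rule Suc.IH) (use Suc.prems False in \<open>auto simp: field_simps\<close>)
        show "cmod (sderiv u f ((1 - y) *\<^sub>R \<zeta>) - sderiv u f ((1 - 2 * y) *\<^sub>R \<zeta>)) \<le> M * 2 powr (3/2 - \<delta>) * y powr (\<delta> - 1/2)"
          by (rule tangential_increment[OF f M _ bloch]) (use Suc.prems False y \<delta> in auto)
      qed
      also have "\<dots> = (A * h + M * 2 powr (3/2 - \<delta>)) * y powr (\<delta> - 1/2)"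
        by (simp add: h_def powr_mult algebra_simps)
      also have "\<dots> \<le> A * y powr (\<delta> - 1/2)"
        using A(2) by (intro mult_right_mono) (auto simp: algebra_simps)
      finally show ?thesis .
    qed
  qed
  define C where "C = A * 2 powr (1/2 - \<delta>) + M + 1"
  have C: "C > 0" "M \<le> C" "A * 2 powr (1/2 - \<delta>) \<le> C" using A M by (auto simp: C_def add_nonneg_pos)
  show thesis
  proof (rule that[OF C(1)])
    fix z u :: "complex ^ 'n" assume z: "z \<in> unit_ball" and u: "hinner u z = 0"
    show "cmod (sderiv u f z) \<le> C * (dfct z powr (\<delta> - 1/2) * norm u)"
    proof (cases "u = 0 \<or> z = 0")
      case True
      then show ?thesis
      proof
        assume z0: "z = 0"
        have "cmod (sderiv u f z) \<le> M * (dfct z powr (\<delta> - 1) * norm u)" by (rule bloch[OF z])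
        also have "\<dots> = M * norm u" by (simp add: z0 dfct_def)
        also have "\<dots> \<le> C * norm u" using C by (intro mult_right_mono) auto
        finally show ?thesis by (simp add: z0 dfct_def)
      qed (simp add: sderiv_zero)
    next
      case False
      define r where "r = norm z"
      have r: "0 < r" "r < 1" using False z by (auto simp: r_def)
      define \<zeta> where "\<zeta> = (1 / r) *\<^sub>R z"
      define u' where "u' = (1 / norm u) *\<^sub>R u"
      have \<zeta>: "norm \<zeta> = 1" "z = (1 - (1 - r)) *\<^sub>R \<zeta>" using r by (auto simp: \<zeta>_def r_def)
      have u': "norm u' = 1" "hinner u' \<zeta> = 0" using False u by (auto simp: u'_def \<zeta>_def)
      obtain k where "(1/2::real) ^ k < 1 - r" using real_arch_pow_inv[of "1 - r" "1/2"] r by auto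
      then have k: "1 / 2 ^ k \<le> 1 - r" by (simp add: power_one_over)
      have "dfct z = (1 + r) * (1 - r)" by (simp add: dfct_def r_def power2_eq_square algebra_simps)
      also have "\<dots> \<le> 2 * (1 - r)" using r by (intro mult_right_mono) auto
      finally have dz: "dfct z / 2 \<le> 1 - r" by simp
      have "cmod (sderiv u' f z) \<le> A * (1 - r) powr (\<delta> - 1/2)"
        using main[OF \<zeta>(1) u' k] r \<zeta>(2) by simp
      also have "\<dots> \<le> A * (dfct z / 2) powr (\<delta> - 1/2)"
        using dz dfct_pos[OF z] \<delta> by (intro mult_left_mono powr_mono2' A) auto
      also have "\<dots> = A * 2 powr (1/2 - \<delta>) * dfct z powr (\<delta> - 1/2)"
      proof -
        have "2 powr (1/2 - \<delta>) * 2 powr (\<delta> - 1/2) = (1::real)" unfolding powr_add[symmetric] by simp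
        then show ?thesis by (simp add: powr_divide field_simps)
      qed
      also have "\<dots> \<le> C * dfct z powr (\<delta> - 1/2)" using C by (intro mult_right_mono) auto
      finally have le: "cmod (sderiv u' f z) \<le> C * dfct z powr (\<delta> - 1/2)" .
      have "u = norm u *\<^sub>R u'" using False by (simp add: u'_def)
      then have "sderiv u f z = of_real (norm u) * sderiv u' f z" by (metis sderiv_scaleR[OF f z])
      then have "cmod (sderiv u f z) = norm u * cmod (sderiv u' f z)" by (simp add: norm_mult)
      also have "\<dots> \<le> norm u * (C * dfct z powr (\<delta> - 1/2))" by (intro mult_left_mono le) auto
      finally show ?thesis by (simp add: mult_ac)
    qed
  qed
qed

section \<open>Sufficiency\<close>

lemma powr_add_le:
  fixes x y q :: real
  assumes "x \<ge> 0" "y \<ge> 0" "q \<ge> 0"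
  shows "(x + y) powr q \<le> 2 powr q * (x powr q + y powr q)"
proof -
  have "(x + y) powr q \<le> (2 * max x y) powr q"
    using assms by (intro powr_mono2) auto
  also have "\<dots> = 2 powr q * (max x y) powr q" by (rule powr_mult)
  also have "(max x y) powr q \<le> x powr q + y powr q" by (auto simp: max_def)
  finally show ?thesis by simp
qed

lemma dominated_Lq:
  fixes H :: "complex ^ 'n \<Rightarrow> complex" and A B :: "complex ^ 'n \<Rightarrow> real"
  assumes H: "H \<in> borel_measurable (bmeas \<beta>)" and q: "q \<ge> 0" and c: "c \<ge> 0"
    and nonneg: "\<And>z. z \<in> unit_ball \<Longrightarrow> A z \<ge> 0" "\<And>z. z \<in> unit_ball \<Longrightarrow> B z \<ge> 0"
    and int: "integrable (bmeas \<beta>) (\<lambda>z. A z powr q)" "integrable (bmeas \<beta>) (\<lambda>z. B z powr q)"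
    and le: "\<And>z. z \<in> unit_ball \<Longrightarrow> cmod (H z) \<le> c * (A z + B z)"
  shows "integrable (bmeas \<beta>) (\<lambda>z. cmod (H z) powr q)"
    and "(\<integral>z. cmod (H z) powr q \<partial>bmeas \<beta>) \<le>
      (c powr q * 2 powr q) * ((\<integral>z. A z powr q \<partial>bmeas \<beta>) + (\<integral>z. B z powr q \<partial>bmeas \<beta>))"
proof -
  have pt: "cmod (H z) powr q \<le> (c powr q * 2 powr q) * (A z powr q + B z powr q)" if z: "z \<in> unit_ball" for z
  proof -
    have "cmod (H z) powr q \<le> (c * (A z + B z)) powr q"
      using le[OF z] q by (intro powr_mono2) auto
    also have "\<dots> = c powr q * (A z + B z) powr q" by (rule powr_mult)
    also have "\<dots> \<le> c powr q * (2 powr q * (A z powr q + B z powr q))"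
      using nonneg[OF z] q by (intro mult_left_mono powr_add_le) auto
    finally show ?thesis by (simp add: mult.assoc)
  qed
  have D: "integrable (bmeas \<beta>) (\<lambda>z. (c powr q * 2 powr q) * (A z powr q + B z powr q))" using int by simp
  show I: "integrable (bmeas \<beta>) (\<lambda>z. cmod (H z) powr q)"
  proof (rule Bochner_Integration.integrable_bound[OF D powr_norm_measurable[OF H]])
    show "AE z in bmeas \<beta>. norm (cmod (H z) powr q) \<le> norm ((c powr q * 2 powr q) * (A z powr q + B z powr q))"
    proof (rule AE_I2)
      fix z :: "complex ^ 'n" assume "z \<in> space (bmeas \<beta>)"
      then have "cmod (H z) powr q \<le> (c powr q * 2 powr q) * (A z powr q + B z powr q)" using pt by simp
      then show "norm (cmod (H z) powr q) \<le> norm ((c powr q * 2 powr q) * (A z powr q + B z powr q))"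
        by (simp only: real_norm_def) (simp add: order_trans[OF _ abs_ge_self])
    qed
  qed
  have "(\<integral>z. cmod (H z) powr q \<partial>bmeas \<beta>) \<le> (\<integral>z. (c powr q * 2 powr q) * (A z powr q + B z powr q) \<partial>bmeas \<beta>)"
    by (rule integral_mono[OF I D]) (use pt in simp)
  also have "\<dots> = (c powr q * 2 powr q) * ((\<integral>z. A z powr q \<partial>bmeas \<beta>) + (\<integral>z. B z powr q \<partial>bmeas \<beta>))"
    using int by simp
  finally show "(\<integral>z. cmod (H z) powr q \<partial>bmeas \<beta>) \<le>
      (c powr q * 2 powr q) * ((\<integral>z. A z powr q \<partial>bmeas \<beta>) + (\<integral>z. B z powr q \<partial>bmeas \<beta>))" .
qed

lemma Lq_imp_L1:
  fixes H :: "complex ^ 'n \<Rightarrow> complex"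
  assumes "\<beta> > -1" "q \<ge> 1" "H \<in> borel_measurable (bmeas \<beta>)" "integrable (bmeas \<beta>) (\<lambda>z. cmod (H z) powr q)"
  shows "integrable (bmeas \<beta>) H"
proof (rule Bochner_Integration.integrable_bound)
  interpret finite_measure "bmeas \<beta> :: (complex ^ 'n) measure" by (rule finite_measure_bmeas[OF assms(1)])
  show "integrable (bmeas \<beta>) (\<lambda>z. 1 + cmod (H z) powr q)" using assms(4) by simp
  have "cmod (H z) \<le> 1 + cmod (H z) powr q" for z
  proof (cases "cmod (H z) \<le> 1")
    case False
    then have "cmod (H z) powr 1 \<le> cmod (H z) powr q" using assms(2) by (intro powr_mono) auto
    then show ?thesis using False by simp
  qed (simp add: add_increasing2)
  then show "AE z in bmeas \<beta>. cmod (H z) \<le> norm (1 + cmod (H z) powr q)"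
    by (intro AE_I2) (simp add: order_trans[OF _ abs_ge_self])
qed (use assms in auto)

text \<open>Exponent bookkeeping: one term of the oscillation bound times the Bergman kernel is a
  Schur kernel with parameters \<open>a\<close> and \<open>b + (c + \<gamma>)\<close>, with its
  outer weight and its change of measure, acting on \<open>x * sw powr (- \<gamma>)\<close>, the
  quantity controlled by \<open>weighted_embedding\<close>.\<close>

lemma kernel_term_eq:
  fixes d sz sw x :: real
  assumes "d > 0" "sw > 0"
  shows "(d powr (- \<gamma> - a - c) * sz powr a * sw powr c) * x * d powr (- (n + 1 + b)) =
    sz powr a * (sw powr (c + \<gamma>) * (d powr (- (n + 1 + a + (b + (c + \<gamma>)))) * (x * sw powr (- \<gamma>))))"
proof -
  have e1: "d powr (- \<gamma> - a - c) * d powr (- (n + 1 + b)) = d powr (- (n + 1 + a + (b + (c + \<gamma>))))"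
    unfolding powr_add[symmetric] by (rule arg_cong[of _ _ "\<lambda>e. d powr e"]) simp
  have e2: "sw powr (c + \<gamma>) * sw powr (- \<gamma>) = sw powr c"
    unfolding powr_add[symmetric] by simp
  have "(d powr (- \<gamma> - a - c) * sz powr a * sw powr c) * x * d powr (- (n + 1 + b))
    = sz powr a * (sw powr c * ((d powr (- \<gamma> - a - c) * d powr (- (n + 1 + b))) * x))"
    by (simp only: mult_ac)
  also have "\<dots> = sz powr a * ((sw powr (c + \<gamma>) * sw powr (- \<gamma>)) * (d powr (- (n + 1 + a + (b + (c + \<gamma>)))) * x))"
    by (simp only: e1 e2)
  finally show ?thesis by (simp only: mult_ac)
qed

text \<open>The projection with weight \<open>\<beta>\<close> fixes the holomorphic function
  \<open>bergman_proj b \<psi>\<close>, so the complementary projection gives the same result on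
  \<open>\<psi>\<close> and on \<open>\<psi>\<close> minus that function. Integrability of
  \<open>hankel b f g\<close> puts the function in the range of the reproducing formula.\<close>

lemma hankel_decomposition:
  fixes f g :: "complex ^ 'n \<Rightarrow> complex"
  assumes f: "integrable (bmeas \<beta>) f" and g: "g \<in> H_infinity" and \<beta>: "\<beta> > -1" and b: "\<beta> \<le> b"
    and Hb: "integrable (bmeas \<beta>) (hankel b f g)" and z: "z \<in> unit_ball"
  shows "hankel \<beta> f g z = hankel b f g z - bergman_proj \<beta> (hankel b f g) z"
proof -
  let ?m = "of_real (bmass TYPE('n) \<beta>) :: complex" and ?k = "\<lambda>w. kpow (real CARD('n) + 1 + \<beta>) (hinner z w)"
  define \<psi> where "\<psi> = (\<lambda>w. cnj (f w) * g w)"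
  have b1: "b > -1" using \<beta> b by simp
  have \<psi>: "integrable (bmeas \<beta>) \<psi>" unfolding \<psi>_def by (rule symbol_times_H_infinity_integrable[OF f g])
  have \<psi>b: "integrable (bmeas b) \<psi>" by (rule integrable_bmeas_mono[OF \<psi> b])
  have hb: "hankel b f g = (\<lambda>w. \<psi> w - bergman_proj b \<psi> w)" by (simp add: hankel_def \<psi>_def)
  have "bergman_proj b \<psi> = (\<lambda>w. \<psi> w - hankel b f g w)" by (simp add: hb)
  then have Pi: "integrable (bmeas \<beta>) (bergman_proj b \<psi>)" using \<psi> Hb by simp
  have P: "bergman_proj \<beta> (bergman_proj b \<psi>) z = bergman_proj b \<psi> z"
    by (rule bergman_proj_reproduces[OF bergman_proj_holomorphic[OF b1 \<psi>b] Pi \<beta> z])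
  have "bergman_proj \<beta> (hankel b f g) z = (\<integral>w. hankel b f g w * ?k w \<partial>bmeas \<beta>) / ?m"
    by (rule bergman_proj_eq[OF \<beta> borel_measurable_integrable[OF Hb] z])
  also have "(\<integral>w. hankel b f g w * ?k w \<partial>bmeas \<beta>) = (\<integral>w. \<psi> w * ?k w \<partial>bmeas \<beta>) - (\<integral>w. bergman_proj b \<psi> w * ?k w \<partial>bmeas \<beta>)"
    unfolding hb left_diff_distrib
    by (rule Bochner_Integration.integral_diff) (intro integrable_mult_kpow \<psi> Pi z)+
  also have "\<dots> / ?m = bergman_proj \<beta> \<psi> z - bergman_proj \<beta> (bergman_proj b \<psi>) z"
    unfolding bergman_proj_eq[OF \<beta> borel_measurable_integrable[OF \<psi>] z] bergman_proj_eq[OF \<beta> borel_measurable_integrable[OF Pi] z]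
    by (rule diff_divide_distrib)
  finally have "bergman_proj \<beta> (hankel b f g) z = bergman_proj \<beta> \<psi> z - bergman_proj b \<psi> z" unfolding P .
  then show ?thesis by (simp add: hb) (simp add: hankel_def \<psi>_def)
qed

text \<open>Replacing \<open>P\<^sub>\<beta>\<close> by a projection \<open>P\<^sub>b\<close> with large \<open>b\<close> makes the absolute value of the kernel
  integrable enough whatever \<open>\<alpha>\<close> is; the two Hankel operators differ by \<open>P\<^sub>\<beta>\<close> applied to \<open>H\<^sup>b\<close>.\<close>

lemma hankel_bounded_of_oscillation:
  fixes f :: "complex ^ 'n \<Rightarrow> complex"
  assumes \<alpha>: "\<alpha> > -1" and \<beta>: "\<beta> > -1" and p: "p > 1" and pq: "p \<le> q"
    and \<gamma>: "\<gamma> = (real CARD('n) + 1 + \<beta>) / q - (real CARD('n) + 1 + \<alpha>) / p"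
    and f: "ball_holomorphic f" and fi: "integrable (bmeas \<beta>) f" and C: "C > 0"
    and a: "- q * a1 < \<beta> + 1" "- q * a2 < \<beta> + 1"
    and osc: "\<And>z w. z \<in> unit_ball \<Longrightarrow> w \<in> unit_ball \<Longrightarrow> cmod (f z - f w) \<le>
      C * (cmod (1 - hinner z w) powr (- \<gamma> - a1 - c1) * dfct z powr a1 * dfct w powr c1
        + cmod (1 - hinner z w) powr (- \<gamma> - a2 - c2) * dfct z powr a2 * dfct w powr c2)"
  shows "hankel_bounded p \<alpha> q \<beta> f"
proof -
  define n where "n = real CARD('n)"
  have q: "q > 1" using p pq by simp
  \<comment> \<open>Chosen so that \<open>b + (c + \<gamma>) > \<beta>\<close> for both values of
    \<open>c\<close>, which with \<open>q > 1\<close> gives the upper condition of Schur's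
    test.\<close>
  define b where "b = \<beta> + 1 + \<bar>c1\<bar> + \<bar>c2\<bar> + \<bar>\<gamma>\<bar>"
  have b: "\<beta> \<le> b" "b > -1" using \<beta> by (auto simp: b_def)
  have bi: "\<beta> + 1 < q * (b + (c + \<gamma>) + 1)" if "c = c1 \<or> c = c2" for c
  proof -
    have "\<beta> + 1 < b + (c + \<gamma>) + 1" using that by (auto simp: b_def abs_if)
    also have "\<dots> = 1 * (b + (c + \<gamma>) + 1)" by simp
    also have "\<dots> \<le> q * (b + (c + \<gamma>) + 1)"
      using q that \<beta> by (intro mult_right_mono) (auto simp: b_def abs_if)
    finally show ?thesis .
  qed
  define K where "K a r z w = cmod (1 - hinner z w) powr (- (n + 1 + a + r))" for a r and z w :: "complex ^ 'n"
  define T where "T a r G z = dfct z powr a * (\<integral>w. K a r z w * G w \<partial>bmeas r)" for a r and G :: "complex ^ 'n \<Rightarrow> real" and z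
  have schur: "\<exists>S>0. \<forall>G. G \<in> borel_measurable (bmeas \<beta>) \<longrightarrow> (\<forall>w. G w \<ge> 0) \<longrightarrow> integrable (bmeas \<beta>) (\<lambda>w. G w powr q) \<longrightarrow>
      (\<forall>z\<in>unit_ball. integrable (bmeas r) (\<lambda>w. K a r z w * G w)) \<and> integrable (bmeas \<beta>) (\<lambda>z. T a r G z powr q) \<and>
      (\<integral>z. T a r G z powr q \<partial>bmeas \<beta>) \<le> S * (\<integral>w. G w powr q \<partial>bmeas \<beta>)"
    if "- q * a < \<beta> + 1" "\<beta> + 1 < q * (r + 1)" for a r
    by (rule schur_test[OF \<beta> q that, where 'n = 'n]) (unfold T_def K_def n_def, blast)
  obtain S1 where S1: "S1 > 0" "\<And>G. G \<in> borel_measurable (bmeas \<beta>) \<Longrightarrow> (\<forall>w. G w \<ge> 0) \<Longrightarrow> integrable (bmeas \<beta>) (\<lambda>w. G w powr q) \<Longrightarrow>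
      (\<forall>z\<in>unit_ball. integrable (bmeas (b + (c1 + \<gamma>))) (\<lambda>w. K a1 (b + (c1 + \<gamma>)) z w * G w)) \<and> integrable (bmeas \<beta>) (\<lambda>z. T a1 (b + (c1 + \<gamma>)) G z powr q) \<and>
      (\<integral>z. T a1 (b + (c1 + \<gamma>)) G z powr q \<partial>bmeas \<beta>) \<le> S1 * (\<integral>w. G w powr q \<partial>bmeas \<beta>)"
    using schur[OF a(1) bi[of c1]] by auto
  obtain S2 where S2: "S2 > 0" "\<And>G. G \<in> borel_measurable (bmeas \<beta>) \<Longrightarrow> (\<forall>w. G w \<ge> 0) \<Longrightarrow> integrable (bmeas \<beta>) (\<lambda>w. G w powr q) \<Longrightarrow>
      (\<forall>z\<in>unit_ball. integrable (bmeas (b + (c2 + \<gamma>))) (\<lambda>w. K a2 (b + (c2 + \<gamma>)) z w * G w)) \<and> integrable (bmeas \<beta>) (\<lambda>z. T a2 (b + (c2 + \<gamma>)) G z powr q) \<and>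
      (\<integral>z. T a2 (b + (c2 + \<gamma>)) G z powr q \<partial>bmeas \<beta>) \<le> S2 * (\<integral>w. G w powr q \<partial>bmeas \<beta>)"
    using schur[OF a(2) bi[of c2]] by auto
  \<comment> \<open>Schur's test with parameters 0 and \<open>\<beta>\<close> bounds the projection
    with weight \<open>\<beta>\<close>, absolute values inside, on the \<open>L\<close>-space of
    exponent \<open>q\<close>.\<close>
  have c0: "- q * 0 < \<beta> + 1" "\<beta> + 1 < q * (\<beta> + 1)" using \<beta> q by auto
  obtain S0 where S0: "S0 > 0" "\<And>G. G \<in> borel_measurable (bmeas \<beta>) \<Longrightarrow> (\<forall>w. G w \<ge> 0) \<Longrightarrow> integrable (bmeas \<beta>) (\<lambda>w. G w powr q) \<Longrightarrow>
      (\<forall>z\<in>unit_ball. integrable (bmeas \<beta>) (\<lambda>w. K 0 \<beta> z w * G w)) \<and> integrable (bmeas \<beta>) (\<lambda>z. T 0 \<beta> G z powr q) \<and>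
      (\<integral>z. T 0 \<beta> G z powr q \<partial>bmeas \<beta>) \<le> S0 * (\<integral>w. G w powr q \<partial>bmeas \<beta>)"
    using schur[OF c0] by auto
  obtain E where E: "E > 0" "\<And>g :: complex ^ 'n \<Rightarrow> complex. g \<in> H_infinity \<Longrightarrow>
    integrable (bmeas \<beta>) (\<lambda>w. (cmod (g w) * dfct w powr (- \<gamma>)) powr q) \<and>
    (\<integral>w. (cmod (g w) * dfct w powr (- \<gamma>)) powr q \<partial>bmeas \<beta>) \<le> E * (\<integral>w. cmod (g w) powr p \<partial>bmeas \<alpha>) powr (q / p)"
    using weighted_embedding[OF \<alpha> \<beta> p pq, where 'n = 'n] unfolding \<gamma>[symmetric] by blast
  define mb where "mb = bmass TYPE('n) b"
  define m\<beta> where "m\<beta> = bmass TYPE('n) \<beta>"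
  have m: "mb > 0" "m\<beta> > 0" unfolding mb_def m\<beta>_def using bmass_pos[where 'n = 'n] b \<beta> by auto
  define D1 where "D1 = (C / mb) powr q * 2 powr q * (S1 + S2)"
  define D2 where "D2 = (1 + 1 / m\<beta>) powr q * 2 powr q * (1 + S0)"
  have "(1 + 1 / m\<beta>) powr q > 0" "(C / mb) powr q > 0"
    unfolding powr_gt_zero using m C by (auto simp: add_pos_pos less_imp_neq[symmetric])
  then have D: "D1 > 0" "D2 > 0"
    unfolding D1_def D2_def using S0(1) S1(1) S2(1) by (intro mult_pos_pos; simp)+
  have K0: "K a r z w \<ge> 0" for a r z w by (simp add: K_def)
  have T0: "T a r G z \<ge> 0" if "\<forall>w. G w \<ge> 0" for a r G z
    unfolding T_def using that K0 by (intro mult_nonneg_nonneg Bochner_Integration.integral_nonneg) auto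
  have main: "hankel \<beta> f g \<in> borel_measurable (bmeas \<beta>) \<and> integrable (bmeas \<beta>) (\<lambda>w. cmod (hankel \<beta> f g w) powr q) \<and>
      (\<integral>w. cmod (hankel \<beta> f g w) powr q \<partial>bmeas \<beta>) powr (1 / q) \<le>
        (D2 * (D1 * E)) powr (1 / q) * (\<integral>w. cmod (g w) powr p \<partial>bmeas \<alpha>) powr (1 / p)"
    if g: "g \<in> H_infinity" for g
  proof -
    note gm = ball_holomorphic_measurable[OF H_infinity_holomorphic[OF g]]
    define X where "X = (\<integral>w. cmod (g w) powr p \<partial>bmeas \<alpha>)"
    define G where "G w = cmod (g w) * dfct w powr (- \<gamma>)" for w
    have Gm: "G \<in> borel_measurable (bmeas r)" for r
      unfolding G_def using gm[of r] by measurable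
    have G0: "\<forall>w. G w \<ge> 0" by (simp add: G_def)
    have Gi: "integrable (bmeas \<beta>) (\<lambda>w. G w powr q)" "(\<integral>w. G w powr q \<partial>bmeas \<beta>) \<le> E * X powr (q / p)"
      using E(2)[OF g] by (auto simp: G_def X_def)
    note s1 = S1(2)[OF Gm G0 Gi(1)] and s2 = S2(2)[OF Gm G0 Gi(1)]
    have fb: "integrable (bmeas b) f" by (rule integrable_bmeas_mono[OF fi b(1)])
    define H where "H = hankel b f g"
    have measH: "hankel r f g \<in> borel_measurable (bmeas \<beta>)" if "r > -1" "integrable (bmeas r) f" for r
      unfolding hankel_def
    proof (rule borel_measurable_diff)
      note \<psi>i = symbol_times_H_infinity_integrable[OF that(2) g]
      show "(\<lambda>z. cnj (f z) * g z) \<in> borel_measurable (bmeas \<beta>)"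
        using borel_measurable_integrable[OF \<psi>i] by (simp only: measurable_bmeas)
      show "bergman_proj r (\<lambda>w. cnj (f w) * g w) \<in> borel_measurable (bmeas \<beta>)"
        by (rule ball_holomorphic_measurable[OF bergman_proj_holomorphic[OF that(1) \<psi>i]])
    qed
    have Hm: "H \<in> borel_measurable (bmeas \<beta>)" unfolding H_def by (rule measH[OF b(2) fb])
    have Hpt: "cmod (H z) \<le> (C / mb) * (T a1 (b + (c1 + \<gamma>)) G z + T a2 (b + (c2 + \<gamma>)) G z)" if z: "z \<in> unit_ball" for z
    proof -
      let ?k = "\<lambda>w. kpow (n + 1 + b) (hinner z w)"
      define R where "R a c w = dfct w powr (c + \<gamma>) *\<^sub>R (K a (b + (c + \<gamma>)) z w * G w)" for a c w
      have Km: "(\<lambda>w. K a r z w * G w) \<in> borel_measurable (bmeas r')" for a r r'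
      proof -
        have "continuous_on unit_ball (\<lambda>w. cmod (kpow (n + 1 + a + r) (hinner z w)))"
          by (intro continuous_intros continuous_on_subset[OF kpow_hinner_right_continuous[OF z]]) auto
        then have "(\<lambda>w. K a r z w) \<in> borel_measurable (bmeas r')"
          by (intro measurable_bmeas_continuous) (simp add: norm_kpow K_def)
        then show ?thesis using Gm by (rule borel_measurable_times)
      qed
      have Ri: "integrable (bmeas b) (R a1 c1)" "integrable (bmeas b) (R a2 c2)"
        unfolding R_def
        by (rule integrable_bmeas_shift[OF Km, THEN iffD1, OF s1[THEN conjunct1, rule_format, OF z]])
          (rule integrable_bmeas_shift[OF Km, THEN iffD1, OF s2[THEN conjunct1, rule_format, OF z]])
      have Re: "(\<integral>w. R a c w \<partial>bmeas b) = (\<integral>w. K a (b + (c + \<gamma>)) z w * G w \<partial>bmeas (b + (c + \<gamma>)))" for a c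
        unfolding R_def by (rule integral_bmeas_shift[OF Km, symmetric])
      define I where "I w = (cnj (f z) - cnj (f w)) * g w * ?k w" for w
      have Ib: "cmod (I w) \<le> C * (dfct z powr a1 * R a1 c1 w + dfct z powr a2 * R a2 c2 w)" if w: "w \<in> unit_ball" for w
      proof -
        have d: "cmod (1 - hinner z w) > 0" by (rule cmod_one_minus_hinner_pos[OF z w])
        note t = kernel_term_eq[OF d dfct_pos[OF w], of \<gamma> _ _ "dfct z" "cmod (g w)" n b]
        have "cmod (I w) = cmod (f z - f w) * cmod (g w) * cmod (1 - hinner z w) powr (- (n + 1 + b))"
          unfolding I_def norm_mult norm_kpow by (metis complex_cnj_diff complex_mod_cnj)
        also have "\<dots> \<le> (C * (cmod (1 - hinner z w) powr (- \<gamma> - a1 - c1) * dfct z powr a1 * dfct w powr c1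
            + cmod (1 - hinner z w) powr (- \<gamma> - a2 - c2) * dfct z powr a2 * dfct w powr c2)) * cmod (g w) * cmod (1 - hinner z w) powr (- (n + 1 + b))"
          by (intro mult_right_mono osc z w) auto
        also have "\<dots> = C * ((cmod (1 - hinner z w) powr (- \<gamma> - a1 - c1) * dfct z powr a1 * dfct w powr c1) * cmod (g w) * cmod (1 - hinner z w) powr (- (n + 1 + b))
            + (cmod (1 - hinner z w) powr (- \<gamma> - a2 - c2) * dfct z powr a2 * dfct w powr c2) * cmod (g w) * cmod (1 - hinner z w) powr (- (n + 1 + b)))"
          by (simp only: distrib_left distrib_right mult.assoc)
        also have "\<dots> = C * (dfct z powr a1 * R a1 c1 w + dfct z powr a2 * R a2 c2 w)"
          unfolding t R_def K_def G_def real_scaleR_def ..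
        finally show ?thesis .
      qed
      have RI: "integrable (bmeas b) (\<lambda>w. C * (dfct z powr a1 * R a1 c1 w + dfct z powr a2 * R a2 c2 w))"
        using Ri by simp
      have "mb * cmod (H z) = cmod (\<integral>w. I w \<partial>bmeas b)"
        unfolding H_def hankel_eq[OF fb g b(2) z] I_def n_def mb_def[symmetric] using m by (simp add: norm_divide)
      also have "\<dots> \<le> (\<integral>w. C * (dfct z powr a1 * R a1 c1 w + dfct z powr a2 * R a2 c2 w) \<partial>bmeas b)"
      \<comment> \<open>If \<open>I\<close> were not integrable its Bochner integral would be 0 and
        the bound trivial, so its measurability need not be discussed.\<close>
      proof (cases "integrable (bmeas b) I")
        case True
        show ?thesis by (rule Bochner_Integration.integral_norm_bound_integral[OF True RI]) (use Ib in simp)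
      next
        case False
        then have "(\<integral>w. I w \<partial>bmeas b) = 0" by (rule not_integrable_integral_eq)
        moreover have "0 \<le> (\<integral>w. C * (dfct z powr a1 * R a1 c1 w + dfct z powr a2 * R a2 c2 w) \<partial>bmeas b)"
          using C G0 K0 by (intro Bochner_Integration.integral_nonneg) (auto simp: R_def intro!: mult_nonneg_nonneg add_nonneg_nonneg)
        ultimately show ?thesis by simp
      qed
      also have "\<dots> = C * (T a1 (b + (c1 + \<gamma>)) G z + T a2 (b + (c2 + \<gamma>)) G z)"
        using Ri by (simp add: Re T_def)
      finally show ?thesis using m by (simp add: field_simps)
    qed
    have Hq: "integrable (bmeas \<beta>) (\<lambda>z. cmod (H z) powr q)" "(\<integral>z. cmod (H z) powr q \<partial>bmeas \<beta>) \<le> D1 * (\<integral>w. G w powr q \<partial>bmeas \<beta>)"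
    proof -
      have q0: "q \<ge> 0" and Cm: "C / mb \<ge> 0" using q C m by auto
      note d = dominated_Lq[OF Hm q0 Cm T0[OF G0] T0[OF G0] _ _ Hpt]
      show "integrable (bmeas \<beta>) (\<lambda>z. cmod (H z) powr q)" by (rule d(1)) (use s1 s2 in auto)
      have "(\<integral>z. cmod (H z) powr q \<partial>bmeas \<beta>) \<le> ((C / mb) powr q * 2 powr q) *
          ((\<integral>z. T a1 (b + (c1 + \<gamma>)) G z powr q \<partial>bmeas \<beta>) + (\<integral>z. T a2 (b + (c2 + \<gamma>)) G z powr q \<partial>bmeas \<beta>))"
        by (rule d(2)) (use s1 s2 in auto)
      also have "\<dots> \<le> ((C / mb) powr q * 2 powr q) * (S1 * (\<integral>w. G w powr q \<partial>bmeas \<beta>) + S2 * (\<integral>w. G w powr q \<partial>bmeas \<beta>))"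
        using s1 s2 by (intro mult_left_mono add_mono) auto
      finally show "(\<integral>z. cmod (H z) powr q \<partial>bmeas \<beta>) \<le> D1 * (\<integral>w. G w powr q \<partial>bmeas \<beta>)"
        by (simp add: D1_def distrib_left distrib_right mult.assoc)
    qed
    have H1: "integrable (bmeas \<beta>) H" by (rule Lq_imp_L1[OF \<beta> _ Hm Hq(1)]) (use q in simp)
    have Hnm: "(\<lambda>w. cmod (H w)) \<in> borel_measurable (bmeas \<beta>)" using Hm by measurable
    have Hn0: "\<forall>w. cmod (H w) \<ge> 0" by simp
    note s0 = S0(2)[OF Hnm Hn0 Hq(1)]
    define Q where "Q = hankel \<beta> f g"
    have Qm: "Q \<in> borel_measurable (bmeas \<beta>)" unfolding Q_def by (rule measH[OF \<beta> fi])
    have Qpt: "cmod (Q z) \<le> (1 + 1 / m\<beta>) * (cmod (H z) + T 0 \<beta> (\<lambda>w. cmod (H w)) z)" if z: "z \<in> unit_ball" for z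
    proof -
      let ?k = "\<lambda>w. kpow (n + 1 + \<beta>) (hinner z w)"
      have t0: "T 0 \<beta> (\<lambda>w. cmod (H w)) z = (\<integral>w. cmod (H w * ?k w) \<partial>bmeas \<beta>)"
        using dfct_pos[OF z] by (simp add: T_def K_def norm_mult norm_kpow mult.commute)
      have "cmod (bergman_proj \<beta> H z) = cmod (\<integral>w. H w * ?k w \<partial>bmeas \<beta>) / m\<beta>"
        unfolding bergman_proj_eq[OF \<beta> Hm z] n_def m\<beta>_def[symmetric] using m by (simp add: norm_divide)
      also have "\<dots> \<le> T 0 \<beta> (\<lambda>w. cmod (H w)) z / m\<beta>"
        unfolding t0 using m by (intro divide_right_mono integral_norm_bound) auto
      finally have P: "cmod (bergman_proj \<beta> H z) \<le> T 0 \<beta> (\<lambda>w. cmod (H w)) z / m\<beta>" .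
      have "Q z = H z - bergman_proj \<beta> H z"
        unfolding Q_def H_def by (rule hankel_decomposition[OF fi g \<beta> b(1) H1[unfolded H_def] z])
      then have "cmod (Q z) \<le> cmod (H z) + cmod (bergman_proj \<beta> H z)" by (simp add: norm_triangle_ineq4)
      also have "\<dots> \<le> cmod (H z) + T 0 \<beta> (\<lambda>w. cmod (H w)) z / m\<beta>" using P by simp
      also have "\<dots> \<le> (1 + 1 / m\<beta>) * (cmod (H z) + T 0 \<beta> (\<lambda>w. cmod (H w)) z)"
        using m T0[OF Hn0, of 0 \<beta> z] by (simp add: algebra_simps)
      finally show ?thesis .
    qed
    have q0: "q \<ge> 0" and Cm: "1 + 1 / m\<beta> \<ge> 0" using q m by auto
    note d = dominated_Lq[OF Qm q0 Cm norm_ge_zero T0[OF Hn0] Hq(1) _ Qpt]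
    have Qi: "integrable (bmeas \<beta>) (\<lambda>z. cmod (Q z) powr q)" by (rule d(1)) (use s0 in auto)
    have "(\<integral>z. cmod (Q z) powr q \<partial>bmeas \<beta>) \<le> ((1 + 1 / m\<beta>) powr q * 2 powr q) *
        ((\<integral>z. cmod (H z) powr q \<partial>bmeas \<beta>) + (\<integral>z. T 0 \<beta> (\<lambda>w. cmod (H w)) z powr q \<partial>bmeas \<beta>))"
      by (rule d(2)) (use s0 in auto)
    also have "\<dots> \<le> ((1 + 1 / m\<beta>) powr q * 2 powr q) * ((\<integral>z. cmod (H z) powr q \<partial>bmeas \<beta>) + S0 * (\<integral>z. cmod (H z) powr q \<partial>bmeas \<beta>))"
      using s0 by (intro mult_left_mono add_mono) auto
    also have "\<dots> = D2 * (\<integral>z. cmod (H z) powr q \<partial>bmeas \<beta>)"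
      by (simp add: D2_def distrib_left distrib_right mult.assoc)
    also have "\<dots> \<le> D2 * (D1 * (E * X powr (q / p)))"
      using Hq(2) Gi(2) D by (intro mult_left_mono order_trans[OF Hq(2)]) auto
    also have "\<dots> = (D2 * (D1 * E)) * X powr (q / p)" by simp
    finally have "(\<integral>z. cmod (Q z) powr q \<partial>bmeas \<beta>) powr (1 / q) \<le> ((D2 * (D1 * E)) * X powr (q / p)) powr (1 / q)"
      using q by (intro powr_mono2 Bochner_Integration.integral_nonneg) auto
    also have "\<dots> = (D2 * (D1 * E)) powr (1 / q) * X powr (1 / p)"
      using q by (simp only: powr_mult powr_powr) simp
    finally show ?thesis using Qi Qm unfolding Q_def X_def by blast
  qed
  show ?thesis
    unfolding hankel_bounded_iff[OF \<alpha> \<beta>]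
    by (intro exI[of _ "(D2 * (D1 * E)) powr (1 / q)"] conjI ballI main) (use D E in auto)
qed

section \<open>Necessity\<close>

lemma kpow_left_has_derivative:
  fixes z :: "complex ^ 'n"
  assumes z: "z \<in> unit_ball" and w: "w \<in> unit_ball"
  shows "((\<lambda>w. kpow \<mu> (hinner w z)) has_derivative (\<lambda>v. of_real \<mu> * kpow (\<mu> + 1) (hinner w z) * hinner v z)) (at w)"
proof -
  have lt: "cmod (hinner w z) < 1" using norm_hinner_less_1[OF w, of z] z by simp
  have "((\<lambda>w. hinner w z) has_derivative (\<lambda>x. hinner x z)) (at w)"
    by (rule bounded_linear_imp_has_derivative[OF bounded_linear_hinner_left])
  from diff_chain_at[OF this kpow_has_derivative[OF lt, unfolded has_field_derivative_def]]
  show ?thesis by (simp add: o_def)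
qed

lemma ball_holomorphic_kpow: "z \<in> unit_ball \<Longrightarrow> ball_holomorphic (\<lambda>w. kpow \<mu> (hinner w z))"
  unfolding ball_holomorphic_def
  by (intro ballI exI conjI allI, erule (1) kpow_left_has_derivative) (simp add: mult_ac)

lemma sderiv_kpow:
  "z \<in> unit_ball \<Longrightarrow> w \<in> unit_ball \<Longrightarrow> sderiv v (\<lambda>w. kpow \<mu> (hinner w z)) w = of_real \<mu> * kpow (\<mu> + 1) (hinner w z) * hinner v z"
  by (rule sderiv_eq[OF kpow_left_has_derivative]) (simp_all add: mult_ac)

lemma ball_holomorphic_mult:
  assumes "ball_holomorphic f" "ball_holomorphic g"
  shows "ball_holomorphic (\<lambda>w. f w * g w)"
    and "w \<in> unit_ball \<Longrightarrow> sderiv v (\<lambda>w. f w * g w) w = f w * sderiv v g w + sderiv v f w * g w"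
proof -
  have d: "((\<lambda>w. f w * g w) has_derivative (\<lambda>v. f w * sderiv v g w + sderiv v f w * g w)) (at w)" if "w \<in> unit_ball" for w
    by (intro has_derivative_mult ball_holomorphic_has_derivative assms that)
  have l: "f w * sderiv (c *s v) g w + sderiv (c *s v) f w * g w = c * (f w * sderiv v g w + sderiv v f w * g w)"
    if "w \<in> unit_ball" for w c v
    by (simp add: sderiv_smult[OF assms(1) that] sderiv_smult[OF assms(2) that] algebra_simps)
  show "ball_holomorphic (\<lambda>w. f w * g w)"
    unfolding ball_holomorphic_def using d l by blast
  show "sderiv v (\<lambda>w. f w * g w) w = f w * sderiv v g w + sderiv v f w * g w" if "w \<in> unit_ball"
    by (rule sderiv_eq[OF d[OF that] l[OF that]])
qed

lemma ball_holomorphic_hinner_diff: "ball_holomorphic (\<lambda>w. hinner (w - z) u)"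
  unfolding ball_holomorphic_def
proof (intro ballI exI conjI allI)
  fix w
  show "((\<lambda>w. hinner (w - z) u) has_derivative (\<lambda>v. hinner v u)) (at w)"
    unfolding hinner_diff_left
    by (auto intro!: derivative_eq_intros bounded_linear_imp_has_derivative bounded_linear_hinner_left)
qed simp

lemma kpow_left_bounded:
  fixes z :: "complex ^ 'n"
  assumes z: "z \<in> unit_ball"
  obtains B where "B > 0" "\<And>w. norm w \<le> 1 \<Longrightarrow> cmod (kpow \<mu> (hinner w z)) \<le> B"
proof -
  have "bounded ((\<lambda>w. kpow \<mu> (hinner z w)) ` cball 0 1)"
    by (intro compact_imp_bounded compact_continuous_image kpow_hinner_right_continuous z) auto
  then obtain B where B: "B > 0" "\<forall>y\<in>(\<lambda>w. kpow \<mu> (hinner z w)) ` cball 0 1. cmod y \<le> B"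
    unfolding bounded_pos by blast
  have "cmod (kpow \<mu> (hinner w z)) = cmod (kpow \<mu> (hinner z w))" for w
    by (simp add: norm_kpow cmod_one_minus_hinner_commute[of w z])
  then show thesis using B by (intro that[of B]) auto
qed

lemma kpow_left_H_infinity:
  assumes "z \<in> unit_ball"
  shows "(\<lambda>w. kpow \<mu> (hinner w z)) \<in> H_infinity"
proof -
  obtain B where B: "B > 0" "\<And>w. norm w \<le> 1 \<Longrightarrow> cmod (kpow \<mu> (hinner w z)) \<le> B"
    by (rule kpow_left_bounded[OF assms, of \<mu>]) blast
  have "bounded ((\<lambda>w. kpow \<mu> (hinner w z)) ` unit_ball)"
    unfolding bounded_iff using B(2) by (intro exI[of _ B]) auto
  then show ?thesis by (simp add: H_infinity_def ball_holomorphic_kpow[OF assms])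
qed

text \<open>The test function \<open>\<langle>w - z, u\<rangle> (1 - \<langle>w,z\<rangle>)\<^sup>m (1 - \<langle>z,w\<rangle>) powr (-l)\<close> annihilates holomorphic functions,
  because its holomorphic factor vanishes at \<open>z\<close>, while its pairing with \<open>cnj f * g\<close> is a derivative of \<open>f\<close> at \<open>z\<close>.\<close>

lemma hankel_pairing:
  fixes f :: "complex ^ 'n \<Rightarrow> complex" and m :: real and u :: "complex ^ 'n"
  assumes f: "ball_holomorphic f" and fi: "integrable (bmeas \<beta>) f" and \<beta>: "\<beta> > -1" and z: "z \<in> unit_ball"
  defines "l \<equiv> real CARD('n) + 1 + \<beta>"
  defines "g \<equiv> \<lambda>w. kpow (l + 1 + m) (hinner w z)"
  defines "\<Theta> \<equiv> \<lambda>w. hinner (w - z) u * kpow (- m) (hinner w z) * kpow l (hinner z w)"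
  assumes Hi: "integrable (bmeas \<beta>) (hankel \<beta> f g)"
  shows "cmod (\<integral>w. hankel \<beta> f g w * \<Theta> w \<partial>bmeas \<beta>)
    = bmass TYPE('n) \<beta> * (dfct z powr (- l) * cmod (sderiv (u - hinner u z *s z) f z) / l)"
proof -
  define mb where "mb = complex_of_real (bmass TYPE('n) \<beta>)"
  have l: "l > 0" using \<beta> by (simp add: l_def)
  have lt: "cmod (hinner z w) < 1" "cmod (hinner w z) < 1" if "w \<in> unit_ball" for w
    using norm_hinner_less_1[OF z, of w] norm_hinner_less_1[OF that, of z] z that by auto
  have g: "g \<in> H_infinity" unfolding g_def by (rule kpow_left_H_infinity[OF z])
  define \<psi> where "\<psi> = (\<lambda>w. cnj (f w) * g w)"
  have \<psi>i: "integrable (bmeas \<beta>) \<psi>" unfolding \<psi>_def by (rule symbol_times_H_infinity_integrable[OF fi g])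
  define P where "P = bergman_proj \<beta> \<psi>"
  have Ph: "ball_holomorphic P" unfolding P_def by (rule bergman_proj_holomorphic[OF \<beta> \<psi>i])
  have hk: "hankel \<beta> f g = (\<lambda>w. \<psi> w - P w)" by (simp add: hankel_def \<psi>_def P_def)
  then have "P = (\<lambda>w. \<psi> w - hankel \<beta> f g w)" by simp
  then have Pi: "integrable (bmeas \<beta>) P" using \<psi>i Hi by simp
  define Q where "Q w = hinner (w - z) u * kpow (- m) (hinner w z)" for w
  have Qh: "ball_holomorphic Q"
    unfolding Q_def[abs_def]
    by (rule ball_holomorphic_mult(1)[OF ball_holomorphic_hinner_diff ball_holomorphic_kpow[OF z]])
  obtain B where B: "B > 0" "\<And>w. norm w \<le> 1 \<Longrightarrow> cmod (kpow (- m) (hinner w z)) \<le> B"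
    by (rule kpow_left_bounded[OF z, of "- m"]) blast
  have Qb: "cmod (Q w) \<le> 2 * norm u * B" if "w \<in> space (bmeas \<beta>)" for w
  proof -
    have "cmod (hinner (w - z) u) \<le> norm (w - z) * norm u" by (rule norm_hinner_le)
    also have "\<dots> \<le> 2 * norm u"
      using norm_triangle_ineq4[of w z] that z by (intro mult_right_mono) auto
    finally show ?thesis unfolding Q_def norm_mult using B that by (intro mult_mono) auto
  qed
  have Qm: "Q \<in> borel_measurable (bmeas \<beta>)" by (rule ball_holomorphic_measurable[OF Qh])
  have PQ: "integrable (bmeas \<beta>) (\<lambda>w. P w * Q w)" "integrable (bmeas \<beta>) (\<lambda>w. \<psi> w * Q w)"
    by (rule integrable_mult_bounded[OF Pi Qm Qb], assumption) (rule integrable_mult_bounded[OF \<psi>i Qm Qb], assumption)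
  have "(\<integral>w. P w * Q w * kpow l (hinner z w) \<partial>bmeas \<beta>) = mb * (P z * Q z)"
    unfolding l_def mb_def
    by (rule reproducing_formula[OF ball_holomorphic_imp_slice_hol[OF ball_holomorphic_mult(1)[OF Ph Qh]] PQ(1) \<beta> z])
  then have P0: "(\<integral>w. P w * Q w * kpow l (hinner z w) \<partial>bmeas \<beta>) = 0" by (simp add: Q_def)
  have th: "hankel \<beta> f g w * \<Theta> w = \<psi> w * Q w * kpow l (hinner z w) - P w * Q w * kpow l (hinner z w)" for w
    by (simp add: hk \<Theta>_def Q_def algebra_simps)
  have "(\<integral>w. hankel \<beta> f g w * \<Theta> w \<partial>bmeas \<beta>) = (\<integral>w. \<psi> w * Q w * kpow l (hinner z w) \<partial>bmeas \<beta>)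
      - (\<integral>w. P w * Q w * kpow l (hinner z w) \<partial>bmeas \<beta>)"
    unfolding th by (rule Bochner_Integration.integral_diff) (intro integrable_mult_kpow PQ z)+
  then have 1: "(\<integral>w. hankel \<beta> f g w * \<Theta> w \<partial>bmeas \<beta>) = (\<integral>w. \<psi> w * Q w * kpow l (hinner z w) \<partial>bmeas \<beta>)"
    unfolding P0 by simp
  \<comment> \<open>After conjugation the symbol appears holomorphically, multiplied by the
    conjugate of the antiholomorphic kernel of the test function.\<close>
  define F where "F w = f w * kpow l (hinner w z)" for w
  have Fh: "ball_holomorphic F"
    unfolding F_def[abs_def] by (rule ball_holomorphic_mult(1)[OF f ball_holomorphic_kpow[OF z]])
  have Fi: "integrable (bmeas \<beta>) F"
  proof -
    obtain B where B: "B > 0" "\<And>w. norm w \<le> 1 \<Longrightarrow> cmod (kpow l (hinner w z)) \<le> B"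
      by (rule kpow_left_bounded[OF z, of l]) blast
    show ?thesis unfolding F_def[abs_def]
      by (rule integrable_mult_bounded[OF fi ball_holomorphic_measurable[OF ball_holomorphic_kpow[OF z]], of l B])
        (use B in auto)
  qed
  define A where "A v = (\<integral>w. F w * (of_real l * kpow (l + 1) (hinner z w) * hinner v w) \<partial>bmeas \<beta>)" for v
  have Ae: "A v = mb * sderiv v F z" for v
    unfolding A_def l_def mb_def by (rule reproducing_formula_deriv[OF Fh Fi \<beta> z])
  have Ai: "integrable (bmeas \<beta>) (\<lambda>w. F w * (of_real l * kpow (l + 1) (hinner z w) * hinner v w))" for v
  proof -
    have "integrable (bmeas \<beta>) (\<lambda>w. (F w * kpow (l + 1) (hinner z w)) * (of_real l * hinner v w))"
    proof (rule integrable_mult_bounded[OF integrable_mult_kpow[OF Fi z]])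
      show "(\<lambda>w. of_real l * hinner v w) \<in> borel_measurable (bmeas \<beta>)"
        by (intro measurable_bmeas_continuous continuous_intros)
      show "cmod (of_real l * hinner v w) \<le> l * norm v" if "w \<in> space (bmeas \<beta>)" for w
        using norm_hinner_le[of v w] that mult_left_le[of "norm w" "norm v"] l
        by (auto simp: norm_mult intro!: mult_left_mono)
    qed
    then show ?thesis by (simp add: mult_ac)
  qed
  have Bi: "integrable (bmeas \<beta>) (\<lambda>w. F w * kpow l (hinner z w))" by (rule integrable_mult_kpow[OF Fi z])
  have Be: "(\<integral>w. F w * kpow l (hinner z w) \<partial>bmeas \<beta>) = mb * F z"
    unfolding l_def mb_def by (rule reproducing_formula[OF ball_holomorphic_imp_slice_hol[OF Fh] Fi \<beta> z])
  \<comment> \<open>The term with \<open>hinner u z\<close> is split by writing 1 as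
    \<open>(1 - hinner z w) + hinner z w\<close>. This expresses everything through the reproducing
    kernel and its derivatives in the directions \<open>u\<close> and \<open>z\<close>.\<close>
  have pt: "cnj (\<psi> w * Q w * kpow l (hinner z w)) =
      F w * (of_real l * kpow (l + 1) (hinner z w) * hinner u w) / of_real l
      - hinner u z * (F w * kpow l (hinner z w) + F w * (of_real l * kpow (l + 1) (hinner z w) * hinner z w) / of_real l)"
    if w: "w \<in> space (bmeas \<beta>)" for w
  proof -
    have wb: "w \<in> unit_ball" using w by simp
    note c = lt[OF wb]
    have k1: "kpow (l + 1 + m) (hinner w z) * kpow (- m) (hinner w z) = kpow (l + 1) (hinner w z)"
      using kpow_add[OF c(2), of "l + 1 + m" "- m"] by simp
    have k2: "kpow (l + 1) (hinner z w) * (1 - hinner z w) = kpow l (hinner z w)"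
      using kpow_add[OF c(1), of "l + 1" "-1"] kpow_minus_1[OF c(1)] by simp
    have "cnj (\<psi> w * Q w * kpow l (hinner z w)) = cnj (cnj (f w) * hinner (w - z) u * (kpow (l + 1 + m) (hinner w z) * kpow (- m) (hinner w z)) * kpow l (hinner z w))"
      by (simp only: \<psi>_def Q_def g_def mult_ac)
    also have "\<dots> = f w * hinner u (w - z) * kpow (l + 1) (hinner z w) * kpow l (hinner w z)"
      unfolding k1 using c by (simp add: cnj_kpow)
    also have "\<dots> = F w * kpow (l + 1) (hinner z w) * hinner u w - hinner u z * (F w * (kpow (l + 1) (hinner z w) * (1 - hinner z w) + kpow (l + 1) (hinner z w) * hinner z w))"
      by (simp add: F_def hinner_diff_right algebra_simps)
    finally show ?thesis unfolding k2 using l by (simp add: algebra_simps)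
  qed
  have "cnj (\<integral>w. \<psi> w * Q w * kpow l (hinner z w) \<partial>bmeas \<beta>) = (\<integral>w. cnj (\<psi> w * Q w * kpow l (hinner z w)) \<partial>bmeas \<beta>)"
    by (rule Bochner_Integration.integral_cnj[symmetric])
  also have "\<dots> = (\<integral>w. F w * (of_real l * kpow (l + 1) (hinner z w) * hinner u w) / of_real l
      - hinner u z * (F w * kpow l (hinner z w) + F w * (of_real l * kpow (l + 1) (hinner z w) * hinner z w) / of_real l) \<partial>bmeas \<beta>)"
    by (rule Bochner_Integration.integral_cong[OF refl pt])
  also have "\<dots> = A u / of_real l - hinner u z * (mb * F z + A z / of_real l)"
  proof -
    have "(\<integral>w. x w / L - U * (y w + t w / L) \<partial>bmeas \<beta>) =
        (\<integral>w. x w \<partial>bmeas \<beta>) / L - U * ((\<integral>w. y w \<partial>bmeas \<beta>) + (\<integral>w. t w \<partial>bmeas \<beta>) / L)"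
      if "integrable (bmeas \<beta>) x" "integrable (bmeas \<beta>) y" "integrable (bmeas \<beta>) t"
      for x y t :: "complex ^ 'n \<Rightarrow> complex" and L U
      using that by simp
    from this[OF Ai Bi Ai] show ?thesis unfolding A_def Be[symmetric] .
  qed
  also have "\<dots> = mb * (sderiv u F z / of_real l - hinner u z * (F z + sderiv z F z / of_real l))"
    unfolding Ae by (simp add: algebra_simps)
  \<comment> \<open>For \<open>v = u - hinner u z *s z\<close> one has
    \<open>hinner v z = hinner u z * of_real (dfct z)\<close>, so differentiating the kernel factor
    of \<open>F\<close> gives exactly \<open>of_real l * (hinner u z * F z)\<close>. This cancels
    and only the derivative of \<open>f\<close> survives.\<close>
  also have "sderiv u F z / of_real l - hinner u z * (F z + sderiv z F z / of_real l)
      = of_real (dfct z powr (- l)) * sderiv (u - hinner u z *s z) f z / of_real l"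
  proof -
    define v where "v = u - hinner u z *s z"
    have s: "dfct z > 0" by (rule dfct_pos[OF z])
    have kz: "kpow r (hinner z z) = of_real (dfct z powr (- r))" for r
      using powr_of_real[of "dfct z" "- r"] s by (simp add: kpow_def hinner_self dfct_def)
    have dF: "sderiv x F z = f z * (of_real l * kpow (l + 1) (hinner z z) * hinner x z) + sderiv x f z * kpow l (hinner z z)" for x
      unfolding F_def[abs_def] ball_holomorphic_mult(2)[OF f ball_holomorphic_kpow[OF z] z] sderiv_kpow[OF z z] ..
    have uv: "sderiv u F z = sderiv v F z + hinner u z * sderiv z F z"
    proof -
      have "u = v + hinner u z *s z" by (simp add: v_def)
      then have "sderiv u F z = sderiv (v + hinner u z *s z) F z" by simp
      then show ?thesis by (simp add: sderiv_add[OF Fh z] sderiv_smult[OF Fh z])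
    qed
    have hv: "hinner v z = hinner u z * of_real (dfct z)"
      by (simp add: v_def hinner_diff_left hinner_self dfct_def algebra_simps)
    have e: "complex_of_real (dfct z powr (- (l + 1))) * of_real (dfct z) = of_real (dfct z powr (- l))"
    proof -
      have "dfct z powr (- (l + 1)) * dfct z powr 1 = dfct z powr (- l)"
        unfolding powr_add[symmetric] by simp
      then show ?thesis using s by (simp flip: of_real_mult)
    qed
    have Fz: "F z = f z * of_real (dfct z powr (- l))" by (simp only: F_def kz)
    have "sderiv v F z = of_real l * (f z * hinner u z * (complex_of_real (dfct z powr (- (l + 1))) * of_real (dfct z))) + sderiv v f z * of_real (dfct z powr (- l))"
      unfolding dF kz hv by (simp only: mult_ac)
    also have "\<dots> = of_real l * (hinner u z * F z) + of_real (dfct z powr (- l)) * sderiv v f z"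
      unfolding e Fz by (simp only: mult_ac)
    finally have "sderiv v F z = of_real l * (hinner u z * F z) + of_real (dfct z powr (- l)) * sderiv v f z" .
    then have "(sderiv v F z + hinner u z * sderiv z F z) / of_real l - hinner u z * (F z + sderiv z F z / of_real l)
      = of_real (dfct z powr (- l)) * sderiv v f z / of_real l"
      using l by (simp add: field_simps)
    then show ?thesis unfolding uv v_def .
  qed
  finally have "cnj (\<integral>w. \<psi> w * Q w * kpow l (hinner z w) \<partial>bmeas \<beta>) =
    mb * (of_real (dfct z powr (- l)) * sderiv (u - hinner u z *s z) f z / of_real l)" .
  then have "cmod (\<integral>w. \<psi> w * Q w * kpow l (hinner z w) \<partial>bmeas \<beta>) =
    cmod (mb * (of_real (dfct z powr (- l)) * sderiv (u - hinner u z *s z) f z / of_real l))"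
    by (metis complex_mod_cnj)
  also have "\<dots> = bmass TYPE('n) \<beta> * (dfct z powr (- l) * cmod (sderiv (u - hinner u z *s z) f z) / l)"
    using l bmass_pos[OF \<beta>, where 'n = 'n] by (simp add: mb_def norm_mult norm_divide)
  finally show ?thesis unfolding 1 .
qed

lemma kernel_Lp_norm_bound:
  assumes b: "b > -1" and p: "p > 0" and \<mu>: "\<mu> * p > real CARD('n) + 1 + b"
  obtains C where "C > 0" "\<And>z :: complex ^ 'n. z \<in> unit_ball \<Longrightarrow>
    (\<integral>w. (cmod (1 - hinner w z) powr (- \<mu>)) powr p \<partial>bmeas b) powr (1 / p) \<le> C * dfct z powr ((real CARD('n) + 1 + b) / p - \<mu>)"
proof -
  define c where "c = \<mu> * p - (real CARD('n) + 1 + b)"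
  have c: "c > 0" using \<mu> by (simp add: c_def)
  obtain C where C: "C > 0" "\<And>z :: complex ^ 'n. z \<in> unit_ball \<Longrightarrow>
    (\<integral>w. cmod (1 - hinner w z) powr (- (real CARD('n) + 1 + b + c)) \<partial>bmeas b) \<le> C * dfct z powr (- c)"
    by (rule kernel_integral_symmetric_bound[OF b c, where 'n = 'n]) blast
  have e: "real CARD('n) + 1 + b + c = \<mu> * p" by (simp add: c_def)
  show thesis
  proof (rule that[of "C powr (1 / p)"])
    show "C powr (1 / p) > 0" using C by simp
    fix z :: "complex ^ 'n" assume z: "z \<in> unit_ball"
    have eq: "(cmod (1 - hinner w z) powr (- \<mu>)) powr p = cmod (1 - hinner w z) powr (- (\<mu> * p))" for w
      by (simp add: powr_powr)
    have "(\<integral>w. (cmod (1 - hinner w z) powr (- \<mu>)) powr p \<partial>bmeas b) powr (1 / p) \<le> (C * dfct z powr (- c)) powr (1 / p)"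
      unfolding eq using C(2)[OF z] p unfolding e
      by (intro powr_mono2 Bochner_Integration.integral_nonneg) auto
    also have "\<dots> = C powr (1 / p) * dfct z powr (- c * (1 / p))" by (simp add: powr_mult powr_powr)
    also have "- c * (1 / p) = (real CARD('n) + 1 + b) / p - \<mu>" using p by (simp add: c_def field_simps)
    finally show "(\<integral>w. (cmod (1 - hinner w z) powr (- \<mu>)) powr p \<partial>bmeas b) powr (1 / p)
      \<le> C powr (1 / p) * dfct z powr ((real CARD('n) + 1 + b) / p - \<mu>)" .
  qed
qed

text \<open>The parameter \<open>\<kappa>\<close> records how fast the linear factor of the test
  function vanishes compared with \<open>1 - hinner w z\<close>. Each unit of
  \<open>\<kappa>\<close> yields one power of \<open>dfct z\<close>; the auxiliary exponent
  \<open>m\<close> drops out of the result.\<close>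

lemma hankel_necessary:
  fixes f :: "complex ^ 'n \<Rightarrow> complex"
  assumes \<alpha>: "\<alpha> > -1" and \<beta>: "\<beta> > -1" and p: "p > 1" and q: "q > 1"
    and \<gamma>: "\<gamma> = (real CARD('n) + 1 + \<beta>) / q - (real CARD('n) + 1 + \<alpha>) / p"
    and \<gamma>l: "\<gamma> + (real CARD('n) + 1 + \<beta>) > 0" and \<kappa>: "\<kappa> \<le> 1"
    and f: "ball_holomorphic f" and fi: "integrable (bmeas \<beta>) f"
    and bounded: "hankel_bounded p \<alpha> q \<beta> f"
  obtains C where "C > 0" "\<And>z u L. z \<in> unit_ball \<Longrightarrow> L \<ge> 0 \<Longrightarrow>
    (\<And>w. w \<in> unit_ball \<Longrightarrow> cmod (hinner (w - z) u) \<le> L * cmod (1 - hinner w z) powr \<kappa>) \<Longrightarrow>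
    cmod (sderiv (u - hinner u z *s z) f z) \<le> C * L * dfct z powr (\<kappa> - 1 - \<gamma>)"
proof -
  define l where "l = real CARD('n) + 1 + \<beta>"
  define la where "la = real CARD('n) + 1 + \<alpha>"
  define q' where "q' = q / (q - 1)"
  have q': "q' > 1" "1 / q + 1 / q' = 1" using q by (auto simp: q'_def field_simps)
  have l: "l > 0" "la > 0" using \<alpha> \<beta> by (auto simp: l_def la_def)
  \<comment> \<open>The exponent \<open>m\<close> is shared between \<open>g\<close> and the test
    function. The lower bound makes Forelli--Rudin applicable to the norm of \<open>g\<close>, the
    upper bound to the dual norm of the test function; \<open>\<gamma> + l > 0\<close> and
    \<open>\<kappa> \<le> 1\<close> leave room between them.\<close>
  have "la / p - l - 1 < l / q - \<kappa>" using \<gamma>l \<kappa> unfolding \<gamma> l_def[symmetric] la_def[symmetric] by simp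
  then obtain m where m: "la / p - l - 1 < m" "m < l / q - \<kappa>" using dense by blast
  have m1: "(l + 1 + m) * p > la" using m(1) p by (simp add: field_simps)
  have m2: "(l - m - \<kappa>) * q' > l"
  proof -
    have "l * (1 / q + 1 / q') = l" unfolding q'(2) by simp
    then have "l / q' = l - l / q" by (simp add: distrib_left)
    then have "l / q' < l - m - \<kappa>" using m(2) by simp
    then show ?thesis using q'(1) by (simp add: field_simps)
  qed
  obtain C1 where C1: "C1 > 0" "\<And>z :: complex ^ 'n. z \<in> unit_ball \<Longrightarrow>
    (\<integral>w. (cmod (1 - hinner w z) powr (- (l + 1 + m))) powr p \<partial>bmeas \<alpha>) powr (1 / p) \<le> C1 * dfct z powr (la / p - (l + 1 + m))"
    using kernel_Lp_norm_bound[OF \<alpha>, of p "l + 1 + m", where 'n = 'n] m1 p unfolding la_def by auto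
  obtain C2 where C2: "C2 > 0" "\<And>z :: complex ^ 'n. z \<in> unit_ball \<Longrightarrow>
    (\<integral>w. (cmod (1 - hinner w z) powr (- (l - m - \<kappa>))) powr q' \<partial>bmeas \<beta>) powr (1 / q') \<le> C2 * dfct z powr (l / q' - (l - m - \<kappa>))"
    using kernel_Lp_norm_bound[OF \<beta>, of q' "l - m - \<kappa>", where 'n = 'n] m2 q' unfolding l_def by auto
  obtain C0 where C0: "C0 > 0" "\<And>g. g \<in> H_infinity \<Longrightarrow>
    hankel \<beta> f g \<in> borel_measurable (bmeas \<beta>) \<and> integrable (bmeas \<beta>) (\<lambda>w. cmod (hankel \<beta> f g w) powr q) \<and>
    (\<integral>w. cmod (hankel \<beta> f g w) powr q \<partial>bmeas \<beta>) powr (1 / q) \<le> C0 * (\<integral>w. cmod (g w) powr p \<partial>bmeas \<alpha>) powr (1 / p)"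
    using bounded unfolding hankel_bounded_iff[OF \<alpha> \<beta>] by blast
  define M where "M = bmass TYPE('n) \<beta>"
  have M: "M > 0" unfolding M_def by (rule bmass_pos[OF \<beta>])
  show thesis
  proof (rule that[of "l / M * (C0 * C1 * C2)"])
    show "l / M * (C0 * C1 * C2) > 0" using l M C0 C1 C2 by simp
    fix z u :: "complex ^ 'n" and L
    assume z: "z \<in> unit_ball" and L: "L \<ge> 0"
      and hb: "\<And>w. w \<in> unit_ball \<Longrightarrow> cmod (hinner (w - z) u) \<le> L * cmod (1 - hinner w z) powr \<kappa>"
    define g where "g = (\<lambda>w. kpow (l + 1 + m) (hinner w z))"
    define \<Theta> where "\<Theta> = (\<lambda>w. hinner (w - z) u * kpow (- m) (hinner w z) * kpow l (hinner z w))"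
    define h where "h = hankel \<beta> f g"
    have g: "g \<in> H_infinity" unfolding g_def by (rule kpow_left_H_infinity[OF z])
    note hg = C0(2)[OF g, folded h_def]
    have hm: "h \<in> borel_measurable (bmeas \<beta>)" and hq: "integrable (bmeas \<beta>) (\<lambda>w. cmod (h w) powr q)" using hg by auto
    interpret finite_measure "bmeas \<beta> :: (complex ^ 'n) measure" by (rule finite_measure_bmeas[OF \<beta>])
    have h1: "integrable (bmeas \<beta>) h"
    proof (rule Bochner_Integration.integrable_bound[OF _ hm])
      show "integrable (bmeas \<beta>) (\<lambda>w. 1 + cmod (h w) powr q)" using hq by simp
      have "cmod (h w) \<le> 1 + cmod (h w) powr q" for w
      proof (cases "cmod (h w) \<le> 1")
        case False
        then have "cmod (h w) powr 1 \<le> cmod (h w) powr q" using q by (intro powr_mono) auto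
        then show ?thesis using False by simp
      qed (simp add: add_increasing2)
      then show "AE w in bmeas \<beta>. cmod (h w) \<le> norm (1 + cmod (h w) powr q)"
        by (intro AE_I2) (simp add: order_trans[OF _ abs_ge_self])
    qed
    define D where "D w = cmod (1 - hinner w z) powr (- (l - m - \<kappa>))" for w
    have Dc: "continuous_on (cball 0 1) D"
    proof -
      have "continuous_on (cball 0 1) (\<lambda>w. cmod (kpow (l - m - \<kappa>) (hinner z w)))"
        by (intro continuous_intros kpow_hinner_right_continuous z)
      then show ?thesis by (simp add: norm_kpow D_def[abs_def] cmod_one_minus_hinner_commute[of _ z])
    qed
    have Dm: "D \<in> borel_measurable (bmeas \<beta>)"
      by (intro measurable_bmeas_continuous continuous_on_subset[OF Dc]) auto
    have Dq: "integrable (bmeas \<beta>) (\<lambda>w. D w powr q')"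
    proof -
      have "D w powr q' = cmod (1 - hinner z w) powr (- ((l - m - \<kappa>) * q'))" for w
        unfolding D_def powr_powr cmod_one_minus_hinner_commute[of w z]
        by (rule arg_cong[of _ _ "\<lambda>e. cmod (1 - hinner z w) powr e"]) (simp add: algebra_simps)
      then show ?thesis using kernel_powr_integrable[OF \<beta> z] by simp
    qed
    have \<Theta>D: "cmod (\<Theta> w) \<le> L * D w" if w: "w \<in> unit_ball" for w
    proof -
      have "cmod (\<Theta> w) = cmod (hinner (w - z) u) * (cmod (1 - hinner w z) powr m * cmod (1 - hinner w z) powr (- l))"
        by (simp add: \<Theta>_def norm_mult norm_kpow cmod_one_minus_hinner_commute[of z w])
      also have "\<dots> \<le> (L * cmod (1 - hinner w z) powr \<kappa>) * (cmod (1 - hinner w z) powr m * cmod (1 - hinner w z) powr (- l))"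
        by (intro mult_right_mono hb w) auto
      also have "\<dots> = L * D w"
      proof -
        have "cmod (1 - hinner w z) powr \<kappa> * (cmod (1 - hinner w z) powr m * cmod (1 - hinner w z) powr (- l)) = D w"
          unfolding powr_add[symmetric] D_def by (rule arg_cong[of _ _ "\<lambda>e. _ powr e"]) simp
        then show ?thesis by (simp only: mult.assoc)
      qed
      finally show ?thesis .
    qed
    have hD: "integrable (bmeas \<beta>) (\<lambda>w. cmod (h w) * D w)"
      and hold: "(\<integral>w. cmod (h w) * D w \<partial>bmeas \<beta>) \<le> (\<integral>w. cmod (h w) powr q \<partial>bmeas \<beta>) powr (1 / q) * (\<integral>w. D w powr q' \<partial>bmeas \<beta>) powr (1 / q')"
    proof -
      have nm: "(\<lambda>w. cmod (h w)) \<in> borel_measurable (bmeas \<beta>)" using hm by measurable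
      have D0: "D w \<ge> 0" for w by (simp add: D_def)
      note H = hoelder_integral[OF q q'(2) nm Dm norm_ge_zero D0 hq Dq]
      show "integrable (bmeas \<beta>) (\<lambda>w. cmod (h w) * D w)" by (rule H(1))
      show "(\<integral>w. cmod (h w) * D w \<partial>bmeas \<beta>) \<le> (\<integral>w. cmod (h w) powr q \<partial>bmeas \<beta>) powr (1 / q) * (\<integral>w. D w powr q' \<partial>bmeas \<beta>) powr (1 / q')"
        by (rule H(2))
    qed
    have pair: "cmod (\<integral>w. h w * \<Theta> w \<partial>bmeas \<beta>) = M * (dfct z powr (- l) * cmod (sderiv (u - hinner u z *s z) f z) / l)"
      unfolding h_def g_def \<Theta>_def M_def l_def
      by (rule hankel_pairing[OF f fi \<beta> z]) (use h1 in \<open>simp add: h_def g_def l_def\<close>)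
    have "cmod (\<integral>w. h w * \<Theta> w \<partial>bmeas \<beta>) \<le> (\<integral>w. L * (cmod (h w) * D w) \<partial>bmeas \<beta>)"
    proof (cases "integrable (bmeas \<beta>) (\<lambda>w. h w * \<Theta> w)")
      case True
      show ?thesis
      proof (rule Bochner_Integration.integral_norm_bound_integral[OF True])
        show "integrable (bmeas \<beta>) (\<lambda>w. L * (cmod (h w) * D w))" using hD by simp
        fix w :: "complex ^ 'n" assume "w \<in> space (bmeas \<beta>)"
        then have "cmod (h w) * cmod (\<Theta> w) \<le> cmod (h w) * (L * D w)" by (intro mult_left_mono \<Theta>D) auto
        then show "cmod (h w * \<Theta> w) \<le> L * (cmod (h w) * D w)" by (simp add: norm_mult mult_ac)
      qed
    next
      case False
      then have "(\<integral>w. h w * \<Theta> w \<partial>bmeas \<beta>) = 0" by (rule not_integrable_integral_eq)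
      moreover have "0 \<le> (\<integral>w. L * (cmod (h w) * D w) \<partial>bmeas \<beta>)"
        using L by (intro Bochner_Integration.integral_nonneg) (auto simp: D_def)
      ultimately show ?thesis by simp
    qed
    also have "\<dots> \<le> L * ((\<integral>w. cmod (h w) powr q \<partial>bmeas \<beta>) powr (1 / q) * (\<integral>w. D w powr q' \<partial>bmeas \<beta>) powr (1 / q'))"
      using mult_left_mono[OF hold L] by simp
    also have "\<dots> \<le> L * ((C0 * (C1 * dfct z powr (la / p - (l + 1 + m)))) * (C2 * dfct z powr (l / q' - (l - m - \<kappa>))))"
    proof (intro mult_left_mono mult_mono L)
      have "(\<integral>w. cmod (g w) powr p \<partial>bmeas \<alpha>) powr (1 / p) \<le> C1 * dfct z powr (la / p - (l + 1 + m))"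
        using C1(2)[OF z] by (simp add: g_def norm_kpow)
      then have "C0 * (\<integral>w. cmod (g w) powr p \<partial>bmeas \<alpha>) powr (1 / p) \<le> C0 * (C1 * dfct z powr (la / p - (l + 1 + m)))"
        using C0(1) by (intro mult_left_mono) auto
      then show "(\<integral>w. cmod (h w) powr q \<partial>bmeas \<beta>) powr (1 / q) \<le> C0 * (C1 * dfct z powr (la / p - (l + 1 + m)))"
        using hg by linarith
      show "(\<integral>w. D w powr q' \<partial>bmeas \<beta>) powr (1 / q') \<le> C2 * dfct z powr (l / q' - (l - m - \<kappa>))"
        unfolding D_def by (rule C2(2)[OF z])
    qed (use C0 C1 in auto)
    also have "\<dots> = (C0 * C1 * C2) * L * dfct z powr (la / p - (l + 1 + m) + (l / q' - (l - m - \<kappa>)))"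
      by (simp only: powr_add mult_ac)
    finally have "M * (dfct z powr (- l) * cmod (sderiv (u - hinner u z *s z) f z) / l) \<le>
        (C0 * C1 * C2) * L * dfct z powr (la / p - (l + 1 + m) + (l / q' - (l - m - \<kappa>)))"
      unfolding pair .
    then have "dfct z powr l * (dfct z powr (- l) * cmod (sderiv (u - hinner u z *s z) f z)) \<le>
        dfct z powr l * (l / M * (C0 * C1 * C2) * L * dfct z powr (la / p - (l + 1 + m) + (l / q' - (l - m - \<kappa>))))"
      using M l by (intro mult_left_mono) (simp_all add: field_simps)
    moreover have canc: "dfct z powr l * (dfct z powr (- l) * X) = X" for X
    proof -
      have "dfct z powr l * dfct z powr (- l) = 1" unfolding powr_add[symmetric] using dfct_pos[OF z] by simp
      then show ?thesis by (simp flip: mult.assoc)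
    qed
    moreover have rhs: "dfct z powr l * (l / M * (C0 * C1 * C2) * L * dfct z powr (la / p - (l + 1 + m) + (l / q' - (l - m - \<kappa>))))
      = l / M * (C0 * C1 * C2) * L * dfct z powr (\<kappa> - 1 - \<gamma>)"
    proof -
      have "l / q' = l - l / q"
      proof -
        have "l * (1 / q + 1 / q') = l" unfolding q'(2) by simp
        then show ?thesis by (simp add: distrib_left)
      qed
      then have "l + (la / p - (l + 1 + m) + (l / q' - (l - m - \<kappa>))) = \<kappa> - 1 - \<gamma>"
        unfolding \<gamma> l_def[symmetric] la_def[symmetric] by simp
      then show ?thesis by (simp only: mult_ac flip: powr_add)
    qed
    ultimately show "cmod (sderiv (u - hinner u z *s z) f z) \<le> l / M * (C0 * C1 * C2) * L * dfct z powr (\<kappa> - 1 - \<gamma>)"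
      by (simp only: canc rhs)
  qed
qed

text \<open>Only the component of \<open>w\<close> orthogonal to \<open>z\<close> meets
  \<open>u\<close>. By Pythagoras its squared norm is at most 1 minus that of the projection, hence
  at most 1 minus the square of \<open>cmod (hinner w z)\<close>, which is at most twice
  \<open>cmod (1 - hinner w z)\<close>.\<close>

lemma tangential_test_bound:
  fixes z w u :: "complex ^ 'n"
  assumes z: "z \<in> unit_ball" and w: "w \<in> unit_ball" and u: "hinner u z = 0"
  shows "cmod (hinner (w - z) u) \<le> (2 * norm u) * cmod (1 - hinner w z) powr (1/2)"
proof -
  define d where "d = cmod (1 - hinner w z)"
  have zu: "hinner z u = 0" using u cnj_hinner[of u z] by simp
  have "hinner (w - z) u = hinner (w - line_proj z w) u"
    by (simp add: hinner_diff_left zu line_proj_multiple)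
  then have le: "cmod (hinner (w - z) u) \<le> norm (w - line_proj z w) * norm u"
    using norm_hinner_le[of "w - line_proj z w" u] by simp
  have "norm (w - line_proj z w) \<le> 2 * sqrt d"
  proof (rule power2_le_imp_le)
    define x where "x = cmod (hinner w z)"
    have x: "0 \<le> x" "x \<le> norm (line_proj z w)" "x < 1"
      using norm_line_proj[of z w] mult_left_le[of "norm z" "norm (line_proj z w)"] z norm_hinner_less_1[OF w, of z]
      by (auto simp: x_def)
    have "(norm (w - line_proj z w))\<^sup>2 = (norm w)\<^sup>2 - (norm (line_proj z w))\<^sup>2"
      using pythagoras_line_proj[of w z] by simp
    also have "\<dots> \<le> 1 - x\<^sup>2"
    proof -
      have "x\<^sup>2 \<le> (norm (line_proj z w))\<^sup>2" using x by (intro power_mono)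
      moreover have "(norm w)\<^sup>2 \<le> 1\<^sup>2" using w by (intro power_mono) auto
      ultimately show ?thesis by simp
    qed
    also have "1 - x\<^sup>2 = (1 + x) * (1 - x)" by (simp add: power2_eq_square algebra_simps)
    also have "\<dots> \<le> 2 * (1 - x)" using x by (intro mult_right_mono) auto
    also have "1 - x \<le> d" using norm_triangle_ineq2[of 1 "hinner w z"] by (simp add: x_def d_def)
    finally have "(norm (w - line_proj z w))\<^sup>2 \<le> 2 * d" by simp
    also have "\<dots> \<le> (2 * sqrt d)\<^sup>2" by (simp add: power_mult_distrib d_def)
    finally show "(norm (w - line_proj z w))\<^sup>2 \<le> (2 * sqrt d)\<^sup>2" .
  qed (simp add: d_def)
  then have "norm (w - line_proj z w) * norm u \<le> 2 * sqrt d * norm u" by (intro mult_right_mono) auto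
  with le show ?thesis by (simp add: d_def powr_half_sqrt mult_ac)
qed

text \<open>The factor \<open>norm z\<close> on the right lets the resulting derivative bound scale
  correctly as \<open>z\<close> tends to 0. It forces two cases: away from the origin
  \<open>hinner (w - z) z\<close> is \<open>dfct z\<close> minus \<open>1 - hinner w z\<close>, near
  it \<open>cmod (1 - hinner w z)\<close> is at least 1/2.\<close>

lemma radial_test_bound:
  fixes z w :: "complex ^ 'n"
  assumes z: "z \<in> unit_ball" and w: "w \<in> unit_ball"
  shows "cmod (hinner (w - z) z) \<le> (6 * norm z) * cmod (1 - hinner w z) powr 1"
proof -
  define d where "d = cmod (1 - hinner w z)"
  have d: "dfct z \<le> 2 * d" "0 \<le> d" "1 - norm z \<le> d"
    using dfct_le_hinner[OF z w] cmod_one_minus_hinner_commute[of z w] Re_one_minus_hinner(1)[OF z, of w] w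
      complex_Re_le_cmod[of "1 - hinner z w"] by (auto simp: d_def)
  have "cmod (hinner (w - z) z) \<le> 6 * norm z * d"
  proof (cases "norm z \<ge> 1/2")
    case True
    have "hinner (w - z) z = of_real (dfct z) - (1 - hinner w z)"
      by (simp add: hinner_diff_left hinner_self dfct_def)
    then have "cmod (hinner (w - z) z) \<le> dfct z + d"
      using norm_triangle_ineq4[of "of_real (dfct z)" "1 - hinner w z"] dfct_pos[OF z] by (simp add: d_def)
    also have "\<dots> \<le> 3 * d" using d by simp
    also have "\<dots> \<le> 6 * norm z * d" using True d by (intro mult_right_mono) auto
    finally show ?thesis .
  next
    case False
    have "cmod (hinner (w - z) z) \<le> norm (w - z) * norm z" by (rule norm_hinner_le)
    also have "\<dots> \<le> 2 * norm z" using norm_triangle_ineq4[of w z] z w by (intro mult_right_mono) auto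
    also have "\<dots> \<le> 6 * norm z * d" 
    proof -
      have "norm z * (1/2) \<le> norm z * d" using False d by (intro mult_left_mono) auto
      moreover have "0 \<le> norm z * d" using d by simp
      ultimately have "2 * norm z \<le> 6 * (norm z * d)" by linarith
      then show ?thesis by (simp only: mult.assoc)
    qed
    finally show ?thesis .
  qed
  then show ?thesis by (simp add: d_def)
qed

text \<open>The radial bound takes \<open>u = z\<close> with \<open>\<kappa> = 1\<close>, the
  tangential one \<open>u\<close> orthogonal to \<open>z\<close> with
  \<open>\<kappa> = 1/2\<close>.\<close>

lemma necessary_bounds:
  fixes f :: "complex ^ 'n \<Rightarrow> complex"
  assumes \<alpha>: "\<alpha> > -1" and \<beta>: "\<beta> > -1" and p: "p > 1" and q: "q > 1"
    and \<gamma>: "\<gamma> = (real CARD('n) + 1 + \<beta>) / q - (real CARD('n) + 1 + \<alpha>) / p"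
    and \<gamma>l: "\<gamma> + (real CARD('n) + 1 + \<beta>) > 0"
    and f: "ball_holomorphic f" and fi: "integrable (bmeas \<beta>) f"
    and bounded: "hankel_bounded p \<alpha> q \<beta> f"
  obtains C where "C > 0"
    "\<And>z. z \<in> unit_ball \<Longrightarrow> cmod (sderiv z f z) \<le> C * dfct z powr (- 1 - \<gamma>) * norm z"
    "\<And>z u. z \<in> unit_ball \<Longrightarrow> hinner u z = 0 \<Longrightarrow> cmod (sderiv u f z) \<le> C * dfct z powr (- (1/2) - \<gamma>) * norm u"
proof -
  obtain C1 where C1: "C1 > 0" "\<And>(z :: complex ^ 'n) u L. z \<in> unit_ball \<Longrightarrow> L \<ge> 0 \<Longrightarrow>
    (\<And>w. w \<in> unit_ball \<Longrightarrow> cmod (hinner (w - z) u) \<le> L * cmod (1 - hinner w z) powr 1) \<Longrightarrow>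
    cmod (sderiv (u - hinner u z *s z) f z) \<le> C1 * L * dfct z powr (1 - 1 - \<gamma>)"
    by (rule hankel_necessary[OF \<alpha> \<beta> p q \<gamma> \<gamma>l _ f fi bounded, of 1]) (simp, blast)
  obtain C2 where C2: "C2 > 0" "\<And>(z :: complex ^ 'n) u L. z \<in> unit_ball \<Longrightarrow> L \<ge> 0 \<Longrightarrow>
    (\<And>w. w \<in> unit_ball \<Longrightarrow> cmod (hinner (w - z) u) \<le> L * cmod (1 - hinner w z) powr (1/2)) \<Longrightarrow>
    cmod (sderiv (u - hinner u z *s z) f z) \<le> C2 * L * dfct z powr (1/2 - 1 - \<gamma>)"
    by (rule hankel_necessary[OF \<alpha> \<beta> p q \<gamma> \<gamma>l _ f fi bounded, of "1/2"]) (simp, blast)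
  show thesis
  proof (rule that[of "6 * C1 + 2 * C2"])
    show "6 * C1 + 2 * C2 > 0" using C1(1) C2(1) by simp
    fix z :: "complex ^ 'n" assume z: "z \<in> unit_ball"
    have s: "dfct z > 0" by (rule dfct_pos[OF z])
    \<comment> \<open>The direction produced by the pairing shrinks to \<open>dfct z\<close> times
      \<open>z\<close>; dividing by this factor turns the exponent \<open>- \<gamma>\<close> into
      \<open>- 1 - \<gamma>\<close>.\<close>
    have "z - hinner z z *s z = of_real (dfct z) *s z"
      by (simp add: hinner_self dfct_def vec_eq_iff algebra_simps)
    then have "dfct z * cmod (sderiv z f z) \<le> C1 * (6 * norm z) * dfct z powr (1 - 1 - \<gamma>)"
      using C1(2)[OF z _ radial_test_bound[OF z]] s by (simp add: sderiv_smult[OF f z] norm_mult)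
    also have "dfct z powr (1 - 1 - \<gamma>) = dfct z * dfct z powr (- 1 - \<gamma>)"
    proof -
      have "dfct z powr (1 - 1 - \<gamma>) = dfct z powr 1 * dfct z powr (- 1 - \<gamma>)" unfolding powr_add[symmetric] by simp
      then show ?thesis using s by simp
    qed
    finally have "dfct z * cmod (sderiv z f z) \<le> dfct z * ((6 * C1) * dfct z powr (- 1 - \<gamma>) * norm z)"
      by (simp add: mult_ac)
    then have "cmod (sderiv z f z) \<le> (6 * C1) * dfct z powr (- 1 - \<gamma>) * norm z"
      using s by simp
    also have "\<dots> \<le> (6 * C1 + 2 * C2) * dfct z powr (- 1 - \<gamma>) * norm z"
      using C2(1) by (intro mult_right_mono) auto
    finally show "cmod (sderiv z f z) \<le> (6 * C1 + 2 * C2) * dfct z powr (- 1 - \<gamma>) * norm z" .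
    fix u :: "complex ^ 'n" assume u: "hinner u z = 0"
    have "cmod (sderiv u f z) \<le> C2 * (2 * norm u) * dfct z powr (1/2 - 1 - \<gamma>)"
      using C2(2)[OF z _ tangential_test_bound[OF z _ u]] by (simp add: u)
    also have "\<dots> = (2 * C2) * dfct z powr (- (1/2) - \<gamma>) * norm u" by simp
    also have "\<dots> \<le> (6 * C1 + 2 * C2) * dfct z powr (- (1/2) - \<gamma>) * norm u"
      using C1(1) by (intro mult_right_mono) auto
    finally show "cmod (sderiv u f z) \<le> (6 * C1 + 2 * C2) * dfct z powr (- (1/2) - \<gamma>) * norm u" .
  qed
qed

section \<open>Between directional bounds and the Bloch condition\<close>

lemma bloch_spaceI:
  fixes f :: "complex ^ 'n \<Rightarrow> complex"
  assumes f: "ball_holomorphic f" and C: "C > 0"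
    and rad: "\<And>z. z \<in> unit_ball \<Longrightarrow> cmod (sderiv z f z) \<le> C * dfct z powr (- 1 - \<gamma>) * norm z"
    and tan: "\<And>z u. z \<in> unit_ball \<Longrightarrow> hinner u z = 0 \<Longrightarrow> cmod (sderiv u f z) \<le> C * dfct z powr (- (1/2) - \<gamma>) * norm u"
  shows "f \<in> bloch_space (1 + \<gamma>)"
    and "z \<in> unit_ball \<Longrightarrow> cmod (sderiv v f z) \<le> 2 * C * dfct z powr (- 1 - \<gamma>) * norm v"
proof -
  have sd: "cmod (sderiv v f z) \<le> 2 * C * dfct z powr (- 1 - \<gamma>) * norm v" if z: "z \<in> unit_ball" for v z
  proof -
    have "sderiv v f z = sderiv (line_proj z v) f z + sderiv (v - line_proj z v) f z"
      by (simp flip: sderiv_add[OF f z])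
    then have "cmod (sderiv v f z) \<le> cmod (sderiv (line_proj z v) f z) + cmod (sderiv (v - line_proj z v) f z)"
      by (simp add: norm_triangle_ineq)
    also have "\<dots> \<le> C * dfct z powr (- 1 - \<gamma>) * norm (line_proj z v) + C * dfct z powr (- (1/2) - \<gamma>) * norm (v - line_proj z v)"
      by (intro add_mono sderiv_line_proj_le[OF f z rad[OF z]] tan[OF z hinner_perp])
    also have "\<dots> \<le> C * dfct z powr (- 1 - \<gamma>) * norm v + C * dfct z powr (- 1 - \<gamma>) * norm v"
    proof (intro add_mono mult_mono mult_left_mono norm_perp_le)
      show "dfct z powr (- (1/2) - \<gamma>) \<le> dfct z powr (- 1 - \<gamma>)"
        using dfct_pos[OF z] dfct_le_1[of z] by (intro powr_mono') auto
    qed (use C in auto)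
    finally show ?thesis by (simp add: mult_ac)
  qed
  then show "z \<in> unit_ball \<Longrightarrow> cmod (sderiv v f z) \<le> 2 * C * dfct z powr (- 1 - \<gamma>) * norm v" .
  have "dfct z powr (1 + \<gamma>) * norm (cgrad f z) \<le> 2 * C" if z: "z \<in> unit_ball" for z
  proof -
    have "norm (cgrad f z) \<le> 2 * C * dfct z powr (- 1 - \<gamma>)"
      by (rule cgrad_le[OF f z _ sd[OF z]]) (use C in simp)
    then have "dfct z powr (1 + \<gamma>) * norm (cgrad f z) \<le> dfct z powr (1 + \<gamma>) * (2 * C * dfct z powr (- 1 - \<gamma>))"
      by (intro mult_left_mono) auto
    also have "\<dots> = 2 * C * (dfct z powr (1 + \<gamma>) * dfct z powr (- 1 - \<gamma>))" by simp
    also have "\<dots> = 2 * C" unfolding powr_add[symmetric] using dfct_pos[OF z] by simp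
    finally show ?thesis .
  qed
  then have "bdd_above ((\<lambda>z. dfct z powr (1 + \<gamma>) * norm (cgrad f z)) ` unit_ball)"
    by (intro bdd_aboveI[of _ "2 * C"]) auto
  then show "f \<in> bloch_space (1 + \<gamma>)" using f by (simp add: bloch_space_def dfct_def)
qed

lemma bloch_spaceD:
  fixes f :: "complex ^ 'n \<Rightarrow> complex"
  assumes "f \<in> bloch_space s"
  obtains M where "M > 0" "ball_holomorphic f"
    "\<And>z v. z \<in> unit_ball \<Longrightarrow> cmod (sderiv v f z) \<le> M * (dfct z powr (- s) * norm v)"
proof -
  have f: "ball_holomorphic f" and bd: "bdd_above ((\<lambda>z. dfct z powr s * norm (cgrad f z)) ` unit_ball)"
    using assms by (auto simp: bloch_space_def dfct_def)
  obtain M where M: "\<And>z. z \<in> unit_ball \<Longrightarrow> dfct z powr s * norm (cgrad f z) \<le> M"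
    using bd unfolding bdd_above_def by blast
  show thesis
  proof (rule that[OF _ f])
    show "\<bar>M\<bar> + 1 > 0" by simp
    fix z v :: "complex ^ 'n" assume z: "z \<in> unit_ball"
    have "norm (cgrad f z) = dfct z powr (- s) * (dfct z powr s * norm (cgrad f z))"
    proof -
      have "dfct z powr (- s) * dfct z powr s = 1" unfolding powr_add[symmetric] using dfct_pos[OF z] by simp
      then show ?thesis by (simp flip: mult.assoc)
    qed
    also have "\<dots> \<le> dfct z powr (- s) * (\<bar>M\<bar> + 1)" using M[OF z] by (intro mult_left_mono) auto
    finally have "norm (cgrad f z) * norm v \<le> dfct z powr (- s) * (\<bar>M\<bar> + 1) * norm v" by (intro mult_right_mono) auto
    then show "cmod (sderiv v f z) \<le> (\<bar>M\<bar> + 1) * (dfct z powr (- s) * norm v)"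
      using sderiv_le_cgrad[OF f z, of v] by (simp add: mult_ac)
  qed
qed

section \<open>Sufficiency in the several ranges of the exponent\<close>

lemma sufficient_growth:
  fixes f :: "complex ^ 'n \<Rightarrow> complex"
  assumes \<alpha>: "\<alpha> > -1" and \<beta>: "\<beta> > -1" and p: "p > 1" and pq: "p \<le> q"
    and \<gamma>: "\<gamma> = (real CARD('n) + 1 + \<beta>) / q - (real CARD('n) + 1 + \<alpha>) / p"
    and fi: "integrable (bmeas \<beta>) f" and pos: "\<gamma> > 0" and bloch: "f \<in> bloch_space (1 + \<gamma>)"
  shows "hankel_bounded p \<alpha> q \<beta> f"
proof -
  obtain M where M: "M > 0" and f: "ball_holomorphic f"
    and b: "\<And>z v. z \<in> unit_ball \<Longrightarrow> cmod (sderiv v f z) \<le> M * (dfct z powr (- (1 + \<gamma>)) * norm v)"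
    by (rule bloch_spaceD[OF bloch]) blast
  have M0: "M \<ge> 0" using M by simp
  obtain C where C: "C > 0" "\<And>z w. z \<in> unit_ball \<Longrightarrow> w \<in> unit_ball \<Longrightarrow>
    cmod (f z - f w) \<le> C * (dfct z powr (- \<gamma>) + dfct w powr (- \<gamma>))"
    by (rule growth_bound[OF f M0 pos b]) blast+
  \<comment> \<open>From \<open>p \<le> q\<close> one gets
    \<open>q * \<gamma> \<le> \<beta> - \<alpha>\<close>, and \<open>\<alpha> > -1\<close> makes
    this less than \<open>\<beta> + 1\<close>.\<close>
  have q\<gamma>: "- q * (- \<gamma>) < \<beta> + 1"
  proof -
    have "q * \<gamma> = real CARD('n) + 1 + \<beta> - q * ((real CARD('n) + 1 + \<alpha>) / p)"
      using p pq by (simp add: \<gamma> right_diff_distrib)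
    moreover have "1 * (real CARD('n) + 1 + \<alpha>) \<le> (q / p) * (real CARD('n) + 1 + \<alpha>)"
      using p pq \<alpha> by (intro mult_right_mono) auto
    ultimately show ?thesis using \<alpha> by simp
  qed
  show ?thesis
  \<comment> \<open>With the pairs \<open>(a, c)\<close> equal to \<open>(- \<gamma>, 0)\<close> and
    \<open>(0, - \<gamma>)\<close> the power of \<open>1 - hinner z w\<close> has exponent 0, which
    is the shape of the growth bound.\<close>
  proof (rule hankel_bounded_of_oscillation[OF \<alpha> \<beta> p pq \<gamma> f fi C(1) q\<gamma>, where ?a2.0 = 0 and ?c1.0 = 0 and ?c2.0 = "- \<gamma>"])
    show "- q * 0 < \<beta> + 1" using \<beta> by simp
    fix z w :: "complex ^ 'n" assume z: "z \<in> unit_ball" and w: "w \<in> unit_ball"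
    show "cmod (f z - f w) \<le> C * (cmod (1 - hinner z w) powr (- \<gamma> - - \<gamma> - 0) * dfct z powr - \<gamma> * dfct w powr 0
        + cmod (1 - hinner z w) powr (- \<gamma> - 0 - - \<gamma>) * dfct z powr 0 * dfct w powr - \<gamma>)"
      using C(2)[OF z w] cmod_one_minus_hinner_pos[OF z w] dfct_pos[OF z] dfct_pos[OF w] by simp
  qed
qed

text \<open>The common route for \<open>\<gamma> \<le> 0\<close>: dimension one, the Bloch case in
  several dimensions, and the critical exponent differ only in how the hypothesis
  \<open>star\<close> is obtained.\<close>

lemma sufficient_star:
  fixes f :: "complex ^ 'n \<Rightarrow> complex"
  assumes \<alpha>: "\<alpha> > -1" and \<beta>: "\<beta> > -1" and p: "p > 1" and pq: "p \<le> q"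
    and \<gamma>: "\<gamma> = (real CARD('n) + 1 + \<beta>) / q - (real CARD('n) + 1 + \<alpha>) / p"
    and f: "ball_holomorphic f" and fi: "integrable (bmeas \<beta>) f" and neg: "\<gamma> \<le> 0" and M: "M \<ge> 0"
    and star: "\<And>x v. x \<in> unit_ball \<Longrightarrow>
      cmod (sderiv v f x) \<le> M * (dfct x powr (- \<gamma> - 1/2) * norm v + dfct x powr (- \<gamma> - 1) * cmod (hinner v x))"
  shows "hankel_bounded p \<alpha> q \<beta> f"
proof -
  have q: "q > 1" using p pq by simp
  \<comment> \<open>Small enough for the lower condition \<open>q * \<epsilon> < \<beta> + 1\<close>
    of Schur's test, with outer weight exponent \<open>- \<epsilon>\<close>.\<close>
  define \<epsilon> where "\<epsilon> = min (1/2) ((\<beta> + 1) / (2 * q))"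
  have \<epsilon>: "0 < \<epsilon>" "\<epsilon> < 1" using \<beta> q by (auto simp: \<epsilon>_def)
  have "q * \<epsilon> \<le> q * ((\<beta> + 1) / (2 * q))" using q by (intro mult_left_mono) (auto simp: \<epsilon>_def)
  also have "\<dots> < \<beta> + 1" using q \<beta> by simp
  finally have q\<epsilon>: "- q * (- \<epsilon>) < \<beta> + 1" by simp
  have \<delta>: "0 \<le> - \<gamma>" using neg by simp
  obtain C where C: "C > 0" "\<And>z w. z \<in> unit_ball \<Longrightarrow> w \<in> unit_ball \<Longrightarrow>
    cmod (f z - f w) \<le> C * (cmod (1 - hinner z w) powr (- \<gamma> + \<epsilon>) * dfct z powr (- \<epsilon>)
      + cmod (1 - hinner z w) powr (- \<gamma> + \<epsilon>) * dfct w powr (- \<epsilon>))"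
    by (rule oscillation_bound[OF f M \<delta> \<epsilon> star]) blast+
  show ?thesis
  proof (rule hankel_bounded_of_oscillation[OF \<alpha> \<beta> p pq \<gamma> f fi C(1) q\<epsilon>, where ?a2.0 = 0 and ?c1.0 = 0 and ?c2.0 = "- \<epsilon>"])
    show "- q * 0 < \<beta> + 1" using \<beta> by simp
    fix z w :: "complex ^ 'n" assume z: "z \<in> unit_ball" and w: "w \<in> unit_ball"
    show "cmod (f z - f w) \<le> C * (cmod (1 - hinner z w) powr (- \<gamma> - - \<epsilon> - 0) * dfct z powr - \<epsilon> * dfct w powr 0
        + cmod (1 - hinner z w) powr (- \<gamma> - 0 - - \<epsilon>) * dfct z powr 0 * dfct w powr - \<epsilon>)"
      using C(2)[OF z w] dfct_pos[OF z] dfct_pos[OF w] by simp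
  qed
qed

lemma sufficient_constant:
  fixes f :: "complex ^ 'n \<Rightarrow> complex"
  assumes \<alpha>: "\<alpha> > -1" and \<beta>: "\<beta> > -1" and p: "p > 1" and pq: "p \<le> q"
    and \<gamma>: "\<gamma> = (real CARD('n) + 1 + \<beta>) / q - (real CARD('n) + 1 + \<alpha>) / p"
    and f: "ball_holomorphic f" and fi: "integrable (bmeas \<beta>) f" and const: "f constant_on unit_ball"
  shows "hankel_bounded p \<alpha> q \<beta> f"
proof (rule hankel_bounded_of_oscillation[OF \<alpha> \<beta> p pq \<gamma> f fi zero_less_one, where ?a1.0 = 0 and ?a2.0 = 0 and ?c1.0 = 0 and ?c2.0 = 0])
  fix z w :: "complex ^ 'n" assume "z \<in> unit_ball" "w \<in> unit_ball"
  then have "f z = f w" using const unfolding constant_on_def by metis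
  then show "cmod (f z - f w) \<le> 1 * (cmod (1 - hinner z w) powr (- \<gamma> - 0 - 0) * dfct z powr 0 * dfct w powr 0
    + cmod (1 - hinner z w) powr (- \<gamma> - 0 - 0) * dfct z powr 0 * dfct w powr 0)" by simp
qed (use \<beta> in auto)

lemma hinner_one_dim:
  assumes "CARD('n) = 1"
  shows "cmod (hinner v x) = norm v * norm (x :: complex ^ 'n)"
proof -
  obtain k where k: "(UNIV :: 'n set) = {k}" using assms by (rule card_1_singletonE)
  show ?thesis unfolding hinner_def norm_vec_def L2_set_def k by (simp add: norm_mult)
qed

text \<open>In dimension one \<open>cmod (hinner v x)\<close> equals \<open>norm v * norm x\<close>,
  and \<open>sqrt (dfct x) + norm x \<ge> 1\<close> distributes the Bloch bound over the two
  terms.\<close>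

lemma star_one_dim:
  fixes f :: "complex ^ 'n \<Rightarrow> complex"
  assumes n: "CARD('n) = 1" and M: "M \<ge> 0" and x: "x \<in> unit_ball"
    and bloch: "cmod (sderiv v f x) \<le> M * (dfct x powr (- (1 + \<gamma>)) * norm v)"
  shows "cmod (sderiv v f x) \<le> M * (dfct x powr (- \<gamma> - 1/2) * norm v + dfct x powr (- \<gamma> - 1) * cmod (hinner v x))"
proof -
  have s: "dfct x > 0" by (rule dfct_pos[OF x])
  have "1 \<le> sqrt (dfct x) + norm x"
  proof (rule power2_le_imp_le)
    have "1 = (sqrt (dfct x))\<^sup>2 + (norm x)\<^sup>2" using s by (simp add: dfct_def)
    also have "\<dots> \<le> (sqrt (dfct x) + norm x)\<^sup>2" using s by (simp add: power2_sum)
    finally show "1\<^sup>2 \<le> (sqrt (dfct x) + norm x)\<^sup>2" by simp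
  qed (use s in simp)
  then have "1 * norm v \<le> (sqrt (dfct x) + norm x) * norm v" by (intro mult_right_mono) auto
  then have "M * (dfct x powr (- (1 + \<gamma>)) * norm v) \<le> M * (dfct x powr (- (1 + \<gamma>)) * (sqrt (dfct x) * norm v + cmod (hinner v x)))"
    using M unfolding hinner_one_dim[OF n] by (intro mult_left_mono) (auto simp: algebra_simps)
  also have "\<dots> = M * ((dfct x powr (- (1 + \<gamma>)) * dfct x powr (1/2)) * norm v + dfct x powr (- (1 + \<gamma>)) * cmod (hinner v x))"
    using s by (simp add: powr_half_sqrt algebra_simps)
  also have "\<dots> = M * (dfct x powr (- \<gamma> - 1/2) * norm v + dfct x powr (- \<gamma> - 1) * cmod (hinner v x))"
  proof -
    have "- (1 + \<gamma>) + 1/2 = - \<gamma> - 1/2" "- (1 + \<gamma>) = - \<gamma> - 1" by simp_all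
    then show ?thesis unfolding powr_add[symmetric] by (simp only:)
  qed
  finally show ?thesis using bloch by linarith
qed

text \<open>The component of \<open>v\<close> along \<open>x\<close> is charged to the Bloch bound
  and measured by \<open>norm_line_proj_le\<close>; the orthogonal component is charged to the
  better tangential bound.\<close>

lemma star_of_tangential:
  fixes f :: "complex ^ 'n \<Rightarrow> complex"
  assumes f: "ball_holomorphic f" and M: "M \<ge> 0" and C: "C \<ge> 0" and x: "x \<in> unit_ball"
    and bloch: "\<And>v. cmod (sderiv v f x) \<le> M * (dfct x powr (\<delta> - 1) * norm v)"
    and tan: "\<And>u. hinner u x = 0 \<Longrightarrow> cmod (sderiv u f x) \<le> C * (dfct x powr (\<delta> - 1/2) * norm u)"
  shows "cmod (sderiv v f x) \<le> (M + C) * (dfct x powr (\<delta> - 1/2) * norm v + dfct x powr (\<delta> - 1) * cmod (hinner v x))"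
proof -
  have s: "dfct x > 0" by (rule dfct_pos[OF x])
  have "sderiv v f x = sderiv (line_proj x v) f x + sderiv (v - line_proj x v) f x"
    by (simp flip: sderiv_add[OF f x])
  then have "cmod (sderiv v f x) \<le> cmod (sderiv (line_proj x v) f x) + cmod (sderiv (v - line_proj x v) f x)"
    by (simp add: norm_triangle_ineq)
  also have "\<dots> \<le> M * (dfct x powr (\<delta> - 1) * norm (line_proj x v)) + C * (dfct x powr (\<delta> - 1/2) * norm (v - line_proj x v))"
    by (intro add_mono bloch tan hinner_perp)
  also have "\<dots> \<le> M * (dfct x powr (\<delta> - 1) * (sqrt (dfct x) * norm v + cmod (hinner v x))) + C * (dfct x powr (\<delta> - 1/2) * norm v)"
    using M C by (intro add_mono mult_left_mono norm_line_proj_le[OF x] norm_perp_le) auto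
  also have "\<dots> = M * ((dfct x powr (\<delta> - 1) * dfct x powr (1/2)) * norm v + dfct x powr (\<delta> - 1) * cmod (hinner v x)) + C * (dfct x powr (\<delta> - 1/2) * norm v)"
    using s by (simp add: powr_half_sqrt algebra_simps)
  also have "dfct x powr (\<delta> - 1) * dfct x powr (1/2) = dfct x powr (\<delta> - 1/2)"
    unfolding powr_add[symmetric] by simp
  also have "M * (dfct x powr (\<delta> - 1/2) * norm v + dfct x powr (\<delta> - 1) * cmod (hinner v x)) + C * (dfct x powr (\<delta> - 1/2) * norm v)
    \<le> (M + C) * (dfct x powr (\<delta> - 1/2) * norm v + dfct x powr (\<delta> - 1) * cmod (hinner v x))"
    using C by (simp add: algebra_simps)
  finally show ?thesis .
qed

section \<open>Symbols with bounded Hankel operator below the critical exponent\<close>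

text \<open>Since \<open>dfct\<close> lies between 0 and 1 on the ball, lowering the exponent only
  enlarges the norm on the domain.\<close>

lemma hankel_bounded_smaller_weight:
  fixes f :: "complex ^ 'n \<Rightarrow> complex"
  assumes \<alpha>: "\<alpha> > -1" and \<alpha>': "\<alpha>' > -1" "\<alpha>' \<le> \<alpha>" and \<beta>: "\<beta> > -1" and p: "p > 1"
    and bounded: "hankel_bounded p \<alpha> q \<beta> f"
  shows "hankel_bounded p \<alpha>' q \<beta> f"
proof -
  have le: "(\<integral>w. cmod (g w) powr p \<partial>bmeas \<alpha>) powr (1 / p) \<le> (\<integral>w. cmod (g w) powr p \<partial>bmeas \<alpha>') powr (1 / p)"
    if g: "g \<in> H_infinity" for g :: "complex ^ 'n \<Rightarrow> complex"
  proof -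
    note m = powr_norm_measurable[OF ball_holomorphic_measurable[OF H_infinity_holomorphic[OF g]], of p \<alpha>']
    note i = H_infinity_integrable(2)[OF g _ , of _ p]
    have "(\<integral>w. cmod (g w) powr p \<partial>bmeas \<alpha>) = (\<integral>w. dfct w powr (\<alpha> - \<alpha>') *\<^sub>R cmod (g w) powr p \<partial>bmeas \<alpha>')"
      using integral_bmeas_shift[OF m, of "\<alpha> - \<alpha>'"] by simp
    also have "\<dots> \<le> (\<integral>w. cmod (g w) powr p \<partial>bmeas \<alpha>')"
    proof (rule integral_mono)
      show "integrable (bmeas \<alpha>') (\<lambda>w. dfct w powr (\<alpha> - \<alpha>') *\<^sub>R cmod (g w) powr p)"
        using integrable_bmeas_shift[OF m, of "\<alpha> - \<alpha>'"] i[OF \<alpha>] p by simp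
      show "integrable (bmeas \<alpha>') (\<lambda>w. cmod (g w) powr p)" using i[OF \<alpha>'(1)] p by simp
      fix w :: "complex ^ 'n" assume "w \<in> space (bmeas \<alpha>')"
      then have "dfct w powr (\<alpha> - \<alpha>') \<le> 1" using dfct_pos[of w] dfct_le_1[of w] \<alpha>' by (simp add: powr_le1)
      from mult_right_mono[OF this, of "cmod (g w) powr p"]
      show "dfct w powr (\<alpha> - \<alpha>') *\<^sub>R cmod (g w) powr p \<le> cmod (g w) powr p" by simp
    qed
    finally show ?thesis
      using p by (intro powr_mono2 Bochner_Integration.integral_nonneg) auto
  qed
  obtain C where C: "C > 0" "\<And>g. g \<in> H_infinity \<Longrightarrow>
    hankel \<beta> f g \<in> borel_measurable (bmeas \<beta>) \<and> integrable (bmeas \<beta>) (\<lambda>w. cmod (hankel \<beta> f g w) powr q) \<and>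
    (\<integral>w. cmod (hankel \<beta> f g w) powr q \<partial>bmeas \<beta>) powr (1 / q) \<le> C * (\<integral>w. cmod (g w) powr p \<partial>bmeas \<alpha>) powr (1 / p)"
    using bounded unfolding hankel_bounded_iff[OF \<alpha> \<beta>] by blast
  show ?thesis
    unfolding hankel_bounded_iff[OF \<alpha>'(1) \<beta>]
  proof (intro exI[of _ C] conjI ballI C(1))
    fix g :: "complex ^ 'n \<Rightarrow> complex" assume g: "g \<in> H_infinity"
    show "hankel \<beta> f g \<in> borel_measurable (bmeas \<beta>)" "integrable (bmeas \<beta>) (\<lambda>w. cmod (hankel \<beta> f g w) powr q)"
      using C(2)[OF g] by auto
    have "C * (\<integral>w. cmod (g w) powr p \<partial>bmeas \<alpha>) powr (1 / p) \<le> C * (\<integral>w. cmod (g w) powr p \<partial>bmeas \<alpha>') powr (1 / p)"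
      using le[OF g] C(1) by (intro mult_left_mono) auto
    then show "(\<integral>w. cmod (hankel \<beta> f g w) powr q \<partial>bmeas \<beta>) powr (1 / q) \<le> C * (\<integral>w. cmod (g w) powr p \<partial>bmeas \<alpha>') powr (1 / p)"
      using C(2)[OF g] by linarith
  qed
qed

text \<open>The test functions require \<open>\<gamma> > - (n + 1 + \<beta>)\<close>; shrinking \<open>\<alpha>\<close> strengthens the norm on the domain and raises \<open>\<gamma>\<close>.\<close>

lemma necessary_bounds_subcritical:
  fixes f :: "complex ^ 'n \<Rightarrow> complex"
  assumes \<alpha>: "\<alpha> > -1" and \<beta>: "\<beta> > -1" and p: "p > 1" and q: "q > 1"
    and \<gamma>: "\<gamma> = (real CARD('n) + 1 + \<beta>) / q - (real CARD('n) + 1 + \<alpha>) / p"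
    and f: "ball_holomorphic f" and fi: "integrable (bmeas \<beta>) f"
    and bounded: "hankel_bounded p \<alpha> q \<beta> f" and \<theta>: "\<gamma> < \<theta>" "\<theta> \<ge> -1"
  obtains C \<gamma>' where "C > 0" "\<gamma>' < \<theta>"
    "\<And>z. z \<in> unit_ball \<Longrightarrow> cmod (sderiv z f z) \<le> C * dfct z powr (- 1 - \<gamma>') * norm z"
    "\<And>z u. z \<in> unit_ball \<Longrightarrow> hinner u z = 0 \<Longrightarrow> cmod (sderiv u f z) \<le> C * dfct z powr (- (1/2) - \<gamma>') * norm u"
proof -
  define n where "n = real CARD('n)"
  define l where "l = n + 1 + \<beta>"
  have n1: "n \<ge> 1" unfolding n_def by (simp add: Suc_le_eq)
  have l: "l > n" using \<beta> by (simp add: l_def)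
  \<comment> \<open>The lower bound \<open>- l < \<gamma>'\<close> is what the test functions
    require, \<open>\<gamma>' < l / q - n / p\<close> means that the corresponding
    \<open>\<alpha>'\<close> exceeds -1, and \<open>\<gamma> \<le> \<gamma>'\<close> means
    \<open>\<alpha>' \<le> \<alpha>\<close>.\<close>
  have "\<exists>\<gamma>'. \<gamma> \<le> \<gamma>' \<and> \<gamma>' < \<theta> \<and> - l < \<gamma>' \<and> \<gamma>' < l / q - n / p"
  proof (cases "\<gamma> + l > 0")
    case True
    have "\<gamma> < l / q - n / p"
      using \<alpha> p unfolding \<gamma> n_def[symmetric] l_def by (simp add: divide_strict_right_mono)
    then show ?thesis using True \<theta> by (intro exI[of _ \<gamma>]) auto
  next
    case False
    have "n / p < n / 1" using p n1 by (intro divide_strict_left_mono) auto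
    moreover have "l / q > 0" using q l n1 by simp
    ultimately have "- l < l / q - n / p" using l by simp
    moreover have "- l < \<theta>" using l n1 \<theta> by simp
    ultimately obtain \<gamma>' where "- l < \<gamma>'" "\<gamma>' < min \<theta> (l / q - n / p)" using dense[of "- l" "min \<theta> (l / q - n / p)"] by auto
    then show ?thesis using False by (intro exI[of _ \<gamma>']) auto
  qed
  then obtain \<gamma>' where \<gamma>': "\<gamma> \<le> \<gamma>'" "\<gamma>' < \<theta>" "- l < \<gamma>'" "\<gamma>' < l / q - n / p" by blast
  define \<alpha>' where "\<alpha>' = p * (l / q - \<gamma>') - (n + 1)"
  have \<gamma>'_eq: "\<gamma>' = (real CARD('n) + 1 + \<beta>) / q - (real CARD('n) + 1 + \<alpha>') / p"
    using p by (simp add: \<alpha>'_def n_def l_def field_simps)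
  have "n < p * (l / q - \<gamma>')" using \<gamma>'(4) p by (simp add: field_simps)
  then have \<alpha>'1: "\<alpha>' > -1" by (simp add: \<alpha>'_def)
  have "(n + 1 + \<alpha>') / p \<le> (n + 1 + \<alpha>) / p" using \<gamma>'(1) unfolding \<gamma>'_eq \<gamma> n_def by simp
  then have \<alpha>'2: "\<alpha>' \<le> \<alpha>" using p by (simp add: divide_le_cancel)
  obtain C where "C > 0"
    "\<And>z. z \<in> unit_ball \<Longrightarrow> cmod (sderiv z f z) \<le> C * dfct z powr (- 1 - \<gamma>') * norm z"
    "\<And>z u. z \<in> unit_ball \<Longrightarrow> hinner u z = 0 \<Longrightarrow> cmod (sderiv u f z) \<le> C * dfct z powr (- (1/2) - \<gamma>') * norm u"
    by (rule necessary_bounds[OF \<alpha>'1 \<beta> p q \<gamma>'_eq _ f fi hankel_bounded_smaller_weight[OF \<alpha> \<alpha>'1 \<alpha>'2 \<beta> p bounded]])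
      (use \<gamma>'(3) in \<open>simp add: l_def n_def\<close>, blast)
  then show thesis using that[of C \<gamma>'] \<gamma>'(2) by blast
qed

section \<open>Constancy from derivatives that decay at the sphere\<close>

lemma constant_of_sderiv_zero:
  fixes f :: "complex ^ 'n \<Rightarrow> complex"
  assumes f: "ball_holomorphic f" and zero: "\<And>z. z \<in> unit_ball \<Longrightarrow> sderiv z f z = 0"
  shows "f constant_on unit_ball"
proof -
  have "f z = f 0" if z: "z \<in> unit_ball" for z
  proof -
    have "cmod (f z - f 0) \<le> 0"
    proof (rule segment_bound[OF f _ z])
      fix t :: real assume t: "0 < t" "t < 1"
      have b: "t *\<^sub>R z \<in> unit_ball" using segment_in_ball[of 0 z t] z t by simp
      have "of_real t * sderiv z f (t *\<^sub>R z) = 0"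
        using zero[OF b] by (simp add: sderiv_scaleR[OF f b])
      then show "cmod (sderiv (z - 0) f (0 + t *\<^sub>R (z - 0))) \<le> 0" using t by simp
    qed simp
    then show ?thesis by simp
  qed
  then show ?thesis unfolding constant_on_def by blast
qed

lemma one_minus_square_powr_tendsto_0:
  fixes e :: real
  assumes "e > 0"
  shows "((\<lambda>r. C * (1 - r\<^sup>2) powr e) \<longlongrightarrow> 0) (at_left 1)"
proof -
  have "((\<lambda>r. C * (1 - r\<^sup>2) powr e) \<longlongrightarrow> C * (1 - 1\<^sup>2) powr e) (at_left 1)"
  proof (intro tendsto_mult tendsto_const tendsto_powr2)
    show "((\<lambda>r::real. 1 - r\<^sup>2) \<longlongrightarrow> 1 - 1\<^sup>2) (at_left 1)" by (intro tendsto_intros)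
    have "\<forall>\<^sub>F r in at_left (1::real). r \<in> {0<..<1}" by (rule eventually_at_left_1) simp_all
    then show "\<forall>\<^sub>F r in at_left (1::real). 0 \<le> 1 - r\<^sup>2"
      by eventually_elim (simp add: abs_square_le_1)
  qed (use assms in auto)
  then show ?thesis using assms by simp
qed

text \<open>On the complex line through \<open>z\<close> the derivative along the line is a
  holomorphic function \<open>H\<close> on the unit disc. The factor \<open>norm z\<close> in the
  hypothesis cancels against the length of the direction, so \<open>H\<close> tends to 0 uniformly
  at the circle and vanishes.\<close>

lemma constant_one_dim:
  fixes f :: "complex ^ 'n \<Rightarrow> complex"
  assumes f: "ball_holomorphic f" and C: "C > 0" and e: "e > 0"
    and bnd: "\<And>z. z \<in> unit_ball \<Longrightarrow> cmod (sderiv z f z) \<le> C * dfct z powr e * norm z"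
  shows "f constant_on unit_ball"
proof (rule constant_of_sderiv_zero[OF f])
  fix z :: "complex ^ 'n" assume z: "z \<in> unit_ball"
  show "sderiv z f z = 0"
  proof (cases "z = 0")
    case True
    then show ?thesis by (simp add: sderiv_zero)
  next
    case False
    define \<eta> where "\<eta> = (1 / norm z) *\<^sub>R z"
    have \<eta>: "norm \<eta> = 1" "z = of_real (norm z) *s \<eta>" using False by (auto simp: \<eta>_def of_real_vec_smult)
    define H where "H t = sderiv \<eta> f (0 + t *s \<eta>)" for t
    have hol: "H holomorphic_on ball 0 1"
    proof -
      have "(\<lambda>t. sderiv \<eta> f (0 + t *s \<eta>)) holomorphic_on {t. 0 + t *s \<eta> \<in> ball 0 1}"
        by (rule slice_hol_slice[OF slice_hol_sderiv[OF ball_holomorphic_imp_slice_hol[OF f]]])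
      then show ?thesis unfolding H_def by (rule holomorphic_on_subset) (auto simp: norm_vec_smult \<eta>)
    qed
    have Hb: "cmod (H t) \<le> C * (1 - (cmod t)\<^sup>2) powr e" if t: "cmod t < 1" "t \<noteq> 0" for t
    proof -
      have tb: "t *s \<eta> \<in> unit_ball" using t \<eta> by (simp add: norm_vec_smult)
      have "cmod t * cmod (H t) = cmod (sderiv (t *s \<eta>) f (t *s \<eta>))"
        by (simp add: sderiv_smult[OF f tb] H_def norm_mult)
      also have "\<dots> \<le> C * dfct (t *s \<eta>) powr e * norm (t *s \<eta>)" by (rule bnd[OF tb])
      also have "\<dots> = cmod t * (C * (1 - (cmod t)\<^sup>2) powr e)" using \<eta> by (simp add: norm_vec_smult dfct_def)
      finally show ?thesis using t by simp
    qed
    let ?t = "complex_of_real (norm z)"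
    have "cmod (H ?t) \<le> C * (1 - r\<^sup>2) powr e" if r: "norm z < r" "r < 1" for r
    proof (rule maximum_modulus_frontier[of H "ball 0 r"])
      have r0: "r > 0" using r norm_ge_zero[of z] by linarith
      show "H holomorphic_on interior (ball 0 r)" using r by (auto intro: holomorphic_on_subset[OF hol])
      show "continuous_on (closure (ball 0 r)) H"
        using r r0 by (intro holomorphic_on_imp_continuous_on holomorphic_on_subset[OF hol]) auto
      show "cmod (H t) \<le> C * (1 - r\<^sup>2) powr e" if "t \<in> frontier (ball 0 r)" for t
        using Hb[of t] that r r0 by (auto simp: frontier_ball)
    qed (use r in auto)
    then have "\<forall>\<^sub>F r in at_left 1. cmod (H ?t) \<le> C * (1 - r\<^sup>2) powr e"
      using eventually_at_left[of "norm z" 1] z by auto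
    from tendsto_lowerbound[OF one_minus_square_powr_tendsto_0[OF e] this] have "H ?t = 0" by simp
    then have "sderiv \<eta> f z = 0" using \<eta>(2) by (simp add: H_def)
    moreover have "sderiv z f z = of_real (norm z) * sderiv \<eta> f z"
      using sderiv_smult[OF f z, of "of_real (norm z)" \<eta>] \<eta>(2) by simp
    ultimately show ?thesis by simp
  qed
qed

lemma exists_unit_orthogonal:
  fixes \<eta> :: "complex ^ 'n"
  assumes "CARD('n) > 1"
  obtains \<zeta> :: "complex ^ 'n" where "norm \<zeta> = 1" "hinner \<zeta> \<eta> = 0"
proof -
  obtain i j :: 'n where ij: "i \<noteq> j"
    using assms card_le_Suc0_iff_eq[of "UNIV :: 'n set"] by (auto simp: not_le[symmetric])
  have ax: "hinner (axis k 1) \<eta> = cnj (\<eta> $ k)" for k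
    by (metis cnj_hinner hinner_axis_right)
  define w where "w = (if \<eta> $ i = 0 then axis i 1 else cnj (\<eta> $ j) *s axis i 1 - cnj (\<eta> $ i) *s axis j (1 :: complex))"
  have "hinner w \<eta> = 0" by (simp add: w_def ax hinner_diff_left)
  moreover have "w \<noteq> 0"
  proof
    assume w0: "w = 0"
    show False
    proof (cases "\<eta> $ i = 0")
      case True
      then have "w $ i = 1" by (simp add: w_def axis_def)
      then show ?thesis using w0 by simp
    next
      case False
      then have "w $ j = - cnj (\<eta> $ i)" using ij by (simp add: w_def axis_def)
      then show ?thesis using w0 False by simp
    qed
  qed
  ultimately show thesis by (intro that[of "(1 / norm w) *\<^sub>R w"]) auto
qed

text \<open>On the circle \<open>\<tau> \<mapsto> b \<eta> + a \<tau> \<zeta>\<close> in a sphere the tangential vector \<open>\<tau> b \<zeta> - a \<eta>\<close> depends holomorphically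
  on \<open>\<tau>\<close>, so the maximum principle transfers the decay at the sphere to the centre \<open>\<tau> = 0\<close>.\<close>

lemma constant_several_dim:
  fixes f :: "complex ^ 'n \<Rightarrow> complex"
  assumes n: "CARD('n) > 1" and f: "ball_holomorphic f" and C: "C > 0" and e: "e > 0"
    and bnd: "\<And>z u. z \<in> unit_ball \<Longrightarrow> hinner u z = 0 \<Longrightarrow> cmod (sderiv u f z) \<le> C * dfct z powr e * norm u"
  shows "f constant_on unit_ball"
proof (rule constant_of_sderiv_zero[OF f])
  fix z :: "complex ^ 'n" assume z: "z \<in> unit_ball"
  show "sderiv z f z = 0"
  proof (cases "z = 0")
    case True
    then show ?thesis by (simp add: sderiv_zero)
  next
    case False
    define b where "b = norm z"
    have b: "0 < b" "b < 1" using False z by (auto simp: b_def)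
    define \<eta> where "\<eta> = (1 / b) *\<^sub>R z"
    have \<eta>: "norm \<eta> = 1" "z = b *\<^sub>R \<eta>" using b by (auto simp: \<eta>_def b_def)
    obtain \<zeta> :: "complex ^ 'n" where \<zeta>: "norm \<zeta> = 1" "hinner \<zeta> \<eta> = 0" by (rule exists_unit_orthogonal[OF n])
    have \<eta>\<zeta>: "hinner \<eta> \<zeta> = 0" using \<zeta>(2) cnj_hinner[of \<zeta> \<eta>] by simp
    have pyth: "(norm (c *s \<eta> + d *s \<zeta>))\<^sup>2 = (cmod c)\<^sup>2 + (cmod d)\<^sup>2" for c d
    proof -
      have "inner (c *s \<eta>) (d *s \<zeta>) = 0" using \<eta>\<zeta> by (simp flip: Re_hinner)
      then show ?thesis using norm_add_Pythagorean[of "c *s \<eta>" "d *s \<zeta>"] \<eta> \<zeta> by (simp add: orthogonal_def norm_vec_smult)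
    qed
    note sl = slice_hol_sderiv[OF ball_holomorphic_imp_slice_hol[OF f]]
    have le: "sqrt (\<rho>\<^sup>2 - b\<^sup>2) * cmod (sderiv \<eta> f z) \<le> C * (1 - \<rho>\<^sup>2) powr e" if \<rho>: "b < \<rho>" "\<rho> < 1" for \<rho>
    proof -
      \<comment> \<open>By Pythagoras this radius places the circle on the sphere of radius
        \<open>\<rho>\<close>; afterwards \<open>\<rho>\<close> tends to 1.\<close>
      define a where "a = sqrt (\<rho>\<^sup>2 - b\<^sup>2)"
      have \<rho>0: "0 < \<rho>" using \<rho> b by simp
      have "b\<^sup>2 < \<rho>\<^sup>2" using \<rho> b by (intro power_strict_mono) auto
      then have a: "a > 0" "a\<^sup>2 = \<rho>\<^sup>2 - b\<^sup>2" by (auto simp: a_def)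
      define X where "X \<tau> = z + \<tau> *s (of_real a *s \<zeta>)" for \<tau>
      have "z $ i = b *\<^sub>R \<eta> $ i" for i
        using arg_cong[OF \<eta>(2), of "\<lambda>v. v $ i"] unfolding vector_scaleR_component .
      then have zi: "z $ i = of_real b * \<eta> $ i" for i unfolding scaleR_conv_of_real .
      have X_eq: "X \<tau> = of_real b *s \<eta> + (\<tau> * of_real a) *s \<zeta>" for \<tau>
        by (simp add: X_def vec_eq_iff zi)
      have nX: "(norm (X \<tau>))\<^sup>2 = b\<^sup>2 + (cmod \<tau>)\<^sup>2 * a\<^sup>2" for \<tau>
        using a b by (simp add: X_eq pyth norm_mult power_mult_distrib)
      have Xb: "X \<tau> \<in> unit_ball" if "cmod \<tau> \<le> 1" for \<tau>
      proof -
        have "(cmod \<tau>)\<^sup>2 * a\<^sup>2 \<le> 1 * a\<^sup>2" using power_mono[OF that, of 2] by (intro mult_right_mono) auto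
        then have "(norm (X \<tau>))\<^sup>2 \<le> \<rho>\<^sup>2" unfolding nX using a(2) by linarith
        then have "norm (X \<tau>) \<le> \<rho>" by (rule power2_le_imp_le) (use \<rho>0 in simp)
        then show ?thesis using \<rho> by simp
      qed
      define H where "H \<tau> = \<tau> * of_real b * sderiv \<zeta> f (X \<tau>) - of_real a * sderiv \<eta> f (X \<tau>)" for \<tau>
      have hol: "H holomorphic_on {\<tau>. X \<tau> \<in> ball 0 1}"
        unfolding H_def X_def by (intro holomorphic_intros slice_hol_slice[OF sl])
      have Hb: "cmod (H \<tau>) \<le> C * (1 - \<rho>\<^sup>2) powr e" if \<tau>: "cmod \<tau> = 1" for \<tau>
      proof -
        define u where "u = (- of_real a) *s \<eta> + (\<tau> * of_real b) *s \<zeta>"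
        have Xu: "X \<tau> \<in> unit_ball" using Xb \<tau> by simp
        \<comment> \<open>On the unit circle this identity cancels the two products
          \<open>a * b\<close> in \<open>hinner u (X \<tau>)\<close>, making \<open>u\<close>
          tangential although it depends holomorphically on \<open>\<tau>\<close>.\<close>
        have "\<tau> * cnj \<tau> = 1" using \<tau> by (simp add: complex_norm_square[symmetric])
        then have "hinner u (X \<tau>) = 0"
          using \<eta>\<zeta> \<zeta> \<eta>(1) by (simp add: u_def X_eq hinner_add_left hinner_add_right hinner_diff_left hinner_self algebra_simps)
        then have "cmod (sderiv u f (X \<tau>)) \<le> C * dfct (X \<tau>) powr e * norm u" by (rule bnd[OF Xu])
        also have "(norm u)\<^sup>2 \<le> 1\<^sup>2"
        proof -
          have "(norm u)\<^sup>2 = a\<^sup>2 + b\<^sup>2" unfolding u_def pyth using \<tau> a b by (simp add: norm_mult)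
          then show ?thesis using a \<rho> \<rho>0 by (simp add: abs_square_le_1)
        qed
        then have "norm u \<le> 1" by (rule power2_le_imp_le) simp
        then have "C * dfct (X \<tau>) powr e * norm u \<le> C * dfct (X \<tau>) powr e * 1" using C by (intro mult_left_mono) auto
        also have "dfct (X \<tau>) = 1 - \<rho>\<^sup>2" using \<tau> a by (simp add: dfct_def nX)
        finally have "cmod (sderiv u f (X \<tau>)) \<le> C * (1 - \<rho>\<^sup>2) powr e" by simp
        moreover have "sderiv u f (X \<tau>) = H \<tau>"
          unfolding u_def sderiv_add[OF f Xu] sderiv_smult[OF f Xu] by (simp add: H_def)
        ultimately show ?thesis by simp
      qed
      have "cmod (H 0) \<le> C * (1 - \<rho>\<^sup>2) powr e"
      proof (rule maximum_modulus_frontier[of H "ball 0 1"])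
        show "H holomorphic_on interior (ball 0 1)" by (rule holomorphic_on_subset[OF hol]) (use Xb in auto)
        show "continuous_on (closure (ball 0 1)) H"
          by (rule holomorphic_on_imp_continuous_on, rule holomorphic_on_subset[OF hol]) (use Xb in auto)
        show "cmod (H t) \<le> C * (1 - \<rho>\<^sup>2) powr e" if "t \<in> frontier (ball 0 1)" for t
          using Hb[of t] that by (auto simp: frontier_ball)
      qed auto
      then show ?thesis using a by (simp add: H_def X_def norm_mult a_def[symmetric])
    qed
    have "((\<lambda>\<rho>. sqrt (\<rho>\<^sup>2 - b\<^sup>2) * cmod (sderiv \<eta> f z)) \<longlongrightarrow> sqrt (1\<^sup>2 - b\<^sup>2) * cmod (sderiv \<eta> f z)) (at_left 1)"
      by (intro tendsto_intros)
    moreover have "\<forall>\<^sub>F \<rho> in at_left 1. sqrt (\<rho>\<^sup>2 - b\<^sup>2) * cmod (sderiv \<eta> f z) \<le> C * (1 - \<rho>\<^sup>2) powr e"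
      using eventually_at_left[of b 1] le b by auto
    ultimately have "sqrt (1\<^sup>2 - b\<^sup>2) * cmod (sderiv \<eta> f z) \<le> 0"
      by (intro tendsto_le[OF _ one_minus_square_powr_tendsto_0[OF e]]) auto
    moreover have "sqrt (1\<^sup>2 - b\<^sup>2) > 0" using b by (simp add: abs_square_less_1)
    ultimately have "sderiv \<eta> f z = 0" by (simp add: mult_le_0_iff)
    moreover have "sderiv z f z = of_real b * sderiv \<eta> f z"
      using sderiv_scaleR[OF f z, of b \<eta>] \<eta>(2) by simp
    ultimately show ?thesis by simp
  qed
qed

section \<open>The characterisation\<close>

theorem corollary4p7:
  fixes f :: "complex ^ 'n \<Rightarrow> complex" and p q \<alpha> \<beta> \<gamma> :: real
  assumes "\<alpha> > -1" and "\<beta> > -1"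
    and "f \<in> bergman_space 1 \<beta>"
    and "1 < p" and "p \<le> q"
    and "\<gamma> = (real CARD('n) + 1 + \<beta>) / q - (real CARD('n) + 1 + \<alpha>) / p"
  shows "(CARD('n) = 1 \<longrightarrow>
      (\<gamma> \<ge> -1 \<longrightarrow> (hankel_bounded p \<alpha> q \<beta> f \<longleftrightarrow> f \<in> bloch_space (1 + \<gamma>))) \<and>
      (\<gamma> < -1 \<longrightarrow> (hankel_bounded p \<alpha> q \<beta> f \<longleftrightarrow> f constant_on unit_ball))) \<and>
    (CARD('n) > 1 \<longrightarrow>
      (\<gamma> > -1/2 \<longrightarrow> (hankel_bounded p \<alpha> q \<beta> f \<longleftrightarrow> f \<in> bloch_space (1 + \<gamma>))) \<and>
      (\<gamma> < -1/2 \<longrightarrow> (hankel_bounded p \<alpha> q \<beta> f \<longleftrightarrow> f constant_on unit_ball)) \<and>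
      (\<gamma> = -1/2 \<longrightarrow> (hankel_bounded p \<alpha> q \<beta> f \<longleftrightarrow>
        bdd_above ((\<lambda>z. (1 - (norm z)\<^sup>2) powr (-1/2) * norm (invariant_grad f z)) ` unit_ball))))"
proof -
  note \<alpha> = assms(1) and \<beta> = assms(2) and p = assms(4) and pq = assms(5) and \<gamma> = assms(6)
  have q: "q > 1" using p pq by simp
  have f: "ball_holomorphic f" using assms(3) by (simp add: bergman_space_def)
  have fi: "integrable (bmeas \<beta>) f"
  proof -
    have "f \<in> borel_measurable (bmeas \<beta>)" "integrable (bmeas \<beta>) (\<lambda>w. cmod (f w) powr 1)"
      using assms(3) Lp_space_iff[OF \<beta>, of f 1] by (auto simp: bergman_space_def)
    then show ?thesis by (simp add: integrable_norm_iff)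
  qed
  have card: "real CARD('n) \<ge> 1" by (simp add: Suc_le_eq)
  have nec: "\<exists>C>0. (\<forall>z\<in>unit_ball. cmod (sderiv z f z) \<le> C * dfct z powr (- 1 - \<gamma>) * norm z) \<and>
      (\<forall>z\<in>unit_ball. \<forall>u. hinner u z = 0 \<longrightarrow> cmod (sderiv u f z) \<le> C * dfct z powr (- (1/2) - \<gamma>) * norm u)"
    if b: "hankel_bounded p \<alpha> q \<beta> f" and g: "\<gamma> \<ge> -1"
  proof -
    have "\<gamma> + (real CARD('n) + 1 + \<beta>) > 0" using g card \<beta> by linarith
    from necessary_bounds[OF \<alpha> \<beta> p q \<gamma> this f fi b] show ?thesis by metis
  qed
  have bloch: "f \<in> bloch_space (1 + \<gamma>)" if "hankel_bounded p \<alpha> q \<beta> f" "\<gamma> \<ge> -1"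
  proof -
    from nec[OF that] obtain C where "C > 0"
      "\<And>z. z \<in> unit_ball \<Longrightarrow> cmod (sderiv z f z) \<le> C * dfct z powr (- 1 - \<gamma>) * norm z"
      "\<And>z u. z \<in> unit_ball \<Longrightarrow> hinner u z = 0 \<Longrightarrow> cmod (sderiv u f z) \<le> C * dfct z powr (- (1/2) - \<gamma>) * norm u"
      by blast
    then show ?thesis by (rule bloch_spaceI(1)[OF f])
  qed
  have const: "hankel_bounded p \<alpha> q \<beta> f" if "f constant_on unit_ball"
    by (rule sufficient_constant[OF \<alpha> \<beta> p pq \<gamma> f fi that])
  have growth: "hankel_bounded p \<alpha> q \<beta> f" if "\<gamma> > 0" "f \<in> bloch_space (1 + \<gamma>)"
    by (rule sufficient_growth[OF \<alpha> \<beta> p pq \<gamma> fi that])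
  have one_a: "hankel_bounded p \<alpha> q \<beta> f" if n: "CARD('n) = 1" and bl: "f \<in> bloch_space (1 + \<gamma>)"
  proof (cases "\<gamma> > 0")
    case True
    then show ?thesis using growth bl by blast
  next
    case False
    obtain M where M: "M > 0" "\<And>z v. z \<in> unit_ball \<Longrightarrow> cmod (sderiv v f z) \<le> M * (dfct z powr (- (1 + \<gamma>)) * norm v)"
      by (rule bloch_spaceD[OF bl]) blast
    have M0: "M \<ge> 0" and g0: "\<gamma> \<le> 0" using M(1) False by auto
    show ?thesis
      by (rule sufficient_star[OF \<alpha> \<beta> p pq \<gamma> f fi g0 M0 star_one_dim[OF n M0 _ M(2)]])
  qed
  \<comment> \<open>The threshold \<open>\<theta> = -1\<close> makes the exponent
    \<open>- 1 - \<gamma>'\<close> of the radial bound positive. In several dimensions the threshold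
    -1/2 does the same for the tangential exponent \<open>- (1/2) - \<gamma>'\<close>.\<close>
  have one_b: "f constant_on unit_ball" if b: "hankel_bounded p \<alpha> q \<beta> f" and g: "\<gamma> < -1"
  proof -
    obtain C \<gamma>' where "C > 0" "\<gamma>' < -1"
      "\<And>z. z \<in> unit_ball \<Longrightarrow> cmod (sderiv z f z) \<le> C * dfct z powr (- 1 - \<gamma>') * norm z"
      by (rule necessary_bounds_subcritical[OF \<alpha> \<beta> p q \<gamma> f fi b g order_refl]) blast
    then show ?thesis by (intro constant_one_dim[OF f, of C "- 1 - \<gamma>'"]) auto
  qed
  have sev_a: "hankel_bounded p \<alpha> q \<beta> f" if g: "\<gamma> > -1/2" and bl: "f \<in> bloch_space (1 + \<gamma>)"
  proof (cases "\<gamma> > 0")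
    case True
    then show ?thesis using growth bl by blast
  next
    case False
    obtain M where M: "M > 0" "\<And>z v. z \<in> unit_ball \<Longrightarrow> cmod (sderiv v f z) \<le> M * (dfct z powr (- (1 + \<gamma>)) * norm v)"
      by (rule bloch_spaceD[OF bl]) blast
    have M0: "M \<ge> 0" and g0: "\<gamma> \<le> 0" and d: "0 \<le> - \<gamma>" "- \<gamma> < 1/2" using M(1) False g by auto
    have M': "cmod (sderiv v f z) \<le> M * (dfct z powr (- \<gamma> - 1) * norm v)" if "z \<in> unit_ball" for z v
    proof -
      have "- (1 + \<gamma>) = - \<gamma> - 1" by simp
      then show ?thesis using M(2)[OF that] by (simp only:)
    qed
    obtain C where C: "C > 0" "\<And>z u. z \<in> unit_ball \<Longrightarrow> hinner u z = 0 \<Longrightarrow>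
        cmod (sderiv u f z) \<le> C * (dfct z powr (- \<gamma> - 1/2) * norm u)"
      by (rule tangential_bound[OF f M0 d M']) blast+
    have C0: "C \<ge> 0" "M + C \<ge> 0" using C(1) M0 by auto
    show ?thesis
      by (rule sufficient_star[OF \<alpha> \<beta> p pq \<gamma> f fi g0 C0(2) star_of_tangential[OF f M0 C0(1) _ M' C(2)]])
  qed
  have sev_b: "f constant_on unit_ball" if n: "CARD('n) > 1" and b: "hankel_bounded p \<alpha> q \<beta> f" and g: "\<gamma> < -1/2"
  proof -
    obtain C \<gamma>' where "C > 0" "\<gamma>' < -1/2"
      "\<And>z u. z \<in> unit_ball \<Longrightarrow> hinner u z = 0 \<Longrightarrow> cmod (sderiv u f z) \<le> C * dfct z powr (- (1/2) - \<gamma>') * norm u"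
      by (rule necessary_bounds_subcritical[OF \<alpha> \<beta> p q \<gamma> f fi b g]) (simp, blast)
    then show ?thesis by (intro constant_several_dim[OF n f, of C "- (1/2) - \<gamma>'"]) auto
  qed
  have sev_c: "hankel_bounded p \<alpha> q \<beta> f \<longleftrightarrow>
      bdd_above ((\<lambda>z. (1 - (norm z)\<^sup>2) powr (-1/2) * norm (invariant_grad f z)) ` unit_ball)" if g: "\<gamma> = -1/2"
  proof
    assume "hankel_bounded p \<alpha> q \<beta> f"
    from nec[OF this] g obtain C where C: "C > 0"
      "\<And>z. z \<in> unit_ball \<Longrightarrow> cmod (sderiv z f z) \<le> C * dfct z powr (- 1 - \<gamma>) * norm z"
      "\<And>z u. z \<in> unit_ball \<Longrightarrow> hinner u z = 0 \<Longrightarrow> cmod (sderiv u f z) \<le> C * dfct z powr (- (1/2) - \<gamma>) * norm u"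
      by auto
    have "dfct z powr (-1/2) * norm (invariant_grad f z) \<le> 2 * C" if z: "z \<in> unit_ball" for z
    proof -
      have s: "dfct z > 0" by (rule dfct_pos[OF z])
      \<comment> \<open>At \<open>\<gamma> = -1/2\<close> the radial and the tangential contribution
        are both of order \<open>dfct z powr (1/2)\<close>.\<close>
      have "norm (invariant_grad f z) \<le> dfct z * (C * dfct z powr (- 1 - \<gamma>)) + sqrt (dfct z) * (C * dfct z powr (- (1/2) - \<gamma>))"
        by (rule invariant_grad_le[OF f z]) (use C z in auto)
      also have "\<dots> = C * (dfct z powr 1 * dfct z powr (-1/2)) + C * dfct z powr (1/2)"
        using s g by (simp add: powr_half_sqrt)
      also have "\<dots> = 2 * C * dfct z powr (1/2)"
        unfolding powr_add[symmetric] by simp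
      finally have "dfct z powr (-1/2) * norm (invariant_grad f z) \<le> dfct z powr (-1/2) * (2 * C * dfct z powr (1/2))"
        by (intro mult_left_mono) auto
      also have "\<dots> = 2 * C * (dfct z powr (-1/2) * dfct z powr (1/2))" by simp
      also have "\<dots> = 2 * C" unfolding powr_add[symmetric] using s by simp
      finally show ?thesis .
    qed
    then show "bdd_above ((\<lambda>z. (1 - (norm z)\<^sup>2) powr (-1/2) * norm (invariant_grad f z)) ` unit_ball)"
      unfolding dfct_def by (intro bdd_aboveI[of _ "2 * C"]) auto
  next
    assume "bdd_above ((\<lambda>z. (1 - (norm z)\<^sup>2) powr (-1/2) * norm (invariant_grad f z)) ` unit_ball)"
    then obtain B where B: "\<And>z. z \<in> unit_ball \<Longrightarrow> dfct z powr (-1/2) * norm (invariant_grad f z) \<le> B"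
      unfolding bdd_above_def dfct_def by blast
    define M where "M = 2 * \<bar>B\<bar>"
    have M: "M \<ge> 0" and g0: "\<gamma> \<le> 0" using g by (auto simp: M_def)
    show "hankel_bounded p \<alpha> q \<beta> f"
    proof (rule sufficient_star[OF \<alpha> \<beta> p pq \<gamma> f fi g0 M])
      fix x v :: "complex ^ 'n" assume x: "x \<in> unit_ball"
      define s where "s = dfct x"
      have s: "s > 0" unfolding s_def by (rule dfct_pos[OF x])
      have r: "s powr (1/2) * s powr (-1/2) = 1" unfolding powr_add[symmetric] using s by simp
      have "norm (invariant_grad f x) = s powr (1/2) * (s powr (-1/2) * norm (invariant_grad f x))"
        unfolding mult.assoc[symmetric] r by simp
      also have "\<dots> \<le> s powr (1/2) * \<bar>B\<bar>"
        using B[OF x] by (intro mult_left_mono) (auto simp: s_def)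
      finally have ig: "norm (invariant_grad f x) \<le> s powr (1/2) * \<bar>B\<bar>" .
      have "cmod (sderiv v f x) \<le> norm (invariant_grad f x) * (2 * (norm v / sqrt s) + cmod (hinner v x) / s)"
        unfolding s_def by (rule sderiv_le_invariant_grad[OF f x])
      also have "\<dots> \<le> (s powr (1/2) * \<bar>B\<bar>) * (2 * (norm v / sqrt s) + cmod (hinner v x) / s)"
        using s by (intro mult_right_mono ig) auto
      \<comment> \<open>The second term is doubled so that the single constant
        \<open>M = 2 * \<bar>B\<bar>\<close> serves both.\<close>
      also have "\<dots> \<le> (s powr (1/2) * \<bar>B\<bar>) * (2 * (norm v / sqrt s) + 2 * (cmod (hinner v x) / s))"
      proof -
        have "0 \<le> cmod (hinner v x) / s" using s by simp
        then show ?thesis by (intro mult_left_mono) auto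
      qed
      also have "\<dots> = M * ((s powr (1/2) / sqrt s) * norm v + (s powr (1/2) / s) * cmod (hinner v x))"
        by (simp add: M_def algebra_simps)
      also have "s powr (1/2) / sqrt s = s powr (- \<gamma> - 1/2)" using s g by (simp add: powr_half_sqrt)
      also have "s powr (1/2) / s = s powr (- \<gamma> - 1)"
      proof -
        have "s powr (1/2) / s powr 1 = s powr (- \<gamma> - 1)" unfolding powr_diff[symmetric] by (simp add: g)
        then show ?thesis using s by simp
      qed
      finally show "cmod (sderiv v f x) \<le> M * (dfct x powr (- \<gamma> - 1/2) * norm v + dfct x powr (- \<gamma> - 1) * cmod (hinner v x))"
        by (simp add: s_def)
    qed
  qed
  have one: "\<gamma> \<ge> -1 \<Longrightarrow> hankel_bounded p \<alpha> q \<beta> f \<longleftrightarrow> f \<in> bloch_space (1 + \<gamma>)"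
    "\<gamma> < -1 \<Longrightarrow> hankel_bounded p \<alpha> q \<beta> f \<longleftrightarrow> f constant_on unit_ball" if n: "CARD('n) = 1"
    using bloch one_a[OF n] one_b const by iprover+
  have several: "\<gamma> > -1/2 \<Longrightarrow> hankel_bounded p \<alpha> q \<beta> f \<longleftrightarrow> f \<in> bloch_space (1 + \<gamma>)"
    "\<gamma> < -1/2 \<Longrightarrow> hankel_bounded p \<alpha> q \<beta> f \<longleftrightarrow> f constant_on unit_ball" if n: "CARD('n) > 1"
  proof -
    show "hankel_bounded p \<alpha> q \<beta> f \<longleftrightarrow> f \<in> bloch_space (1 + \<gamma>)" if g: "\<gamma> > -1/2"
    proof
      assume "hankel_bounded p \<alpha> q \<beta> f"
      then show "f \<in> bloch_space (1 + \<gamma>)" by (rule bloch) (use g in simp)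
    qed (rule sev_a[OF g])
    show "hankel_bounded p \<alpha> q \<beta> f \<longleftrightarrow> f constant_on unit_ball" if g: "\<gamma> < -1/2"
      using sev_b[OF n _ g] const by iprover
  qed
  show ?thesis
    by (intro conjI impI one several sev_c)
qed

end
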